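(* Let $T>0$ and $\alpha\in(0,1)$. Let $X$ be a separable, reflexive Banach space that is compactly and densely embedded in the separable Hilbert space $H$, with $H$ identified with its dual so that $(X,H,X')$ is a Gelfand triple. Let $u_0\in H$, let $\mathcal{E}\in C^1(X;\mathbb{R})$, and assume there are $p>1$ and positive constants $C_0,C_1,C_2<\infty$ such that $$\|\nabla_H\mathcal{E}(u)\|_{X'}\le C_0\|u\|_X^{p-1}+C_0,\qquad \delta\mathcal{E}(u,u)\ge C_1\|u\|_X^p-C_2\|u\|_H^2\qquad\text{for all }u\in X,$$ and that the realization of $\nabla_H\mathcal{E}$ as an operator from $L^p(0,T;X)$ to $L^{p'}(0,T;X')$, $\frac1p+\frac1{p'}=1$, is weak-to-weak continuous. Let $\tilde X=L^2_\alpha(0,1;X)$ and $\tilde H=L^2_{\alpha,0}(0,1;H)$, and let $$\tilde{\mathcal{E}}=\mathcal{E}\circ\mathcal{C}+\mathcal{H}.$$ Then for any solution $u$ to the variational form of the time-fractional gradient flow $$\partial_t^\alpha u=-\nabla_H\mathcal{E}(u),\qquad u(0)=u_0,$$ there exists a solution $\tilde u$ to the variational form of the integer-order gradient flow $$\partial_t\tilde u=-\nabla_{\tilde H}\tilde{\mathcal{E}}(\tilde u),\qquad \tilde u(0)=0,$$ and vice versa, such that the following equivalence of solutions holds: $$u(t)=\mathcal{C}\tilde u(t)=u_0+\int_0^1g_{1-\alpha}(\theta)\,g_\alpha(1-\theta)\,\tilde u(t,\theta)\,\mathrm{d}\theta,$$ $$\tilde u(t,\theta)=\mathcal{G}\{u\}(t,\theta):=-c_0(\theta)\int_0^te^{-c_1(\theta)(t-s)}\,\nabla_H\mathcal{E}(u(s))\,\mathrm{d}s.$$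 Moreover, one has the regularity $$u\in L^p(0,T;X)\cap L^\infty(0,T;H)\cap H^\alpha(0,T;H),$$ $$\tilde u\in L^\infty(0,T;L^2_\alpha(0,1;H))\cap H^1(0,T;L^2_{\alpha,0}(0,1;H))\cap L^\infty(0,1;L^{p'}(0,T;H)).$$
   Context: $\delta\mathcal{E}(u,v)=\lim_{h\to0}\frac{\mathcal{E}(u+hv)-\mathcal{E}(u)}{h}$ is the Gâteaux derivative of $\mathcal{E}$, and $\nabla_H\mathcal{E}:X\to X'$ is defined by $\langle\nabla_H\mathcal{E}(u),v\rangle_{X'\times X}=\delta\mathcal{E}(u,v)$ for all $v\in X$; $\nabla_{\tilde H}\tilde{\mathcal{E}}:\tilde X\to\tilde X'$ is defined in the same way from $\delta\tilde{\mathcal{E}}$, with the pairing $\langle\cdot,\cdot\rangle_{\tilde X'\times\tilde X}$ extending the inner product of $\tilde H$. The pairing $\langle\cdot,\cdot\rangle_{X'\times X}$ extends the inner product of $H$. For $\alpha>0$, $g_\alpha(t)=t^{\alpha-1}/\Gamma(\alpha)$, and $*$ is convolution in time on the positive half-line. The Caputo derivative of order $\alpha\in(0,1)$ is $\partial_t^\alpha u=g_{1-\alpha}*\partial_tu$ for absolutely continuous $u$; for less regular $u$ with initial datum $u_0$ it is understood as $\partial_t\big(g_{1-\alpha}*(u-u_0)\big)$ in the distributional sense. $W^{\alpha,q}(0,T;Z)$ is the space of $u\in L^q(0,T;Z)$ with $\partial_t^\alpha u\in L^q(0,T;Z)$, and $H^\alpha=W^{\alpha,2}$. Weights on $(0,1)$: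 $w_\alpha(\theta)=g_{1-\alpha}(\theta)g_\alpha(1-\theta)$, $w_{\alpha,0}(\theta)=w_\alpha(\theta)(1-\theta)$, $w_{\alpha,1}(\theta)=w_\alpha(\theta)\theta$. For a space $Z$, $L^2_\alpha(0,1;Z)$, $L^2_{\alpha,0}(0,1;Z)$, $L^2_{\alpha,1}(0,1;Z)$ are the $L^2$ Bochner spaces of $Z$-valued functions of $\theta\in(0,1)$ with weights $w_\alpha,w_{\alpha,0},w_{\alpha,1}$ respectively. Further $c_0(\theta)=\frac1{1-\theta}$, $c_1(\theta)=\frac\theta{1-\theta}$, and $$\mathcal{C}\tilde v=u_0+\int_0^1w_\alpha(\theta)\tilde v(\theta)\,\mathrm{d}\theta,\qquad \mathcal{H}(\tilde v)=\frac12\|\tilde v\|^2_{L^2_{\alpha,1}(0,1;H)}=\frac12\int_0^1\theta\,w_\alpha(\theta)\|\tilde v(\theta)\|_H^2\,\mathrm{d}\theta.$$ Variational form of the fractional flow: $u\in L^p(0,T;X)\cap L^\infty(0,T;H)\cap W^{\alpha,p'}(0,T;X')$ with $g_{1-\alpha}*(u-u_0)\in C([0,T];H)$ satisfies $\langle\partial_t^\alpha u+\nabla_H\mathcal{E}(u),v\rangle_{X'\times X}=0$ for all $v\in X$ (a.e. in $(0,T)$), with $(g_{1-\alpha}*(u-u_0))(t)\to0$ in $H$ as $t\to0$. Variational form of the integer-order flow: $\langle\partial_t\tilde u+\nabla_{\tilde H}\tilde{\mathcal{E}}(\tilde u),\tilde v\rangle_{\tilde X'\times\tilde X}=0$ for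 all $\tilde v\in\tilde X$ (a.e. in $(0,T)$), with $\tilde u(0)=0$.
   Formalization: It is additionally assumed that C maps X̃ into X, which amounts to u_0 in X rather than only u_0 in H; for u_0 outside X the energy E∘C is defined nowhere on X̃, so the integer-order flow has no meaning. *)

theory Defs
  imports "HOL-Analysis.Analysis"
begin

section \<open>Lebesgue and Bochner spaces\<close>

text \<open>
  Elements of function spaces are represented by functions; equality of elements is equality
  almost everywhere.
\<close>

abbreviation interval_measure :: "real \<Rightarrow> real measure" where
  "interval_measure T \<equiv> restrict_space lborel {0<..<T}"

definition weighted_measure :: "(real \<Rightarrow> real) \<Rightarrow> real measure" where
  "weighted_measure w = density (interval_measure 1) (\<lambda>\<theta>. ennreal (w \<theta>))"

definition Lq :: "real \<Rightarrow> 'a measure \<Rightarrow> ('a \<Rightarrow> 'b::real_normed_vector) set" where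
  "Lq q M = {f. f \<in> borel_measurable M \<and> integrable M (\<lambda>x. norm (f x) powr q)}"

definition Lnorm :: "real \<Rightarrow> 'a measure \<Rightarrow> ('a \<Rightarrow> 'b::real_normed_vector) \<Rightarrow> real" where
  "Lnorm q M f = (\<integral>x. norm (f x) powr q \<partial>M) powr (1 / q)"

definition Linf :: "'a measure \<Rightarrow> ('a \<Rightarrow> 'b::real_normed_vector) set" where
  "Linf M = {f. f \<in> borel_measurable M \<and> (\<exists>C. AE x in M. norm (f x) \<le> C)}"

text \<open>
  The iterated spaces \<open>L\<^sup>q(M; L\<^sup>r(N; Z))\<close> and \<open>L\<^sup>\<infinity>(M; L\<^sup>r(N; Z))\<close>: for finite \<open>r\<close>, strongly
  measurable maps into \<open>L\<^sup>r(N; Z)\<close> are those having a jointly measurable representative.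
\<close>

definition LqLr ::
  "real \<Rightarrow> 'a measure \<Rightarrow> real \<Rightarrow> 'c measure \<Rightarrow> ('a \<Rightarrow> 'c \<Rightarrow> 'b::real_normed_vector) set" where
  "LqLr q M r N = {u. case_prod u \<in> borel_measurable (M \<Otimes>\<^sub>M N) \<and>
     (AE x in M. u x \<in> Lq r N) \<and> integrable M (\<lambda>x. Lnorm r N (u x) powr q)}"

definition LinfLr ::
  "'a measure \<Rightarrow> real \<Rightarrow> 'c measure \<Rightarrow> ('a \<Rightarrow> 'c \<Rightarrow> 'b::real_normed_vector) set" where
  "LinfLr M r N = {u. case_prod u \<in> borel_measurable (M \<Otimes>\<^sub>M N) \<and>
     (\<exists>C. AE x in M. u x \<in> Lq r N \<and> Lnorm r N (u x) \<le> C)}"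

text \<open>
  Dual of a function space \<open>V\<close> with (semi)norm \<open>N\<close>; a bounded functional automatically
  respects equality almost everywhere.
\<close>

definition fun_dual ::
  "('a \<Rightarrow> 'b::real_normed_vector) set \<Rightarrow> (('a \<Rightarrow> 'b) \<Rightarrow> real) \<Rightarrow> (('a \<Rightarrow> 'b) \<Rightarrow> real) set" where
  "fun_dual V N = {l. (\<forall>f\<in>V. \<forall>g\<in>V. l (\<lambda>x. f x + g x) = l f + l g) \<and>
     (\<forall>c. \<forall>f\<in>V. l (\<lambda>x. c *\<^sub>R f x) = c * l f) \<and>
     (\<exists>C. \<forall>f\<in>V. \<bar>l f\<bar> \<le> C * N f)}"

definition fun_dual_norm ::
  "('a \<Rightarrow> 'b::real_normed_vector) set \<Rightarrow> (('a \<Rightarrow> 'b) \<Rightarrow> real) \<Rightarrow> (('a \<Rightarrow> 'b) \<Rightarrow> real) \<Rightarrow> real" where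
  "fun_dual_norm V N l = (SUP f\<in>{f\<in>V. N f \<le> 1}. \<bar>l f\<bar>)"

text \<open>
  \<open>L\<^sup>q(M; V')\<close> for separable \<open>V'\<close>, where weak and strong measurability agree by Pettis' theorem.
\<close>

definition Lq_dual ::
  "real \<Rightarrow> 'c measure \<Rightarrow> ('a \<Rightarrow> 'b::real_normed_vector) set \<Rightarrow> (('a \<Rightarrow> 'b) \<Rightarrow> real)
    \<Rightarrow> ('c \<Rightarrow> ('a \<Rightarrow> 'b) \<Rightarrow> real) set" where
  "Lq_dual q M V N = {W. (\<forall>v\<in>V. (\<lambda>t. W t v) \<in> borel_measurable M) \<and>
     (AE t in M. W t \<in> fun_dual V N) \<and>
     integrable M (\<lambda>t. fun_dual_norm V N (W t) powr q)}"

definition weakly_converges ::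
  "('a \<Rightarrow> 'b::real_normed_vector) set \<Rightarrow> (('a \<Rightarrow> 'b) \<Rightarrow> real) \<Rightarrow>
    (nat \<Rightarrow> 'a \<Rightarrow> 'b) \<Rightarrow> ('a \<Rightarrow> 'b) \<Rightarrow> bool" where
  "weakly_converges V N f g \<longleftrightarrow> (\<forall>l\<in>fun_dual V N. (\<lambda>n. l (f n)) \<longlonglongrightarrow> l g)"

text \<open>
  Weak-to-weak continuity, in the sequential sense, of the realization \<open>u \<mapsto> F \<circ> u\<close> of
  \<open>F\<close> as an operator from \<open>L\<^sup>p(0,T;X)\<close> to \<open>L\<^sup>q(0,T;Y)\<close>.
\<close>

definition weak_weak_continuous ::
  "real \<Rightarrow> real \<Rightarrow> real \<Rightarrow> ('x::real_normed_vector \<Rightarrow> 'y::real_normed_vector) \<Rightarrow> bool" where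
  "weak_weak_continuous T p q F \<longleftrightarrow>
    (\<forall>f g. (\<forall>n. f n \<in> Lq p (interval_measure T)) \<and> g \<in> Lq p (interval_measure T) \<and>
       weakly_converges (Lq p (interval_measure T)) (Lnorm p (interval_measure T)) f g \<longrightarrow>
       weakly_converges (Lq q (interval_measure T)) (Lnorm q (interval_measure T))
         (\<lambda>n t. F (f n t)) (\<lambda>t. F (g t)))"

section \<open>Banach spaces and the Gelfand triple\<close>

definition reflexive :: "'x::real_normed_vector itself \<Rightarrow> bool" where
  "reflexive _ \<longleftrightarrow> (\<forall>\<Phi> :: ('x \<Rightarrow>\<^sub>L real) \<Rightarrow>\<^sub>L real. \<exists>x::'x. \<forall>f. blinfun_apply \<Phi> f = blinfun_apply f x)"

definition compact_dense_embedding ::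
  "('x::real_normed_vector \<Rightarrow> 'h::real_normed_vector) \<Rightarrow> bool" where
  "compact_dense_embedding i \<longleftrightarrow> bounded_linear i \<and> inj i \<and>
     compact (closure (i ` cball 0 1)) \<and> closure (range i) = UNIV"

text \<open>\<open>H \<subseteq> X'\<close> through the Riesz identification of \<open>H\<close> with its dual.\<close>

definition dual_embedding ::
  "('x::real_normed_vector \<Rightarrow> 'h::real_inner) \<Rightarrow> 'h \<Rightarrow> ('x \<Rightarrow>\<^sub>L real)" where
  "dual_embedding i h = Blinfun (\<lambda>v. inner h (i v))"

text \<open>
  The Bochner integral in \<open>X'\<close>, given by its action on \<open>X\<close>. The library's Bochner integral
  is restricted to types of class \<open>second_countable_topology\<close>; the dual of a separable reflexive
  space is separable, but its type is not an instance of that class.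
\<close>

definition dual_integral ::
  "'a measure \<Rightarrow> ('a \<Rightarrow> ('x::real_normed_vector \<Rightarrow>\<^sub>L real)) \<Rightarrow> ('x \<Rightarrow>\<^sub>L real)" where
  "dual_integral M f = Blinfun (\<lambda>v. \<integral>s. blinfun_apply (f s) v \<partial>M)"

definition C1_functional :: "('x::real_normed_vector \<Rightarrow> real) \<Rightarrow> bool" where
  "C1_functional E \<longleftrightarrow> (\<exists>E' :: 'x \<Rightarrow> ('x \<Rightarrow>\<^sub>L real).
     (\<forall>u. (E has_derivative blinfun_apply (E' u)) (at u)) \<and> continuous_on UNIV E')"

definition gateaux :: "('x::real_normed_vector \<Rightarrow> real) \<Rightarrow> 'x \<Rightarrow> 'x \<Rightarrow> real" where
  "gateaux E u v = Lim (at 0) (\<lambda>h::real. (E (u + h *\<^sub>R v) - E u) / h)"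

definition grad :: "('x::real_normed_vector \<Rightarrow> real) \<Rightarrow> 'x \<Rightarrow> ('x \<Rightarrow>\<^sub>L real)" where
  "grad E u = Blinfun (\<lambda>v. gateaux E u v)"

text \<open>
  The gradient of a functional on a function space, as an element of the dual of that space.
\<close>

definition fun_grad ::
  "(('a \<Rightarrow> 'x::real_normed_vector) \<Rightarrow> real) \<Rightarrow> ('a \<Rightarrow> 'x) \<Rightarrow> ('a \<Rightarrow> 'x) \<Rightarrow> real" where
  "fun_grad E u v = Lim (at 0) (\<lambda>h::real. (E (\<lambda>x. u x + h *\<^sub>R v x) - E u) / h)"

section \<open>Fractional calculus in time\<close>

definition gker :: "real \<Rightarrow> real \<Rightarrow> real" where
  "gker \<alpha> t = t powr (\<alpha> - 1) / Gamma \<alpha>"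

definition conv ::
  "(real \<Rightarrow> real) \<Rightarrow> (real \<Rightarrow> 'b::{banach, second_countable_topology}) \<Rightarrow> real \<Rightarrow> 'b" where
  "conv k f t = (LINT s:{0<..<t}|lborel. k (t - s) *\<^sub>R f s)"

definition test_functions :: "real \<Rightarrow> (real \<Rightarrow> real) set" where
  "test_functions T = {\<phi>. (\<forall>n x. ((deriv ^^ n) \<phi>) differentiable (at x)) \<and>
     (\<exists>a b. 0 < a \<and> b < T \<and> (\<forall>x. x \<notin> {a..b} \<longrightarrow> \<phi> x = 0))}"

text \<open>Distributional derivative on \<open>(0,T)\<close> within integrable functions.\<close>

definition has_distr_deriv ::
  "real \<Rightarrow> (real \<Rightarrow> 'b::{banach, second_countable_topology}) \<Rightarrow> (real \<Rightarrow> 'b) \<Rightarrow> bool" where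
  "has_distr_deriv T f g \<longleftrightarrow>
     integrable (interval_measure T) f \<and> integrable (interval_measure T) g \<and>
     (\<forall>\<phi>\<in>test_functions T.
        (\<integral>t. deriv \<phi> t *\<^sub>R f t \<partial>interval_measure T) = - (\<integral>t. \<phi> t *\<^sub>R g t \<partial>interval_measure T))"

text \<open>
  The Caputo derivative with initial datum \<open>u\<^sub>0\<close>, for an \<open>H\<close>-valued function, as an element of
  \<open>L\<^sup>1(0,T;H)\<close> and, through \<open>H \<subseteq> X'\<close>, as an element of \<open>L\<^sup>1(0,T;X')\<close>. In the latter case the
  identity between elements of \<open>X'\<close> is evaluated at each \<open>v\<close> in \<open>X\<close>.
\<close>

definition has_caputo ::
  "real \<Rightarrow> real \<Rightarrow> 'h::{banach, second_countable_topology} \<Rightarrow> (real \<Rightarrow> 'h) \<Rightarrow> (real \<Rightarrow> 'h) \<Rightarrow> bool"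
where
  "has_caputo T \<alpha> u0 u w \<longleftrightarrow> has_distr_deriv T (conv (gker (1 - \<alpha>)) (\<lambda>s. u s - u0)) w"

definition has_caputo_dual ::
  "real \<Rightarrow> real \<Rightarrow> ('x::real_normed_vector \<Rightarrow> 'h::{real_inner, banach, second_countable_topology}) \<Rightarrow>
    'h \<Rightarrow> (real \<Rightarrow> 'h) \<Rightarrow> (real \<Rightarrow> ('x \<Rightarrow>\<^sub>L real)) \<Rightarrow> bool"
where
  "has_caputo_dual T \<alpha> i u0 u w \<longleftrightarrow>
    (\<forall>v. has_distr_deriv T
           (\<lambda>t. blinfun_apply (dual_embedding i (conv (gker (1 - \<alpha>)) (\<lambda>s. u s - u0) t)) v)
           (\<lambda>t. blinfun_apply (w t) v))"

definition W_frac ::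
  "real \<Rightarrow> real \<Rightarrow> real \<Rightarrow> 'h::{banach, second_countable_topology} \<Rightarrow> (real \<Rightarrow> 'h) set" where
  "W_frac T \<alpha> q u0 = {u \<in> Lq q (interval_measure T).
     \<exists>w\<in>Lq q (interval_measure T). has_caputo T \<alpha> u0 u w}"

section \<open>The extended energy\<close>

definition wt :: "real \<Rightarrow> real \<Rightarrow> real" where
  "wt \<alpha> \<theta> = gker (1 - \<alpha>) \<theta> * gker \<alpha> (1 - \<theta>)"

definition wt0 :: "real \<Rightarrow> real \<Rightarrow> real" where
  "wt0 \<alpha> \<theta> = wt \<alpha> \<theta> * (1 - \<theta>)"

definition c0 :: "real \<Rightarrow> real" where "c0 \<theta> = 1 / (1 - \<theta>)"

definition c1 :: "real \<Rightarrow> real" where "c1 \<theta> = \<theta> / (1 - \<theta>)"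

definition Cop ::
  "real \<Rightarrow> 'h::{banach, second_countable_topology} \<Rightarrow> (real \<Rightarrow> 'h) \<Rightarrow> 'h" where
  "Cop \<alpha> u0 v = u0 + (LINT \<theta>:{0<..<1}|lborel. wt \<alpha> \<theta> *\<^sub>R v \<theta>)"

definition Hop :: "real \<Rightarrow> (real \<Rightarrow> 'h::real_normed_vector) \<Rightarrow> real" where
  "Hop \<alpha> v = 1 / 2 * (LINT \<theta>:{0<..<1}|lborel. \<theta> * wt \<alpha> \<theta> * (norm (v \<theta>))\<^sup>2)"

definition Xt :: "real \<Rightarrow> (real \<Rightarrow> 'x::real_normed_vector) set" where
  "Xt \<alpha> = Lq 2 (weighted_measure (wt \<alpha>))"

definition Xt_norm :: "real \<Rightarrow> (real \<Rightarrow> 'x::real_normed_vector) \<Rightarrow> real" where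
  "Xt_norm \<alpha> = Lnorm 2 (weighted_measure (wt \<alpha>))"

definition Ht :: "real \<Rightarrow> (real \<Rightarrow> 'h::real_normed_vector) set" where
  "Ht \<alpha> = Lq 2 (weighted_measure (wt0 \<alpha>))"

definition Ht_norm :: "real \<Rightarrow> (real \<Rightarrow> 'h::real_normed_vector) \<Rightarrow> real" where
  "Ht_norm \<alpha> = Lnorm 2 (weighted_measure (wt0 \<alpha>))"

definition Ht_inner :: "real \<Rightarrow> (real \<Rightarrow> 'h::real_inner) \<Rightarrow> (real \<Rightarrow> 'h) \<Rightarrow> real" where
  "Ht_inner \<alpha> v w = (\<integral>\<theta>. inner (v \<theta>) (w \<theta>) \<partial>weighted_measure (wt0 \<alpha>))"

text \<open>
  \<open>C\<close> has values in \<open>H\<close> while \<open>E\<close> is a functional on \<open>X\<close>: \<open>inv i\<close> reads an element of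
  \<open>X \<subseteq> H\<close> as an element of \<open>X\<close>. This is meaningful only if \<open>C\<close> maps the domain \<open>Xt\<close> into \<open>X\<close>.
\<close>

definition Et ::
  "real \<Rightarrow> ('x::real_normed_vector \<Rightarrow> 'h::{banach, second_countable_topology}) \<Rightarrow> 'h \<Rightarrow>
    ('x \<Rightarrow> real) \<Rightarrow> (real \<Rightarrow> 'x) \<Rightarrow> real" where
  "Et \<alpha> i u0 E v = E (inv i (Cop \<alpha> u0 (\<lambda>\<theta>. i (v \<theta>)))) + Hop \<alpha> (\<lambda>\<theta>. i (v \<theta>))"

definition Gop ::
  "('x::real_normed_vector \<Rightarrow> real) \<Rightarrow> (real \<Rightarrow> 'x) \<Rightarrow> real \<Rightarrow> real \<Rightarrow> ('x \<Rightarrow>\<^sub>L real)" where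
  "Gop E u t \<theta> = - c0 \<theta> *\<^sub>R
     dual_integral (interval_measure t) (\<lambda>s. exp (- c1 \<theta> * (t - s)) *\<^sub>R grad E (u s))"

section \<open>The two gradient flows\<close>

definition fractional_solution ::
  "real \<Rightarrow> real \<Rightarrow> real \<Rightarrow> real \<Rightarrow>
    ('x::{banach, second_countable_topology} \<Rightarrow> 'h::{real_inner, banach, second_countable_topology}) \<Rightarrow>
    'h \<Rightarrow> ('x \<Rightarrow> real) \<Rightarrow> (real \<Rightarrow> 'x) \<Rightarrow> bool"
where
  "fractional_solution T \<alpha> p p' i u0 E u \<longleftrightarrow>
     u \<in> Lq p (interval_measure T) \<and>
     (\<lambda>t. i (u t)) \<in> Linf (interval_measure T) \<and>
     (\<lambda>t. dual_embedding i (i (u t))) \<in> Lq p' (interval_measure T) \<and>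
     continuous_on {0..T} (conv (gker (1 - \<alpha>)) (\<lambda>s. i (u s) - u0)) \<and>
     (conv (gker (1 - \<alpha>)) (\<lambda>s. i (u s) - u0) \<longlongrightarrow> 0) (at_right 0) \<and>
     (\<exists>w\<in>Lq p' (interval_measure T).
        has_caputo_dual T \<alpha> i u0 (\<lambda>t. i (u t)) w \<and>
        (AE t in interval_measure T. \<forall>v. blinfun_apply (w t + grad E (u t)) v = 0))"

text \<open>
  Solutions of the extended flow lie in \<open>L\<^sup>p(0,T;Xt)\<close> with time derivative in \<open>L\<^sup>p\<^sup>'(0,T;Xt')\<close>;
  the pairing of \<open>Xt'\<close> and \<open>Xt\<close> extends the inner product of \<open>Ht\<close>. The initial value is that of
  the representative in \<open>C([0,T];Ht)\<close>.
\<close>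

definition integer_solution ::
  "real \<Rightarrow> real \<Rightarrow> real \<Rightarrow> real \<Rightarrow>
    ('x::{banach, second_countable_topology} \<Rightarrow> 'h::{real_inner, banach, second_countable_topology}) \<Rightarrow>
    'h \<Rightarrow> ('x \<Rightarrow> real) \<Rightarrow> (real \<Rightarrow> real \<Rightarrow> 'x) \<Rightarrow> bool"
where
  "integer_solution T \<alpha> p p' i u0 E ut \<longleftrightarrow>
     ut \<in> LqLr p (interval_measure T) 2 (weighted_measure (wt \<alpha>)) \<and>
     (\<exists>W\<in>Lq_dual p' (interval_measure T) (Xt \<alpha>) (Xt_norm \<alpha>).
        (\<forall>v\<in>Xt \<alpha>. has_distr_deriv T
           (\<lambda>t. Ht_inner \<alpha> (\<lambda>\<theta>. i (ut t \<theta>)) (\<lambda>\<theta>. i (v \<theta>))) (\<lambda>t. W t v)) \<and>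
        (AE t in interval_measure T. \<forall>v\<in>Xt \<alpha>. W t v + fun_grad (Et \<alpha> i u0 E) (ut t) v = 0)) \<and>
     (\<exists>z. (\<forall>t\<in>{0..T}. z t \<in> Ht \<alpha> \<and>
             ((\<lambda>s. Ht_norm \<alpha> (\<lambda>\<theta>. z s \<theta> - z t \<theta>)) \<longlongrightarrow> 0) (at t within {0..T})) \<and>
          (AE t in interval_measure T. AE \<theta> in interval_measure 1. z t \<theta> = i (ut t \<theta>)) \<and>
          (AE \<theta> in interval_measure 1. z 0 \<theta> = 0))"

definition equivalent_solutions ::
  "real \<Rightarrow> real \<Rightarrow>
    ('x::{banach, second_countable_topology} \<Rightarrow> 'h::{real_inner, banach, second_countable_topology}) \<Rightarrow>
    'h \<Rightarrow> ('x \<Rightarrow> real) \<Rightarrow> (real \<Rightarrow> 'x) \<Rightarrow> (real \<Rightarrow> real \<Rightarrow> 'x) \<Rightarrow> bool"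
where
  "equivalent_solutions T \<alpha> i u0 E u ut \<longleftrightarrow>
     (AE t in interval_measure T. i (u t) = Cop \<alpha> u0 (\<lambda>\<theta>. i (ut t \<theta>))) \<and>
     (AE (t, \<theta>) in interval_measure T \<Otimes>\<^sub>M interval_measure 1.
        dual_embedding i (i (ut t \<theta>)) = Gop E u t \<theta>)"

text \<open>
  \<open>H\<^sup>1(0,T;Ht)\<close>: an integral with values in \<open>Ht = L\<^sup>2\<^sub>\<alpha>\<^sub>,\<^sub>0(0,1;H)\<close> is evaluated pointwise
  at almost every \<open>\<theta>\<close>.
\<close>

definition H1_Ht ::
  "real \<Rightarrow> real \<Rightarrow> (real \<Rightarrow> real \<Rightarrow> 'h::{banach, second_countable_topology}) set" where
  "H1_Ht T \<alpha> = {ut \<in> LqLr 2 (interval_measure T) 2 (weighted_measure (wt0 \<alpha>)).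
     \<exists>D\<in>LqLr 2 (interval_measure T) 2 (weighted_measure (wt0 \<alpha>)).
       AE \<theta> in interval_measure 1. has_distr_deriv T (\<lambda>t. ut t \<theta>) (\<lambda>t. D t \<theta>)}"

definition regular_fractional ::
  "real \<Rightarrow> real \<Rightarrow> real \<Rightarrow>
    ('x::{banach, second_countable_topology} \<Rightarrow> 'h::{real_inner, banach, second_countable_topology}) \<Rightarrow>
    'h \<Rightarrow> (real \<Rightarrow> 'x) \<Rightarrow> bool"
where
  "regular_fractional T \<alpha> p i u0 u \<longleftrightarrow>
     u \<in> Lq p (interval_measure T) \<and>
     (\<lambda>t. i (u t)) \<in> Linf (interval_measure T) \<and>
     (\<lambda>t. i (u t)) \<in> W_frac T \<alpha> 2 u0"

definition regular_integer ::
  "real \<Rightarrow> real \<Rightarrow> real \<Rightarrow>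
    (real \<Rightarrow> real \<Rightarrow> 'h::{real_inner, banach, second_countable_topology}) \<Rightarrow> bool"
where
  "regular_integer T \<alpha> p' ut \<longleftrightarrow>
     ut \<in> LinfLr (interval_measure T) 2 (weighted_measure (wt \<alpha>)) \<and>
     ut \<in> H1_Ht T \<alpha> \<and>
     (\<lambda>\<theta> t. ut t \<theta>) \<in> LinfLr (interval_measure 1) p' (interval_measure T)"

end

theory Submission
 imports Defs
begin

text \<open>
 Testing weak-to-weak continuity on functions that oscillate rapidly between two values shows that
 \<open>grad E\<close> maps midpoints to midpoints. Hence it is affine, \<open>E\<close> is quadratic, and coercivity
 forces \<open>p = 2\<close> unless \<open>X\<close> is trivial.

 The exponential kernels \<open>pk \<theta> t = c0 \<theta> * exp (- c1 \<theta> * t)\<close> average to the fractional one,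
 \<open>gker \<alpha> t = \<integral> wt \<alpha> \<theta> * pk \<theta> t d\<theta>\<close>. So if \<open>w\<close> is the Caputo derivative of \<open>u\<close>, then \<open>u - u0\<close> is the
 weighted average of the functions \<open>ut \<theta> = pk \<theta> * w\<close>, which solve \<open>(1 - \<theta>) ut' + \<theta> ut = w\<close>.
 For \<open>w\<close> mollified in time, testing these equations with \<open>ut\<close> and with \<open>ut'\<close> and averaging over
 \<open>\<theta>\<close> gives two energy estimates, uniform in the mollification; Fatou's lemma passes them to the
 limit. Conversely, the lemma of du Bois-Reymond turns the weak form of the integer-order flow
 into these equations for almost every \<open>\<theta>\<close>, and their solutions are unique.
\<close>

text \<open>Why the estimates are made on the extended side: the Caputo derivative is nonlocal in
  time and has no product rule, whereas for fixed \<open>th\<close> the extended equation is an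
  ordinary differential equation, and testing it gives exact time derivatives. After averaging,
  \<open>th\<close> disappears from the right-hand side, and the gradient flow itself can be
  inserted there.

  The obstacle is regularity. A weak solution gives \<open>w\<close> only with values in the dual of
  \<open>X\<close>, so \<open>ut\<close> and its derivative are not yet admissible test functions.
  The fractional integral \<open>F\<close> of \<open>u - u0\<close> does have values in
  \<open>X\<close>, and mollification puts all time derivatives of \<open>F\<close> on a scalar
  kernel. In exchange, the constant part \<open>b\<close> of the affine gradient acquires a factor
  depending on time, and it must be estimated although \<open>b\<close> is not bounded in the norm
  of \<open>H\<close>. The estimates therefore have to survive with constants that see neither the
  kernel nor its derivatives.

  The form \<open>A\<close> is coercive only up to a multiple of the norm of \<open>H\<close>; the
  first estimate absorbs this by the square integrability of \<open>u\<close>, the second by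
  interpolation between the two weights \<open>th\<close> and \<open>1 - th\<close>.\<close>

abbreviation (input) "ivl \<equiv> interval_measure"
abbreviation (input) "bm \<equiv> borel_measurable"
abbreviation (input) "prim \<equiv> conv (\<lambda>_. 1)"
abbreviation (input) "nsq x \<equiv> (norm x)\<^sup>2"
abbreviation (input) "wm \<equiv> weighted_measure"
abbreviation (input) pairm (infixr "*M" 80) where "pairm \<equiv> pair_measure"
abbreviation (input) scR (infixr "*R" 75) where "scR \<equiv> scaleR"
abbreviation (input) lims (infix "---->" 60) where "f ----> l \<equiv> (f \<longlonglongrightarrow> l)"
lemmas set_int = set_lebesgue_integral_def
lemmas LI_cong = Bochner_Integration.integral_cong
lemmas LI_bound = Bochner_Integration.integrable_bound
lemmas LI_icong = Bochner_Integration.integrable_cong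

syntax
 "_LI" :: "pttrn \<Rightarrow> 'a measure \<Rightarrow> 'b \<Rightarrow> 'b" ("(LI _|_./ _)" [0,61,10] 10)
 "_PI" :: "pttrn \<Rightarrow> 'a measure \<Rightarrow> ennreal \<Rightarrow> ennreal" ("(PI _|_./ _)" [0,61,10] 10)
 "_NI" :: "pttrn \<Rightarrow> 'a measure \<Rightarrow> real \<Rightarrow> ennreal" ("(NI _|_./ _)" [0,61,10] 10)
 "_LI0" :: "pttrn \<Rightarrow> real \<Rightarrow> 'b \<Rightarrow> 'b" ("(LI _<_./ _)" [0,51,10] 10)
 "_NI0" :: "pttrn \<Rightarrow> real \<Rightarrow> real \<Rightarrow> ennreal" ("(NI _<_./ _)" [0,51,10] 10)
translations
 "NI x<t. f" \<rightharpoonup> "CONST nn_integral (CONST lborel) (\<lambda>x. CONST ennreal f * CONST indicator (CONST greaterThanLessThan (CONST zero_class.zero) t) x)"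
 "LI x|M. f" \<rightharpoonup> "CONST lebesgue_integral M (\<lambda>x. f)"
 "PI x|M. f" \<rightharpoonup> "CONST nn_integral M (\<lambda>x. f)"
 "NI x|M. f" \<rightharpoonup> "CONST nn_integral M (\<lambda>x. CONST ennreal f)"
 "LI x<t. f" \<rightharpoonup> "CONST set_lebesgue_integral (CONST lborel) (CONST greaterThanLessThan (CONST zero_class.zero) t) (\<lambda>x. f)"


section \<open>Convolution\<close>

abbreviation iint :: "real => (real => 'b::{banach, second_countable_topology}) => bool" where
 "iint t f \<equiv> set_integrable lborel {0<..<t} f"

lemma iint_iff: "integrable (ivl T) f \<longleftrightarrow> iint T f"
 by (simp add: set_integrable_def integrable_restrict_space)

lemma integral_interval:
 fixes f :: "real => 'b::{banach, second_countable_topology}"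
 shows "(LI t|ivl T. f t) = (LI t<T. f t)"
 by (subst integral_restrict_space) (auto simp: set_int)

lemma AE_interval: "(AE t in ivl T. P t) \<longleftrightarrow> (AE t in lborel. t \<in> {0<..<T} \<longrightarrow> P t)"
 by (simp add: AE_restrict_space_iff)

text \<open>No integrability is required: for nonzero \<open>c\<close> the scaled function is
  integrable exactly when \<open>f\<close> is, and otherwise both integrals take the default value
  0.\<close>

lemma integral_scaleR_const:
 fixes f :: "'a => 'b::{banach, second_countable_topology}"
 shows "(LI x|M. c *R f x) = c *R (LI x|M. f x)"
proof (cases "c = 0 \<or> integrable M f")
 case False
 hence "\<not> integrable M (%x. c *R f x)"
  using integrable_scaleR_right[of "1/c" M "%x. c *R f x"] by auto
 with False show ?thesis by (simp add: not_integrable_integral_eq)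
qed auto

text \<open>Convolution over the whole line, where Fubini's theorem and translation invariance need
  no boundary terms. Cutting both factors off to an interval recovers \<open>conv\<close>, see
  \<open>conv_cv\<close>.\<close>

definition cv :: "(real => real) => (real => 'b::{banach, second_countable_topology}) => real => 'b" where
 "cv k f t = (LI s|lborel. k (t - s) *R f s)"

lemma cv_pair_integrable:
 fixes f :: "real => 'b::{banach, second_countable_topology}"
 assumes k: "integrable lborel k" and f: "integrable lborel f"
 shows "integrable (lborel *M lborel) (%(t, s). k (t - s) *R f s)"
proof -
 have [measurable]: "k \<in> bm borel" "f \<in> bm borel"
  using k f by auto
 have k_shift: "integrable lborel (%t. k (t - s))" for s
  using lborel_integrable_real_affine[OF k, of 1 "-s"] by simp
 have "integrable (lborel *M lborel) (%(s, t). k (t - s) *R f s)"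
 proof (rule lborel_pair.Fubini_integrable)
  have *: "(LI t|lborel. norm (k (t - s) *R f s)) = (LI t|lborel. \<bar>k t\<bar>) * norm (f s)" for s
   using lborel_integral_real_affine[of 1 "%t. \<bar>k t\<bar>" "-s"] by simp
  show "integrable lborel (%s. LI t|lborel. norm (case (s, t) of (s, t) => k (t - s) *R f s))"
   unfolding prod.case * using f by simp
 qed (use k_shift in auto)
 from lborel_pair.integrable_product_swap[OF this] show ?thesis by (simp add: split_beta')
qed

text \<open>Young's inequality for two integrable factors: a shift in \<open>t\<close> decouples the
  double integral of the norms into a product.\<close>

lemma cv_integrable:
 fixes f :: "real => 'b::{banach, second_countable_topology}"
 assumes k: "integrable lborel k" and f: "integrable lborel f"
 shows "integrable lborel (cv k f)"
  and "AE t in lborel. integrable lborel (%s. k (t - s) *R f s)"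
  and "(LI t|lborel. norm (cv k f t)) <= (LI t|lborel. \<bar>k t\<bar>) * (LI t|lborel. norm (f t))"
proof -
 note I = cv_pair_integrable[OF k f]
 show 1: "integrable lborel (cv k f)"
  using lborel_pair.integrable_fst'[OF I] by (simp add: cv_def[abs_def])
 show "AE t in lborel. integrable lborel (%s. k (t - s) *R f s)"
  using lborel_pair.AE_integrable_fst'[OF I] by simp
 let ?n = "%t s. \<bar>k (t - s)\<bar> * norm (f s)"
 have In: "integrable (lborel *M lborel) (%(t, s). ?n t s)"
  using cv_pair_integrable[of "%x. \<bar>k x\<bar>" "%x. norm (f x)"] k f by simp
 have "(LI t|lborel. norm (cv k f t)) <= (LI t|lborel. (LI s|lborel. ?n t s))"
 proof (rule integral_mono)
  show "integrable lborel (%t. LI s|lborel. ?n t s)"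
   using lborel_pair.integrable_fst'[OF In] by simp
  show "norm (cv k f t) <= (LI s|lborel. ?n t s)" for t
   unfolding cv_def by (rule order_trans[OF integral_norm_bound]) simp
 qed (use 1 in simp)
 also have "... = (LI s|lborel. (LI t|lborel. ?n t s))"
  using lborel_pair.Fubini_integral[OF In] by simp
 also have "... = (LI s|lborel. (LI t|lborel. \<bar>k t\<bar>) * norm (f s))"
 proof (rule LI_cong)
  show "(LI t|lborel. ?n t s) = (LI t|lborel. \<bar>k t\<bar>) * norm (f s)" for s
   using lborel_integral_real_affine[of 1 "%t. \<bar>k t\<bar>" "-s"] by simp
 qed simp
 also have "... = (LI t|lborel. \<bar>k t\<bar>) * (LI t|lborel. norm (f t))" by simp
 finally show "(LI t|lborel. norm (cv k f t)) <= (LI t|lborel. \<bar>k t\<bar>) * (LI t|lborel. norm (f t))" .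
qed

text \<open>Associativity is wanted at every single \<open>t\<close>, whereas integrability of the
  factors alone would give it almost everywhere. The bound \<open>C\<close> makes the double
  integral converge absolutely at the given \<open>t\<close>.\<close>

lemma cv_assoc:
 fixes f :: "real => 'b::{banach, second_countable_topology}"
 assumes k: "integrable lborel k" and l: "integrable lborel l" and f: "integrable lborel f"
  and C: "!!r. f r \<noteq> 0 ==> (NI s|lborel. \<bar>k (t - r - s) * l s\<bar>) <= ennreal C"
 shows "cv k (cv l f) t = cv (cv k l) f t"
proof -
 have [measurable]: "k \<in> bm borel" "l \<in> bm borel" "f \<in> bm borel"
  using k l f by auto
 let ?g = "%s r. (k (t - s) * l (s - r)) *R f r"
 have shift: "(NI s|lborel. norm (?g s r)) = (NI s|lborel. \<bar>k (t - r - s) * l s\<bar>) * ennreal (norm (f r))" for r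
  by (subst nn_integral_real_affine[where c=1 and t=r])
   (simp_all add: nn_integral_multc[symmetric] nn_integral_cmult[symmetric] ennreal_mult'[symmetric] abs_mult ac_simps diff_diff_eq)
 have I: "integrable (lborel *M lborel) (%(s, r). ?g s r)"
 proof (rule integrableI_bounded)
  have "(NI x|(lborel *M lborel). norm (case x of (s, r) => ?g s r))
    = (PI r|lborel. (NI s|lborel. norm (?g s r)))"
   by (subst lborel_pair.nn_integral_snd[symmetric]) auto
  also have "... <= (PI r|lborel. ennreal C * ennreal (norm (f r)))"
  proof (rule nn_integral_mono)
   show "(NI s|lborel. norm (?g s r)) <= ennreal C * ennreal (norm (f r))" for r
    unfolding shift using C[of r] by (cases "f r = 0") (auto intro: mult_right_mono)
  qed
  also have "... < \<infinity>"
   using f by (subst nn_integral_cmult) (auto simp: integrable_iff_bounded ennreal_mult_less_top)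
  finally show "(NI x|(lborel *M lborel). norm (case x of (s, r) => ?g s r)) < \<infinity>" .
 qed measurable
 have "cv k (cv l f) t = (LI s|lborel. (LI r|lborel. ?g s r))"
  unfolding cv_def by (simp add: integral_scaleR_const[symmetric])
 also have "... = (LI r|lborel. (LI s|lborel. ?g s r))"
  using lborel_pair.Fubini_integral[OF I] by simp
 also have "... = (LI r|lborel. cv k l (t - r) *R f r)"
 proof (rule LI_cong[OF refl])
  fix r
  show "(LI s|lborel. ?g s r) = cv k l (t - r) *R f r"
  proof (cases "f r = 0")
   case False
   have "integrable lborel (%s. k (t - r - s) * l s)"
    using C[OF False] by (intro integrableI_bounded) (auto simp: le_less_trans[OF _ ennreal_less_top])
   from lborel_integrable_real_affine[OF this, of 1 "-r"]
   have i: "integrable lborel (%s. k (t - s) * l (s - r))" by (simp add: algebra_simps)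
   have "(LI s|lborel. k (t - s) * l (s - r)) = (LI s|lborel. k (t - r - s) * l s)"
    using lborel_integral_real_affine[of 1 "%s. k (t - s) * l (s - r)" r] by (simp add: algebra_simps)
   thus ?thesis
    using i by (simp add: cv_def)
  qed simp
 qed
 finally show ?thesis by (simp add: cv_def)
qed

lemma cv_commute: "cv k l t = cv l k t" for k l :: "real => real"
 unfolding cv_def
 by (subst lborel_integral_real_affine[of "-1" _ t]) (auto simp: mult.commute)

abbreviation cut :: "real => (real => 'b::real_vector) => real => 'b" where
 "cut t f s \<equiv> indicator {0<..<t} s *R f s"

lemma iint_cut: "iint t f \<longleftrightarrow> integrable lborel (cut t f)"
 by (simp add: set_integrable_def)

text \<open>Any cut-off point \<open>t\<close> beyond \<open>s\<close> gives the same value at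
  \<open>s\<close>, because the kernel cut off at 0 already removes the future. So one pair of
  functions on the line serves a whole time interval.\<close>

lemma conv_cv:
 assumes "s <= t" shows "conv k f s = cv (cut t k) (cut t f) s"
 unfolding conv_def cv_def set_int
 by (rule LI_cong) (use assms in "auto simp: indicator_def")

lemma conv_cong:
 assumes "!!s. [|0 < s; s < t|] ==> k s = k' s" "!!s. [|0 < s; s < t|] ==> f s = f' s"
 shows "conv k f t = conv k' f' t"
 unfolding conv_def set_int
 by (rule LI_cong) (use assms in "auto simp: indicator_def")

lemma conv_integrable:
 assumes k: "iint T k" and f: "iint T f"
 shows "iint T (conv k f)"
  and "AE t in lborel. t \<in> {0<..<T} \<longrightarrow> iint t (%s. k (t - s) *R f s)"
  and "(LI t<T. norm (conv k f t)) <=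
    (LI t<T. \<bar>k t\<bar>) * (LI t<T. norm (f t))"
proof -
 have k': "integrable lborel (cut T k)" and f': "integrable lborel (cut T f)"
  using k f by (auto simp: iint_cut)
 note I = cv_integrable[OF k' f']
 have eq: "cut T (conv k f) t = cut T (cv (cut T k) (cut T f)) t" for t
  by (auto simp: indicator_def conv_cv[of t T k f])
 have J: "iint T (cv (cut T k) (cut T f))"
  using I(1) unfolding set_integrable_def by (intro integrable_mult_indicator) auto
 thus "iint T (conv k f)"
  unfolding set_integrable_def eq .
 show "AE t in lborel. t \<in> {0<..<T} \<longrightarrow> iint t (%s. k (t - s) *R f s)"
  using I(2)
 proof eventually_elim
  case (elim t)
  show ?case
  proof
   assume "t \<in> {0<..<T}"
   hence "(%s. cut T k (t - s) *R cut T f s) = cut t (%s. k (t - s) *R f s)"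
    by (auto simp: fun_eq_iff indicator_def)
   with elim show "iint t (%s. k (t - s) *R f s)" by (simp add: set_integrable_def)
  qed
 qed
 have "(LI t<T. norm (conv k f t)) <= (LI t|lborel. norm (cv (cut T k) (cut T f) t))"
  unfolding set_int
 proof (rule integral_mono)
  have "integrable lborel (%x. norm (cut T (conv k f) x))"
   using J unfolding set_integrable_def eq by (rule integrable_norm)
  thus "integrable lborel (%x. indicator {0<..<T} x *R norm (conv k f x))"
   by simp
  show "indicator {0<..<T} t *R norm (conv k f t) <= norm (cv (cut T k) (cut T f) t)" for t
   by (auto simp: indicator_def conv_cv[of t T k f])
 qed (use I(1) in simp)
 also have "... <= (LI t|lborel. \<bar>cut T k t\<bar>) * (LI t|lborel. norm (cut T f t))"
  by (rule I(3))
 also have "... = (LI t<T. \<bar>k t\<bar>) * (LI t<T. norm (f t))"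
  by (simp add: set_int abs_mult)
 finally show "(LI t<T. norm (conv k f t)) <=
    (LI t<T. \<bar>k t\<bar>) * (LI t<T. norm (f t))" .
qed

lemma conv_assoc:
 assumes k: "iint t k" and l: "iint t l" and f: "iint t f"
  and C: "!!x. [|0 < x; x < t|] ==> (NI s<x. \<bar>k (x - s) * l s\<bar>) <= ennreal C"
 shows "conv k (conv l f) t = conv (conv k l) f t"
proof -
 let ?k = "cut t k" and ?l = "cut t l" and ?f = "cut t f"
 have "conv k (conv l f) t = cv ?k (cv ?l ?f) t"
  unfolding conv_def[of _ _ t] cv_def[of _ _ t] set_int
 proof (rule LI_cong[OF refl])
  fix s
  have "cv ?l ?f s = 0" if "s <= 0"
   unfolding conv_cv[symmetric, OF less_imp_le, of s t l f] cv_def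
   by (rule integral_eq_zero_AE) (use that in "auto simp: indicator_def")
  thus "indicator {0<..<t} s *R k (t - s) *R conv l f s = ?k (t - s) *R cv ?l ?f s"
   by (auto simp: indicator_def conv_cv[of s t l f])
 qed
 also have "... = cv (cv ?k ?l) ?f t"
 proof (rule cv_assoc[where C=C])
  fix r assume "?f r \<noteq> 0"
  hence r: "0 < r" "r < t" by (auto simp: indicator_def split: if_splits)
  have "(NI s|lborel. \<bar>?k (t - r - s) * ?l s\<bar>)
   = (NI s<t-r. \<bar>k (t - r - s) * l s\<bar>)"
   by (rule nn_integral_cong) (use r in "auto simp: indicator_def")
  also have "... <= ennreal C" using r by (intro C) auto
  finally show "(NI s|lborel. \<bar>?k (t - r - s) * ?l s\<bar>) <= ennreal C" .
 qed (use k l f in "auto simp: iint_cut")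
 also have "... = conv (conv k l) f t"
  unfolding conv_def[of "conv k l"] cv_def[of "cv ?k ?l"] set_int
  by (rule LI_cong[OF refl])
   (auto simp: indicator_def conv_cv[of _ t k l])
 finally show ?thesis .
qed

lemma conv_commute: "conv k l t = conv l k t" for k l :: "real => real"
 by (simp add: conv_cv[OF order_refl] cv_commute)

section \<open>Fractional kernels and weights\<close>

lemma gker_measurable [measurable]: "gker a \<in> bm borel"
 unfolding gker_def[abs_def] by measurable

lemma wt_measurable [measurable]: "wt a \<in> bm borel"
 unfolding wt_def[abs_def] by measurable

lemma gker_nonneg: "a > 0 ==> gker a t \<ge> 0"
 by (simp add: gker_def)

lemma wt_nonneg: "[|0 < a; a < 1|] ==> wt a th \<ge> 0"
 by (simp add: wt_def gker_nonneg)

lemma wt_pos: "[|0 < a; a < 1; 0 < th; th < 1|] ==> wt a th > 0"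
 by (simp add: wt_def gker_def)

text \<open>The substitution \<open>s = t * x\<close> removes \<open>t\<close>, since the two
  exponents add up to -1, and leaves a Beta integral, which the Gamma factors of the kernels
  normalize to 1.\<close>

lemma nn_integral_gker_gker:
 assumes "a > 0" "b > 0" "a + b = 1" "t > 0"
 shows "(NI s<t. gker a (t - s) * gker b s) = 1"
proof -
 have "(NI s<t. gker a (t - s) * gker b s)
   = (PI x|lborel. ennreal t * (ennreal (gker a (t - t * x) * gker b (t * x)) * indicator {0<..<t} (t * x)))"
  using \<open>t > 0\<close> by (subst nn_integral_real_affine[where c=t and t=0]) (auto simp: nn_integral_cmult)
 also have "... = (PI x|lborel. ennreal (1 / (Gamma a * Gamma b)) *
   ennreal (indicator {0..1} x * (x powr (b - 1) * (1 - x) powr (a - 1))))"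
 proof (rule nn_integral_cong_AE)
  have "AE x in lborel. x \<noteq> 0 \<and> x \<noteq> (1::real)"
   by (intro AE_conjI AE_lborel_singleton)
  thus "AE x in lborel. ennreal t * (ennreal (gker a (t - t * x) * gker b (t * x)) * indicator {0<..<t} (t * x))
   = ennreal (1 / (Gamma a * Gamma b)) *
   ennreal (indicator {0..1} x * (x powr (b - 1) * (1 - x) powr (a - 1)))"
  proof eventually_elim
   case (elim x)
   show ?case
   proof (cases "0 < x \<and> x < 1")
    case True
    hence tx: "0 < t * x" "t * x < t" using \<open>t > 0\<close> by auto
    have p: "t * (t powr (a - 1) * t powr (b - 1)) = 1"
    proof -
     have "t powr 1 * (t powr (a - 1) * t powr (b - 1)) = t powr (1 + ((a - 1) + (b - 1)))"
      by (simp only: powr_add)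
     also have "1 + ((a - 1) + (b - 1)) = 0" using assms by simp
     finally show ?thesis using \<open>t > 0\<close> by simp
    qed
    have "t - t * x = t * (1 - x)" by (simp add: algebra_simps)
    hence "gker a (t - t * x) * gker b (t * x) = (t powr (a - 1) * t powr (b - 1)) *
      (1 / (Gamma a * Gamma b) * (x powr (b - 1) * (1 - x) powr (a - 1)))"
     using True \<open>t > 0\<close> by (simp add: gker_def powr_mult)
    hence "t * (gker a (t - t * x) * gker b (t * x)) = 1 / (Gamma a * Gamma b) * (x powr (b - 1) * (1 - x) powr (a - 1))"
     using p by (metis mult.assoc mult.left_neutral)
    thus ?thesis using True tx \<open>t > 0\<close> assms
     by (auto simp: ennreal_mult'[symmetric])
   next
    case False
    with elim have "x < 0 \<or> x > 1" by auto
    thus ?thesis using \<open>t > 0\<close> by (auto simp: indicator_def zero_less_mult_iff)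
   qed
  qed
 qed
 also have "... = ennreal (1 / (Gamma a * Gamma b)) * ennreal (Beta b a)"
  using nn_integral_has_integral_lebesgue[OF _ has_integral_Beta_real[of b a]] assms
  by (subst nn_integral_cmult) auto
 also have "... = ennreal (1 / (Gamma a * Gamma b) * Beta b a)"
  using assms by (subst ennreal_mult') auto
 also have "1 / (Gamma a * Gamma b) * Beta b a = 1"
 proof -
  have "b + a = 1" using assms by simp
  moreover have "Gamma a > 0" "Gamma b > 0" using assms by auto
  ultimately show ?thesis by (simp add: Beta_def)
 qed
 finally show ?thesis by simp
qed

lemma nn_integral_wt:
 assumes "0 < a" "a < 1"
 shows "(NI th<1. wt a th) = 1"
 using nn_integral_gker_gker[of a "1-a" 1] assms by (simp add: wt_def mult.commute)

text \<open>The impulse response of the operator \<open>(1 - th) y' + th y\<close>: the jump at 0 is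
  \<open>c0 th\<close> and the rate of decay is \<open>c1 th\<close>.\<close>

definition pk :: "real => real => real" where "pk th \<tau> = c0 th * exp (- c1 th * \<tau>)"

lemma c0_measurable [measurable]: "c0 \<in> bm borel"
 and c1_measurable [measurable]: "c1 \<in> bm borel"
 unfolding c0_def[abs_def] c1_def[abs_def] by measurable

text \<open>With \<open>x = t * th / (1 - th)\<close> the exponential becomes
  \<open>exp (- x)\<close>. The powers of \<open>1 - th\<close> in the weight and in
  \<open>c0\<close> are those of the Jacobian and of \<open>x powr (- a)\<close>, so the Gamma
  integral of order \<open>1 - a\<close> remains and cancels the factor \<open>Gamma (1 - a)\<close>
  of the weight.\<close>

lemma nn_integral_wt_pk:
 assumes "0 < a" "a < 1" "t > 0"
 shows "(NI th<1. wt a th * pk th t) = ennreal (gker a t)"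
proof -
 have G0: "Gamma (1 - a) > 0" by (rule Gamma_real_pos) (use assms in simp)
 let ?S = "{0<..<1::real}"
 let ?g = "%th. t * th / (1 - th)" and ?f = "%x. x powr (1 - a - 1) / exp x"
 let ?h = "%th. t / (1 - th)^2"
 have img: "?g ` ?S = {0<..}"
 proof (intro set_eqI iffI)
  fix x :: real assume x: "x \<in> {0<..}"
  have "1 - x / (t + x) = t / (t + x)" using x \<open>t > 0\<close> by (simp add: field_simps)
  hence "x = ?g (x / (t + x))" "x / (t + x) \<in> ?S"
   using x \<open>t > 0\<close> by auto
  thus "x \<in> ?g ` ?S" by blast
 qed (use \<open>t > 0\<close> in auto)
 have inj: "inj_on ?g ?S"
 proof (rule inj_onI)
  fix x y assume xy: "x \<in> ?S" "y \<in> ?S" "?g x = ?g y"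
  have "z / (1 - z) = 1 / (1 - z) - 1" if "z \<in> ?S" for z :: real
   using that by (simp add: field_simps)
  with xy \<open>t > 0\<close> have "1 / (1 - x) = 1 / (1 - y)"
   by (metis (no_types, lifting) add_diff_cancel_left' diff_add_cancel less_numeral_extra(3) mult_cancel_left times_divide_eq_right)
  thus "x = y" by simp
 qed
 have der: "(?g has_field_derivative ?h x) (at x within ?S)" if "x \<in> ?S" for x
  using that by (auto intro!: derivative_eq_intros simp: power2_eq_square field_simps)
 have G: "(?f has_integral Gamma (1 - a)) {0..}" using Gamma_integral_real[of "1 - a"] assms by simp
 have "(?f has_integral Gamma (1 - a)) {0<..} \<longleftrightarrow> (?f has_integral Gamma (1 - a)) {0..}"
  by (rule has_integral_spike_set_eq) (auto intro!: negligible_subset[OF negligible_sing[of 0]])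
 with G have "(?f has_integral Gamma (1 - a)) {0<..}" by simp
 hence f: "?f absolutely_integrable_on ?g ` ?S \<and> integral (?g ` ?S) ?f = Gamma (1 - a)"
  unfolding img by (auto simp: integral_unique intro!: nonnegative_absolutely_integrable_1)
 have "(%x. \<bar>?h x\<bar> * ?f (?g x)) absolutely_integrable_on ?S \<and> integral ?S (%x. \<bar>?h x\<bar> * ?f (?g x)) = Gamma (1 - a)"
  by (rule iffD2[OF has_absolute_integral_change_of_variables_1' f]) (use der inj in auto)
 hence HI: "((%x. \<bar>?h x\<bar> * ?f (?g x)) has_integral Gamma (1 - a)) ?S"
  using set_lebesgue_integral_eq_integral(1)[of ?S "%x. \<bar>?h x\<bar> * ?f (?g x)"]
   integrable_integral[of "%x. \<bar>?h x\<bar> * ?f (?g x)" ?S] by presburger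
 have "(\<integral>\<^sup>+th\<in>?S. ennreal (wt a th * pk th t) \<partial>lborel)
  = (PI th|lborel. ennreal (t powr (a - 1) / (Gamma a * Gamma (1 - a))) * ennreal (indicator ?S th * (\<bar>?h th\<bar> * ?f (?g th))))"
 proof (rule nn_integral_cong)
  fix th
  show "ennreal (wt a th * pk th t) * indicator ?S th = ennreal (t powr (a - 1) / (Gamma a * Gamma (1 - a))) * ennreal (indicator ?S th * (\<bar>?h th\<bar> * ?f (?g th)))"
  proof (cases "th \<in> ?S")
   case True
   hence th: "0 < th" "th < 1" by auto
   define d where "d = 1 - th"
   have d: "d > 0" using th by (simp add: d_def)
   have e: "- c1 th * t = - (t * th / d)" by (simp add: c1_def d_def)
   have f_eq: "?f (?g th) = t powr (-a) * th powr (-a) * d powr a * exp (- c1 th * t)"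
    unfolding e exp_minus d_def[symmetric] using th \<open>t > 0\<close> d
    by (simp add: powr_divide powr_mult powr_minus divide_simps)
   have h_eq: "\<bar>?h th\<bar> = t / d^2" using d \<open>t > 0\<close> by (simp add: d_def)
   have t1: "t powr (a - 1) * t * t powr (- a) = 1"
   proof -
    have "t powr (a - 1) * t powr 1 * t powr (- a) = t powr ((a - 1) + 1 + - a)"
     by (simp only: powr_add)
    thus ?thesis using \<open>t > 0\<close> by simp
   qed
   have d1: "d powr a / d^2 = d powr (a - 1) / d"
    using d by (simp add: powr_diff power2_eq_square)
   have "t powr (a - 1) * (\<bar>?h th\<bar> * ?f (?g th)) =
    (t powr (a - 1) * t * t powr (- a)) * (th powr (-a) * (d powr a / d^2) * exp (- c1 th * t))"
    unfolding f_eq h_eq by (simp only: times_divide_eq_left times_divide_eq_right ac_simps)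
   hence 1: "t powr (a - 1) * (\<bar>?h th\<bar> * ?f (?g th)) = th powr (-a) * (d powr (a - 1) / d) * exp (- c1 th * t)"
    unfolding t1 d1 by simp
   have "wt a th * pk th t = th powr (-a) * (d powr (a - 1) / d) * exp (- c1 th * t) / (Gamma a * Gamma (1 - a))"
    by (simp add: wt_def gker_def pk_def c0_def d_def)
   also have "... = (t powr (a - 1) / (Gamma a * Gamma (1 - a))) * (\<bar>?h th\<bar> * ?f (?g th))"
    unfolding 1[symmetric] by (simp only: times_divide_eq_left)
   finally have "wt a th * pk th t = (t powr (a - 1) / (Gamma a * Gamma (1 - a))) * (\<bar>?h th\<bar> * ?f (?g th))" .
   moreover have "0 <= t powr (a - 1) / (Gamma a * Gamma (1 - a))" using assms by simp
   ultimately have "ennreal (wt a th * pk th t) = ennreal (t powr (a - 1) / (Gamma a * Gamma (1 - a))) * ennreal (\<bar>?h th\<bar> * ?f (?g th))"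
    by (simp only: ennreal_mult')
   thus ?thesis using True by (simp only: indicator_simps mult_1_left mult_1_right)
  next
   case False
   hence "indicator ?S th = (0::real)" "indicator ?S th = (0::ennreal)" by (auto simp del: greaterThanLessThan_iff)
   thus ?thesis by (simp only: mult_zero_left mult_zero_right ennreal_0)
  qed
 qed
 also have "... = ennreal (t powr (a - 1) / (Gamma a * Gamma (1 - a))) * ennreal (Gamma (1 - a))"
 proof -
  define q where "q th = \<bar>?h th\<bar> * ?f (?g th)" for th
  have [measurable]: "q \<in> bm borel" unfolding q_def by measurable
  have "(NI th|lborel. indicator ?S th * q th) = ennreal (Gamma (1 - a))"
   by (rule nn_integral_has_integral_lebesgue) (use HI in "auto simp: q_def")
  thus ?thesis unfolding q_def[symmetric] by (subst nn_integral_cmult) auto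
 qed
 also have "... = ennreal (t powr (a - 1) / (Gamma a * Gamma (1 - a)) * Gamma (1 - a))"
  using less_imp_le[OF G0] by (rule ennreal_mult''[symmetric])
 also have "t powr (a - 1) / (Gamma a * Gamma (1 - a)) * Gamma (1 - a) = gker a t"
  using less_imp_neq[OF G0] by (simp add: gker_def)
 finally show ?thesis .
qed

abbreviation Mw :: "real => real measure" where "Mw a \<equiv> wm (wt a)"

lemma sets_weighted [simp]: "sets (wm w) = sets (ivl 1)"
 and space_weighted [simp]: "space (wm w) = {0<..<1}"
 by (auto simp: weighted_measure_def space_restrict_space)

lemma interval_measurable: "f \<in> bm borel ==> f \<in> bm (ivl T)"
 by (intro measurable_restrict_space1) simp

lemma bm_weighted:
 "f \<in> bm borel ==> f \<in> bm (wm w)"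
 by (subst measurable_cong_sets[OF sets_weighted refl]) (rule interval_measurable)

lemma nn_integral_weighted:
 assumes [measurable]: "w \<in> bm borel" and f: "f \<in> bm (ivl 1)"
 shows "(PI th|wm w. f th) = (\<integral>\<^sup>+th\<in>{0<..<1}. ennreal (w th) * f th \<partial>lborel)"
proof -
 have "(%th. ennreal (w th)) \<in> bm (ivl 1)"
  by (rule interval_measurable) simp
 from nn_integral_density[OF this f] show ?thesis
  unfolding weighted_measure_def by (simp add: nn_integral_restrict_space)
qed

lemma integral_weighted:
 fixes f :: "real => 'b::{banach, second_countable_topology}"
 assumes w: "w \<in> bm borel" and f: "f \<in> bm (ivl 1)"
  and nn: "!!th. w th \<ge> 0"
 shows "(LI th|wm w. f th) = (LI th<1. w th *R f th)"
 unfolding weighted_measure_def integral_interval[symmetric]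
 by (rule integral_density[OF f interval_measurable[OF w]]) (simp add: nn)

lemma integrable_weighted:
 fixes f :: "real => 'b::{banach, second_countable_topology}"
 assumes w: "w \<in> bm borel" and f: "f \<in> bm (ivl 1)"
  and nn: "!!th. w th \<ge> 0"
 shows "integrable (wm w) f \<longleftrightarrow> iint 1 (%th. w th *R f th)"
 unfolding weighted_measure_def iint_iff[symmetric]
 by (rule integrable_density[OF f interval_measurable[OF w]]) (simp add: nn)

lemma AE_weighted:
 assumes [measurable]: "w \<in> bm borel"
  and pos: "!!th. [|0 < th; th < 1|] ==> w th > 0"
 shows "(AE th in wm w. P th) \<longleftrightarrow> (AE th in ivl 1. P th)"
proof -
 have "(%th. ennreal (w th)) \<in> bm (ivl 1)"
  by (rule interval_measurable) simp
 from AE_density[OF this] have "(AE th in wm w. P th) \<longleftrightarrow> (AE th in ivl 1. 0 < ennreal (w th) \<longrightarrow> P th)"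
  unfolding weighted_measure_def by simp
 also have "... \<longleftrightarrow> (AE th in ivl 1. P th)"
  by (rule AE_cong) (simp add: space_restrict_space pos)
 finally show ?thesis .
qed

lemma iint_gker: "a > 0 ==> iint T (gker a)"
proof -
 assume a: "a > 0"
 have "(%x. x powr (a - 1)) absolutely_integrable_on {0<..<T}"
 proof (cases "T > 0")
  case True
  have "(%x. x powr (a - 1)) integrable_on {0..T}"
   using a True by (intro integrable_on_powr_from_0) auto
  thus ?thesis
   by (intro nonnegative_absolutely_integrable_1) (auto simp: integrable_on_Icc_iff_Ioo)
 qed auto
 hence "iint T (%x. x powr (a - 1))"
  unfolding set_integrable_def by (subst (asm) integrable_completion) measurable
 hence "iint T (%x. x powr (a - 1) / Gamma a)"
  by (rule set_integrable_divide)
 thus ?thesis unfolding gker_def[abs_def] .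
qed

lemma pk_nonneg: "th < 1 ==> pk th t \<ge> 0"
 by (simp add: pk_def c0_def)

lemma prob_space_Mw: assumes "0 < a" "a < 1" shows "emeasure (Mw a) {0<..<1} = 1" "finite_measure (Mw a)"
proof -
 have "emeasure (Mw a) (space (Mw a)) = (PI th|Mw a. 1)" by simp
 also have "... = 1" by (subst nn_integral_weighted) (use nn_integral_wt[OF assms] in auto)
 finally show "emeasure (Mw a) {0<..<1} = 1" by simp
 thus "finite_measure (Mw a)" by (intro finite_measureI) simp
qed

lemma conv_measurable_param:
 assumes [measurable]: "(%(th, s). k th s) \<in> bm (borel *M borel)" "f \<in> bm borel"
 shows "(%(th, t). conv (k th) f t) \<in> bm (borel *M borel)"
proof -
 have *: "(%(th, t). conv (k th) f t) =
  (%x. LI s|lborel. indicator {s. 0 < s \<and> s < snd x} s *R (case (fst x, snd x - s) of (th, s) => k th s) *R f s)"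
  by (auto simp: conv_def set_int fun_eq_iff greaterThanLessThan_def greaterThan_def lessThan_def Int_def)
 show ?thesis unfolding * by measurable
qed

lemma conv_measurable [measurable]:
 assumes [measurable]: "k \<in> bm borel" "f \<in> bm borel"
 shows "conv k f \<in> bm borel"
proof -
 have "(%(th::real, t). conv k f t) \<in> bm (borel *M borel)"
  by (rule conv_measurable_param) measurable
 from measurable_compose[OF _ this, of "%t. (0, t)" borel] show ?thesis by simp
qed

lemma iint_mono: "[|iint T f; t <= T|] ==> iint t f"
 by (rule set_integrable_subset) auto

lemma iint_bounded:
 assumes f: "f \<in> bm borel" and b: "!!s. [|0 < s; s < t|] ==> norm (f s) <= C"
 shows "iint t f"
proof (cases "t > 0")
 case True
 show ?thesis
  unfolding set_integrable_def
  by (rule integrableI_bounded_set_indicator[where B=C]) (use f b True in auto)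
qed (simp add: set_integrable_def)

lemma iint_mult_bounded:
 assumes k: "k \<in> bm borel" and b: "!!s. [|0 < s; s < t|] ==> \<bar>k s\<bar> <= C"
  and f: "iint t f"
 shows "iint t (%s. k s *R f s)"
proof -
 have "integrable lborel (%s. C *R norm (cut t f s))" using f unfolding set_integrable_def
  by (intro integrable_scaleR_right integrable_norm)
 thus ?thesis unfolding set_integrable_def
 proof (rule LI_bound)
  have [measurable]: "cut t f \<in> bm borel" using f by (auto simp: set_integrable_def)
  have "(%s. k s *R cut t f s) \<in> bm lborel" using k by measurable
  moreover have "(%s. k s *R cut t f s) = cut t (%s. k s *R f s)"
   by (auto simp: fun_eq_iff indicator_def)
  ultimately show "cut t (%s. k s *R f s) \<in> bm lborel" by simp
  show "AE s in lborel. norm (cut t (%s. k s *R f s) s) <= norm (C *R norm (cut t f s))"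
   using b by (auto simp: indicator_def abs_mult intro!: AE_I2 mult_right_mono order_trans[OF b])
 qed
qed

lemma iint_conv_bounded:
 assumes k: "k \<in> bm borel" and b: "!!s. [|0 < s; s < t|] ==> \<bar>k s\<bar> <= C"
  and f: "iint t f"
 shows "iint t (%s. k (t - s) *R f s)"
 by (rule iint_mult_bounded[where C=C]) (use k b f in auto)

lemma conv_bounded:
 assumes k: "k \<in> bm borel" and b: "!!s. [|0 < s; s < t|] ==> \<bar>k s\<bar> <= C"
  and f: "iint t f" and C: "C \<ge> 0"
 shows "norm (conv k f t) <= C * (LI s<t. norm (f s))"
proof -
 have i: "iint t (%s. norm (f s))" by (rule set_integrable_norm[OF f])
 have "norm (conv k f t) <= (LI s<t. norm (k (t - s) *R f s))"
  unfolding conv_def by (rule set_integral_norm_bound[OF iint_conv_bounded[OF k b f]])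
 also have "... <= (LI s<t. C * norm (f s))"
 proof (rule set_integral_mono)
  show "iint t (%s. norm (k (t - s) *R f s))" by (rule set_integrable_norm[OF iint_conv_bounded[OF k b f]])
  show "iint t (%s. C * norm (f s))" using i by simp
  show "norm (k (t - s) *R f s) <= C * norm (f s)" if "s \<in> {0<..<t}" for s
   using that b[of "t - s"] by (auto intro: mult_right_mono)
 qed
 also have "... = C * (LI s<t. norm (f s))" by simp
 finally show ?thesis .
qed

lemma conv_bounded':
 fixes f :: "real => 'b::{banach, second_countable_topology}"
 assumes k: "iint t k" "k \<in> bm borel" and b: "!!s. [|0 < s; s < t|] ==> norm (f s) <= C"
  and f: "f \<in> bm borel"
 shows "iint t (%s. k (t - s) *R f s)"
  and "norm (conv k f t) <= C * (LI s<t. \<bar>k s\<bar>)"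
proof -
 have ik: "iint t (%s. k (t - s))"
  using lborel_integrable_real_affine[OF k(1)[unfolded set_integrable_def], of "-1" t]
  unfolding set_integrable_def
  by (rule back_subst[of "integrable lborel"]) (auto simp: indicator_def fun_eq_iff)
 have ik': "iint t (%s. C * \<bar>k (t - s)\<bar>)" using ik by (simp add: set_integrable_abs)
 show I: "iint t (%s. k (t - s) *R f s)"
 proof (rule set_integrable_bound[OF ik'])
  show "set_borel_measurable lborel {0<..<t} (%s. k (t - s) *R f s)"
   unfolding set_borel_measurable_def using k f by measurable
  show "AE s\<in>{0<..<t} in lborel. norm (k (t - s) *R f s) <= norm (C * \<bar>k (t - s)\<bar>)"
  proof (intro AE_I2 impI)
   fix s assume s: "s \<in> {0<..<t}"
   hence "norm (f s) <= C" using b by auto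
   thus "norm (k (t - s) *R f s) <= norm (C * \<bar>k (t - s)\<bar>)"
    using norm_ge_zero[of "f s"] by (simp add: abs_mult mult.commute mult_right_mono)
  qed
 qed
 have "norm (conv k f t) <= (LI s<t. norm (k (t - s) *R f s))"
  unfolding conv_def by (rule set_integral_norm_bound[OF I])
 also have "... <= (LI s<t. C * \<bar>k (t - s)\<bar>)"
 proof (rule set_integral_mono[OF set_integrable_norm[OF I] ik'])
  show "norm (k (t - s) *R f s) <= C * \<bar>k (t - s)\<bar>" if "s \<in> {0<..<t}" for s
   using that b[of s] by (simp add: mult.commute mult_right_mono)
 qed
 also have "... = C * (LI s<t. \<bar>k (t - s)\<bar>)" by simp
 also have "(LI s<t. \<bar>k (t - s)\<bar>) = (LI s<t. \<bar>k s\<bar>)"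
  unfolding set_int
  by (subst lborel_integral_real_affine[of "-1" _ t])
   (auto intro!: LI_cong simp: indicator_def)
 finally show "norm (conv k f t) <= C * (LI s<t. \<bar>k s\<bar>)" .
qed

text \<open>A bounded first factor dominates the double integral by the integral of \<open>l\<close>
  alone, so \<open>l\<close> may be singular at 0, as \<open>gker\<close> is. In
  \<open>conv_assoc_bounded2\<close> the roles of the first two factors are exchanged.\<close>

lemma conv_assoc_bounded:
 assumes k: "k \<in> bm borel" and b: "!!s. [|0 < s; s < t|] ==> \<bar>k s\<bar> <= C"
  and l: "iint t l" and f: "iint t f"
 shows "conv k (conv l f) t = conv (conv k l) f t"
proof (rule conv_assoc)
 show "iint t k" by (rule iint_bounded) (use k b in auto)
 fix x assume x: "0 < x" "x < t"
 have "(NI s<x. \<bar>k (x - s) * l s\<bar>)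
   <= (PI s|lborel. ennreal C * ennreal (norm (cut t l s)))"
 proof (rule nn_integral_mono)
  fix s
  have "ennreal \<bar>k (x - s) * l s\<bar> <= ennreal C * ennreal \<bar>l s\<bar>" if "0 < s" "s < x"
  proof -
   have "\<bar>k (x - s)\<bar> <= C" using that x by (intro b) auto
   hence "ennreal \<bar>k (x - s) * l s\<bar> <= ennreal (C * \<bar>l s\<bar>)"
    by (auto simp: abs_mult intro!: ennreal_leI mult_right_mono)
   thus ?thesis by (simp add: ennreal_mult'')
  qed
  thus "ennreal \<bar>k (x - s) * l s\<bar> * indicator {0<..<x} s <= ennreal C * ennreal (norm (cut t l s))"
   using x by (auto simp: indicator_def)
 qed
 also have "... = ennreal C * ennreal (LI s|lborel. norm (cut t l s))"
  using l unfolding set_integrable_def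
  by (subst nn_integral_cmult) (auto intro!: arg_cong[where f="%x. ennreal C * x"] nn_integral_eq_integral)
 also have "... = ennreal (C * (LI s|lborel. norm (cut t l s)))"
  by (simp add: ennreal_mult'')
 finally show "(NI s<x. \<bar>k (x - s) * l s\<bar>) <= ennreal (C * (LI s|lborel. norm (cut t l s)))" .
qed fact+

lemma conv_gker_gker:
 assumes "0 < a" "a < 1" "t > 0"
 shows "conv (gker a) (gker (1 - a)) t = 1"
proof -
 have "(NI s|lborel. indicator {0<..<t} s * (gker a (t - s) * gker (1 - a) s)) = 1"
  using nn_integral_gker_gker[of a "1-a" t] assms
  by (simp add: ennreal_mult' mult.commute indicator_mult_ennreal)
 hence "(LI s|lborel. indicator {0<..<t} s * (gker a (t - s) * gker (1 - a) s)) = 1"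
  by (subst integral_eq_nn_integral) (use assms in "auto simp: gker_nonneg intro!: mult_nonneg_nonneg")
 thus ?thesis by (simp add: conv_def set_int)
qed

text \<open>Both kernels are singular, so neither boundedness version of associativity applies; the
  bound needed by \<open>conv_assoc\<close> is the Beta integral, whose value is 1 for every length
  of the interval.\<close>

lemma conv_gker_inverse:
 assumes a: "0 < a" "a < 1" and f: "iint t f"
 shows "conv (gker a) (conv (gker (1 - a)) f) t = prim f t"
proof -
 have "conv (gker a) (conv (gker (1 - a)) f) t = conv (conv (gker a) (gker (1 - a))) f t"
 proof (rule conv_assoc[where C=1])
  fix x :: real assume "0 < x" "x < t"
  thus "(NI s<x. \<bar>gker a (x - s) * gker (1 - a) s\<bar>) <= ennreal 1"
   using nn_integral_gker_gker[of a "1-a" x] a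
   by (simp add: gker_nonneg abs_mult)
 qed (use a f iint_gker in auto)
 also have "... = prim f t"
  by (rule conv_cong) (use a in "auto simp: conv_gker_gker")
 finally show ?thesis .
qed

lemma conv_one: "prim f t = (LI s<t. f s)"
 by (simp add: conv_def)

lemma conv_one_diff:
 assumes f: "iint T f" and "0 <= s" "s <= t" "t <= T"
 shows "prim f t - prim f s = (LINT r:{s<..<t}|lborel. f r)"
proof (cases "s = 0 \<or> s = t")
 case True
 thus ?thesis by (auto simp: conv_one set_int)
next
 case False
 have "(LI r<t. f r) = (LINT r:{0<..<s}\<union>{s<..<t}|lborel. f r)"
  unfolding set_int
 proof (rule integral_cong_AE)
  have m [measurable]: "cut T f \<in> bm borel" using f by (auto simp: set_integrable_def)
  have "(%r. indicator {0<..<t} r *R cut T f r) \<in> bm lborel" by measurable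
  moreover have "(%r. indicator {0<..<t} r *R cut T f r) = cut t f"
   using \<open>t <= T\<close> by (auto simp: fun_eq_iff indicator_def)
  ultimately show "cut t f \<in> bm lborel" by simp
  have "(%r. indicator ({0<..<s}\<union>{s<..<t}) r *R cut T f r) \<in> bm lborel" by measurable
  moreover have "(%r. indicator ({0<..<s}\<union>{s<..<t}) r *R cut T f r) = (%r. indicator ({0<..<s}\<union>{s<..<t}) r *R f r)"
   using assms by (auto simp: fun_eq_iff indicator_def)
  ultimately show "(%r. indicator ({0<..<s}\<union>{s<..<t}) r *R f r) \<in> bm lborel" by simp
  show "AE r in lborel. cut t f r = indicator ({0<..<s}\<union>{s<..<t}) r *R f r"
   using AE_lborel_singleton[of s] by eventually_elim (use assms False in "auto simp: indicator_def")
 qed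
 also have "... = (LI r<s. f r) + (LINT r:{s<..<t}|lborel. f r)"
  by (rule set_integral_Un) (use assms in "auto intro!: set_integrable_subset[OF f]")
 finally show ?thesis by (simp add: conv_one)
qed

lemma conv_one_continuous:
 assumes f: "iint T f"
 shows "continuous_on {0..T} (prim f)"
 unfolding continuous_on_sequentially
proof (intro allI ballI impI)
 fix X t assume t: "t \<in> {0..T}" and X: "(\<forall>n. X n \<in> {0..T}) \<and> X ----> t"
 have m [measurable]: "cut T f \<in> bm borel" using f by (auto simp: set_integrable_def)
 have eq: "prim f s = (LI r|lborel. indicator {0<..<s} r *R cut T f r)" if "s \<in> {0..T}" for s
  unfolding conv_one set_int
  by (rule LI_cong) (use that in "auto simp: indicator_def")
 have "(%n. LI r|lborel. indicator {0<..<X n} r *R cut T f r) ----> (LI r|lborel. indicator {0<..<t} r *R cut T f r)"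
 proof (rule integral_dominated_convergence)
  show "integrable lborel (%r. norm (cut T f r))" using integrable_norm[OF f[unfolded set_integrable_def]] .
  show "AE r in lborel. (%n. indicator {0<..<X n} r *R cut T f r) ----> indicator {0<..<t} r *R cut T f r"
   using AE_lborel_singleton[of t]
  proof eventually_elim
   case (elim r)
   have "eventually (%n. indicator {0<..<X n} r = (indicator {0<..<t} r :: real)) sequentially"
   proof (cases "r < t")
    case True
    hence "eventually (%n. r < X n) sequentially" using X order_tendstoD(1) by blast
    thus ?thesis by eventually_elim (use True in "auto simp: indicator_def")
   next
    case False
    with elim have "t < r" by simp
    hence "eventually (%n. X n < r) sequentially" using X order_tendstoD(2) by blast
    thus ?thesis by eventually_elim (use False in "auto simp: indicator_def")
   qed
   hence "eventually (%n. indicator {0<..<X n} r *R cut T f r = indicator {0<..<t} r *R cut T f r) sequentially"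
    by eventually_elim simp
   thus ?case by (rule tendsto_eventually)
  qed
  show "AE r in lborel. norm (indicator {0<..<X n} r *R cut T f r) <= norm (cut T f r)" for n
   by (auto simp: indicator_def)
 qed measurable
 thus "(prim f \<circ> X) ----> prim f t"
  using eq t X by (simp add: o_def)
qed

lemma conv_one_has_vector_derivative:
 assumes f: "continuous_on {0..T} f" and i: "iint T f" and t: "t \<in> {0..T}"
 shows "(prim f has_vector_derivative f t) (at t within {0..T})"
proof -
 have est: "norm (prim f y - prim f x - (y - x) *R c) <= e * (y - x)"
  if "0 <= x" "x <= y" "y <= T" and e: "!!s. s \<in> {x<..<y} ==> norm (f s - c) <= e" for x y e c
 proof -
  have I: "set_integrable lborel {x<..<y} f" by (rule set_integrable_subset[OF i]) (use that in auto)
  have Ic: "set_integrable lborel {x<..<y} (%_. d)" for d :: "'z::{banach,second_countable_topology}"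
   unfolding set_integrable_def using that(2) by (intro integrable_scaleR_left integrable_real_indicator) auto
  have "prim f y - prim f x - (y - x) *R c = (LINT r:{x<..<y}|lborel. f r) - (LINT r:{x<..<y}|lborel. c)"
   using that by (simp add: conv_one_diff[OF i] set_int)
  also have "... = (LINT r:{x<..<y}|lborel. f r - c)" by (rule set_integral_diff(2)[symmetric, OF I Ic])
  also have "norm ... <= (LINT r:{x<..<y}|lborel. norm (f r - c))"
   by (rule set_integral_norm_bound[OF set_integral_diff(1)[OF I Ic]])
  also have "... <= (LINT r:{x<..<y}|lborel. e)"
   by (rule set_integral_mono[OF set_integrable_norm[OF set_integral_diff(1)[OF I Ic]] Ic]) (use e in auto)
  also have "... = e * (y - x)" using that by (simp add: set_int)
  finally show ?thesis .
 qed
 show ?thesis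
  unfolding has_vector_derivative_def has_derivative_within_alt
 proof (intro conjI allI impI)
  show "bounded_linear (%x. x *R f t)" by (rule bounded_linear_scaleR_left)
  fix e :: real assume "e > 0"
  with f t obtain d where d: "d > 0" "!!s. [|s \<in> {0..T}; dist s t < d|] ==> dist (f s) (f t) < e"
   unfolding continuous_on_iff by blast
  show "\<exists>d>0. \<forall>y\<in>{0..T}. norm (y - t) < d \<longrightarrow> norm (prim f y - prim f t - (y - t) *R f t) <= e * norm (y - t)"
  proof (intro exI[of _ d] conjI ballI impI)
   fix y assume y: "y \<in> {0..T}" "norm (y - t) < d"
   have *: "norm (f s - f t) <= e" if "s \<in> {min y t<..<max y t}" for s
    using d(2)[of s] y t that by (auto simp: dist_norm min_def max_def split: if_splits)
   show "norm (prim f y - prim f t - (y - t) *R f t) <= e * norm (y - t)"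
   proof (cases "t <= y")
    case True
    thus ?thesis using est[of t y "f t" e] * y t by auto
   next
    case False
    hence "norm (prim f t - prim f y - (t - y) *R f t) <= e * (t - y)"
     using est[of y t "f t" e] * y t by auto
    moreover have "prim f t - prim f y - (t - y) *R f t = - (prim f y - prim f t - (y - t) *R f t)"
     by (simp add: algebra_simps)
    ultimately show ?thesis using False by (simp only: norm_minus_cancel) simp
   qed
  qed fact
 qed
qed

lemma conv_zero [simp]: "t <= 0 ==> conv k f t = 0"
 by (simp add: conv_def set_int)

lemma conv_linear:
 fixes f :: "real => 'b::{banach, second_countable_topology}"
  and L :: "'b => 'c::{banach, second_countable_topology}"
 assumes L: "bounded_linear L" and i: "iint t (%s. k (t - s) *R f s)"
 shows "conv k (%s. L (f s)) t = L (conv k f t)"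
proof -
 have "L (conv k f t) = (LI s|lborel. L (cut t (%s. k (t - s) *R f s) s))"
  unfolding conv_def set_int
  by (rule integral_bounded_linear[symmetric, OF L]) (use i in "simp add: set_integrable_def")
 also have "... = conv k (%s. L (f s)) t"
  unfolding conv_def set_int
  by (simp add: linear_simps(5)[OF L] linear_scale[OF bounded_linear.linear[OF L]])
 finally show ?thesis by simp
qed

lemma conv_assoc_bounded2:
 assumes l: "l \<in> bm borel" and b: "!!s. [|0 < s; s < t|] ==> \<bar>l s\<bar> <= C"
  and k: "iint t k" "k \<in> bm borel" and f: "iint t f"
 shows "conv k (conv l f) t = conv (conv k l) f t"
proof (rule conv_assoc)
 show "iint t l" by (rule iint_bounded) (use l b in auto)
 fix x assume x: "0 < x" "x < t"
 have [measurable]: "l \<in> bm borel" "k \<in> bm borel" by fact+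
 have ik: "iint x k" by (rule iint_mono[OF k(1)]) (use x in simp)
 have I: "iint x (%s. k (x - s) * l s)"
  using conv_bounded'(1)[OF ik k(2), of l C] b x l by simp
 have "(NI s<x. \<bar>k (x - s) * l s\<bar>)
   <= (NI s<x. C * \<bar>k (x - s)\<bar>)"
 proof (rule nn_integral_mono)
  show "ennreal \<bar>k (x - s) * l s\<bar> * indicator {0<..<x} s <= ennreal (C * \<bar>k (x - s)\<bar>) * indicator {0<..<x} s" for s
   using b[of s] x by (auto simp: indicator_def abs_mult mult.commute intro!: ennreal_leI mult_right_mono)
 qed
 also have "... = (NI s|lborel. C * (indicator {0<..<x} s * \<bar>k s\<bar>))"
  by (subst nn_integral_real_affine[where c="-1" and t=x])
   (auto intro!: nn_integral_cong simp: indicator_def)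
 also have "... <= (NI s|lborel. C * (indicator {0<..<t} s * \<bar>k s\<bar>))"
  using b[of "t/2"] x by (intro nn_integral_mono ennreal_leI mult_left_mono) (auto simp: indicator_def)
 also have "... = ennreal (LI s|lborel. C * (indicator {0<..<t} s * \<bar>k s\<bar>))"
 proof (rule nn_integral_eq_integral)
  have "integrable lborel (%s. \<bar>cut t k s\<bar>)" using k(1) unfolding set_integrable_def by (rule integrable_abs)
  hence "integrable lborel (%s. indicator {0<..<t} s * \<bar>k s\<bar>)" by (simp add: abs_mult)
  thus "integrable lborel (%s. C * (indicator {0<..<t} s * \<bar>k s\<bar>))" by simp
  have "C \<ge> 0" using b[of "t/2"] x by (auto intro: order_trans[OF abs_ge_zero])
  thus "AE s in lborel. 0 <= C * (indicator {0<..<t} s * \<bar>k s\<bar>)" by simp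
 qed
 finally show "(NI s<x. \<bar>k (x - s) * l s\<bar>) <= ennreal (LI s|lborel. C * (indicator {0<..<t} s * \<bar>k s\<bar>))" .
qed fact+

lemma continuous_bounded_on:
 assumes "continuous_on UNIV (k :: real => real)"
 obtains C where "!!s. [|0 < s; s < t|] ==> \<bar>k s\<bar> <= C" "C \<ge> 0"
proof -
 have "bounded (k ` {0..t})"
  by (intro compact_imp_bounded compact_continuous_image continuous_on_subset[OF assms]) auto
 then obtain C where "\<forall>y\<in>k ` {0..t}. norm y <= C" unfolding bounded_iff by blast
 hence C: "!!x. x \<in> {0..t} ==> norm (k x) <= C" by auto
 show ?thesis
 proof (rule that[of "max C 0"])
  show "\<bar>k s\<bar> <= max C 0" if "0 < s" "s < t" for s using C[of s] that by simp
 qed simp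
qed

text \<open>Lets the fractional kernels act across a smooth one. With \<open>k\<close> the
  derivative of a mollifier, the fractional integral of the mollified Caputo derivative comes out as
  the mollified function itself.\<close>

lemma conv_gker_kernel:
 assumes a: "0 < a" "a < 1" and f: "iint t f" and k: "continuous_on UNIV k"
 shows "conv (gker a) (conv k (conv (gker (1 - a)) f)) t = conv (prim k) f t"
proof -
 have km: "k \<in> bm borel" using k by (rule borel_measurable_continuous_onI)
 obtain C where C: "!!s. [|0 < s; s < t|] ==> \<bar>k s\<bar> <= C" using continuous_bounded_on[OF k] by metis
 have i1: "iint t (conv (gker (1 - a)) f)" by (rule conv_integrable(1)) (use a f iint_gker in auto)
 have ik: "iint t k" by (rule iint_bounded[where C=C]) (use km C in auto)
 have "conv (gker a) (conv k (conv (gker (1 - a)) f)) t = conv (conv (gker a) k) (conv (gker (1 - a)) f) t"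
  by (rule conv_assoc_bounded2[where C=C]) (use km C a iint_gker i1 in auto)
 also have "... = conv (conv k (gker a)) (conv (gker (1 - a)) f) t"
  by (rule conv_cong) (auto simp: conv_commute)
 also have "... = conv k (conv (gker a) (conv (gker (1 - a)) f)) t"
  by (rule conv_assoc_bounded[where C=C, symmetric]) (use km C a iint_gker i1 in auto)
 also have "... = conv k (prim f) t"
  by (rule conv_cong) (auto simp: conv_gker_inverse[OF a iint_mono[OF f]])
 also have "... = conv (conv k (%_. 1)) f t"
  by (rule conv_assoc_bounded[where C=C]) (use km C f in "auto intro!: iint_bounded[where C=1]")
 also have "... = conv (prim k) f t"
  by (rule conv_cong) (auto simp: conv_commute)
 finally show ?thesis .
qed

lemma conv_one_kernel:
 assumes f: "iint t f" and k: "continuous_on UNIV k"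
 shows "prim (conv k f) t = conv (prim k) f t"
  and "conv k (prim f) t = conv (prim k) f t"
proof -
 have km: "k \<in> bm borel" using k by (rule borel_measurable_continuous_onI)
 obtain C where C: "!!s. [|0 < s; s < t|] ==> \<bar>k s\<bar> <= C" using continuous_bounded_on[OF k] by metis
 have ik: "iint t k" by (rule iint_bounded[where C=C]) (use km C in auto)
 show "prim (conv k f) t = conv (prim k) f t"
  by (rule conv_assoc_bounded[where C=1]) (use f ik in auto)
 have "conv k (prim f) t = conv (conv k (%_. 1)) f t"
  by (rule conv_assoc_bounded[where C=C]) (use km C f in "auto intro!: iint_bounded[where C=1]")
 also have "... = conv (prim k) f t"
  by (rule conv_cong) (auto simp: conv_commute)
 finally show "conv k (prim f) t = conv (prim k) f t" .
qed

lemma integral_Ioo_Icc: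
 fixes f :: "real => 'b::{banach, second_countable_topology}"
 assumes f: "f \<in> bm borel"
 shows "(LINT s:{a<..<b}|lborel. f s) = (LINT s:{a..b}|lborel. f s)"
 unfolding set_int
proof (rule integral_cong_AE)
 show "AE r in lborel. indicator {a<..<b} r *R f r = indicator {a..b} r *R f r"
  using AE_lborel_singleton[of a] AE_lborel_singleton[of b] by eventually_elim (auto simp: indicator_def)
qed (use f in simp_all)

lemma conv_one_FTC:
 fixes F f :: "real => real"
 assumes "t \<ge> 0" "!!x. (F has_real_derivative f x) (at x)" "continuous_on UNIV f"
 shows "prim f t = F t - F 0"
proof -
 have "f \<in> bm borel" using assms(3) by (rule borel_measurable_continuous_onI)
 hence "prim f t = (LINT s:{0..t}|lborel. f s)" by (simp add: conv_one integral_Ioo_Icc)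
 also have "... = F t - F 0"
  unfolding set_int
  by (rule integral_FTC_atLeastAtMost) (use assms continuous_on_subset[OF assms(3) subset_UNIV] in
   \<open>auto simp: has_real_derivative_iff_has_vector_derivative[symmetric] intro: DERIV_subset\<close>)
 finally show ?thesis .
qed

section \<open>Smooth one-sided kernels built from exp(-1/x)\<close>

definition ebump :: "nat => real => real" where
 "ebump k x = (if x > 0 then (1 / x) ^ k * exp (- (1 / x)) else 0)"

lemma ebump_limit: "((%x. ebump k x) \<longlongrightarrow> 0) (at_right 0)"
proof -
 have "((%x. x ^ k / exp x) \<longlongrightarrow> (0::real)) at_top" by (rule tendsto_power_div_exp_0)
 hence "((%x. (inverse x) ^ k / exp (inverse x)) \<longlongrightarrow> (0::real)) (at_right 0)"
  by (rule filterlim_compose[OF _ filterlim_inverse_at_top_right])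
 thus ?thesis
  by (rule Lim_transform_eventually)
   (auto simp: eventually_at_right_less ebump_def exp_minus field_simps eventually_at_filter)
qed

text \<open>Up to linear combinations the family is closed under differentiation, so this one rule
  yields all derivatives of the mollifying kernels and of the test functions built from it.\<close>

lemma DERIV_ebump: "(ebump k has_real_derivative ebump (k + 2) x - real k * ebump (k + 1) x) (at x)"
proof (cases x "0::real" rule: linorder_cases)
 case less
 have "((%_. 0) has_real_derivative 0) (at x)" by simp
 hence "(ebump k has_real_derivative 0) (at x)"
  by (rule has_field_derivative_transform_within_open[where S="{..<0}"]) (use less in "auto simp: ebump_def")
 thus ?thesis using less by (simp add: ebump_def)
next
 case greater
 have "((%x. (1 / x) ^ k * exp (- (1 / x))) has_real_derivative ebump (k + 2) x - real k * ebump (k + 1) x) (at x)"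
 proof -
  have d1: "((%x. 1 / x) has_real_derivative - ((1 / x)\<^sup>2)) (at x)"
   using greater by (auto intro!: derivative_eq_intros simp: power2_eq_square)
  have d2: "((%x. exp (- (1 / x))) has_real_derivative exp (- (1 / x)) * (1 / x)\<^sup>2) (at x)"
   using DERIV_chain2[OF DERIV_exp DERIV_minus[OF d1]] by simp
  have "real k * (- ((1 / x)\<^sup>2) * (1 / x) ^ (k - Suc 0)) * exp (- (1 / x)) + exp (- (1 / x)) * (1 / x)\<^sup>2 * (1 / x) ^ k
   = ebump (k + 2) x - real k * ebump (k + 1) x"
   using greater by (cases k) (auto simp: ebump_def power2_eq_square algebra_simps)
  thus ?thesis by (rule DERIV_cong[OF DERIV_mult[OF DERIV_power[OF d1] d2]])
 qed
 thus ?thesis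
  by (rule has_field_derivative_transform_within_open[where S="{0<..}"]) (use greater in "auto simp: ebump_def")
next
 case equal
 have "((%y. (ebump k y - ebump k 0) / (y - 0)) \<longlongrightarrow> 0) (at 0)"
 proof (rule filterlim_split_at)
  have "eventually (%y. (ebump k y - ebump k 0) / (y - 0) = 0) (at_left (0::real))"
   by (auto simp: eventually_at_filter ebump_def)
  thus "((%y. (ebump k y - ebump k 0) / (y - 0)) \<longlongrightarrow> 0) (at_left 0)"
   by (rule tendsto_eventually)
  \<comment> \<open>For positive \<open>y\<close> this difference quotient is
    \<open>ebump (k + 1) y\<close>.\<close>
  show "((%y. (ebump k y - ebump k 0) / (y - 0)) \<longlongrightarrow> 0) (at_right 0)"
   by (rule Lim_transform_eventually[OF ebump_limit[of "k + 1"]])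
    (auto simp: eventually_at_filter ebump_def)
 qed
 thus ?thesis unfolding equal by (simp add: has_field_derivative_iff ebump_def)
qed

lemma ebump_bounds: "0 <= ebump k x" "ebump 0 x <= 1" "ebump 2 x <= 2" "ebump 2 x <= (1 / x)\<^sup>2"
proof -
 have "(1 / x)\<^sup>2 / 2 <= exp (1 / x)" if "x > 0" using exp_lower_Taylor_quadratic[of "1 / x"] that by (smt (verit) zero_le_divide_1_iff)
 thus "ebump 2 x <= 2" by (auto simp: ebump_def exp_minus field_simps)
 show "ebump 2 x <= (1 / x)\<^sup>2" unfolding ebump_def by (auto intro!: mult_left_le)
qed (auto simp: ebump_def)

text \<open>\<open>rho m\<close> is a causal approximate identity: it lives on positive times, so
  mollification uses only the past and commutes with the other convolutions on the half-line. Its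
  support is not compact; the mass on \<open>(0, t)\<close> is \<open>chi m t\<close>, which is
  below 1, and this factor stays visible in the mollified equation. \<open>rho1\<close> and
  \<open>rho2\<close> take over the time derivatives of the data.\<close>

definition chi :: "real => real => real" where "chi m t = ebump 0 (m * t)"
definition rho :: "real => real => real" where "rho m t = m * ebump 2 (m * t)"
definition rho1 :: "real => real => real" where "rho1 m t = m\<^sup>2 * (ebump 4 (m * t) - 2 * ebump 3 (m * t))"
definition rho2 :: "real => real => real" where
 "rho2 m t = m^3 * (ebump 6 (m * t) - 6 * ebump 5 (m * t) + 6 * ebump 4 (m * t))"

lemma DERIV_ebump_scaled:
 "((%t. ebump k (m * t)) has_real_derivative m * (ebump (k + 2) (m * t) - real k * ebump (k + 1) (m * t))) (at t)"
 by (rule DERIV_cong[OF DERIV_chain2[OF DERIV_ebump DERIV_cmult_Id[of m]]]) simp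

lemma DERIV_chi: "(chi m has_real_derivative rho m t) (at t)"
 and DERIV_rho: "(rho m has_real_derivative rho1 m t) (at t)"
 and DERIV_rho1: "(rho1 m has_real_derivative rho2 m t) (at t)"
 using DERIV_ebump_scaled[of 0 m t] DERIV_cmult[OF DERIV_ebump_scaled[of 2 m t], of m]
  DERIV_cmult[OF DERIV_diff[OF DERIV_ebump_scaled[of 4 m t] DERIV_cmult[OF DERIV_ebump_scaled[of 3 m t], of 2]], of "m\<^sup>2"]
 unfolding chi_def[abs_def] rho_def[abs_def] rho1_def[abs_def] rho2_def[abs_def]
 by (simp_all add: power2_eq_square power3_eq_cube algebra_simps flip: numeral_2_eq_2 numeral_3_eq_3)

lemma rho_continuous: "continuous_on UNIV (rho m)" "continuous_on UNIV (rho1 m)" "continuous_on UNIV (rho2 m)"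
  "continuous_on UNIV (chi m)"
proof -
 have [continuous_intros]: "continuous_on UNIV (%t. ebump k (m * t))" for k
  by (rule DERIV_continuous_on[OF DERIV_subset[OF DERIV_ebump_scaled subset_UNIV]])
 show "continuous_on UNIV (rho m)" "continuous_on UNIV (rho1 m)" "continuous_on UNIV (rho2 m)" "continuous_on UNIV (chi m)"
  unfolding chi_def[abs_def] rho_def[abs_def] rho1_def[abs_def] rho2_def[abs_def] by (intro continuous_intros)+
qed

lemma conv_one_rho: "t \<ge> 0 ==> prim (rho m) t = chi m t"
 and conv_one_rho1: "t \<ge> 0 ==> prim (rho1 m) t = rho m t"
 and conv_one_rho2: "t \<ge> 0 ==> prim (rho2 m) t = rho1 m t"
 using conv_one_FTC[OF _ DERIV_chi rho_continuous(1), of t m]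
  conv_one_FTC[OF _ DERIV_rho rho_continuous(2), of t m] conv_one_FTC[OF _ DERIV_rho1 rho_continuous(3), of t m]
 by (simp_all add: chi_def[of m 0] rho_def[of m 0] rho1_def[of m 0] ebump_def)

lemma rho_nonneg: "m > 0 ==> rho m t \<ge> 0"
 by (simp add: rho_def ebump_bounds)

text \<open>The first bound is the height near 0; the second makes \<open>rho m\<close> negligible
  outside any neighbourhood of 0 as \<open>m\<close> grows.\<close>

lemma rho_le: "m > 0 ==> rho m t <= 2 * m" "m > 0 ==> rho m t <= 1 / (m * t\<^sup>2)"
 using mult_left_mono[OF ebump_bounds(3), of m "m * t"] mult_left_mono[OF ebump_bounds(4), of m "m * t"]
 by (simp_all add: rho_def power2_eq_square ac_simps)

lemma chi_bounds: "0 <= chi m t" "chi m t <= 1"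
 by (simp_all add: chi_def ebump_bounds)

lemma chi_tendsto: assumes "t > 0" shows "(%n. chi (real (Suc n)) t) ----> 1"
proof -
 have "(%n. exp (- (1 / t * (1 / real (Suc n))))) ----> exp (- (1 / t * 0))"
  by (intro tendsto_intros LIMSEQ_Suc[OF lim_1_over_n])
 moreover have "chi (real (Suc n)) t = exp (- (1 / t * (1 / real (Suc n))))" for n
  using assms by (simp add: chi_def ebump_def)
 ultimately show ?thesis by simp
qed

lemma pk_measurable [measurable]: "(%(th, s). pk th s) \<in> bm (borel *M borel)"
 unfolding pk_def by measurable

lemma pk_continuous: "continuous_on UNIV (pk th)"
 unfolding pk_def[abs_def] by (intro continuous_intros)

lemma pk_measurable1 [measurable]: "pk th \<in> bm borel"
 by (rule borel_measurable_continuous_onI[OF pk_continuous])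

lemma pk_le: "[|0 < th; th < 1; t \<ge> 0|] ==> \<bar>pk th t\<bar> <= c0 th"
 using mult_left_le[of "exp (- c1 th * t)" "c0 th"] by (simp add: pk_def c0_def c1_def abs_mult)

lemma conv_one_pk:
 assumes "0 < th" "th < 1" "t \<ge> 0"
 shows "prim (pk th) t = (1 - exp (- c1 th * t)) / th"
proof -
 have "prim (pk th) t = (- exp (- c1 th * t) / th) - (- exp (- c1 th * 0) / th)"
 proof (rule conv_one_FTC)
  have "c1 th / th = c0 th" using assms by (simp add: c1_def c0_def)
  thus "((%t. - exp (- c1 th * t) / th) has_real_derivative pk th x) (at x)" for x
   unfolding pk_def using assms by (auto intro!: derivative_eq_intros simp: field_simps)
 qed (use assms pk_continuous in auto)
 thus ?thesis by (simp add: diff_divide_distrib)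
qed

lemma c1_conv_one_pk:
 assumes "0 < th" "th < 1" "t \<ge> 0"
 shows "c1 th * prim (pk th) t = c0 th - pk th t"
 using assms unfolding conv_one_pk[OF assms] by (simp add: pk_def c0_def c1_def field_simps)

text \<open>The mass of the kernel is bounded uniformly in \<open>th\<close>, unlike its height
  \<open>c0 th\<close>. The closed form looks singular at \<open>th = 0\<close>; there
  \<open>1 - exp (- x) <= x\<close> brings in a factor \<open>th\<close> that cancels the
  denominator.\<close>

lemma conv_one_pk_bounds:
 assumes "0 < th" "th < 1" "t \<ge> 0"
 shows "0 <= prim (pk th) t" "prim (pk th) t <= 2 * (1 + t)"
proof -
 have c1: "c1 th \<ge> 0" using assms by (simp add: c1_def)
 thus "0 <= prim (pk th) t" using assms by (simp add: conv_one_pk)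
 show "prim (pk th) t <= 2 * (1 + t)"
 proof (cases "th \<ge> 1/2")
  case True
  hence "(1 - exp (- c1 th * t)) / th <= 1 / (1/2)" by (intro frac_le) auto
  thus ?thesis using assms by (simp add: conv_one_pk)
 next
  case False
  have "1 - exp (- c1 th * t) <= c1 th * t" using exp_ge_add_one_self[of "- c1 th * t"] by simp
  hence "(1 - exp (- c1 th * t)) / th <= c1 th * t / th" using assms by (intro divide_right_mono) auto
  also have "... = t / (1 - th)" using assms by (simp add: c1_def)
  also have "... <= t / (1/2)" using False assms by (intro divide_left_mono) auto
  finally show ?thesis using assms by (simp add: conv_one_pk)
 qed
qed

lemma conv_one_pk_eq:
 assumes "0 < th" "th < 1" "t \<ge> 0"
 shows "prim (pk th) t = (LI s<t. \<bar>pk th s\<bar>)"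
 unfolding conv_one using pk_nonneg[OF assms(2)] by simp

lemma conv_diff:
 assumes "iint t (%s. k (t - s) *R f s)" "iint t (%s. l (t - s) *R f s)"
 shows "conv (%s. k s - l s) f t = conv k f t - conv l f t"
 using set_integral_diff(2)[OF assms] by (simp add: conv_def scaleR_diff_left)

lemma conv_scale: "conv (%s. c * k s) f t = c *R conv k f t"
 unfolding conv_def set_int
 by (subst integral_scaleR_const[symmetric]) (simp add: ac_simps)

text \<open>The equation \<open>(1 - th) y' + th y = f\<close> with initial value 0, integrated in
  time and divided by \<open>1 - th\<close>. No derivative occurs, so \<open>f\<close> need only be
  integrable.\<close>

lemma conv_pk_ode:
 assumes th: "0 < th" "th < 1" and t: "t \<ge> 0" and f: "iint t f"
 shows "conv (pk th) f t = c0 th *R prim f t - c1 th *R prim (conv (pk th) f) t"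
  and "conv (pk th) f t = c0 th *R prim f t - c1 th *R conv (pk th) (prim f) t"
proof -
 have kb: "\<bar>c1 th * prim (pk th) s\<bar> <= 2 * c0 th" if "0 < s" "s < t" for s
  using that c1_conv_one_pk[OF th, of s] pk_le[OF th, of s] by (simp add: abs_le_iff)
 have eq: "conv (pk th) f t = conv (%s. c0 th * 1 - c1 th * prim (pk th) s) f t"
  by (rule conv_cong) (use th c1_conv_one_pk in auto)
 also have "... = conv (%s. c0 th * 1) f t - conv (%s. c1 th * prim (pk th) s) f t"
 proof (rule conv_diff)
  show "iint t (%s. (c0 th * 1) *R f s)" using f by simp
  show "iint t (%s. (c1 th * prim (pk th) (t - s)) *R f s)"
   by (rule iint_conv_bounded[where C="2 * c0 th" and k="%s. c1 th * prim (pk th) s"]) (use kb f in auto)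
 qed
 also have "... = c0 th *R prim f t - c1 th *R conv (prim (pk th)) f t"
  by (simp only: conv_scale)
 finally have *: "conv (pk th) f t = c0 th *R prim f t - c1 th *R conv (prim (pk th)) f t" .
 thus "conv (pk th) f t = c0 th *R prim f t - c1 th *R prim (conv (pk th) f) t"
  "conv (pk th) f t = c0 th *R prim f t - c1 th *R conv (pk th) (prim f) t"
  by (simp_all only: conv_one_kernel[OF f pk_continuous])
qed

lemma integral_pk_gker:
 assumes a: "0 < a" "a < 1" and t: "t > 0"
 shows "integrable (Mw a) (%th. pk th t)" "(LI th|Mw a. pk th t) = gker a t"
  "(NI th|Mw a. pk th t) = ennreal (gker a t)"
proof -
 have m: "(%th. pk th t) \<in> bm borel" unfolding pk_def by measurable
 hence m': "(%th. ennreal (pk th t)) \<in> bm (ivl 1)"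
  by (intro interval_measurable) simp
 have "(NI th|Mw a. pk th t) = (NI th<1. wt a th * pk th t)"
  by (subst nn_integral_weighted[OF wt_measurable m'])
   (auto intro!: nn_integral_cong simp: ennreal_mult' wt_nonneg a indicator_def)
 also have "... = ennreal (gker a t)" by (rule nn_integral_wt_pk[OF a t])
 finally show nn: "(NI th|Mw a. pk th t) = ennreal (gker a t)" .
 have ae: "AE th in Mw a. 0 <= pk th t" by (rule AE_I2) (simp add: pk_nonneg)
 have m2: "(%th. pk th t) \<in> bm (Mw a)" by (rule bm_weighted[OF m])
 show "integrable (Mw a) (%th. pk th t)"
  by (rule integrableI_nonneg[OF m2 ae]) (simp add: nn)
 show "(LI th|Mw a. pk th t) = gker a t"
  by (subst integral_eq_nn_integral[OF m2 ae]) (simp add: nn gker_nonneg a)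
qed

lemma sets_pair_Mw: "sets (Mw a *M M) = sets (ivl 1 *M M)"
 by (rule sets_pair_measure_cong) auto

lemma measurable_pair_Mw:
 "f \<in> bm (borel *M N) ==> f \<in> bm (Mw a *M N)"
proof -
 assume f: "f \<in> bm (borel *M N)"
 have "(%x. x) \<in> bm (Mw a)" by (rule bm_weighted) simp
 hence "(%x. (fst x, snd x)) \<in> (Mw a *M N) \<rightarrow>\<^sub>M (borel *M N)"
  by (intro measurable_Pair measurable_compose[OF measurable_fst] measurable_snd) auto
 from measurable_compose[OF this f] show ?thesis by simp
qed

text \<open>Since \<open>pk\<close> is nonnegative, averaging the norms over \<open>th\<close> first
  gives exactly the norm of the integrand with \<open>gker\<close>. So the hypothesis on
  \<open>gker\<close> at the time \<open>t\<close> is precisely absolute convergence of the double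
  integral.\<close>

lemma integral_conv_pk:
 assumes a: "0 < a" "a < 1" and [measurable]: "f \<in> bm borel"
  and I: "iint t (%s. gker a (t - s) *R f s)"
 shows "integrable (Mw a) (%th. conv (pk th) f t)"
  and "(LI th|Mw a. conv (pk th) f t) = conv (gker a) f t"
proof -
 interpret finite_measure "Mw a" by (rule prob_space_Mw(2)[OF a])
 interpret P: pair_sigma_finite "Mw a" "lborel :: real measure" ..
 let ?g = "%th s. indicator {0<..<t} s *R pk th (t - s) *R f s"
 have m: "(%(th, s). ?g th s) \<in> bm (Mw a *M lborel)"
 proof (rule measurable_pair_Mw)
  have "(%x. indicator {0<..<t} (snd x) *R (case (fst x, t - snd x) of (th, s) => pk th s) *R f (snd x)) \<in> bm (borel *M lborel)"
   by measurable
  thus "(%(th, s). ?g th s) \<in> bm (borel *M lborel)"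
   by (simp add: split_beta')
 qed
 have m': "(%x. ennreal (norm (case x of (th, s) => ?g th s))) \<in> bm (Mw a *M lborel)"
  using m by measurable
 have inner: "(NI th|Mw a. norm (?g th s)) = ennreal (norm (cut t (%s. gker a (t - s) *R f s) s))" for s
 proof (cases "s \<in> {0<..<t}")
  case True
  have "(NI th|Mw a. norm (?g th s)) = (PI th|Mw a. ennreal (pk th (t - s)) * ennreal (norm (f s)))"
   by (rule nn_integral_cong) (use True in "auto simp: pk_nonneg ennreal_mult'")
  also have "... = ennreal (gker a (t - s)) * ennreal (norm (f s))"
   by (subst nn_integral_multc)
    (use True integral_pk_gker(3)[OF a, of "t - s"] in "auto intro!: bm_weighted simp: pk_def")
  finally show ?thesis using True a by (simp add: ennreal_mult' gker_nonneg)
 qed simp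
 have Int: "integrable (Mw a *M lborel) (%(th, s). ?g th s)"
 proof (rule integrableI_bounded[OF m])
  have "(NI x|(Mw a *M lborel). norm (case x of (th, s) => ?g th s))
   = (PI s|lborel. (NI th|Mw a. norm (?g th s)))"
   using P.nn_integral_snd[OF m', symmetric] by simp
  also have "... < \<infinity>" unfolding inner using I by (simp add: set_integrable_def integrable_iff_bounded)
  finally show "(NI x|(Mw a *M lborel). norm (case x of (th, s) => ?g th s)) < \<infinity>" .
 qed
 show "integrable (Mw a) (%th. conv (pk th) f t)"
  using P.integrable_fst'[OF Int] by (simp add: conv_def set_int)
 have "(LI th|Mw a. conv (pk th) f t) = (LI s|lborel. (LI th|Mw a. ?g th s))"
  using P.Fubini_integral[OF Int] by (simp add: conv_def set_int)
 also have "... = conv (gker a) f t"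
  unfolding conv_def set_int
 proof (rule LI_cong[OF refl])
  fix s
  show "(LI th|Mw a. ?g th s) = cut t (%s. gker a (t - s) *R f s) s"
   using integral_pk_gker(1,2)[OF a, of "t - s"] by (cases "s \<in> {0<..<t}") auto
 qed
 finally show "(LI th|Mw a. conv (pk th) f t) = conv (gker a) f t" .
qed

section \<open>Cauchy-Schwarz and interpolation inequalities for averages over
  \<open>th\<close>\<close>

lemma Cauchy_Schwarz_integral:
 fixes f g :: "'a => real"
 assumes [measurable]: "f \<in> bm M" "g \<in> bm M"
  and f2: "integrable M (%x. (f x)\<^sup>2)" and g2: "integrable M (%x. (g x)\<^sup>2)"
 shows "integrable M (%x. f x * g x)" and "(LI x|M. f x * g x)\<^sup>2 <= (LI x|M. (f x)\<^sup>2) * (LI x|M. (g x)\<^sup>2)"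
proof -
 have b: "\<bar>a * c\<bar> <= a\<^sup>2 + c\<^sup>2" for a c :: real
 proof -
  have "0 <= \<bar>a\<bar> * \<bar>c\<bar>" by simp
  thus ?thesis
  using zero_le_power2[of "\<bar>a\<bar> - \<bar>c\<bar>"]
   unfolding power2_diff abs_mult power2_abs by linarith
 qed
 show I: "integrable M (%x. f x * g x)"
  by (rule LI_bound[OF Bochner_Integration.integrable_add[OF f2 g2]]) (use b in auto)
 define p q r where "p = (LI x|M. (f x)\<^sup>2)" "q = (LI x|M. (g x)\<^sup>2)" "r = (LI x|M. f x * g x)"
 have pos: "0 <= a\<^sup>2 * p + 2 * a * c * r + c\<^sup>2 * q" for a c
 proof -
  have "0 <= (LI x|M. (a * f x + c * g x)\<^sup>2)" by simp
  also have "(%x. (a * f x + c * g x)\<^sup>2) = (%x. a\<^sup>2 * (f x)\<^sup>2 + (2 * a * c) * (f x * g x) + c\<^sup>2 * (g x)\<^sup>2)"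
   by (auto simp: fun_eq_iff power2_eq_square algebra_simps)
  also have "(LI x|M. a\<^sup>2 * (f x)\<^sup>2 + (2 * a * c) * (f x * g x) + c\<^sup>2 * (g x)\<^sup>2) = a\<^sup>2 * p + 2 * a * c * r + c\<^sup>2 * q"
   using f2 g2 I by (simp add: p_q_r_def)
  finally show ?thesis .
 qed
 have q0: "q \<ge> 0" by (simp add: p_q_r_def)
 have "r\<^sup>2 <= p * q"
 proof (cases "q = 0")
  case True
  \<comment> \<open>For \<open>q = 0\<close> the quadratic form is affine in \<open>n\<close>, and
    the value of \<open>n\<close> inserted next makes it -1 unless \<open>r = 0\<close>.\<close>
  have "0 <= p - (2 * n) * r\<^sup>2" for n using pos[of 1 "- n * r"] True by (simp add: power2_eq_square)
  from this[of "(p + 1) / (2 * r\<^sup>2)"] have "r = 0" by (cases "r = 0") auto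
  thus ?thesis using True by simp
 next
  case False
  have "0 <= q * (p * q - r\<^sup>2)" using pos[of q "- r"] by (simp add: power2_eq_square algebra_simps)
  with False q0 show ?thesis by (simp add: zero_le_mult_iff)
 qed
 thus "(LI x|M. f x * g x)\<^sup>2 <= (LI x|M. (f x)\<^sup>2) * (LI x|M. (g x)\<^sup>2)" by (simp add: p_q_r_def)
qed

lemma norm_integral_square_le:
 fixes f :: "'a => 'b::{banach, second_countable_topology}"
 assumes fin: "finite_measure M" and f: "f \<in> bm M" and f2: "integrable M (%x. nsq (f x))"
  and S: "S \<in> sets M"
 shows "integrable M f"
  and "nsq (LI x|M. indicator S x *R f x) <= measure M S * (LI x|M. indicator S x * nsq (f x))"
proof -
 interpret finite_measure M by fact
 have nf: "(%x. indicator S x * norm (f x)) \<in> bm M" using f S by measurable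
 have i1: "integrable M (%x. (indicator S x :: real)\<^sup>2)"
  by (rule integrable_const_bound[where B=1]) (use S in "auto simp: indicator_def")
 have i2: "integrable M (%x. (indicator S x * norm (f x))\<^sup>2)"
  using integrable_mult_indicator[OF S f2]
  by (rule back_subst[of "integrable M"]) (auto simp: fun_eq_iff indicator_def)
 have "integrable M (%x. 1 * norm (f x))"
  by (rule Cauchy_Schwarz_integral) (use f f2 in auto)
 thus I: "integrable M f" using f by (simp add: integrable_norm_iff)
 have "norm (LI x|M. indicator S x *R f x) <= (LI x|M. indicator S x * (indicator S x * norm (f x)))"
  by (rule order_trans[OF integral_norm_bound])
   (auto intro!: eq_refl LI_cong simp: indicator_def)
 hence "nsq (LI x|M. indicator S x *R f x) <= (LI x|M. indicator S x * (indicator S x * norm (f x)))\<^sup>2"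
  by (intro power_mono) auto
 also have "... <= (LI x|M. (indicator S x)\<^sup>2) * (LI x|M. (indicator S x * norm (f x))\<^sup>2)"
  by (rule Cauchy_Schwarz_integral) (use nf S i1 i2 in auto)
 also have "(LI x|M. (indicator S x :: real)\<^sup>2) = measure M S"
  using S sets.sets_into_space[OF S] by (simp add: power2_eq_square indicator_inter_arith[symmetric] Int_absorb1 Int_commute)
 also have "(%x. (indicator S x * norm (f x))\<^sup>2) = (%x. indicator S x * nsq (f x))"
  by (auto simp: fun_eq_iff indicator_def)
 finally show "nsq (LI x|M. indicator S x *R f x) <= measure M S * (LI x|M. indicator S x * nsq (f x))" .
qed

lemma norm_integral_Mw_square_le:
 fixes f :: "real => 'b::{banach, second_countable_topology}"
 assumes a: "0 < a" "a < 1" and f: "f \<in> bm (Mw a)" and f2: "integrable (Mw a) (%x. nsq (f x))"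
 shows "nsq (LI x|Mw a. f x) <= (LI x|Mw a. nsq (f x))"
proof -
 have "(LI x|Mw a. f x) = (LI x|Mw a. indicator (space (Mw a)) x *R f x)"
  by (rule LI_cong) auto
 moreover have "(LI x|Mw a. nsq (f x)) = (LI x|Mw a. indicator (space (Mw a)) x * nsq (f x))"
  by (rule LI_cong) auto
 moreover have "measure (Mw a) (space (Mw a)) = 1" using prob_space_Mw(1)[OF a] by (simp add: measure_def)
 ultimately show ?thesis
  using norm_integral_square_le(2)[OF prob_space_Mw(2)[OF a] f f2 sets.top] by simp
qed

lemma Mw_bounded_integrable:
 fixes f :: "real => 'b::{banach, second_countable_topology}"
 assumes a: "0 < a" "a < 1" and f: "f \<in> bm (Mw a)" and C: "!!x. [|0 < x; x < 1|] ==> norm (f x) <= C"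
 shows "integrable (Mw a) f"
 by (rule finite_measure.integrable_const_bound[OF prob_space_Mw(2)[OF a], where B=C]) (use f C in auto)

text \<open>The weight \<open>1 - x\<close> degenerates at \<open>x = 1\<close>, but a small
  neighbourhood of 1 has small measure, and this produces the small factor \<open>e\<close>. Away
  from 1 the weight is bounded below by \<open>d\<close>, which costs
  \<open>K = 2 / d\<close>.\<close>

lemma Mw_interpolation:
 assumes a: "0 < a" "a < 1" and e: "e > 0"
 obtains K where "K \<ge> 0" "!!f :: real => 'b::{banach, second_countable_topology}.
  [|f \<in> bm (Mw a); integrable (Mw a) (%x. nsq (f x))|] ==>
   nsq (LI x|Mw a. f x) <= e * (LI x|Mw a. x * nsq (f x)) + K * (LI x|Mw a. (1 - x) * nsq (f x))"
proof -
 interpret finite_measure "Mw a" by (rule prob_space_Mw(2)[OF a])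
 \<comment> \<open>Starting at \<open>n + 2\<close> keeps these sets inside \<open>x > 1/2\<close>,
   where \<open>1 <= 2 * x\<close>.\<close>
 define S where "S n = {1 - 1 / real (n + 2) <..<1}" for n
 have sets: "B \<in> sets (Mw a)" if "B \<in> sets borel" "B \<subseteq> {0<..<1}" for B
  using that by (simp add: sets_restrict_space_iff)
 have S: "S n \<in> sets (Mw a)" for n by (rule sets) (auto simp: S_def, smt (verit) divide_le_eq_1 of_nat_0_le_iff)
 have "(%n. measure (Mw a) (S n)) ----> measure (Mw a) (\<Inter>n. S n)"
 proof (rule finite_Lim_measure_decseq)
  show "range S \<subseteq> sets (Mw a)" using S by auto
  show "decseq S" unfolding S_def decseq_def
  proof (intro allI impI)
   fix m n :: nat assume "m <= n"
   hence "1 / real (n + 2) <= 1 / real (m + 2)" by (intro divide_left_mono) auto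
   thus "{1 - 1 / real (n + 2)<..<1} \<subseteq> {1 - 1 / real (m + 2)<..<1}" by auto
  qed
 qed
 moreover have "(\<Inter>n. S n) = {}"
 proof (rule ccontr)
  assume "(\<Inter>n. S n) \<noteq> {}"
  then obtain x where "x \<in> S n" for n by blast
  hence x: "1 - 1 / real (n + 2) < x" "x < 1" for n unfolding S_def by auto
  obtain n where "1 / real (Suc n) < 1 - x" using x(2) nat_approx_posE[of "1 - x"] by auto
  moreover have "1 / real (n + 2) <= 1 / real (Suc n)" by (simp add: field_simps)
  ultimately show False using x(1)[of n] by linarith
 qed
 ultimately have "(%n. measure (Mw a) (S n)) ----> 0" by simp
 \<comment> \<open>Of the factor 4, one 2 pays for squaring a sum of two terms and the other for
   \<open>1 <= 2 * x\<close>.\<close>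
 hence "eventually (%n. measure (Mw a) (S n) < e / 4) sequentially" using e by (intro order_tendstoD) auto
 then obtain n where n: "measure (Mw a) (S n) < e / 4" by (auto simp: eventually_sequentially)
 define d where "d = 1 / real (n + 2)"
 have d: "d > 0" "d <= 1/2" by (auto simp: d_def field_simps)
 have Sn: "S n = {1 - d<..<1}" by (simp add: S_def d_def)
 let ?R = "{0<..1 - d}"
 have R: "?R \<in> sets (Mw a)" by (rule sets) (use d in auto)
 show ?thesis
 proof (rule that[of "2 / d"])
  fix f :: "real => 'b::{banach, second_countable_topology}"
  assume f: "f \<in> bm (Mw a)" and f2: "integrable (Mw a) (%x. nsq (f x))"
  have id: "(%x. x) \<in> bm (Mw a)" by (rule bm_weighted) simp
  have If: "integrable (Mw a) f" by (rule norm_integral_square_le(1)[OF prob_space_Mw(2)[OF a] f f2 sets.top])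
  have split: "(LI x|Mw a. f x) = (LI x|Mw a. indicator (S n) x *R f x) + (LI x|Mw a. indicator ?R x *R f x)"
   unfolding Bochner_Integration.integral_add[OF integrable_mult_indicator[OF S If] integrable_mult_indicator[OF R If], symmetric]
   by (rule LI_cong) (auto simp: Sn indicator_def)
  have w1: "integrable (Mw a) (%x. x * nsq (f x))" and w2: "integrable (Mw a) (%x. (1 - x) * nsq (f x))"
   by (rule LI_bound[OF f2]; use f id in "auto simp: abs_mult mult_left_le_one_le")+
  have 1: "nsq (LI x|Mw a. indicator (S n) x *R f x) <= e / 4 * (2 * (LI x|Mw a. x * nsq (f x)))"
  proof (rule order_trans[OF norm_integral_square_le(2)[OF prob_space_Mw(2)[OF a] f f2 S]])
   have "(LI x|Mw a. indicator (S n) x * nsq (f x)) <= (LI x|Mw a. 2 * (x * nsq (f x)))"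
   proof (rule integral_mono)
    show "integrable (Mw a) (%x. indicator (S n) x * nsq (f x))"
     using integrable_mult_indicator[OF S f2] by simp
    fix x assume "x \<in> space (Mw a)"
    hence x: "0 < x" by simp
    show "indicator (S n) x * nsq (f x) <= 2 * (x * nsq (f x))"
     using d x mult_right_mono[of 1 "2 * x" "nsq (f x)"] by (auto simp: indicator_def Sn)
   qed (use w1 in auto)
   thus "measure (Mw a) (S n) * (LI x|Mw a. indicator (S n) x * nsq (f x)) <= e / 4 * (2 * (LI x|Mw a. x * nsq (f x)))"
    using n e by (intro mult_mono) auto
  qed
  have 2: "nsq (LI x|Mw a. indicator ?R x *R f x) <= 1 * (1 / d * (LI x|Mw a. (1 - x) * nsq (f x)))"
  proof (rule order_trans[OF norm_integral_square_le(2)[OF prob_space_Mw(2)[OF a] f f2 R]])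
   have "(LI x|Mw a. indicator ?R x * nsq (f x)) <= (LI x|Mw a. 1 / d * ((1 - x) * nsq (f x)))"
   proof (rule integral_mono)
    show "integrable (Mw a) (%x. indicator ?R x * nsq (f x))"
     using integrable_mult_indicator[OF R f2] by simp
    fix x assume "x \<in> space (Mw a)"
    hence x: "x < 1" by simp
    have "0 <= (1 - x) * nsq (f x)" using x by simp
    moreover have "d * nsq (f x) <= (1 - x) * nsq (f x)" if "x <= 1 - d"
     by (rule mult_right_mono) (use that in auto)
    ultimately show "indicator ?R x * nsq (f x) <= 1 / d * ((1 - x) * nsq (f x))"
     using d by (auto simp: indicator_def pos_le_divide_eq mult.commute)
   qed (use w2 in auto)
   moreover have "measure (Mw a) ?R <= 1"
    using bounded_measure[of ?R] prob_space_Mw(1)[OF a] by (simp add: measure_def)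
   ultimately show "measure (Mw a) ?R * (LI x|Mw a. indicator ?R x * nsq (f x)) <= 1 * (1 / d * (LI x|Mw a. (1 - x) * nsq (f x)))"
    by (intro mult_mono) auto
  qed
  have "nsq (u + v) <= 2 * nsq u + 2 * nsq v" for u v :: 'b
  proof -
   have "nsq (u + v) <= (norm u + norm v)\<^sup>2" by (intro power_mono norm_triangle_ineq) simp
   also have "... <= 2 * nsq u + 2 * nsq v"
    using zero_le_power2[of "norm u - norm v"] by (simp add: power2_eq_square algebra_simps)
   finally show ?thesis .
  qed
  from this[of "LI x|Mw a. indicator (S n) x *R f x" "LI x|Mw a. indicator ?R x *R f x"] 1 2
  show "nsq (LI x|Mw a. f x) <= e * (LI x|Mw a. x * nsq (f x)) + 2 / d * (LI x|Mw a. (1 - x) * nsq (f x))"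
   unfolding split by simp
 qed (use d in simp)
qed

lemma Fubini_bounded:
 fixes f :: "real => real => real"
 assumes a: "0 < a" "a < 1" and m: "(%(th, s). f th s) \<in> bm (borel *M borel)"
  and C: "!!th s. [|0 < th; th < 1; 0 < s; s < t|] ==> \<bar>f th s\<bar> <= C"
 shows "integrable (Mw a) (%th. LI s<t. f th s)"
  and "iint t (%s. LI th|Mw a. f th s)"
  and "(LI th|Mw a. (LI s<t. f th s)) = (LI s<t. (LI th|Mw a. f th s))"
proof -
 interpret finite_measure "Mw a" by (rule prob_space_Mw(2)[OF a])
 interpret P: pair_sigma_finite "Mw a" "lborel :: real measure" ..
 let ?g = "%th s. indicator {0<..<t} s * f th s"
 have m1: "(%x. indicator {0<..<t} (snd x) * (case x of (th, s) => f th s)) \<in> bm (borel *M lborel)"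
  using m by measurable
 have m2: "(%(th, s). ?g th s) \<in> bm (Mw a *M lborel)"
  by (rule measurable_pair_Mw) (use m1 in "simp add: split_beta'")
 have Int: "integrable (Mw a *M lborel) (%(th, s). ?g th s)"
 proof (rule integrableI_bounded[OF m2])
  have m': "(%x. ennreal (norm (case x of (th, s) => ?g th s))) \<in> bm (Mw a *M lborel)"
   using m2 by measurable
  have "(NI x|(Mw a *M lborel). norm (case x of (th, s) => ?g th s))
   = (PI th|Mw a. (NI s|lborel. norm (?g th s)))"
   using lborel.nn_integral_fst[OF m', symmetric] by simp
  also have "... <= (PI th|Mw a. (PI s|lborel. ennreal C * indicator {0<..<t} s))"
   by (intro nn_integral_mono) (use C in "auto simp: indicator_def intro!: ennreal_leI")
  also have "... = ennreal C * emeasure lborel {0<..<t} * emeasure (Mw a) (space (Mw a))"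
   by (simp add: nn_integral_cmult)
  also have "... < \<infinity>" using prob_space_Mw(1)[OF a] by (cases "t > 0") (auto simp: ennreal_mult_less_top)
  finally show "(NI x|(Mw a *M lborel). norm (case x of (th, s) => ?g th s)) < \<infinity>" .
 qed
 show "integrable (Mw a) (%th. LI s<t. f th s)"
  using P.integrable_fst'[OF Int] by (simp add: set_int)
 show "iint t (%s. LI th|Mw a. f th s)"
  using P.integrable_snd[OF Int] by (simp add: set_integrable_def)
 show "(LI th|Mw a. (LI s<t. f th s)) = (LI s<t. (LI th|Mw a. f th s))"
  using P.Fubini_integral[OF Int] by (simp add: set_int)
qed

lemma FTC_within:
 fixes F f :: "real => real"
 assumes t: "0 <= t" "t <= T" and F: "!!s. s \<in> {0..T} ==> (F has_vector_derivative f s) (at s within {0..T})"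
  and f: "continuous_on {0..T} f"
 shows "iint t f" "(LI s<t. f s) = F t - F 0"
proof -
 have ft: "continuous_on {0..t} f" by (rule continuous_on_subset[OF f]) (use t in auto)
 have I: "set_integrable lborel {0..t} f" by (rule borel_integrable_atLeastAtMost'[OF ft])
 thus J: "iint t f" by (rule set_integrable_subset) auto
 have "(LI s<t. f s) = (LINT s:{0..t}|lborel. f s)"
  unfolding set_int
 proof (rule integral_cong_AE)
  show "AE r in lborel. cut t f r = indicator {0..t} r *R f r"
   using AE_lborel_singleton[of 0] AE_lborel_singleton[of t] by eventually_elim (auto simp: indicator_def)
 qed (use I J in "auto simp: set_integrable_def")
 also have "... = F t - F 0"
  unfolding set_int
  by (rule integral_FTC_atLeastAtMost[OF t(1) _ ft])
   (use t in "auto intro!: has_vector_derivative_within_subset[OF F]")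
 finally show "(LI s<t. f s) = F t - F 0" .
qed

lemma iint_continuous:
 assumes "continuous_on {0..T} f" "t <= T"
 shows "iint t f"
proof -
 have "set_integrable lborel {0..t} f"
  unfolding set_integrable_def
  by (rule borel_integrable_compact) (use assms in "auto intro: continuous_on_subset")
 thus ?thesis by (rule set_integrable_subset) auto
qed

section \<open>Energy estimates for regular flows\<close>

lemma bilinear_measurable:
 fixes H :: "'a::{real_normed_vector, second_countable_topology} => 'b::{real_normed_vector, second_countable_topology} => 'c::real_normed_vector"
 assumes H: "bounded_bilinear H" and [measurable]: "f \<in> bm N" "g \<in> bm N"
 shows "(%x. H (f x) (g x)) \<in> bm N"
 by (rule borel_measurable_continuous_Pair)
  (auto intro!: bounded_bilinear.continuous_on[OF H] continuous_intros)

locale quad_flow =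
 fixes i :: "'x::{banach, second_countable_topology} => 'h::{real_inner, banach, second_countable_topology}"
  and A :: "'x => 'x => real" and b :: "'x => real" and C1 C2 al T :: real
 assumes i: "bounded_linear i"
  and A: "bounded_bilinear A" and A_sym: "A u v = A v u"
  and b: "bounded_linear b"
  and coercive: "A v v \<ge> C1 * nsq v - C2 * nsq (i v)"
  and C1: "C1 > 0" and C2: "C2 > 0" and al: "0 < al" "al < 1" and T: "T > 0"
begin

text \<open>\<open>A\<close> is coercive only up to the norm of \<open>H\<close>; adding this
  multiple of the inner product of \<open>H\<close> gives a form that controls the norm of
  \<open>X\<close>. The extra term reappears on the right-hand side of the first estimate, where
  \<open>M0\<close> bounds it.\<close>

definition B :: "'x => 'x => real" where "B u v = A u v + C2 * inner (i u) (i v)"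

definition kb :: real where "kb = onorm b"
definition ki :: real where "ki = onorm i"

lemma kb: "\<bar>b v\<bar> <= kb * norm v" "kb \<ge> 0"
 using onorm[OF b, of v] onorm_pos_le[OF b] by (auto simp: kb_def)

lemma ki: "norm (i v) <= ki * norm v" "ki \<ge> 0"
 using onorm[OF i, of v] onorm_pos_le[OF i] by (auto simp: ki_def)

lemma i_measurable [measurable]: "i \<in> bm borel"
 by (rule borel_measurable_continuous_onI) (rule bounded_linear.continuous_on[OF i continuous_on_id])

lemma b_simps: "b (u + v) = b u + b v" "b (u - v) = b u - b v" "b (c *R u) = c * b u" "b 0 = 0"
 using linear_simps[OF b] by auto

lemma B_bilinear: "bounded_bilinear B"
proof (rule bounded_bilinear.intro)
 interpret A: bounded_bilinear A by (rule A)
 note il = linear_simps[OF i]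
 show "B (u + u') v = B u v + B u' v" "B u (v + v') = B u v + B u v'"
  "B (r *R u) v = r *R B u v" "B u (r *R v) = r *R B u v" for u u' v v' r
  by (simp_all add: B_def A.add_left A.add_right A.scaleR_left A.scaleR_right il inner_add_left inner_add_right algebra_simps)
 obtain K where K: "!!u v. norm (A u v) <= norm u * norm v * K" using A.bounded by blast
 have "norm (B u v) <= norm u * norm v * (K + C2 * (ki * ki))" for u v
 proof -
  have "\<bar>inner (i u) (i v)\<bar> <= (ki * norm u) * (ki * norm v)"
   by (rule order_trans[OF Cauchy_Schwarz_ineq2]) (use ki in "auto intro!: mult_mono")
  hence "C2 * \<bar>inner (i u) (i v)\<bar> <= C2 * ((ki * norm u) * (ki * norm v))"
   using C2 by (intro mult_left_mono) auto
  moreover have "\<bar>B u v\<bar> <= \<bar>A u v\<bar> + C2 * \<bar>inner (i u) (i v)\<bar>"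
   using abs_triangle_ineq[of "A u v" "C2 * inner (i u) (i v)"] C2 by (simp add: B_def abs_mult)
  ultimately show ?thesis using K[of u v] by (simp add: algebra_simps)
 qed
 thus "\<exists>K. \<forall>u v. norm (B u v) <= norm u * norm v * K" by blast
qed

lemma B_sym: "B u v = B v u"
 by (simp add: B_def A_sym[of u] inner_commute)

lemma B_coercive: "B v v \<ge> C1 * nsq v"
 using coercive[of v] by (simp add: B_def power2_norm_eq_inner)

lemma B_nonneg: "B v v \<ge> 0"
 using B_coercive[of v] C1 by (intro order_trans[OF _ B_coercive]) simp

text \<open>The additive constant is the maximum of \<open>kb * x - d * C1 * x\<^sup>2\<close> over
  \<open>x\<close>.\<close>

lemma b_young:
 assumes "d > 0" shows "\<bar>b v\<bar> <= d * B v v + kb\<^sup>2 / (4 * d * C1)"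
proof -
 have "0 <= (2 * d * C1 * norm v - kb)\<^sup>2" by simp
 hence "4 * d * C1 * (kb * norm v) <= 4 * d * C1 * (d * (C1 * nsq v)) + kb\<^sup>2"
  by (simp add: power2_eq_square algebra_simps)
 hence "kb * norm v <= d * (C1 * nsq v) + kb\<^sup>2 / (4 * d * C1)"
  using assms C1 by (simp add: field_simps)
 also have "... <= d * B v v + kb\<^sup>2 / (4 * d * C1)" using B_coercive[of v] assms by simp
 finally show ?thesis using kb(1)[of v] by simp
qed

end

text \<open>What a mollified solution looks like: \<open>U\<close> is the solution, \<open>G\<close>
  its Caputo derivative, both with values in \<open>X\<close> so that they may be inserted into
  \<open>A\<close>, and \<open>ch\<close> is the factor that mollification puts on the constant part
  \<open>b\<close> of the gradient. \<open>M0\<close> is a parameter because the resulting constants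
  must not depend on the kernel; for the same reason \<open>ch\<close> enters only through its
  monotonicity and its range in \<open>[0, 1]\<close>, not through a bound on
  \<open>ch'\<close>.\<close>

locale smooth_flow = quad_flow i A b C1 C2 al T
 for i :: "'x::{banach, second_countable_topology} => 'h::{real_inner, banach, second_countable_topology}"
  and A b C1 C2 al T +
 fixes G G' U U' :: "real => 'x" and ch ch' :: "real => real" and M0 :: real
 assumes G_meas [measurable]: "G \<in> bm borel" "G' \<in> bm borel"
  and U_meas [measurable]: "U \<in> bm borel" "U' \<in> bm borel"
  and G'_bounded: "\<exists>C. \<forall>s. 0 < s \<longrightarrow> s < T \<longrightarrow> norm (G' s) <= C"
  and G_eq: "t \<in> {0..T} ==> G t = prim G' t"
  and U_gker: "t \<in> {0..T} ==> U t = conv (gker al) G t" "t \<in> {0..T} ==> U' t = conv (gker al) G' t"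
  and U_eq: "t \<in> {0..T} ==> U t = prim U' t"
  and U'_cont: "continuous_on {0..T} U'"
  and chi: "(ch has_real_derivative ch' t) (at t)" "continuous_on UNIV ch'" "ch 0 = 0"
   "t \<in> {0..T} ==> 0 <= ch t" "t \<in> {0..T} ==> ch t <= 1" "t \<in> {0..T} ==> 0 <= ch' t"
  and eq: "t \<in> {0..T} ==> inner (i (G t)) (i v) = - (A (U t) v + ch t * b v)"
  and M0: "(LI s<T. nsq (i (U s))) <= M0"
begin

abbreviation "M \<equiv> Mw al"
text \<open>The extended unknown for mollified data. Since \<open>G\<close> vanishes at time 0, the
  time derivative of \<open>y\<close> is again a convolution with \<open>pk\<close>, namely that of
  \<open>G'\<close>.\<close>

definition y where "y th t = conv (pk th) G t"
definition y' where "y' th t = conv (pk th) G' t"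

lemma y_measurable [measurable]: "(%x. y (fst x) (snd x)) \<in> bm (borel *M borel)"
 "(%x. y' (fst x) (snd x)) \<in> bm (borel *M borel)"
 using conv_measurable_param[OF pk_measurable G_meas(1)] conv_measurable_param[OF pk_measurable G_meas(2)]
 by (simp_all add: split_beta' y_def y'_def)

lemma y_measurable1 [measurable]: "(%th. y th s) \<in> bm borel" "(%th. y' th s) \<in> bm borel"
 "y th \<in> bm borel" "y' th \<in> bm borel"
proof -
 have 1: "(%th. (th, s)) \<in> borel \<rightarrow>\<^sub>M borel *M borel" and 2: "(%s. (th, s)) \<in> borel \<rightarrow>\<^sub>M borel *M borel" by measurable
 show "(%th. y th s) \<in> bm borel" "(%th. y' th s) \<in> bm borel"
  using measurable_compose[OF 1 y_measurable(1)] measurable_compose[OF 1 y_measurable(2)] by simp_all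
 show "y th \<in> bm borel" "y' th \<in> bm borel"
  using measurable_compose[OF 2 y_measurable(1)] measurable_compose[OF 2 y_measurable(2)] by simp_all
qed

lemma G'_iint: "t <= T ==> iint t G'"
proof -
 assume "t <= T"
 obtain C where "!!s. 0 < s ==> s < T ==> norm (G' s) <= C" using G'_bounded by auto
 with \<open>t <= T\<close> show "iint t G'" by (intro iint_bounded[where C=C]) auto
qed

lemma G_cont: "continuous_on {0..T} G"
 by (rule iffD2[OF continuous_on_cong[OF refl G_eq] conv_one_continuous[OF G'_iint[OF order_refl]]])

lemma U_cont: "continuous_on {0..T} U"
 by (rule iffD2[OF continuous_on_cong[OF refl U_eq] conv_one_continuous[OF iint_continuous[OF U'_cont order_refl]]])

lemma U_deriv: "t \<in> {0..T} ==> (U has_vector_derivative U' t) (at t within {0..T})"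
 by (rule has_vector_derivative_transform[OF _ U_eq conv_one_has_vector_derivative[OF U'_cont iint_continuous[OF U'_cont order_refl]]])

lemma G_iint: "t <= T ==> iint t G"
 by (rule iint_continuous[OF G_cont])

lemma compact_bound:
 fixes f :: "real => 'b::real_normed_vector"
 assumes "continuous_on {0..T} f"
 obtains C where "!!s. s \<in> {0..T} ==> norm (f s) <= C" "C \<ge> 0"
proof -
 have "bounded (f ` {0..T})" by (intro compact_imp_bounded compact_continuous_image assms) auto
 then obtain C where "\<forall>y\<in>f ` {0..T}. norm y <= C" unfolding bounded_iff by blast
 thus ?thesis using T by (intro that[of C]) (auto intro: order_trans[OF norm_ge_zero, of "f 0"])
qed

lemma y_zero [simp]: "y th 0 = 0" "y' th 0 = 0"
 by (simp_all add: y_def y'_def)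

text \<open>The height \<open>c0 th\<close> of the kernel is unbounded as \<open>th\<close> tends to
  1, so the estimate goes through its mass, which is uniform in \<open>th\<close>.\<close>

lemma conv_pk_bound:
 fixes f :: "real => 'x"
 assumes th: "0 < th" "th < 1" and t: "t \<in> {0..T}" and f: "f \<in> bm borel"
  and C: "!!s. 0 < s ==> s < T ==> norm (f s) <= C" "C \<ge> 0"
 shows "norm (conv (pk th) f t) <= C * (2 * (1 + T))"
proof -
 have "norm (conv (pk th) f t) <= C * (LI s<t. \<bar>pk th s\<bar>)"
  by (rule conv_bounded'(2)) (use C t f pk_le[OF th] in \<open>auto intro!: iint_bounded[where C="c0 th"]\<close>)
 also have "... <= C * (2 * (1 + t))"
  using conv_one_pk_bounds[OF th, of t] conv_one_pk_eq[OF th, of t] t C by (intro mult_left_mono) auto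
 also have "... <= C * (2 * (1 + T))" using C t by (intro mult_left_mono) auto
 finally show ?thesis .
qed

lemma y_bounds:
 obtains C where "C \<ge> 0" "!!th s. [|0 < th; th < 1; s \<in> {0..T}|] ==> norm (y th s) <= C"
  "!!th s. [|0 < th; th < 1; s \<in> {0..T}|] ==> norm (y' th s) <= C"
  "!!s. s \<in> {0..T} ==> norm (G s) <= C"
proof -
 obtain C where C: "!!s. s \<in> {0..T} ==> norm (G s) <= C" "C \<ge> 0" using compact_bound[OF G_cont] by blast
 obtain C' where C': "!!s. 0 < s ==> s < T ==> norm (G' s) <= C'" using G'_bounded by auto
 define D where "D = max C C'"
 have D: "D \<ge> 0" "C <= D" "C' <= D" using C by (auto simp: D_def)
 show ?thesis
 proof (rule that[of "D * (2 * (1 + T))"])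
  show "norm (y th s) <= D * (2 * (1 + T))" if "0 < th" "th < 1" "s \<in> {0..T}" for th s
   unfolding y_def by (rule conv_pk_bound) (use that D order_trans[OF C(1) D(2)] in auto)
  show "norm (y' th s) <= D * (2 * (1 + T))" if "0 < th" "th < 1" "s \<in> {0..T}" for th s
   unfolding y'_def by (rule conv_pk_bound) (use that D order_trans[OF C' D(3)] in auto)
  have "D * 1 <= D * (2 * (1 + T))" using D T by (intro mult_left_mono) auto
  thus "norm (G s) <= D * (2 * (1 + T))" if "s \<in> {0..T}" for s
   using C(1)[OF that] D by linarith
 qed (use D T in simp)
qed

context
 fixes th :: real assumes th: "0 < th" "th < 1"
begin

lemma y_cont: "continuous_on {0..T} (y th)"
proof -
 obtain C where "!!s. s \<in> {0..T} ==> norm (y th s) <= C" using y_bounds th by metis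
 hence "iint T (y th)" by (intro iint_bounded[where C=C]) auto
 hence "continuous_on {0..T} (%t. c0 th *R prim G t - c1 th *R prim (y th) t)"
  by (intro continuous_intros conv_one_continuous G_iint) auto
 moreover have "y th t = c0 th *R prim G t - c1 th *R prim (y th) t" if "t \<in> {0..T}" for t
  unfolding y_def[abs_def] by (rule conv_pk_ode) (use that th G_iint in auto)
 ultimately show ?thesis by (rule iffD2[OF continuous_on_cong[OF refl], rotated])
qed

lemma y'_eq: assumes t: "t \<in> {0..T}" shows "y' th t = c0 th *R G t - c1 th *R y th t"
proof -
 have "y' th t = c0 th *R prim G' t - c1 th *R conv (pk th) (prim G') t"
  unfolding y'_def by (rule conv_pk_ode) (use t th G'_iint in auto)
 also have "conv (pk th) (prim G') t = y th t"
  unfolding y_def by (rule conv_cong) (use t G_eq in auto)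
 finally show ?thesis using t G_eq by simp
qed

lemma y'_cont: "continuous_on {0..T} (y' th)"
 by (rule iffD2[OF continuous_on_cong[OF refl y'_eq]]) (auto intro!: continuous_intros y_cont G_cont)

lemma y_deriv: assumes t: "t \<in> {0..T}" shows "(y th has_vector_derivative y' th t) (at t within {0..T})"
proof -
 have "y th t = prim (y' th) t" if "t \<in> {0..T}" for t
 proof -
  have "y th t = conv (pk th) (prim G') t"
   unfolding y_def by (rule conv_cong) (use that G_eq in auto)
  also have "... = prim (y' th) t"
   unfolding y'_def[abs_def] using conv_one_kernel[OF G'_iint pk_continuous] that by simp
  finally show ?thesis .
 qed
 thus ?thesis
  by (rule has_vector_derivative_transform[OF t _ conv_one_has_vector_derivative[OF y'_cont iint_continuous[OF y'_cont order_refl] t]])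
qed

lemma y_ode: assumes t: "t \<in> {0..T}" shows "(1 - th) *R y' th t = G t - th *R y th t"
 using th unfolding y'_eq[OF t] by (simp add: scaleR_diff_right c0_def c1_def)

end

lemma integral_y:
 assumes t: "t \<in> {0..T}"
 shows "integrable M (%th. y th t)" "(LI th|M. y th t) = U t"
  "integrable M (%th. y' th t)" "(LI th|M. y' th t) = U' t"
proof -
 obtain C where C: "!!s. s \<in> {0..T} ==> norm (G s) <= C" using y_bounds by metis
 obtain C' where C': "!!s. 0 < s ==> s < T ==> norm (G' s) <= C'" using G'_bounded by auto
 have 1: "iint t (%s. gker al (t - s) *R G s)"
  by (rule conv_bounded'(1)[where C=C]) (use C al t iint_gker in auto)
 have 2: "iint t (%s. gker al (t - s) *R G' s)"
  by (rule conv_bounded'(1)[where C=C']) (use C' al t iint_gker in auto)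
 show "integrable M (%th. y th t)" "(LI th|M. y th t) = U t"
  using integral_conv_pk[OF al G_meas(1) 1] U_gker(1)[OF t] by (simp_all add: y_def)
 show "integrable M (%th. y' th t)" "(LI th|M. y' th t) = U' t"
  using integral_conv_pk[OF al G_meas(2) 2] U_gker(2)[OF t] by (simp_all add: y'_def)
qed

end

section \<open>First energy estimate: testing with the extended unknown\<close>

context smooth_flow
begin

lemmas B_measurable [measurable (raw)] = bilinear_measurable[OF B_bilinear]

definition Q where "Q th s = B (y th s) (y th s)"
text \<open>\<open>YY\<close> is the squared state in the weight \<open>wt0\<close> of the extended
  Hilbert space, measured by \<open>B\<close>; \<open>SS\<close>, with weight \<open>th\<close>, is
  the dissipation.\<close>

definition YY where "YY s = (LI th|M. (1 - th) * Q th s)"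
definition SS where "SS s = (LI th|M. th * Q th s)"

lemma Q_measurable [measurable]: "(%x. Q (fst x) (snd x)) \<in> bm (borel *M borel)"
 unfolding Q_def by measurable

lemma Q_measurable1 [measurable]: "(%th. Q th s) \<in> bm borel"
 unfolding Q_def by measurable

lemma Q_nonneg: "Q th s \<ge> 0"
 by (simp add: Q_def B_nonneg)

lemma Q_bound:
 obtains C where "C \<ge> 0" "!!th s. [|0 < th; th < 1; s \<in> {0..T}|] ==> Q th s <= C"
  "!!th s. [|0 < th; th < 1; s \<in> {0..T}|] ==> \<bar>B (G s) (y th s)\<bar> <= C"
proof -
 obtain K where K: "!!u v. norm (B u v) <= norm u * norm v * K" "K > 0"
  using bounded_bilinear.pos_bounded[OF B_bilinear] by blast
 obtain C where C: "C \<ge> 0" "!!th s. [|0 < th; th < 1; s \<in> {0..T}|] ==> norm (y th s) <= C"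
  "!!s. s \<in> {0..T} ==> norm (G s) <= C" using y_bounds by metis
 have *: "\<bar>B u v\<bar> <= C * C * K" if "norm u <= C" "norm v <= C" for u v
  using K(1)[of u v] mult_mono[OF that] K(2) C(1)
  by (smt (verit, ccfv_SIG) mult_right_mono norm_ge_zero real_norm_def)
 show ?thesis
  by (rule that[of "C * C * K"]) (use C K *[OF C(2) C(2)] *[OF C(3) C(2)] in "auto simp: Q_def abs_le_iff")
qed

lemma Q_integrable:
 assumes s: "s \<in> {0..T}"
 shows "integrable M (%th. (1 - th) * Q th s)" "integrable M (%th. th * Q th s)" "integrable M (%th. Q th s)"
proof -
 obtain C where C: "C \<ge> 0" "!!th s. [|0 < th; th < 1; s \<in> {0..T}|] ==> Q th s <= C" using Q_bound by metis
 have le: "c * Q th s <= C" if "0 <= c" "c <= 1" "0 < th" "th < 1" for c th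
  using mult_left_le_one_le[of "Q th s" c] that C(2)[OF that(3,4) s] Q_nonneg[of th s] by linarith
 show "integrable M (%th. (1 - th) * Q th s)" "integrable M (%th. th * Q th s)"
  by (rule Mw_bounded_integrable[OF al, where C=C], rule bm_weighted; use le Q_nonneg in "simp add: abs_mult")+
 show "integrable M (%th. Q th s)"
  by (rule Mw_bounded_integrable[OF al, where C=C]) (use C s Q_nonneg in "auto intro!: bm_weighted")
qed

lemma YY_nonneg: "YY s \<ge> 0" and SS_nonneg: "SS s \<ge> 0"
 unfolding YY_def SS_def by (auto intro!: integral_nonneg_AE AE_I2 mult_nonneg_nonneg Q_nonneg)

lemma YY_bound: obtains C where "C \<ge> 0" "!!s. s \<in> {0..T} ==> YY s <= C"
proof -
 obtain C where C: "C \<ge> 0" "!!th s. [|0 < th; th < 1; s \<in> {0..T}|] ==> Q th s <= C" using Q_bound by metis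
 show ?thesis
 proof (rule that[of C])
  fix s assume s: "s \<in> {0..T}"
  have "YY s <= (LI th|M. C)" unfolding YY_def
  proof (rule integral_mono[OF Q_integrable(1)[OF s]])
   show "integrable M (%th. C)" by (rule Mw_bounded_integrable[OF al, where C=C]) (use C in auto)
   fix th assume "th \<in> space M"
   hence th: "0 < th" "th < 1" by auto
   show "(1 - th) * Q th s <= C"
    using mult_left_le_one_le[of "Q th s" "1 - th"] th C(2)[OF th s] Q_nonneg[of th s] by linarith
  qed
  also have "... = C" using prob_space_Mw(1)[OF al] by (simp add: measure_def)
  finally show "YY s <= C" .
 qed fact
qed

lemma B_cont: "[|continuous_on S f; continuous_on S g|] ==> continuous_on S (%s. B (f s) (g s))"
 by (rule bounded_bilinear.continuous_on[OF B_bilinear])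

text \<open>The extended equation tested with \<open>y\<close> in the form \<open>B\<close>; by
  symmetry of \<open>B\<close> the first term is half a time derivative.\<close>

lemma energy_theta:
 assumes th: "0 < th" "th < 1" and t: "t \<in> {0..T}"
 shows "1/2 * ((1 - th) * Q th t) + (LI s<t. th * Q th s) = (LI s<t. B (G s) (y th s))"
proof -
 interpret B: bounded_bilinear B by (rule B_bilinear)
 let ?f = "%s. B (G s) (y th s) - th * Q th s"
 have c1: "continuous_on {0..T} (%s. B (G s) (y th s))" and c2: "continuous_on {0..T} (%s. th * Q th s)"
  unfolding Q_def by (intro continuous_intros B_cont G_cont y_cont[OF th])+
 have der: "((%s. 1/2 * ((1 - th) * Q th s)) has_vector_derivative ?f s) (at s within {0..T})" if s: "s \<in> {0..T}" for s
 proof -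
  have "(Q th has_vector_derivative B (y th s) (y' th s) + B (y' th s) (y th s)) (at s within {0..T})"
   unfolding Q_def[abs_def] by (rule B.has_vector_derivative[OF y_deriv[OF th s] y_deriv[OF th s]])
  hence "((%s. (1/2 * (1 - th)) *R Q th s) has_vector_derivative (1/2 * (1 - th)) *R (B (y th s) (y' th s) + B (y' th s) (y th s))) (at s within {0..T})"
   by (rule bounded_linear.has_vector_derivative[OF bounded_linear_scaleR_right])
  moreover have "(1/2 * (1 - th)) *R (B (y th s) (y' th s) + B (y' th s) (y th s)) = ?f s"
  proof -
   have "(1/2 * (1 - th)) *R (B (y th s) (y' th s) + B (y' th s) (y th s)) = B ((1 - th) *R y' th s) (y th s)"
    by (simp add: B_sym[of "y th s" "y' th s"] B.scaleR_left)
   thus ?thesis unfolding y_ode[OF th s] by (simp add: B.diff_left B.scaleR_left Q_def)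
  qed
  ultimately show ?thesis by (simp only: real_scaleR_def mult.assoc)
 qed
 have "(LI s<t. ?f s) = 1/2 * ((1 - th) * Q th t) - 1/2 * ((1 - th) * Q th 0)"
  by (rule FTC_within(2)[OF _ _ der]) (use t c1 c2 in "auto intro!: continuous_intros")
 moreover have "Q th 0 = 0" by (simp add: Q_def B.zero_left)
 moreover have "(LI s<t. ?f s) = (LI s<t. B (G s) (y th s)) - (LI s<t. th * Q th s)"
  by (rule set_integral_diff(2)) (use t in "auto intro!: iint_continuous[OF c1] iint_continuous[OF c2]")
 ultimately show ?thesis by simp
qed

text \<open>\<open>B\<close> is linear in its second argument and \<open>y\<close> averages to
  \<open>U\<close>, so after averaging the right-hand side no longer sees \<open>th\<close>.\<close>

lemma energy1:
 assumes t: "t \<in> {0..T}"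
 shows "1/2 * YY t + (LI s<t. SS s) = (LI s<t. B (G s) (U s))"
proof -
 interpret B: bounded_bilinear B by (rule B_bilinear)
 obtain C where C: "C \<ge> 0" "!!th s. [|0 < th; th < 1; s \<in> {0..T}|] ==> Q th s <= C"
  "!!th s. [|0 < th; th < 1; s \<in> {0..T}|] ==> \<bar>B (G s) (y th s)\<bar> <= C" using Q_bound by metis
 have m1: "(%(th, s). th * Q th s) \<in> bm (borel *M borel)"
  and m2: "(%(th, s). B (G s) (y th s)) \<in> bm (borel *M borel)"
  unfolding split_beta' by measurable
 have b1: "\<bar>th * Q th s\<bar> <= C" if "0 < th" "th < 1" "0 < s" "s < t" for th s
  using mult_left_le_one_le[of "Q th s" th] that C(2)[of th s] Q_nonneg[of th s] t by (simp add: abs_mult)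
 have b2: "\<bar>B (G s) (y th s)\<bar> <= C" if "0 < th" "th < 1" "0 < s" "s < t" for th s
  using C(3) that t by auto
 note F1 = Fubini_bounded[OF al m1 b1] and F2 = Fubini_bounded[OF al m2 b2]
 have "1/2 * YY t + (LI s<t. SS s)
  = (LI th|M. 1/2 * ((1 - th) * Q th t) + (LI s<t. th * Q th s))"
  using F1(1,3) Q_integrable(1)[OF t] by (simp add: YY_def SS_def)
 also have "... = (LI th|M. (LI s<t. B (G s) (y th s)))"
  by (rule LI_cong[OF refl]) (use energy_theta t in auto)
 also have "... = (LI s<t. (LI th|M. B (G s) (y th s)))" by (rule F2(3))
 also have "... = (LI s<t. B (G s) (U s))"
 proof (rule set_lebesgue_integral_cong)
  show "\<forall>s. s \<in> {0<..<t} \<longrightarrow> (LI th|M. B (G s) (y th s)) = B (G s) (U s)"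
   using integral_bounded_linear[OF B.bounded_linear_right integral_y(1)] integral_y(2) t by auto
 qed simp
 finally show ?thesis .
qed

text \<open>The first summand is the price of replacing \<open>A\<close> by \<open>B\<close>. The
  second collects the Young constants of \<open>bterm_theta\<close> in units of
  \<open>c = kb\<^sup>2 / C1\<close>: \<open>c\<close> from the final time, \<open>2 * c\<close>
  from the term with \<open>ch'\<close>, and \<open>T * c / 2\<close> from the dissipation.\<close>

definition KK :: real where "KK = C2\<^sup>2 / 2 * M0 + (3 + T / 2) * (kb\<^sup>2 / C1)"

lemma iG_cont: "continuous_on {0..T} (%s. i (G s))" "continuous_on {0..T} (%s. i (U s))" "continuous_on {0..T} (%s. i (U' s))"
 by (intro bounded_linear.continuous_on[OF i] G_cont U_cont U'_cont)+

lemma b_cont: "continuous_on S f ==> continuous_on S (%s. b (f s))"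
 by (rule bounded_linear.continuous_on[OF b])

lemma ch_cont: "continuous_on S ch" "continuous_on S ch'"
proof -
 have "continuous_on UNIV ch" using chi(1) by (intro DERIV_continuous_on) (auto intro: DERIV_subset)
 thus "continuous_on S ch" by (rule continuous_on_subset) simp
 show "continuous_on S ch'" using chi(2) by (rule continuous_on_subset) simp
qed

text \<open>The equation with test vector \<open>G\<close> itself turns the leading part into
  \<open>- nsq (i (G s))\<close>. Half of it absorbs the extra term of \<open>B\<close>; the other
  half is what later bounds the Caputo derivative in \<open>H\<close>.\<close>

lemma BGU: assumes "s \<in> {0..T}"
 shows "B (G s) (U s) <= - (1/2 * nsq (i (G s))) + C2\<^sup>2 / 2 * nsq (i (U s)) - ch s * b (G s)"
proof -
 have "B (G s) (U s) = A (U s) (G s) + C2 * inner (i (U s)) (i (G s))" by (simp add: B_sym[of "G s"]) (simp add: B_def)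
 also have "A (U s) (G s) = - nsq (i (G s)) - ch s * b (G s)"
  using eq[OF assms, of "G s"] by (simp add: power2_norm_eq_inner)
 also have "C2 * inner (i (U s)) (i (G s)) <= 1/2 * nsq (i (G s)) + C2\<^sup>2 / 2 * nsq (i (U s))"
 proof -
  have "0 <= nsq (i (G s) - C2 *R i (U s))" by simp
  thus ?thesis unfolding power2_norm_eq_inner
   by (simp add: inner_diff inner_commute power2_eq_square algebra_simps)
 qed
 finally show ?thesis by simp
qed

lemma iint_norm2: assumes "continuous_on {0..T} f" "t <= T" shows "iint t (%s. nsq (f s :: 'b::{real_normed_vector}))"
 by (rule iint_continuous[of T]) (use assms in "auto intro!: continuous_intros")

lemma energy1_le:
 assumes t: "t \<in> {0..T}"
 shows "1/2 * YY t + (LI s<t. SS s) + 1/2 * (LI s<t. nsq (i (G s)))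
  <= C2\<^sup>2 / 2 * M0 - (LI s<t. ch s * b (G s))"
proof -
 have tT: "t <= T" using t by simp
 have i1: "iint t (%s. B (G s) (U s))" by (rule iint_continuous[OF B_cont[OF G_cont U_cont] tT])
 note i2 = iint_norm2[OF iG_cont(1) tT] and i3 = iint_norm2[OF iG_cont(2) tT]
 have i4: "iint t (%s. ch s * b (G s))"
  by (rule iint_continuous[OF _ tT]) (intro continuous_intros ch_cont b_cont G_cont)
 have "(LI s<t. B (G s) (U s)) <=
  (LI s<t. (- (1/2 * nsq (i (G s))) + C2\<^sup>2 / 2 * nsq (i (U s))) - ch s * b (G s))"
  by (rule set_integral_mono) (use i1 i2 i3 i4 BGU t in auto)
 also have "... = - (1/2 * (LI s<t. nsq (i (G s)))) + C2\<^sup>2 / 2 * (LI s<t. nsq (i (U s)))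
   - (LI s<t. ch s * b (G s))"
 proof -
  have j: "iint t (%s. - (1/2 * nsq (i (G s))))" "iint t (%s. C2\<^sup>2 / 2 * nsq (i (U s)))" using i2 i3 set_integrable_mult_right[OF i2, of "- (1/2)"] by auto
  show ?thesis
   unfolding set_integral_diff(2)[OF set_integral_add(1)[OF j] i4] set_integral_add(2)[OF j]
   by (simp add: set_int)
 qed
 finally have "(LI s<t. B (G s) (U s)) <= - (1/2 * (LI s<t. nsq (i (G s))))
   + C2\<^sup>2 / 2 * (LI s<t. nsq (i (U s))) - (LI s<t. ch s * b (G s))" .
 moreover have "(LI s<t. nsq (i (U s))) <= M0"
 proof (rule order_trans[OF _ M0])
  show "(LI s<t. nsq (i (U s))) <= (LI s<T. nsq (i (U s)))"
   unfolding set_int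
   by (rule integral_mono) (use i3 iint_norm2[OF iG_cont(2) order_refl] tT in "auto simp: set_integrable_def indicator_def")
 qed
 hence "C2\<^sup>2 / 2 * (LI s<t. nsq (i (U s))) <= C2\<^sup>2 / 2 * M0" by (intro mult_left_mono) auto
 ultimately show ?thesis using energy1[OF t] by linarith
qed

end

context quad_flow
begin

text \<open>The interpolation constant for \<open>e = 1 / (2 * C2)\<close>, the value for which
  \<open>C2 / 2\<close> times the first term is a quarter of it. It is fixed here, before any
  mollification, so that all mollified flows share it.\<close>

definition KI :: real where
 "KI = (SOME K. K \<ge> 0 \<and> (\<forall>f :: real => 'h. f \<in> bm (Mw al) \<longrightarrow> integrable (Mw al) (%x. nsq (f x)) \<longrightarrow>
   nsq (LI x|Mw al. f x) <= 1 / (2 * C2) * (LI x|Mw al. x * nsq (f x)) + K * (LI x|Mw al. (1 - x) * nsq (f x))))"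

lemma KI: "KI \<ge> 0"
 "[|f \<in> bm (Mw al); integrable (Mw al) (%x. nsq (f x :: 'h))|] ==>
  nsq (LI x|Mw al. f x) <= 1 / (2 * C2) * (LI x|Mw al. x * nsq (f x)) + KI * (LI x|Mw al. (1 - x) * nsq (f x))"
proof -
 have "1 / (2 * C2) > 0" using C2 by simp
 obtain K0 where K0: "K0 \<ge> 0" "!!f :: real => 'h. [|f \<in> bm (Mw al); integrable (Mw al) (%x. nsq (f x))|] ==>
   nsq (LI x|Mw al. f x) <= 1 / (2 * C2) * (LI x|Mw al. x * nsq (f x)) + K0 * (LI x|Mw al. (1 - x) * nsq (f x))"
  by (rule Mw_interpolation[OF al \<open>1 / (2 * C2) > 0\<close>, where 'b='h]) (rule that)
 have "\<exists>K. K \<ge> 0 \<and> (\<forall>f :: real => 'h. f \<in> bm (Mw al) \<longrightarrow> integrable (Mw al) (%x. nsq (f x)) \<longrightarrow>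
   nsq (LI x|Mw al. f x) <= 1 / (2 * C2) * (LI x|Mw al. x * nsq (f x)) + K * (LI x|Mw al. (1 - x) * nsq (f x)))"
  by (intro exI[of _ K0] conjI allI impI K0)
 from someI_ex[OF this] show "KI \<ge> 0"
  "[|f \<in> bm (Mw al); integrable (Mw al) (%x. nsq (f x :: 'h))|] ==>
  nsq (LI x|Mw al. f x) <= 1 / (2 * C2) * (LI x|Mw al. x * nsq (f x)) + KI * (LI x|Mw al. (1 - x) * nsq (f x))"
  unfolding KI_def[symmetric] by blast+
qed

end

context smooth_flow
begin

lemma ch_measurable [measurable]: "ch \<in> bm borel" "ch' \<in> bm borel"
 by (intro borel_measurable_continuous_onI ch_cont)+

lemma integral_ch': assumes "t \<in> {0..T}" shows "(LI s<t. ch' s) = ch t" "iint t ch'"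
proof -
 have "(ch has_vector_derivative ch' s) (at s within {0..T})" for s
  using chi(1)[of s] unfolding has_real_derivative_iff_has_vector_derivative by (rule has_vector_derivative_at_within)
 from FTC_within[OF _ _ this ch_cont(2), of t] assms chi(3)
 show "(LI s<t. ch' s) = ch t" "iint t ch'" by auto
qed

lemma Q_cont: "0 < th ==> th < 1 ==> continuous_on {0..T} (Q th)"
 unfolding Q_def[abs_def] by (intro B_cont y_cont)

text \<open>\<open>b\<close> acts on \<open>X\<close>, where no bound for \<open>G\<close> is at
  hand, so this term cannot be estimated directly. But \<open>G = (1 - th) y' + th y\<close>, and
  integration by parts moves the derivative from \<open>y\<close> onto \<open>ch\<close>, whose
  derivative is nonnegative with integral at most 1 whatever the mollification.\<close>

lemma bterm_theta:
 assumes th: "0 < th" "th < 1" and t: "t \<in> {0..T}"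
 shows "- (LI s<t. ch s * b (G s)) <= 1/4 * ((1 - th) * Q th t)
  + (LI s<t. ch' s * (1/8 * ((1 - th) * Q th s))) + 1/2 * (LI s<t. th * Q th s)
  + (3 + T / 2) * (kb\<^sup>2 / C1)"
proof -
 define c where "c = kb\<^sup>2 / C1"
 have c: "c \<ge> 0" using C1 by (simp add: c_def)
 have tT: "t <= T" "0 <= t" using t by auto
 let ?F = "%s. (1 - th) * (ch s * b (y th s))"
 let ?r = "%s. (1 - th) * (ch' s * b (y th s)) - th * (ch s * b (y th s))"
 let ?f = "%s. ?r s + ch s * b (G s)"
 have cr: "continuous_on {0..T} ?r" and cb: "continuous_on {0..T} (%s. ch s * b (G s))"
  by (intro continuous_intros b_cont y_cont[OF th] ch_cont G_cont)+
 have der: "(?F has_vector_derivative ?f s) (at s within {0..T})" if s: "s \<in> {0..T}" for s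
 proof -
  have 1: "(ch has_vector_derivative ch' s) (at s within {0..T})"
   using chi(1)[of s] unfolding has_real_derivative_iff_has_vector_derivative by (rule has_vector_derivative_at_within)
  have 2: "((%s. b (y th s)) has_vector_derivative b (y' th s)) (at s within {0..T})"
   by (rule bounded_linear.has_vector_derivative[OF b y_deriv[OF th s]])
  have "(?F has_vector_derivative (1 - th) * (ch s * b (y' th s) + ch' s * b (y th s))) (at s within {0..T})"
   by (rule bounded_linear.has_vector_derivative[OF bounded_linear_mult_right has_vector_derivative_mult[OF 1 2]])
  moreover have "(1 - th) * (ch s * b (y' th s) + ch' s * b (y th s)) = ?f s"
  proof -
   have "(1 - th) * b (y' th s) = b (G s) - th * b (y th s)"
    using arg_cong[OF y_ode[OF th s], of b] by (simp only: b_simps)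
   hence "ch s * ((1 - th) * b (y' th s)) = ch s * (b (G s) - th * b (y th s))" by simp
   thus ?thesis by (simp add: algebra_simps)
  qed
  ultimately show ?thesis by simp
 qed
 have "(LI s<t. ?f s) = ?F t - ?F 0"
  by (rule FTC_within(2)[OF tT(2,1) der continuous_on_add[OF cr cb]])
 moreover have "?F 0 = 0" by (simp add: b_simps)
 moreover have "(LI s<t. ?f s) = (LI s<t. ?r s) + (LI s<t. ch s * b (G s))"
  by (rule set_integral_add(2)[OF iint_continuous[OF cr tT(1)] iint_continuous[OF cb tT(1)]])
 ultimately have e: "- (LI s<t. ch s * b (G s)) = (LI s<t. ?r s) - ?F t" by linarith
 \<comment> \<open>The parameter 1/4 here and 1/8 and 1/2 below are chosen so that each term takes
   half of what is available: half of \<open>1/2 * YY t\<close>, half of the supremum term then left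
   over, and half of the dissipation.\<close>
 have f0: "- ?F t <= 1/4 * ((1 - th) * Q th t) + c"
 proof -
  have "- (ch t * b (y th t)) <= \<bar>b (y th t)\<bar>"
   using chi(4,5)[OF t] mult_left_le_one_le[of "\<bar>b (y th t)\<bar>" "ch t"] abs_ge_minus_self[of "ch t * b (y th t)"]
   by (simp add: abs_mult)
  also have "... <= 1/4 * Q th t + c"
   using b_young[of "1/4" "y th t"] by (simp add: Q_def c_def)
  finally have "(1 - th) * (- (ch t * b (y th t))) <= (1 - th) * (1/4 * Q th t + c)"
   using th by (intro mult_left_mono) auto
  also have "... <= 1/4 * ((1 - th) * Q th t) + c"
   unfolding distrib_left using mult_left_le_one_le[of c "1 - th"] th c by simp
  finally show ?thesis by simp
 qed
 have "(LI s<t. ?r s) <= (LI s<t. (ch' s * (1/8 * ((1 - th) * Q th s)) + ch' s * (2 * c)) + (1/2 * (th * Q th s) + c / 2))"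
 proof (rule set_integral_mono)
  show "iint t ?r" by (rule iint_continuous[OF cr tT(1)])
  show "iint t (%s. (ch' s * (1/8 * ((1 - th) * Q th s)) + ch' s * (2 * c)) + (1/2 * (th * Q th s) + c / 2))"
   by (rule iint_continuous[OF _ tT(1)]) (intro continuous_intros ch_cont Q_cont th)
  fix s assume "s \<in> {0<..<t}"
  hence s: "s \<in> {0..T}" using tT by auto
  have "(1 - th) * (ch' s * b (y th s)) <= (1 - th) * (ch' s * (1/8 * Q th s + 2 * c))"
   using b_young[of "1/8" "y th s"] th chi(6)[OF s]
   by (intro mult_left_mono) (auto simp: Q_def c_def)
  also have "... = ch' s * (1/8 * ((1 - th) * Q th s)) + (1 - th) * (ch' s * (2 * c))"
   by (simp add: algebra_simps add_divide_distrib diff_divide_distrib)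
  also have "... <= ch' s * (1/8 * ((1 - th) * Q th s)) + ch' s * (2 * c)"
   using mult_left_le_one_le[of "ch' s * (2 * c)" "1 - th"] th c chi(6)[OF s] by simp
  finally have r1: "(1 - th) * (ch' s * b (y th s)) <= ch' s * (1/8 * ((1 - th) * Q th s)) + ch' s * (2 * c)" .
  have "- (ch s * b (y th s)) <= \<bar>b (y th s)\<bar>"
   using chi(4,5)[OF s] mult_left_le_one_le[of "\<bar>b (y th s)\<bar>" "ch s"] abs_ge_minus_self[of "ch s * b (y th s)"]
   by (simp add: abs_mult)
  also have "... <= 1/2 * Q th s + c / 2"
   using b_young[of "1/2" "y th s"] by (simp add: Q_def c_def)
  finally have "th * (- (ch s * b (y th s))) <= th * (1/2 * Q th s + c / 2)"
   using th by (intro mult_left_mono) auto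
  also have "... <= 1/2 * (th * Q th s) + c / 2"
   using mult_left_le_one_le[of "c / 2" "th"] th c by (simp add: algebra_simps)
  finally have r2: "- (th * (ch s * b (y th s))) <= 1/2 * (th * Q th s) + c / 2" by simp
  from r1 r2 show "?r s <= (ch' s * (1/8 * ((1 - th) * Q th s)) + ch' s * (2 * c)) + (1/2 * (th * Q th s) + c / 2)" by simp
 qed
 also have "... = (LI s<t. ch' s * (1/8 * ((1 - th) * Q th s))) + ch t * (2 * c)
   + (1/2 * (LI s<t. th * Q th s) + t * (c / 2))"
 proof -
  have i1: "iint t (%s. ch' s * (1/8 * ((1 - th) * Q th s)))" and i2: "iint t (%s. ch' s * (2 * c))"
   and i3: "iint t (%s. 1/2 * (th * Q th s))" and i4: "iint t (%s. c / 2)"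
   by (rule iint_continuous[OF _ tT(1)], intro continuous_intros ch_cont Q_cont th)+
  have "(LI s<t. ch' s * (2 * c)) = ch t * (2 * c)"
   using integral_ch'(1)[OF t] by simp
  moreover have "(LI s<t. c / 2) = t * (c / 2)"
   using tT by (simp add: set_int)
  moreover have "(LI s<t. 1/2 * (th * Q th s)) = 1/2 * (LI s<t. th * Q th s)"
   by (rule set_integral_mult_right)
  ultimately show ?thesis
   unfolding set_integral_add(2)[OF set_integral_add(1)[OF i1 i2] set_integral_add(1)[OF i3 i4]]
    set_integral_add(2)[OF i1 i2] set_integral_add(2)[OF i3 i4] by simp
 qed
 finally have r3: "(LI s<t. ?r s) <= (LI s<t. ch' s * (1/8 * ((1 - th) * Q th s))) + ch t * (2 * c)
   + (1/2 * (LI s<t. th * Q th s) + t * (c / 2))" .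
 have "ch t * (2 * c) <= 2 * c" using mult_left_le_one_le[of "2 * c" "ch t"] c chi(4,5)[OF t] by simp
 moreover have "t * (c / 2) <= T * (c / 2)" using tT c by (intro mult_right_mono) auto
 moreover have "(3 + T / 2) * (kb\<^sup>2 / C1) = 3 * c + T * (c / 2)" by (simp add: c_def[symmetric] algebra_simps)
 ultimately show ?thesis unfolding e using f0 r3 by linarith
qed

lemma integral_const_M: "integrable M (%_. c)" "(LI th|M. c) = (c :: real)"
proof -
 show "integrable M (%_. c)" by (rule Mw_bounded_integrable[OF al, where C="\<bar>c\<bar>"]) auto
 show "(LI th|M. c) = c" using prob_space_Mw(1)[OF al] by (simp add: measure_def)
qed

lemma bterm:
 assumes t: "t \<in> {0..T}"
 shows "- (LI s<t. ch s * b (G s)) <= 1/4 * YY t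
  + (LI s<t. ch' s * (1/8 * YY s)) + 1/2 * (LI s<t. SS s)
  + (3 + T / 2) * (kb\<^sup>2 / C1)"
  and "iint t (%s. ch' s * (1/8 * YY s))" and "iint t SS"
proof -
 obtain C where C: "C \<ge> 0" "!!th s. [|0 < th; th < 1; s \<in> {0..T}|] ==> Q th s <= C" using Q_bound by metis
 obtain D where D: "!!s. s \<in> {0..T} ==> norm (ch' s) <= D" "D \<ge> 0"
  using compact_bound[OF ch_cont(2)] by blast
 have m1: "(%(th, s). th * Q th s) \<in> bm (borel *M borel)"
  and m2: "(%(th, s). ch' s * (1/8 * ((1 - th) * Q th s))) \<in> bm (borel *M borel)"
  unfolding split_beta' by measurable
 have b1: "\<bar>th * Q th s\<bar> <= C" if "0 < th" "th < 1" "0 < s" "s < t" for th s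
  using mult_left_le_one_le[of "Q th s" th] that C(2)[of th s] Q_nonneg[of th s] t by (simp add: abs_mult)
 have b2: "\<bar>ch' s * (1/8 * ((1 - th) * Q th s))\<bar> <= D * C" if "0 < th" "th < 1" "0 < s" "s < t" for th s
 proof -
  have "\<bar>1/8 * ((1 - th) * Q th s)\<bar> <= C"
   using mult_left_le_one_le[of "Q th s" "1 - th"] that C(2)[of th s] Q_nonneg[of th s] t by (simp add: abs_mult)
  thus ?thesis using D(1)[of s] that t D(2) unfolding abs_mult[of "ch' s"] by (intro mult_mono) auto
 qed
 have F1: "integrable M (%th. LI s<t. th * Q th s)" "iint t (%s. LI th|M. th * Q th s)"
  "(LI th|M. (LI s<t. th * Q th s)) = (LI s<t. (LI th|M. th * Q th s))"
  by (rule Fubini_bounded[OF al m1], rule b1; assumption)+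
 have F2: "integrable M (%th. LI s<t. ch' s * (1/8 * ((1 - th) * Q th s)))"
  "iint t (%s. LI th|M. ch' s * (1/8 * ((1 - th) * Q th s)))"
  "(LI th|M. (LI s<t. ch' s * (1/8 * ((1 - th) * Q th s)))) = (LI s<t. (LI th|M. ch' s * (1/8 * ((1 - th) * Q th s))))"
  by (rule Fubini_bounded[OF al m2], rule b2; assumption)+
 show I: "iint t SS" using F1(2) by (simp add: SS_def[abs_def])
 have YY_eq: "(LI th|M. ch' s * (1/8 * ((1 - th) * Q th s))) = ch' s * (1/8 * YY s)" for s
  by (simp add: YY_def)
 show "iint t (%s. ch' s * (1/8 * YY s))" using F2(2) unfolding YY_eq .
 have "- (LI s<t. ch s * b (G s)) = (LI th|M. - (LI s<t. ch s * b (G s)))"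
  by (simp only: integral_const_M)
 also have "... <= (LI th|M. 1/4 * ((1 - th) * Q th t)
  + (LI s<t. ch' s * (1/8 * ((1 - th) * Q th s))) + 1/2 * (LI s<t. th * Q th s)
  + (3 + T / 2) * (kb\<^sup>2 / C1))"
  by (rule integral_mono)
   (use F1(1) F2(1) Q_integrable(1)[OF t] bterm_theta t in "auto intro!: integral_const_M Bochner_Integration.integrable_add integrable_mult_right")
 also have "... = 1/4 * YY t
  + (LI s<t. ch' s * (1/8 * YY s)) + 1/2 * (LI s<t. SS s)
  + (3 + T / 2) * (kb\<^sup>2 / C1)"
 proof -
  note q = Q_integrable(1)[OF t]
  have j1: "integrable M (%th. 1/4 * ((1 - th) * Q th t))" by (rule integrable_mult_right) (rule q)
  have j3: "integrable M (%th. 1/2 * (LI s<t. th * Q th s))" by (rule integrable_mult_right) (rule F1(1))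
  note j12 = Bochner_Integration.integrable_add[OF j1 F2(1)]
  note j123 = Bochner_Integration.integrable_add[OF j12 j3]
  let ?a = "%th. 1/4 * ((1 - th) * Q th t)" and ?b = "%th. LI s<t. ch' s * (1/8 * ((1 - th) * Q th s))"
   and ?c = "%th. 1/2 * (LI s<t. th * Q th s)" and ?d = "(3 + T / 2) * (kb\<^sup>2 / C1)"
  have "(LI th|M. ?a th + ?b th + ?c th + ?d) = (LI th|M. ?a th + ?b th + ?c th) + (LI th|M. ?d)"
   by (rule Bochner_Integration.integral_add[OF j123 integral_const_M(1)])
  also have "(LI th|M. ?a th + ?b th + ?c th) = (LI th|M. ?a th + ?b th) + (LI th|M. ?c th)"
   by (rule Bochner_Integration.integral_add[OF j12 j3])
  also have "(LI th|M. ?a th + ?b th) = (LI th|M. ?a th) + (LI th|M. ?b th)"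
   by (rule Bochner_Integration.integral_add[OF j1 F2(1)])
  also have "(LI th|M. ?a th) = 1/4 * YY t" unfolding YY_def by (rule integral_mult_right_zero)
  also have "(LI th|M. ?b th) = (LI s<t. ch' s * (1/8 * YY s))"
   using F2(3) unfolding YY_eq .
  also have "(LI th|M. ?c th) = 1/2 * (LI s<t. SS s)"
   unfolding SS_def by (subst F1(3)[symmetric]) (rule integral_mult_right_zero)
  also have "(LI th|M. ?d) = ?d" by (rule integral_const_M)
  finally show ?thesis .
 qed
 finally show "- (LI s<t. ch s * b (G s)) <= 1/4 * YY t
  + (LI s<t. ch' s * (1/8 * YY s)) + 1/2 * (LI s<t. SS s)
  + (3 + T / 2) * (kb\<^sup>2 / C1)" .
qed

text \<open>Only the integral of \<open>ch'\<close> is under control, so the term with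
  \<open>ch'\<close> is bounded by the supremum \<open>N\<close> of \<open>YY\<close>. It is
  absorbed by evaluating the inequality at all times: \<open>N / 4 <= KK + N / 8\<close>, where
  \<open>N\<close> is finite by \<open>YY_bound\<close>.\<close>

lemma first_estimate:
 shows "t \<in> {0..T} ==> YY t <= 8 * KK" and "(LI s<T. SS s) <= 4 * KK"
  and "(LI s<T. nsq (i (G s))) <= 4 * KK"
proof -
 define N where "N = (SUP s\<in>{0..T}. YY s)"
 obtain C where C: "C \<ge> 0" "!!s. s \<in> {0..T} ==> YY s <= C" using YY_bound by metis
 have bdd: "bdd_above (YY ` {0..T})" by (rule bdd_aboveI[of _ C]) (use C in auto)
 have N: "YY s <= N" if "s \<in> {0..T}" for s unfolding N_def by (rule cSUP_upper[OF that bdd])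
 have N0: "N \<ge> 0" using N[of 0] YY_nonneg[of 0] T by simp
 have est: "1/4 * YY t + 1/2 * (LI s<t. SS s) + 1/2 * (LI s<t. nsq (i (G s)))
   <= KK + N / 8" if t: "t \<in> {0..T}" for t
 proof -
  have "(LI s<t. ch' s * (1/8 * YY s)) <= (LI s<t. ch' s * (1/8 * N))"
  proof (rule set_integral_mono[OF bterm(2)[OF t]])
   show "iint t (%s. ch' s * (1/8 * N))" using integral_ch'(2)[OF t] by simp
   show "ch' s * (1/8 * YY s) <= ch' s * (1/8 * N)" if "s \<in> {0<..<t}" for s
    using that t N[of s] chi(6)[of s] by (intro mult_left_mono) auto
  qed
  also have "... = ch t * (1/8 * N)" using integral_ch'(1)[OF t] by simp
  also have "... <= N / 8" using mult_left_le_one_le[of "1/8 * N" "ch t"] N0 chi(4,5)[OF t] by simp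
  finally show ?thesis using energy1_le[OF t] bterm(1)[OF t] unfolding KK_def by linarith
 qed
 have SS0: "(LI s<t. SS s) \<ge> 0" for t
  unfolding set_int by (rule integral_nonneg_AE) (simp add: SS_nonneg)
 have G0: "(LI s<t. nsq (i (G s))) \<ge> 0" for t
  unfolding set_int by (rule integral_nonneg_AE) simp
 have "YY s <= 4 * KK + N / 2" if "s \<in> {0..T}" for s
  using est[OF that] SS0[of s] G0[of s] by linarith
 hence "N <= 4 * KK + N / 2" unfolding N_def by (intro cSUP_least) (use T in auto)
 hence N8: "N <= 8 * KK" by simp
 show "YY t <= 8 * KK" if "t \<in> {0..T}" using N[OF that] N8 by simp
 have TT: "T \<in> {0..T}" using T by simp
 show "(LI s<T. SS s) <= 4 * KK" "(LI s<T. nsq (i (G s))) <= 4 * KK"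
  using est[OF TT] SS0[of T] G0[of T] N8 YY_nonneg[of T] by linarith+
qed

end

section \<open>Second energy estimate: testing with the time derivative\<close>

context smooth_flow
begin

text \<open>The first summand is the part of \<open>C2 / 2 * nsq (i (U s))\<close> that
  interpolation leaves to the first estimate; the second is the Young constant of the terms with
  \<open>b\<close>.\<close>

definition R where "R = 1/2 * C2 * KI * (ki\<^sup>2 / C1) * (8 * KK) + 4 * kb\<^sup>2 / C1"
definition Z where "Z th s = nsq (i (y th s))"
definition V where "V th s = nsq (i (y' th s))"
definition ZZ where "ZZ s = (LI th|M. th * Z th s)"
definition VV where "VV s = (LI th|M. (1 - th) * V th s)"

lemma ZV_measurable [measurable]: "(%x. Z (fst x) (snd x)) \<in> bm (borel *M borel)"
  "(%x. V (fst x) (snd x)) \<in> bm (borel *M borel)"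
 unfolding Z_def V_def by measurable

lemma ZV_measurable1 [measurable]: "(%th. Z th s) \<in> bm borel" "(%th. V th s) \<in> bm borel"
 unfolding Z_def V_def by measurable

lemma ZV_nonneg: "Z th s \<ge> 0" "V th s \<ge> 0"
 by (simp_all add: Z_def V_def)

lemma ZV_bound:
 obtains C where "C \<ge> 0" "!!th s. [|0 < th; th < 1; s \<in> {0..T}|] ==> Z th s <= C"
  "!!th s. [|0 < th; th < 1; s \<in> {0..T}|] ==> V th s <= C"
  "!!th s. [|0 < th; th < 1; s \<in> {0..T}|] ==> \<bar>inner (i (G s)) (i (y' th s))\<bar> <= C"
proof -
 obtain C where C: "C \<ge> 0" "!!th s. [|0 < th; th < 1; s \<in> {0..T}|] ==> norm (y th s) <= C"
  "!!th s. [|0 < th; th < 1; s \<in> {0..T}|] ==> norm (y' th s) <= C"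
  "!!s. s \<in> {0..T} ==> norm (G s) <= C" using y_bounds by metis
 have ib: "norm (i v) <= ki * C" if "norm v <= C" for v
  using ki(1)[of v] mult_left_mono[OF that ki(2)] by linarith
 have kC: "0 <= ki * C" using ki C by simp
 show ?thesis
 proof (rule that[of "(ki * C)\<^sup>2"])
  fix th s :: real assume th: "0 < th" "th < 1" "s \<in> {0..T}"
  show "Z th s <= (ki * C)\<^sup>2" "V th s <= (ki * C)\<^sup>2"
   unfolding Z_def V_def using ib[OF C(2)[OF th]] ib[OF C(3)[OF th]] by (auto intro!: power_mono)
  show "\<bar>inner (i (G s)) (i (y' th s))\<bar> <= (ki * C)\<^sup>2"
   unfolding power2_eq_square using ib[OF C(4)[OF th(3)]] ib[OF C(3)[OF th]] kC
   by (intro order_trans[OF Cauchy_Schwarz_ineq2] mult_mono) auto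
 qed simp
qed

lemma weighted_integrable:
 assumes [measurable]: "f \<in> bm borel" and f: "!!th. [|0 < th; th < 1|] ==> f th <= C" "!!th. f th \<ge> (0 :: real)"
 shows "integrable M f" "integrable M (%th. th * f th)" "integrable M (%th. (1 - th) * f th)"
proof -
 have le: "c * f th <= C" if "0 <= c" "c <= 1" "0 < th" "th < 1" for c th
  using mult_left_le_one_le[of "f th" c] that f(1)[OF that(3,4)] f(2)[of th] by linarith
 show "integrable M (%th. th * f th)" "integrable M (%th. (1 - th) * f th)" "integrable M f"
  by (rule Mw_bounded_integrable[OF al, where C=C], rule bm_weighted; use le f in "simp add: abs_mult")+
qed

lemma ZV_integrable:
 assumes s: "s \<in> {0..T}"
 shows "integrable M (%th. Z th s)" "integrable M (%th. th * Z th s)" "integrable M (%th. (1 - th) * Z th s)"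
  "integrable M (%th. V th s)" "integrable M (%th. (1 - th) * V th s)"
proof -
 obtain C where C: "!!th s. [|0 < th; th < 1; s \<in> {0..T}|] ==> Z th s <= C"
  "!!th s. [|0 < th; th < 1; s \<in> {0..T}|] ==> V th s <= C" using ZV_bound by metis
 show "integrable M (%th. Z th s)" "integrable M (%th. th * Z th s)" "integrable M (%th. (1 - th) * Z th s)"
  by (rule weighted_integrable[where C=C]; use C s ZV_nonneg in simp)+
 show "integrable M (%th. V th s)" "integrable M (%th. (1 - th) * V th s)"
  by (rule weighted_integrable[where C=C]; use C s ZV_nonneg in simp)+
qed

text \<open>The extended equation tested with \<open>y'\<close> in the inner product of
  \<open>H\<close>: now the term with weight \<open>th\<close> is the exact derivative and the one
  with weight \<open>1 - th\<close> is the dissipation.\<close>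

lemma energy2_theta:
 assumes th: "0 < th" "th < 1" and t: "t \<in> {0..T}"
 shows "1/2 * (th * Z th t) + (LI s<t. (1 - th) * V th s) = (LI s<t. inner (i (G s)) (i (y' th s)))"
proof -
 note il = linear_simps[OF i]
 let ?f = "%s. inner (i (G s)) (i (y' th s)) - (1 - th) * V th s"
 have ci: "continuous_on {0..T} (%s. i (y' th s))" by (rule bounded_linear.continuous_on[OF i y'_cont[OF th]])
 have c1: "continuous_on {0..T} (%s. inner (i (G s)) (i (y' th s)))" and c2: "continuous_on {0..T} (%s. (1 - th) * V th s)"
  unfolding V_def by (intro continuous_intros ci iG_cont)+
 have der: "((%s. 1/2 * (th * Z th s)) has_vector_derivative ?f s) (at s within {0..T})" if s: "s \<in> {0..T}" for s
 proof -
  have d: "((%s. i (y th s)) has_vector_derivative i (y' th s)) (at s within {0..T})"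
   by (rule bounded_linear.has_vector_derivative[OF i y_deriv[OF th s]])
  have "(Z th has_vector_derivative inner (i (y th s)) (i (y' th s)) + inner (i (y' th s)) (i (y th s))) (at s within {0..T})"
   unfolding Z_def[abs_def] power2_norm_eq_inner by (rule bounded_bilinear.has_vector_derivative[OF bounded_bilinear_inner d d])
  hence "((%s. (1/2 * th) *R Z th s) has_vector_derivative (1/2 * th) *R (inner (i (y th s)) (i (y' th s)) + inner (i (y' th s)) (i (y th s)))) (at s within {0..T})"
   by (rule bounded_linear.has_vector_derivative[OF bounded_linear_scaleR_right])
  moreover have "(1/2 * th) *R (inner (i (y th s)) (i (y' th s)) + inner (i (y' th s)) (i (y th s))) = ?f s"
  proof -
   have "i (G s) - th *R i (y th s) = (1 - th) *R i (y' th s)"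
    using arg_cong[OF y_ode[OF th s], of i] by (simp add: il)
   hence "inner (i (G s) - th *R i (y th s)) (i (y' th s)) = (1 - th) * V th s"
    by (simp add: V_def power2_norm_eq_inner)
   hence "inner (i (G s)) (i (y' th s)) - th * inner (i (y th s)) (i (y' th s)) = (1 - th) * V th s"
    unfolding inner_diff_left inner_scaleR_left .
   thus ?thesis by (simp add: inner_commute[of "i (y' th s)"])
  qed
  ultimately show ?thesis by (simp only: real_scaleR_def mult.assoc)
 qed
 have "(LI s<t. ?f s) = 1/2 * (th * Z th t) - 1/2 * (th * Z th 0)"
  by (rule FTC_within(2)[OF _ _ der continuous_on_diff[OF c1 c2]]) (use t in auto)
 moreover have "Z th 0 = 0" by (simp add: Z_def il)
 moreover have "(LI s<t. ?f s) = (LI s<t. inner (i (G s)) (i (y' th s))) - (LI s<t. (1 - th) * V th s)"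
  by (rule set_integral_diff(2)) (use t in "auto intro!: iint_continuous[OF c1] iint_continuous[OF c2]")
 ultimately show ?thesis by simp
qed

lemma energy2:
 assumes t: "t \<in> {0..T}"
 shows "1/2 * ZZ t + (LI s<t. VV s) = (LI s<t. inner (i (G s)) (i (U' s)))"
  and "iint t VV"
proof -
 obtain C where C: "C \<ge> 0"
  "!!th s. [|0 < th; th < 1; s \<in> {0..T}|] ==> V th s <= C"
  "!!th s. [|0 < th; th < 1; s \<in> {0..T}|] ==> \<bar>inner (i (G s)) (i (y' th s))\<bar> <= C" using ZV_bound by metis
 have m1: "(%(th, s). (1 - th) * V th s) \<in> bm (borel *M borel)"
  and m2: "(%(th, s). inner (i (G s)) (i (y' th s))) \<in> bm (borel *M borel)"
  unfolding split_beta' by measurable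
 have b1: "\<bar>(1 - th) * V th s\<bar> <= C" if "0 < th" "th < 1" "0 < s" "s < t" for th s
  using mult_left_le_one_le[of "V th s" "1 - th"] that C(2)[of th s] ZV_nonneg[of th s] t by (simp add: abs_mult)
 have b2: "\<bar>inner (i (G s)) (i (y' th s))\<bar> <= C" if "0 < th" "th < 1" "0 < s" "s < t" for th s
  using C(3) that t by auto
 have F1: "integrable M (%th. LI s<t. (1 - th) * V th s)" "iint t (%s. LI th|M. (1 - th) * V th s)"
  "(LI th|M. (LI s<t. (1 - th) * V th s)) = (LI s<t. (LI th|M. (1 - th) * V th s))"
  by (rule Fubini_bounded[OF al m1], rule b1; assumption)+
 have F2: "(LI th|M. (LI s<t. inner (i (G s)) (i (y' th s)))) = (LI s<t. (LI th|M. inner (i (G s)) (i (y' th s))))"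
  by (rule Fubini_bounded[OF al m2], rule b2; assumption)+
 show "iint t VV" using F1(2) by (simp add: VV_def[abs_def])
 have j: "integrable M (%th. 1/2 * (th * Z th t))" by (rule integrable_mult_right) (rule ZV_integrable[OF t])
 have "1/2 * ZZ t + (LI s<t. VV s)
  = (LI th|M. 1/2 * (th * Z th t)) + (LI th|M. (LI s<t. (1 - th) * V th s))"
  unfolding ZZ_def VV_def F1(3) by (simp only: integral_mult_right_zero)
 also have "... = (LI th|M. 1/2 * (th * Z th t) + (LI s<t. (1 - th) * V th s))"
  by (rule Bochner_Integration.integral_add[OF j F1(1), symmetric])
 also have "... = (LI th|M. (LI s<t. inner (i (G s)) (i (y' th s))))"
  by (rule LI_cong[OF refl]) (use energy2_theta t in auto)
 also have "... = (LI s<t. inner (i (G s)) (i (U' s)))"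
  unfolding F2
 proof (rule set_lebesgue_integral_cong)
  have L: "bounded_linear (%v. inner (i (G s)) (i v))" for s
   by (rule bounded_linear_compose[OF bounded_linear_inner_right i])
  show "\<forall>s. s \<in> {0<..<t} \<longrightarrow> (LI th|M. inner (i (G s)) (i (y' th s))) = inner (i (G s)) (i (U' s))"
   using integral_bounded_linear[OF L integral_y(3)] integral_y(4) t by auto
 qed simp
 finally show "1/2 * ZZ t + (LI s<t. VV s) = (LI s<t. inner (i (G s)) (i (U' s)))" .
qed

text \<open>Testing with \<open>U'\<close> makes the gradient term the exact derivative of the
  energy along the flow, up to the term with \<open>ch'\<close>, which is there because the linear
  part of the energy depends on time.\<close>

lemma energy2_rhs:
 assumes t: "t \<in> {0..T}"
 shows "(LI s<t. inner (i (G s)) (i (U' s))) = (LI s<t. ch' s * b (U s)) - (1/2 * A (U t) (U t) + ch t * b (U t))"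
proof -
 interpret A: bounded_bilinear A by (rule A)
 let ?P = "%s. 1/2 * A (U s) (U s) + ch s * b (U s)"
 let ?f = "%s. ch' s * b (U s) - inner (i (G s)) (i (U' s))"
 have c1: "continuous_on {0..T} (%s. ch' s * b (U s))" and c2: "continuous_on {0..T} (%s. inner (i (G s)) (i (U' s)))"
  by (intro continuous_intros b_cont U_cont ch_cont iG_cont)+
 have der: "(?P has_vector_derivative ?f s) (at s within {0..T})" if s: "s \<in> {0..T}" for s
 proof -
  have 1: "(ch has_vector_derivative ch' s) (at s within {0..T})"
   using chi(1)[of s] unfolding has_real_derivative_iff_has_vector_derivative by (rule has_vector_derivative_at_within)
  have 2: "((%s. b (U s)) has_vector_derivative b (U' s)) (at s within {0..T})"
   by (rule bounded_linear.has_vector_derivative[OF b U_deriv[OF s]])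
  have 3: "((%s. A (U s) (U s)) has_vector_derivative A (U s) (U' s) + A (U' s) (U s)) (at s within {0..T})"
   by (rule A.has_vector_derivative[OF U_deriv[OF s] U_deriv[OF s]])
  have "(?P has_vector_derivative 1/2 * (A (U s) (U' s) + A (U' s) (U s)) + (ch s * b (U' s) + ch' s * b (U s))) (at s within {0..T})"
   by (rule has_vector_derivative_add[OF bounded_linear.has_vector_derivative[OF bounded_linear_mult_right 3] has_vector_derivative_mult[OF 1 2]])
  moreover have "1/2 * (A (U s) (U' s) + A (U' s) (U s)) + (ch s * b (U' s) + ch' s * b (U s)) = ?f s"
   using eq[OF s, of "U' s"] A_sym[of "U' s" "U s"] by simp
  ultimately show ?thesis by (simp only:)
 qed
 have "(LI s<t. ?f s) = ?P t - ?P 0"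
  by (rule FTC_within(2)[OF _ _ der continuous_on_diff[OF c1 c2]]) (use t in auto)
 moreover have "U 0 = 0" using U_eq[of 0] T by simp
 hence "?P 0 = 0" using chi(3) by (simp add: A.zero_left)
 moreover have "(LI s<t. ?f s) = (LI s<t. ch' s * b (U s)) - (LI s<t. inner (i (G s)) (i (U' s)))"
  by (rule set_integral_diff(2)) (use t in "auto intro!: iint_continuous[OF c1] iint_continuous[OF c2]")
 ultimately show ?thesis by linarith
qed

text \<open>The energy bounds the norm of \<open>U\<close> only up to \<open>C2\<close> times the
  norm in \<open>H\<close>. That norm is interpolated between the quantity \<open>ZZ\<close>, which
  is on the left-hand side already, and \<open>YY\<close>, which the first estimate bounds. The
  terms with \<open>b\<close> are absorbed by the maximum of \<open>norm (U t)\<close>.\<close>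

lemma second_estimate:
 assumes "t \<in> {0..T}"
 shows "ZZ t <= 8 * R" "nsq (U t) <= 4 * R / C1"
  and "(LI s<T. VV s) <= 2 * R"
proof -
 have c: "continuous_on {0..T} (%s. norm (U s))" by (intro continuous_intros U_cont)
 \<comment> \<open>At this maximum point the inequality below reads
   \<open>1/2 * C1 * N\<^sup>2 <= R + 1/4 * C1 * N\<^sup>2\<close> after dropping nonnegative
   terms.\<close>
 obtain t0 where t0: "t0 \<in> {0..T}" "!!s. s \<in> {0..T} ==> norm (U s) <= norm (U t0)"
  using continuous_attains_sup[OF _ _ c] T by auto
 define N where "N = norm (U t0)"
 have N: "norm (U s) <= N" if "s \<in> {0..T}" for s using t0(2)[OF that] by (simp add: N_def)
 have KK0: "KK \<ge> 0" using first_estimate(1)[of 0] YY_nonneg[of 0] T by simp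
 have VV0: "VV s \<ge> 0" for s unfolding VV_def by (auto intro!: integral_nonneg_AE AE_I2 mult_nonneg_nonneg ZV_nonneg)
 have ZZ0: "ZZ s \<ge> 0" for s unfolding ZZ_def by (auto intro!: integral_nonneg_AE AE_I2 mult_nonneg_nonneg ZV_nonneg)
 have est: "1/4 * ZZ s + (LI s<s. VV s) + 1/2 * C1 * nsq (U s) <= R + 1/4 * C1 * N\<^sup>2"
  if s: "s \<in> {0..T}" for s
 proof -
  have bound: "\<bar>b (U r)\<bar> <= kb * N" if "r \<in> {0..T}" for r
   using kb(1)[of "U r"] mult_left_mono[OF N[OF that] kb(2)] by linarith
  have kN: "0 <= kb * N" using kb(2) by (simp add: N_def)
  have "(LI r<s. ch' r * b (U r)) <= (LI r<s. ch' r * (kb * N))"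
  proof (rule set_integral_mono)
   show "iint s (%r. ch' r * b (U r))"
    by (rule iint_continuous[of T]) (use s in "auto intro!: continuous_intros ch_cont b_cont U_cont")
   show "iint s (%r. ch' r * (kb * N))" using integral_ch'(2)[OF s] by simp
   show "ch' r * b (U r) <= ch' r * (kb * N)" if "r \<in> {0<..<s}" for r
    using bound[of r] chi(6)[of r] that s by (intro mult_left_mono) auto
  qed
  also have "... = ch s * (kb * N)" using integral_ch'(1)[OF s] by simp
  also have "... <= kb * N" using mult_left_le_one_le[OF kN chi(4,5)[OF s]] .
  finally have 1: "(LI r<s. ch' r * b (U r)) <= kb * N" .
  have 2: "- (ch s * b (U s)) <= kb * N"
   using mult_left_le_one_le[OF _ chi(4,5)[OF s], of "\<bar>b (U s)\<bar>"] bound[OF s] chi(4)[OF s]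
    abs_ge_minus_self[of "ch s * b (U s)"] by (simp add: abs_mult)
  \<comment> \<open>\<open>U s\<close> is the average of \<open>y th s\<close>, so the interpolation
    inequality applies; the coercivity of \<open>B\<close> converts its second term into
    \<open>YY\<close>.\<close>
  have 3: "1/2 * C2 * nsq (i (U s)) <= 1/4 * ZZ s + (R - 4 * kb\<^sup>2 / C1)"
  proof -
   have "i (U s) = (LI th|M. i (y th s))"
    using integral_bounded_linear[OF i integral_y(1)[OF s]] integral_y(2)[OF s] by simp
   moreover have "nsq (LI th|M. i (y th s)) <= 1 / (2 * C2) * (LI x|M. x * nsq (i (y x s))) + KI * (LI x|M. (1 - x) * nsq (i (y x s)))"
   proof (rule KI(2))
    show "(%th. i (y th s)) \<in> bm M" by (rule bm_weighted) measurable
    show "integrable M (%x. nsq (i (y x s)))" using ZV_integrable(1)[OF s] by (simp add: Z_def)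
   qed
   ultimately have "nsq (i (U s)) <= 1 / (2 * C2) * ZZ s + KI * (LI th|M. (1 - th) * Z th s)"
    by (simp add: ZZ_def Z_def)
   also have "(LI th|M. (1 - th) * Z th s) <= (LI th|M. ki\<^sup>2 / C1 * ((1 - th) * Q th s))"
   proof (rule integral_mono[OF ZV_integrable(3)[OF s] integrable_mult_right])
    show "integrable M (%th. (1 - th) * Q th s)" by (rule Q_integrable(1)[OF s])
    fix th assume "th \<in> space M"
    hence th: "th < 1" by simp
    have "Z th s <= (ki * norm (y th s))\<^sup>2" unfolding Z_def by (intro power_mono ki) simp
    also have "... <= ki\<^sup>2 / C1 * Q th s"
    proof -
     have "ki\<^sup>2 * (C1 * nsq (y th s)) <= ki\<^sup>2 * Q th s" unfolding Q_def by (intro mult_left_mono B_coercive) simp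
     thus ?thesis using C1 by (simp add: power_mult_distrib field_simps)
    qed
    finally have "(1 - th) * Z th s <= (1 - th) * (ki\<^sup>2 / C1 * Q th s)" using th by (intro mult_left_mono) auto
    thus "(1 - th) * Z th s <= ki\<^sup>2 / C1 * ((1 - th) * Q th s)" by (simp add: ac_simps)
   qed
   also have "... = ki\<^sup>2 / C1 * YY s" unfolding YY_def by (rule integral_mult_right_zero)
   also have "... <= ki\<^sup>2 / C1 * (8 * KK)" using C1 by (intro mult_left_mono first_estimate(1)[OF s]) simp
   finally have "nsq (i (U s)) <= 1 / (2 * C2) * ZZ s + KI * (ki\<^sup>2 / C1 * (8 * KK))"
    using KI(1) by (simp add: mult_left_mono)
   hence "C2 / 2 * nsq (i (U s)) <= C2 / 2 * (1 / (2 * C2) * ZZ s + KI * (ki\<^sup>2 / C1 * (8 * KK)))"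
    using C2 by (intro mult_left_mono) auto
   also have "... = 1/4 * ZZ s + (R - 4 * kb\<^sup>2 / C1)"
    using C2 by (simp add: R_def field_simps)
   finally show ?thesis by simp
  qed
  have 4: "2 * (kb * N) <= 1/4 * C1 * N\<^sup>2 + 4 * kb\<^sup>2 / C1"
  proof -
   have "0 <= (C1 * N - 4 * kb)\<^sup>2" by simp
   hence "C1 * (8 * (kb * N)) <= C1 * (C1 * N\<^sup>2) + 16 * kb\<^sup>2" by (simp add: power2_eq_square algebra_simps)
   thus ?thesis using C1 by (simp add: field_simps power2_eq_square)
  qed
  have 5: "A (U s) (U s) \<ge> C1 * nsq (U s) - C2 * nsq (i (U s))" by (rule coercive)
  show ?thesis using energy2(1)[OF s] energy2_rhs[OF s] 1 2 3 4 5 by simp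
 qed
 have VVi: "(LI r<s. VV r) \<ge> 0" for s
  unfolding set_int by (rule integral_nonneg_AE) (simp add: VV0)
 have N2: "1/4 * C1 * N\<^sup>2 <= R"
  using est[OF t0(1)] VVi[of t0] ZZ0[of t0] unfolding N_def by linarith
 have U0: "0 <= 1/2 * C1 * nsq (U s)" for s using C1 by simp
 show "ZZ t <= 8 * R" using est[OF assms] VVi[of t] N2 U0[of t] by linarith
 have "1/2 * C1 * nsq (U t) <= 2 * R" using est[OF assms] VVi[of t] N2 ZZ0[of t] by linarith
 thus "nsq (U t) <= 4 * R / C1" using C1 by (simp add: field_simps)
 have TT: "T \<in> {0..T}" using T by simp
 show "(LI s<T. VV s) <= 2 * R" using est[OF TT] N2 ZZ0[of T] U0[of T] by linarith
qed

end

section \<open>Mollification in time\<close>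

lemma rho_measurable [measurable]: "rho m \<in> bm borel" "rho1 m \<in> bm borel" "rho2 m \<in> bm borel"
 by (intro borel_measurable_continuous_onI rho_continuous)+

lemma rho_iint: "iint t (rho m)" "iint t (rho1 m)" "iint t (rho2 m)"
 by (rule iint_continuous[of t, OF _ order_refl], rule continuous_on_subset[OF rho_continuous(1)], simp)
  (rule iint_continuous[of t, OF _ order_refl], rule continuous_on_subset[OF rho_continuous(2)], simp,
   rule iint_continuous[of t, OF _ order_refl], rule continuous_on_subset[OF rho_continuous(3)], simp)

lemma iint_conv_continuous:
 assumes "continuous_on UNIV k" "iint t f"
 shows "iint t (%s. k (t - s) *R f s)"
proof -
 obtain C where "!!s. [|0 < s; s < t|] ==> \<bar>k s\<bar> <= C" using continuous_bounded_on[OF assms(1)] by metis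
 thus ?thesis
  by (intro iint_conv_bounded[where C=C]) (use assms borel_measurable_continuous_onI in auto)
qed

lemma conv_diff_right:
 assumes "iint t (%s. k (t - s) *R f s)" "iint t (%s. k (t - s) *R g s)"
 shows "conv k (%s. f s - g s) t = conv k f t - conv k g t"
 using set_integral_diff(2)[OF assms] by (simp add: conv_def scaleR_diff_right)

lemma conv_add_right:
 assumes "iint t (%s. k (t - s) *R f s)" "iint t (%s. k (t - s) *R g s)"
 shows "conv k (%s. f s + g s) t = conv k f t + conv k g t"
 using set_integral_add(2)[OF assms] by (simp add: conv_def scaleR_add_right)

text \<open>The mollification error in the space of integrable functions. The index
  \<open>Suc n\<close> keeps the parameter of \<open>rho\<close> positive.\<close>

definition moll_err :: "real => nat => (real => 'b::{banach, second_countable_topology}) => real" where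
 "moll_err T n f = (LI t<T. norm (conv (rho (real (Suc n))) f t - f t))"

lemma moll_integrable:
 assumes f: "iint T f"
 shows "iint T (conv (rho m) f)" "iint T (%t. norm (conv (rho m) f t - f t))"
  and "m > 0 ==> T \<ge> 0 ==> (LI t<T. norm (conv (rho m) f t)) <= (LI t<T. norm (f t))"
proof -
 show I: "iint T (conv (rho m) f)" by (rule conv_integrable(1)[OF rho_iint(1) f])
 show "iint T (%t. norm (conv (rho m) f t - f t))"
  by (rule set_integrable_norm[OF set_integral_diff(1)[OF I f]])
 assume m: "m > 0" and T: "T \<ge> 0"
 have "(LI t<T. \<bar>rho m t\<bar>) = prim (rho m) T"
  unfolding conv_one using rho_nonneg[OF m] by simp
 also have "... <= 1" using chi_bounds by (simp add: conv_one_rho[OF T])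
 finally have 1: "(LI t<T. \<bar>rho m t\<bar>) <= 1" .
 have "0 <= (LI t<T. norm (f t))"
  unfolding set_int by (rule integral_nonneg_AE) simp
 with mult_right_mono[OF 1 this] conv_integrable(3)[OF rho_iint(1)[of T m] f]
 show "(LI t<T. norm (conv (rho m) f t)) <= (LI t<T. norm (f t))" by simp
qed

lemma moll_err_nonneg: "moll_err T n f \<ge> 0"
 unfolding moll_err_def set_int by (rule integral_nonneg_AE) simp

lemma moll_err_add:
 assumes f: "iint T f" and g: "iint T g"
 shows "moll_err T n (%t. f t + g t) <= moll_err T n f + moll_err T n g"
proof -
 note fg = moll_integrable(2)[OF f, of "real (Suc n)"] moll_integrable(2)[OF g, of "real (Suc n)"]
 have I: "iint t (%s. rho m (t - s) *R f s)" "iint t (%s. rho m (t - s) *R g s)" if "t < T" for t m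
  using that by (auto intro!: iint_conv_continuous rho_continuous iint_mono[OF f] iint_mono[OF g])
 show "moll_err T n (%t. f t + g t) <= moll_err T n f + moll_err T n g"
  unfolding moll_err_def set_integral_add(2)[OF fg, symmetric]
 proof (rule set_integral_mono)
  show "iint T (%t. norm (conv (rho (real (Suc n))) (%t. f t + g t) t - (f t + g t)))"
   by (rule moll_integrable(2)) (rule set_integral_add(1)[OF f g])
  fix t assume t: "t \<in> {0<..<T}"
  have "conv (rho (real (Suc n))) (%t. f t + g t) t - (f t + g t) = (conv (rho (real (Suc n))) f t - f t) + (conv (rho (real (Suc n))) g t - g t)"
   using t I by (subst conv_add_right) auto
  thus "norm (conv (rho (real (Suc n))) (%t. f t + g t) t - (f t + g t)) <= norm (conv (rho (real (Suc n))) f t - f t) + norm (conv (rho (real (Suc n))) g t - g t)"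
   by (simp only: norm_triangle_ineq)
 qed (rule set_integral_add(1)[OF fg])
qed

lemma moll_err_minus: "moll_err T n (%t. - f t) = moll_err T n f"
 by (simp add: moll_err_def conv_def set_int norm_minus_commute)

text \<open>The bound does not depend on \<open>n\<close>, which is what lets convergence of the
  error pass to limits of integrable functions in \<open>moll_err_lim\<close>.\<close>

lemma moll_err_le:
 assumes f: "iint T f" and T: "T \<ge> 0"
 shows "moll_err T n f <= 2 * (LI t<T. norm (f t))"
proof -
 note I = moll_integrable(1)[OF f, of "real (Suc n)"]
 have "moll_err T n f <= (LI t<T. norm (conv (rho (real (Suc n))) f t) + norm (f t))"
  unfolding moll_err_def
  by (rule set_integral_mono[OF moll_integrable(2)[OF f] set_integral_add(1)[OF set_integrable_norm[OF I] set_integrable_norm[OF f]]])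
   (rule norm_triangle_ineq4)
 also have "... = (LI t<T. norm (conv (rho (real (Suc n))) f t)) + (LI t<T. norm (f t))"
  by (rule set_integral_add(2)[OF set_integrable_norm[OF I] set_integrable_norm[OF f]])
 also have "... <= 2 * (LI t<T. norm (f t))" using moll_integrable(3)[OF f, of "real (Suc n)"] T by simp
 finally show ?thesis .
qed

lemma moll_err_lim:
 assumes T: "T \<ge> 0" and s: "!!i. iint T (s i)" "!!i. (%n. moll_err T n (s i)) ----> 0"
  and f: "iint T f" and lim: "(%i. (LI t<T. norm (f t - s i t))) ----> 0"
 shows "(%n. moll_err T n f) ----> 0"
proof (rule LIMSEQ_I)
 fix e :: real assume e: "e > 0"
 have "eventually (%i. (LI t<T. norm (f t - s i t)) < e / 4) sequentially"
  using e by (intro order_tendstoD(2)[OF lim]) simp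
 then obtain i where i: "(LI t<T. norm (f t - s i t)) < e / 4" by (auto simp: eventually_sequentially)
 have "eventually (%n. moll_err T n (s i) < e / 2) sequentially"
  using e by (intro order_tendstoD(2)[OF s(2)]) simp
 then obtain n0 where n0: "!!n. n \<ge> n0 ==> moll_err T n (s i) < e / 2" by (auto simp: eventually_sequentially)
 show "\<exists>no. \<forall>n\<ge>no. norm (moll_err T n f - 0) < e"
 proof (intro exI allI impI)
  fix n assume n: "n \<ge> n0"
  have d: "iint T (%t. f t - s i t)" by (rule set_integral_diff(1)[OF f s(1)])
  have "moll_err T n f = moll_err T n (%t. (f t - s i t) + s i t)" by simp
  also have "... <= moll_err T n (%t. f t - s i t) + moll_err T n (s i)" by (rule moll_err_add[OF d s(1)])
  also have "... < e" using moll_err_le[OF d T, of n] i n0[OF n] by simp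
  finally show "norm (moll_err T n f - 0) < e" using moll_err_nonneg[of T n f] by simp
 qed
qed

lemma conv_rho_greaterThan:
 assumes "t > 0"
 shows "conv (rho m) (indicator {a<..}) t = (if t > max a 0 then chi m (t - max a 0) else 0)"
proof -
 have "conv (rho m) (indicator {a<..}) t = conv (indicator {a<..}) (rho m) t" by (rule conv_commute)
 also have "... = (LI s<t - max a 0. rho m s)"
  unfolding conv_def set_int
  by (rule LI_cong) (auto simp: indicator_def max_def)
 also have "... = (if t > max a 0 then chi m (t - max a 0) else 0)"
 proof (cases "t > max a 0")
  case True
  thus ?thesis using conv_one_rho[of "t - max a 0" m] by (simp add: conv_one)
 next
  case False
  hence "{0<..<t - max a 0} = {}" by auto
  hence "(LI s<t - max a 0. rho m s) = 0" by (simp add: set_int)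
  with False show ?thesis by (simp only: if_False)
 qed
 finally show ?thesis .
qed

lemma iint_indicator: "A \<in> sets borel ==> iint T (indicator A :: real => real)"
 by (rule iint_bounded[where C=1]) auto

text \<open>On half-lines the mollified indicator is explicit, and half-lines form an
  intersection-stable generator of the Borel sets. A Dynkin argument does the rest: complements by
  subtraction from the constant 1, disjoint unions by finite sums and
  \<open>moll_err_lim\<close>.\<close>

lemma moll_err_indicator:
 assumes T: "T \<ge> 0" and A: "A \<in> sets borel"
 shows "(%n. moll_err T n (indicator A :: real => real)) ----> 0"
proof -
 let ?e = "%n A. moll_err T n (indicator A :: real => real)"
 have gt: "(%n. ?e n {a<..}) ----> 0" for a
 proof -
  let ?d = "%n t. conv (rho (real (Suc n))) (indicator {a<..}) t - indicator {a<..} t :: real"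
  have "(%n. LI t|lborel. indicator {0<..<T} t *R norm (?d n t))
    ----> (LI t|(lborel :: real measure). 0)"
  proof (rule integral_dominated_convergence)
   show "integrable lborel (%t. indicator {0<..<T} t *R (2 :: real))"
    using iint_bounded[of "%_. 2::real" T 2] by (simp add: set_integrable_def)
   show "AE t in lborel. (%n. indicator {0<..<T} t *R norm (?d n t)) ----> 0"
    using AE_lborel_singleton[of a]
   proof eventually_elim
    case (elim t)
    show ?case
    proof (cases "t \<in> {0<..<T}")
     case True
     hence t: "t > 0" by simp
     have "(%n. conv (rho (real (Suc n))) (indicator {a<..}) t :: real) ----> indicator {a<..} t"
     proof (cases "t > a")
      case True
      thus ?thesis using chi_tendsto[of "t - max a 0"] t by (simp add: conv_rho_greaterThan[OF t])
     qed (use t in "simp add: conv_rho_greaterThan[OF t]")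
     hence "(%n. norm (?d n t)) ----> 0"
      using LIM_zero tendsto_norm_zero by blast
     thus ?thesis using True by simp
    qed simp
   qed
   show "AE t in lborel. norm (indicator {0<..<T} t *R norm (?d n t)) <= indicator {0<..<T} t *R 2" for n
   proof (rule AE_I2)
    fix t
    have "norm (?d n t) <= 2" if "t > 0"
    proof -
     have "\<bar>conv (rho (real (Suc n))) (indicator {a<..}) t :: real\<bar> <= 1"
      unfolding conv_rho_greaterThan[OF that] using chi_bounds[of "real (Suc n)" "t - max a 0"] by auto
     moreover have "\<bar>indicator {a<..} t :: real\<bar> <= 1" by (simp add: indicator_def)
     ultimately show ?thesis unfolding real_norm_def by linarith
    qed
    thus "norm (indicator {0<..<T} t *R norm (?d n t)) <= indicator {0<..<T} t *R 2"
     by (auto simp: indicator_def)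
   qed
  qed measurable
  thus ?thesis by (simp add: moll_err_def set_int)
 qed
 have eq0: "moll_err T n f = moll_err T n g" if "!!t. [|0 < t; t < T|] ==> f t = g t" for f g :: "real => real" and n
  unfolding moll_err_def
 proof (rule set_lebesgue_integral_cong)
  show "\<forall>t. t \<in> {0<..<T} \<longrightarrow> norm (conv (rho (real (Suc n))) f t - f t) = norm (conv (rho (real (Suc n))) g t - g t)"
   using that conv_cong[of _ "rho (real (Suc n))" "rho (real (Suc n))" f g] by auto
 qed simp
 \<comment> \<open>On \<open>(0, T)\<close> the constant 1 is the indicator of a half-line that
   starts before 0.\<close>
 have one: "(%n. moll_err T n (%_. 1 :: real)) ----> 0"
 proof -
  have "moll_err T n (%_. 1 :: real) = ?e n {-1<..}" for n
   by (rule eq0) auto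
  thus ?thesis using gt[of "-1"] by simp
 qed
 have S: "sets (borel :: real measure) = sigma_sets UNIV (range greaterThan)"
  by (subst borel_Ioi) (rule sets_measure_of, simp)
 show ?thesis
 proof (rule sigma_sets_induct_disjoint[of "range greaterThan" UNIV A "%A. (%n. ?e n A) ----> 0"])
  show "Int_stable (range greaterThan :: real set set)"
  proof (rule Int_stableI)
   fix a b :: "real set" assume "a \<in> range greaterThan" "b \<in> range greaterThan"
   then obtain x y where "a = {x<..}" "b = {y<..}" by auto
   hence "a \<inter> b = {max x y<..}" by auto
   thus "a \<inter> b \<in> range greaterThan" by auto
  qed
  show "A \<in> sigma_sets UNIV (range greaterThan)" using A S by simp
  show "(%n. ?e n A) ----> 0" if "A \<in> range greaterThan" for A
   using that gt by auto
  show "(%n. ?e n {}) ----> 0"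
   by (simp add: moll_err_def conv_def set_int)
  show "(%n. ?e n (UNIV - A)) ----> 0"
   if A: "A \<in> sigma_sets UNIV (range greaterThan)" "(%n. ?e n A) ----> 0" for A
  proof (rule tendsto_sandwich[OF _ _ tendsto_const])
   have "A \<in> sets borel" using A S by simp
   hence nI: "iint T (%t. - indicator A t :: real)" by (intro iint_bounded[where C=1]) auto
   show "\<forall>\<^sub>F n in sequentially. ?e n (UNIV - A) <= moll_err T n (%_. 1 :: real) + ?e n A"
   proof (rule always_eventually, rule allI)
    fix n
    have "(indicator (UNIV - A) :: real => real) = (%t. 1 - indicator A t)" by (auto simp: indicator_def fun_eq_iff)
    thus "?e n (UNIV - A) <= moll_err T n (%_. 1 :: real) + ?e n A"
     using moll_err_add[OF iint_bounded[of "%_. 1::real" T 1] nI, of n] by (simp add: moll_err_minus)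
   qed
   show "(%n. moll_err T n (%_. 1 :: real) + ?e n A) ----> 0"
    using tendsto_add[OF one A(2)] by simp
  qed (simp add: moll_err_nonneg)
  fix F :: "nat => real set"
  assume disj: "disjoint_family F" and F: "range F \<subseteq> sigma_sets UNIV (range greaterThan)"
   and P: "!!i. (%n. ?e n (F i)) ----> 0"
  have Fb: "F i \<in> sets borel" for i using F S by auto
  define G where "G m = (\<Union>i<m. F i)" for m
  have Gb: "G m \<in> sets borel" for m using Fb by (auto simp: G_def)
  have Ub: "(\<Union>i. F i) \<in> sets borel" using Fb by auto
  have PG: "(%n. ?e n (G m)) ----> 0" for m
  proof (induction m)
   case 0
   show ?case by (simp add: G_def moll_err_def conv_def set_int)
  next
   case (Suc m)
   have "F i \<inter> F m = {}" if "i < m" for i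
    by (rule disjoint_family_onD[OF disj]) (use that in auto)
   hence "G m \<inter> F m = {}" by (auto simp: G_def)
   hence e: "(indicator (G (Suc m)) :: real => real) = (%t. indicator (G m) t + indicator (F m) t)"
    by (auto simp: G_def fun_eq_iff indicator_def lessThan_Suc)
   show ?case
   proof (rule tendsto_sandwich[OF _ _ tendsto_const])
    show "\<forall>\<^sub>F n in sequentially. ?e n (G (Suc m)) <= ?e n (G m) + ?e n (F m)"
     unfolding e using moll_err_add[OF iint_indicator[OF Gb] iint_indicator[OF Fb]] by simp
    show "(%n. ?e n (G m) + ?e n (F m)) ----> 0"
     using tendsto_add[OF Suc P] by simp
   qed (simp add: moll_err_nonneg)
  qed
  show "(%n. ?e n (\<Union>i. F i)) ----> 0"
  proof (rule moll_err_lim[OF T iint_indicator[OF Gb] PG iint_indicator[OF Ub]])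
   have "(%m. LI t|lborel. indicator {0<..<T} t *R norm (indicator (\<Union>i. F i) t - indicator (G m) t :: real)) ----> (LI t|(lborel :: real measure). 0)"
   proof (rule integral_dominated_convergence)
    show "integrable lborel (%t. indicator {0<..<T} t *R (1 :: real))"
     using iint_bounded[of "%_. 1::real" T 1] by (simp add: set_integrable_def)
    show "AE t in lborel. (%m. indicator {0<..<T} t *R norm (indicator (\<Union>i. F i) t - indicator (G m) t :: real)) ----> 0"
    proof (rule AE_I2, rule tendsto_eventually)
     fix t
     show "\<forall>\<^sub>F m in sequentially. indicator {0<..<T} t *R norm (indicator (\<Union>i. F i) t - indicator (G m) t :: real) = 0"
     proof (cases "\<exists>i. t \<in> F i")
      case True
      then obtain i where i: "t \<in> F i" by auto
      have "\<forall>m\<ge>Suc i. t \<in> G m" using i by (force simp: G_def)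
      hence "eventually (%m. t \<in> G m) sequentially" by (auto simp: eventually_sequentially)
      thus ?thesis by eventually_elim (use i in "auto simp: indicator_def")
     qed (auto simp: G_def indicator_def)
    qed
    show "AE t in lborel. norm (indicator {0<..<T} t *R norm (indicator (\<Union>i. F i) t - indicator (G m) t :: real)) <= indicator {0<..<T} t *R 1" for m
     by (auto simp: indicator_def)
   qed (use Ub Gb in measurable)
   thus "(%m. LI t<T. norm (indicator (\<Union>i. F i) t - indicator (G m) t :: real)) ----> 0"
    by (simp add: set_int)
  qed
 qed simp
qed

lemma moll_err_tendsto:
 assumes T: "T \<ge> 0" and f: "iint T f"
 shows "(%n. moll_err T n f) ----> 0"
 using f[folded iint_iff]
proof (induction rule: integrable_induct)
 case (base A c)
 have A: "A \<in> sets borel" using base(1) by (auto simp: sets_restrict_space)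
 have "moll_err T n (%x. indicator A x *R c) = moll_err T n (indicator A :: real => real) * norm c" for n
 proof -
  have "conv (rho m) (%x. indicator A x *R c) t = conv (rho m) (indicator A) t *R c" for m t
   by (rule conv_linear[OF bounded_linear_scaleR_left]) (rule iint_conv_continuous[OF rho_continuous(1) iint_indicator[OF A]])
  hence "norm (conv (rho (real (Suc n))) (%x. indicator A x *R c) t - indicator A t *R c) =
    norm (conv (rho (real (Suc n))) (indicator A) t - indicator A t :: real) * norm c" for t
   by (simp add: scaleR_diff_left[symmetric])
  thus ?thesis unfolding moll_err_def by simp
 qed
 thus ?case using tendsto_mult_right[OF moll_err_indicator[OF T A], of "norm c"] by simp
next
 case (add f g)
 show ?case
 proof (rule tendsto_sandwich[OF _ _ tendsto_const])
  show "\<forall>\<^sub>F n in sequentially. moll_err T n (%x. f x + g x) <= moll_err T n f + moll_err T n g"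
   using moll_err_add[OF add(1,2)[unfolded iint_iff]] by simp
  show "(%n. moll_err T n f + moll_err T n g) ----> 0" using tendsto_add[OF add(3,4)] by simp
 qed (simp add: moll_err_nonneg)
next
 case (lim f s)
 have 1: "iint T (s i)" for i using lim(1)[of i] by (simp add: iint_iff)
 have 2: "(%i. LI t<T. norm (f t - s i t)) ----> 0"
 proof -
  have "(%i. LI x|ivl T. norm (f x - s i x)) ----> (LI x|ivl T. norm (f x - f x))"
  proof (rule integral_dominated_convergence)
   show "integrable (ivl T) (%x. 3 * norm (f x))" using lim(4) by simp
   show "AE x in ivl T. (%i. norm (f x - s i x)) ----> norm (f x - f x)"
    using lim(2) by (intro AE_I2 tendsto_intros) auto
   show "AE x in ivl T. norm (norm (f x - s i x)) <= 3 * norm (f x)" for i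
   proof (rule AE_I2)
    fix x assume "x \<in> space (ivl T)"
    thus "norm (norm (f x - s i x)) <= 3 * norm (f x)" using lim(3)[of x i] norm_triangle_ineq4[of "f x" "s i x"] by simp
   qed
  qed (use lim(1,4) in auto)
  thus ?thesis by (simp add: integral_interval)
 qed
 show ?case by (rule moll_err_lim[OF T 1 lim(5) _ 2]) (use lim(4) in "simp add: iint_iff")
qed

text \<open>Adding the two errors before extracting a subsequence yields one subsequence that serves
  both functions.\<close>

lemma moll_AE_subseq:
 fixes f :: "real => 'b::{banach, second_countable_topology}" and g :: "real => 'c::{banach, second_countable_topology}"
 assumes T: "T \<ge> 0" and f: "iint T f" and g: "iint T g"
 obtains r where "strict_mono r" "AE t in ivl T. (%n. conv (rho (real (Suc (r n)))) f t) ----> f t"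
  "AE t in ivl T. (%n. conv (rho (real (Suc (r n)))) g t) ----> g t"
proof -
 let ?u = "%n t. norm (conv (rho (real (Suc n))) f t - f t) + norm (conv (rho (real (Suc n))) g t - g t)"
 have "\<exists>r::nat=>nat. strict_mono r \<and> (AE x in ivl T. (%n. ?u (r n) x) ----> 0)"
 proof (rule tendsto_L1_AE_subseq)
  note fg = moll_integrable(2)[OF f] moll_integrable(2)[OF g]
  show "integrable (ivl T) (?u n)" for n
   unfolding iint_iff by (rule set_integral_add(1)[OF fg])
  have "(LI x|ivl T. norm (?u n x)) = moll_err T n f + moll_err T n g" for n
   unfolding moll_err_def set_integral_add(2)[OF fg, symmetric] integral_interval by simp
  thus "(%n. LI x|ivl T. norm (?u n x)) ----> 0"
   using tendsto_add[OF moll_err_tendsto[OF T f] moll_err_tendsto[OF T g]] by simp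
 qed
 then obtain r where r: "strict_mono r" "AE x in ivl T. (%n. ?u (r n) x) ----> 0" by blast
 have z: "a ----> l" if "(%n. norm (a n - l) + c n) ----> 0" "!!n. c n \<ge> 0"
  for a :: "nat => 'z::real_normed_vector" and l and c :: "nat => real"
 proof -
  have "(%n. norm (a n - l)) ----> 0"
   by (rule tendsto_sandwich[OF _ _ tendsto_const that(1)]) (use that(2) in auto)
  thus ?thesis using tendsto_norm_zero_iff LIM_zero_iff by blast
 qed
 show ?thesis
 proof (rule that[OF r(1)])
  show "AE t in ivl T. (%n. conv (rho (real (Suc (r n)))) f t) ----> f t"
   using r(2) by eventually_elim (rule z, auto)
  show "AE t in ivl T. (%n. conv (rho (real (Suc (r n)))) g t) ----> g t"
   using r(2) by eventually_elim (rule z, auto simp: add.commute)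
 qed
qed

section \<open>Passage to the limit\<close>

text \<open>The range of \<open>i\<close> need not be closed, so \<open>h\<close> is found by
  minimizing the quadratic functional \<open>J\<close>. The bound by \<open>norm (i v)\<close> keeps
  \<open>J\<close> bounded below, the parallelogram identity makes the images of a minimizing
  sequence Cauchy in \<open>H\<close>, and the first variation at the limit gives the
  representation.\<close>

lemma riesz_through_embedding:
 fixes i :: "'x::real_vector => 'h::{real_inner, banach}"
 assumes i: "linear i" and phi: "linear \<phi>" and C: "!!v. \<bar>\<phi> v\<bar> <= C * norm (i v)"
 obtains h where "!!v. \<phi> v = inner h (i v)"
proof -
 define J where "J v = 1/2 * nsq (i v) - \<phi> v" for v
 have "- (C\<^sup>2 / 2) <= J v" for v
 proof -
  have "0 <= (norm (i v) - C)\<^sup>2" by simp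
  thus ?thesis using C[of v] by (simp add: J_def power2_eq_square algebra_simps)
 qed
 hence bdd: "bdd_below (range J)" by (intro bdd_belowI2[where m="- (C\<^sup>2 / 2)"])
 define d where "d = (INF v. J v)"
 have d: "d <= J v" for v unfolding d_def by (rule cINF_lower[OF bdd]) simp
 have "\<exists>v. J v < d + 1 / real (Suc n)" for n
  using cINF_less_iff[OF UNIV_not_empty bdd, of "d + 1 / real (Suc n)"] by (simp add: d_def)
 then obtain v where v: "J (v n) < d + 1 / real (Suc n)" for n by metis
 have par: "1/4 * nsq (i x - i y) <= J x + J y - 2 * d" for x y
 proof -
  have "2 * J ((1/2) *R (x + y)) = nsq (i x + i y) / 4 - (\<phi> x + \<phi> y)"
   by (simp add: J_def linear_scale[OF i] linear_scale[OF phi] linear_add[OF i] linear_add[OF phi] power_divide) (simp add: algebra_simps)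
  moreover have "nsq (i x + i y) + nsq (i x - i y) = 2 * nsq (i x) + 2 * nsq (i y)"
   by (simp add: power2_norm_eq_inner inner_add_left inner_add_right inner_diff_left inner_diff_right)
  ultimately have "1/4 * nsq (i x - i y) = J x + J y - 2 * J ((1/2) *R (x + y))"
   by (simp add: J_def)
  thus ?thesis using d[of "(1/2) *R (x + y)"] by simp
 qed
 have "Cauchy (%n. i (v n))"
 proof (rule metric_CauchyI)
  fix e :: real assume e: "e > 0"
  obtain N where N: "1 / real (Suc N) < e\<^sup>2 / 8" using nat_approx_posE[of "e\<^sup>2 / 8"] e by auto
  show "\<exists>M. \<forall>m\<ge>M. \<forall>n\<ge>M. dist (i (v m)) (i (v n)) < e"
  proof (intro exI allI impI)
   fix m n assume mn: "m \<ge> N" "n \<ge> N"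
   have "1 / real (Suc m) <= 1 / real (Suc N)" "1 / real (Suc n) <= 1 / real (Suc N)" using mn by (auto simp: frac_le)
   hence "1/4 * nsq (i (v m) - i (v n)) < e\<^sup>2 / 4"
    using par[of "v m" "v n"] v[of m] v[of n] N by linarith
   hence "nsq (i (v m) - i (v n)) < e\<^sup>2" by simp
   thus "dist (i (v m)) (i (v n)) < e" using e by (simp add: dist_norm power2_less_imp_less)
  qed
 qed
 then obtain h where h: "(%n. i (v n)) ----> h" using Cauchy_convergent_iff convergent_def by blast
 have Jv: "(%n. J (v n)) ----> d"
 proof (rule tendsto_sandwich[OF _ _ tendsto_const])
  show "\<forall>\<^sub>F n in sequentially. J (v n) <= d + 1 / real (Suc n)" using v by (intro always_eventually allI less_imp_le)
  have "(%n. d + 1 / real (Suc n)) ----> d + 0" by (intro tendsto_add tendsto_const LIMSEQ_Suc[OF lim_1_over_n])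
  thus "(%n. d + 1 / real (Suc n)) ----> d" by simp
 qed (use d in simp)
 \<comment> \<open>The first variation: the minimizing sequence itself need not converge, so
   \<open>J\<close> is expanded around \<open>v n\<close> in the direction \<open>w\<close>, and the
   limit is taken in the coefficients only.\<close>
 have key: "0 <= t * (inner h (i w) - \<phi> w) + 1/2 * t\<^sup>2 * nsq (i w)" for t w
 proof -
  have e: "J (v n + t *R w) = J (v n) + t * (inner (i (v n)) (i w) - \<phi> w) + 1/2 * t\<^sup>2 * nsq (i w)" for n
  proof -
   have "nsq (i (v n) + t *R i w) = nsq (i (v n)) + 2 * t * inner (i (v n)) (i w) + t\<^sup>2 * nsq (i w)"
    unfolding power2_norm_eq_inner by (simp add: inner_add_left inner_add_right inner_commute power2_eq_square)
   thus ?thesis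
    by (simp add: J_def linear_scale[OF i] linear_scale[OF phi] linear_add[OF i] linear_add[OF phi] algebra_simps)
  qed
  have "(%n. J (v n + t *R w)) ----> d + t * (inner h (i w) - \<phi> w) + 1/2 * t\<^sup>2 * nsq (i w)"
   unfolding e by (intro tendsto_intros Jv h)
  hence "d <= d + t * (inner h (i w) - \<phi> w) + 1/2 * t\<^sup>2 * nsq (i w)"
   by (rule LIMSEQ_le_const) (use d in auto)
  thus ?thesis by simp
 qed
 show ?thesis
 proof (rule that[of h])
  fix w
  define q p where "q = inner h (i w) - \<phi> w" and "p = nsq (i w)"
  have k: "0 <= t * q + 1/2 * t\<^sup>2 * p" for t using key[of t w] by (simp add: q_def p_def)
  have "q = 0"
  proof (cases "p = 0")
   case True
   hence "0 <= - (q\<^sup>2)" using k[of "- q"] by (simp add: power2_eq_square)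
   thus ?thesis by simp
  next
   case False
   have p: "p > 0" using False by (simp add: p_def)
   \<comment> \<open>The value \<open>- (q / p)\<close> minimizes the quadratic polynomial of
     \<open>k\<close>.\<close>
   have "0 <= (- (q / p)) * q + 1/2 * (q / p)\<^sup>2 * p" using k[of "- (q / p)"] by simp
   also have "... = - (q\<^sup>2 / (2 * p))" using p by (simp add: power2_eq_square field_simps)
   finally have "q\<^sup>2 / (2 * p) <= 0" by simp
   thus ?thesis using p by (simp add: divide_le_0_iff)
  qed
  thus "\<phi> w = inner h (i w)" by (simp add: q_def)
 qed
qed

lemma dense_norm_le:
 fixes h :: "'h::real_inner"
 assumes dense: "closure D = UNIV" and C: "!!v. v \<in> D ==> inner h v <= C * norm v" and C0: "C \<ge> 0"
 shows "norm h <= C"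
proof -
 have "h \<in> closure D" using dense by simp
 then obtain x where x: "!!n. x n \<in> D" "x ----> h" unfolding closure_sequential by blast
 have "inner h (x n) <= C * norm (x n)" for n using x(1)[of n] C by auto
 hence "inner h h <= C * norm h"
  by (intro tendsto_le[OF _ tendsto_mult[OF tendsto_const tendsto_norm[OF x(2)]] tendsto_inner[OF tendsto_const x(2)]]) auto
 hence "norm h * norm h <= C * norm h" by (simp add: power2_norm_eq_inner[symmetric] power2_eq_square)
 thus ?thesis using C0 by (cases "h = 0") auto
qed

lemma countable_dense_closure:
 obtains D :: "'a::{second_countable_topology} set" where "countable D" "closure D = UNIV"
proof -
 obtain D :: "'a set" where D: "countable D" "!!X. open X ==> X \<noteq> {} ==> \<exists>d\<in>D. d \<in> X"
  using countable_dense_exists by blast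
 have "closure D = UNIV"
 proof (rule ccontr)
  assume "closure D \<noteq> UNIV"
  then obtain d where "d \<in> D" "d \<in> - closure D" using D(2)[of "- closure D"] by auto
  thus False using closure_subset[of D] by auto
 qed
 thus ?thesis using D(1) that by blast
qed

text \<open>Pettis' theorem in Hilbert space. Membership in a closed ball is a countable family of
  inequalities between inner products, and an open set is a countable union of closed balls with
  centres in a countable dense set.\<close>

lemma weakly_measurable:
 fixes h :: "'a => 'h::{real_inner, second_countable_topology}"
 assumes w: "!!v. (%t. inner (h t) v) \<in> bm N"
 shows "h \<in> bm N"
proof -
 obtain D :: "'h set" where D: "countable D" "closure D = UNIV" by (rule countable_dense_closure)
 have cb: "h -` cball e q \<inter> space N \<in> sets N" if "q \<ge> 0" for e q
 proof -
  have "h -` cball e q \<inter> space N = {t \<in> space N. \<forall>v\<in>D. inner (h t) v - inner e v <= q * norm v}"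
  proof (intro set_eqI iffI)
   fix t assume "t \<in> h -` cball e q \<inter> space N"
   hence t: "t \<in> space N" "norm (h t - e) <= q" by (auto simp: dist_norm norm_minus_commute)
   have "inner (h t) v - inner e v <= q * norm v" for v
    using norm_cauchy_schwarz[of "h t - e" v] mult_right_mono[OF t(2), of "norm v"] by (simp add: inner_diff_left)
   with t show "t \<in> {t \<in> space N. \<forall>v\<in>D. inner (h t) v - inner e v <= q * norm v}" by simp
  next
   fix t assume t: "t \<in> {t \<in> space N. \<forall>v\<in>D. inner (h t) v - inner e v <= q * norm v}"
   have "norm (h t - e) <= q"
    by (rule dense_norm_le[OF D(2) _ that]) (use t in "simp add: inner_diff_left")
   with t show "t \<in> h -` cball e q \<inter> space N" by (simp add: dist_norm norm_minus_commute)
  qed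
  also have "... \<in> sets N"
  proof (rule sets.sets_Collect_countable_All')
   show "{t \<in> space N. inner (h t) v - inner e v <= q * norm v} \<in> sets N" for v
    using w[of v] by measurable
  qed (rule D(1))
  finally show ?thesis .
 qed
 show ?thesis
 proof (rule borel_measurableI)
  fix S :: "'h set" assume S: "open S"
  let ?I = "{(e, n). e \<in> D \<and> cball e (1 / real (Suc n)) \<subseteq> S}"
  have S_eq: "S = (\<Union>(e, n)\<in>?I. cball e (1 / real (Suc n)))"
  proof (intro set_eqI iffI)
   fix x assume "x \<in> S"
   then obtain r where r: "r > 0" "ball x r \<subseteq> S" using S open_contains_ball by blast
   obtain n where n: "1 / real (Suc n) < r / 2" using nat_approx_posE[of "r/2"] r by auto
   obtain e where e: "e \<in> D" "dist e x < 1 / real (Suc n)"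
    using D(2) closure_approachable[of x D] by (metis UNIV_I zero_less_divide_1_iff of_nat_0_less_iff zero_less_Suc)
   have "cball e (1 / real (Suc n)) \<subseteq> ball x r"
   proof
    fix z assume "z \<in> cball e (1 / real (Suc n))"
    hence "dist e z <= 1 / real (Suc n)" by simp
    thus "z \<in> ball x r" using e(2) n dist_triangle[of x z e] by (simp add: dist_commute)
   qed
   with r e show "x \<in> (\<Union>(e, n)\<in>?I. cball e (1 / real (Suc n)))" by (force simp: dist_commute)
  qed auto
  have "h -` S \<inter> space N = h -` (\<Union>(e, n)\<in>?I. cball e (1 / real (Suc n))) \<inter> space N"
   by (rule arg_cong[OF S_eq, of "%S. h -` S \<inter> space N"])
  also have "... = (\<Union>(e, n)\<in>?I. h -` cball e (1 / real (Suc n)) \<inter> space N)" by blast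
  finally have "h -` S \<inter> space N = (\<Union>(e, n)\<in>?I. h -` cball e (1 / real (Suc n)) \<inter> space N)" .
  moreover have "countable ?I"
   by (rule countable_subset[of _ "D \<times> UNIV"]) (use D(1) in auto)
  moreover have "h -` cball e (1 / real (Suc n)) \<inter> space N \<in> sets N" for e n by (rule cb) simp
  ultimately show "h -` S \<inter> space N \<in> sets N" by (auto intro!: sets.countable_UN')
 qed
qed

lemma iint_of_square:
 fixes f :: "real => 'b::{banach, second_countable_topology}"
 assumes [measurable]: "f \<in> bm borel" and f2: "iint T (%s. nsq (f s))"
 shows "iint T f"
proof (rule set_integrable_bound)
 show "iint T (%s. 1 + nsq (f s))"
  by (rule set_integral_add(1)[OF iint_bounded[where C=1] f2]) auto
 show "set_borel_measurable lborel {0<..<T} f" unfolding set_borel_measurable_def by measurable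
 have "norm v <= 1 + nsq v" for v :: 'b
 proof -
  have "2 * norm v <= nsq v + 1" using zero_le_power2[of "norm v - 1"] by (simp add: power2_diff)
  moreover have "0 <= nsq v" by simp
  ultimately show ?thesis by linarith
 qed
 thus "AE s\<in>{0<..<T} in lborel. norm (f s) <= norm (1 + nsq (f s))" by auto
qed

text \<open>Young's inequality for an integrable kernel and a square integrable function: the kernel
  is split as \<open>sqrt k * sqrt k\<close>, and Cauchy-Schwarz is applied with one root on each
  side.\<close>

lemma conv_L2:
 assumes k [measurable]: "k \<in> bm borel" and k0: "!!s. [|0 < s; s < T|] ==> 0 <= k s"
  and kC: "!!s. [|0 < s; s < T|] ==> \<bar>k s\<bar> <= C" and K: "(LI s<T. \<bar>k s\<bar>) <= K"
  and f [measurable]: "f \<in> bm borel" and f2: "iint T (%s. nsq (f s))"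
 shows "iint T (%t. nsq (conv k f t))"
  and "(LI t<T. nsq (conv k f t)) <= K\<^sup>2 * (LI t<T. nsq (f t))"
proof -
 have f1: "iint T f" by (rule iint_of_square[OF f f2])
 have ik: "iint T k" by (rule iint_bounded[where C=C]) (use k kC in auto)
 have K0: "K \<ge> 0"
  by (rule order_trans[OF _ K]) (auto simp: set_int intro!: integral_nonneg_AE)
 have pw: "nsq (conv k f t) <= K * conv k (%s. nsq (f s)) t" if t: "t \<in> {0<..<T}" for t
 proof -
  let ?a = "%s. indicator {0<..<t} s * sqrt (k (t - s))"
  let ?b = "%s. indicator {0<..<t} s * (sqrt (k (t - s)) * norm (f s))"
  have kp: "0 <= k (t - s)" if "s \<in> {0<..<t}" for s using that t k0[of "t - s"] by auto
  have a2: "(%s. (?a s)\<^sup>2) = (%s. indicator {0<..<t} s *R k (t - s))"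
   using kp by (auto simp: fun_eq_iff indicator_def)
  have b2: "(%s. (?b s)\<^sup>2) = (%s. indicator {0<..<t} s *R k (t - s) *R (nsq (f s)))"
   using kp by (auto simp: fun_eq_iff indicator_def power_mult_distrib)
  have ab: "(%s. ?a s * ?b s) = (%s. indicator {0<..<t} s *R norm (k (t - s) *R f s))"
   using kp by (auto simp: fun_eq_iff indicator_def mult.assoc[symmetric])
  have kt: "!!s. [|0 < s; s < t|] ==> \<bar>k s\<bar> <= C" using kC t by auto
  have Ia: "integrable lborel (%s. (?a s)\<^sup>2)"
   unfolding a2 using iint_conv_bounded[OF k kt, of t "%_. 1::real"] iint_bounded[of "%_. 1::real" t 1]
   by (simp add: set_integrable_def)
  have Ib: "integrable lborel (%s. (?b s)\<^sup>2)"
   unfolding b2 using iint_conv_bounded[OF k kt iint_mono[OF f2], of t] t by (simp add: set_integrable_def)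
  have "norm (conv k f t) <= (LI s|lborel. ?a s * ?b s)"
   unfolding ab conv_def set_int[symmetric]
   by (rule set_integral_norm_bound) (rule iint_conv_bounded[OF k kt iint_mono[OF f1]], use t in auto)
  hence "nsq (conv k f t) <= (LI s|lborel. ?a s * ?b s)\<^sup>2" by (intro power_mono) auto
  also have "... <= (LI s|lborel. (?a s)\<^sup>2) * (LI s|lborel. (?b s)\<^sup>2)"
   by (rule Cauchy_Schwarz_integral(2)[OF _ _ Ia Ib]) measurable
  also have "... <= K * conv k (%s. nsq (f s)) t"
  proof -
   have "(LI s|lborel. (?a s)\<^sup>2) = conv k (%_. 1) t" unfolding a2 by (simp add: conv_def set_int)
   also have "... = prim k t" by (rule conv_commute)
   also have "... <= (LI s<T. \<bar>k s\<bar>)"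
    unfolding conv_one set_int
   proof (rule integral_mono)
    show "integrable lborel (cut t k)" using iint_mono[OF ik, of t] t by (simp add: set_integrable_def)
    show "integrable lborel (%x. indicator {0<..<T} x *R \<bar>k x\<bar>)" using set_integrable_abs[OF ik] by (simp add: set_integrable_def)
   qed (use t in "auto simp: indicator_def")
   finally have "(LI s|lborel. (?a s)\<^sup>2) <= K" using K by simp
   from mult_right_mono[OF this, of "LI s|lborel. (?b s)\<^sup>2"]
   have "(LI s|lborel. (?a s)\<^sup>2) * (LI s|lborel. (?b s)\<^sup>2) <= K * (LI s|lborel. (?b s)\<^sup>2)" by simp
   moreover have beq: "(LI s|lborel. (?b s)\<^sup>2) = conv k (%s. nsq (f s)) t"
    unfolding b2 by (simp add: conv_def set_int)
   ultimately show ?thesis by (simp only: beq)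
  qed
  finally show ?thesis .
 qed
 have Ic: "iint T (conv k (%s. nsq (f s)))" by (rule conv_integrable(1)[OF ik f2])
 hence Ic': "iint T (%t. K * conv k (%s. nsq (f s)) t)" by simp
 show I: "iint T (%t. nsq (conv k f t))"
 proof (rule set_integrable_bound[OF Ic'])
  show "set_borel_measurable lborel {0<..<T} (%t. nsq (conv k f t))" unfolding set_borel_measurable_def by measurable
  show "AE t\<in>{0<..<T} in lborel. norm (nsq (conv k f t)) <= norm (K * conv k (%s. nsq (f s)) t)"
   using pw by (intro AE_I2 impI) (force intro: order_trans[OF _ abs_ge_self])
 qed
 have "(LI t<T. conv k (%s. nsq (f s)) t) <= (LI t<T. norm (conv k (%s. nsq (f s)) t))"
  by (rule set_integral_mono[OF Ic set_integrable_norm[OF Ic]]) simp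
 also have "... <= (LI t<T. \<bar>k t\<bar>) * (LI t<T. norm (nsq (f t)))"
  by (rule conv_integrable(3)[OF ik f2])
 also have "... <= K * (LI t<T. nsq (f t))"
  using K by (auto intro!: mult_right_mono integral_nonneg_AE simp: set_int)
 finally have le: "(LI t<T. conv k (%s. nsq (f s)) t) <= K * (LI t<T. nsq (f t))" .
 have "(LI t<T. nsq (conv k f t)) <= (LI t<T. K * conv k (%s. nsq (f s)) t)"
  by (rule set_integral_mono[OF I Ic']) (rule pw)
 also have "... = K * (LI t<T. conv k (%s. nsq (f s)) t)" by simp
 also have "... <= K * (K * (LI t<T. nsq (f t)))" by (rule mult_left_mono[OF le K0])
 finally show "(LI t<T. nsq (conv k f t)) <= K\<^sup>2 * (LI t<T. nsq (f t))"
  by (simp add: power2_eq_square mult.assoc)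
qed

lemma nn_iint:
 assumes "iint T f" "!!t. f t \<ge> (0::real)"
 shows "(NI t|ivl T. f t) = ennreal (LI t<T. f t)"
 using nn_integral_eq_integral[of "ivl T" f] assms by (simp add: iint_iff integral_interval)

context smooth_flow
begin

lemma nn_Mw: "[|integrable M f; !!th. [|0 < th; th < 1|] ==> f th \<ge> (0::real)|] ==> (NI th|M. f th) = ennreal (LI th|M. f th)"
 by (rule nn_integral_eq_integral) (auto intro: AE_I2)

lemma space_interval: "t \<in> space (ivl T) ==> t \<in> {0..T}"
 by (auto simp: space_restrict_space)

text \<open>The estimates in terms of \<open>nn_integral\<close>, the form in which Fatou's lemma
  applies before the limits are known to be integrable. In the first one,
  \<open>1 = (1 - th) + th\<close> splits the norm into state and dissipation.\<close>

lemma nn_estimates: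
 shows "(PI t|ivl T. (NI th|M. nsq (y th t))) <= ennreal ((8 * KK * T + 4 * KK) / C1)"
  and "(NI t|ivl T. nsq (i (G t))) <= ennreal (4 * KK)"
  and "t \<in> {0..T} ==> (NI th|M. th * nsq (i (y th t))) <= ennreal (8 * R)"
  and "(PI t|ivl T. (NI th|M. (1 - th) * nsq (i (y' th t)))) <= ennreal (2 * R)"
proof -
 show "(NI t|ivl T. nsq (i (G t))) <= ennreal (4 * KK)"
  using nn_iint[OF iint_norm2[OF iG_cont(1) order_refl]] first_estimate(3) by (simp add: ennreal_leI)
 show "t \<in> {0..T} ==> (NI th|M. th * nsq (i (y th t))) <= ennreal (8 * R)"
  using nn_Mw[OF ZV_integrable(2)[of t]] second_estimate(1)[of t] ZV_nonneg by (simp add: ennreal_leI ZZ_def Z_def)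
 have "(PI t|ivl T. (NI th|M. (1 - th) * nsq (i (y' th t)))) = (NI t|ivl T. VV t)"
 proof (rule nn_integral_cong)
  fix t assume "t \<in> space (ivl T)"
  hence t: "t \<in> {0..T}" by (rule space_interval)
  show "(NI th|M. (1 - th) * nsq (i (y' th t))) = ennreal (VV t)"
   using nn_Mw[OF ZV_integrable(5)[OF t]] by (simp add: VV_def V_def)
 qed
 also have "... = ennreal (LI t<T. VV t)"
  by (rule nn_iint[OF energy2(2)]) (use T in "auto simp: VV_def intro!: integral_nonneg_AE AE_I2 mult_nonneg_nonneg ZV_nonneg")
 also have "... <= ennreal (2 * R)" using second_estimate(3)[of T] T by (auto intro!: ennreal_leI)
 finally show "(PI t|ivl T. (NI th|M. (1 - th) * nsq (i (y' th t)))) <= ennreal (2 * R)" .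
 have TT: "T \<in> {0..T}" using T by simp
 have Is: "iint T SS" by (rule bterm(3)[OF TT])
 have KK0: "KK \<ge> 0" using first_estimate(1)[of 0] YY_nonneg[of 0] T by simp
 have I1: "iint T (%t. 8 * KK / C1)" by (rule iint_bounded[where C="8 * KK / C1"]) (use KK0 C1 in auto)
 have I2: "iint T (%t. SS t / C1)" using Is by simp
 have "(PI t|ivl T. (NI th|M. nsq (y th t))) <= (NI t|ivl T. 8 * KK / C1 + SS t / C1)"
 proof (rule nn_integral_mono)
  fix t assume "t \<in> space (ivl T)"
  hence t: "t \<in> {0..T}" by (rule space_interval)
  have "(NI th|M. nsq (y th t)) <= (NI th|M. ((1 - th) * Q th t + th * Q th t) / C1)"
  proof (rule nn_integral_mono, rule ennreal_leI)
   fix th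
   have "C1 * nsq (y th t) <= Q th t" unfolding Q_def by (rule B_coercive)
   also have "Q th t = (1 - th) * Q th t + th * Q th t" by (simp add: algebra_simps)
   finally show "nsq (y th t) <= ((1 - th) * Q th t + th * Q th t) / C1"
    using C1 by (simp add: pos_le_divide_eq mult.commute)
  qed
  also have "... = ennreal (LI th|M. ((1 - th) * Q th t + th * Q th t) / C1)"
   by (rule nn_Mw) (use Q_integrable[OF t] Q_nonneg C1 in "auto intro!: divide_nonneg_pos add_nonneg_nonneg mult_nonneg_nonneg")
  also have "(LI th|M. ((1 - th) * Q th t + th * Q th t) / C1) = (YY t + SS t) / C1"
   using Bochner_Integration.integral_add[OF Q_integrable(1,2)[OF t]] by (simp add: YY_def SS_def)
  also have "ennreal ((YY t + SS t) / C1) <= ennreal (8 * KK / C1 + SS t / C1)"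
   unfolding add_divide_distrib[symmetric] using first_estimate(1)[OF t] C1 by (intro ennreal_leI divide_right_mono) auto
  finally show "(NI th|M. nsq (y th t)) <= ennreal (8 * KK / C1 + SS t / C1)" .
 qed
 also have "... = ennreal (LI t<T. 8 * KK / C1 + SS t / C1)"
  by (rule nn_iint[OF set_integral_add(1)[OF I1 I2]]) (use KK0 C1 SS_nonneg in auto)
 also have "(LI t<T. 8 * KK / C1 + SS t / C1) = T * (8 * KK / C1) + (LI t<T. SS t) / C1"
  unfolding set_integral_add(2)[OF I1 I2] using T by (simp add: set_int)
 also have "... <= (8 * KK * T + 4 * KK) / C1"
  using first_estimate(2) C1 by (simp add: field_simps)
 finally show "(PI t|ivl T. (NI th|M. nsq (y th t))) <= ennreal ((8 * KK * T + 4 * KK) / C1)"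
  by (simp add: ennreal_leI)
qed

end

lemma conv_cong_AE:
 assumes [measurable]: "k \<in> bm borel" "f \<in> bm borel" "g \<in> bm borel"
  and ae: "AE s in ivl T. f s = g s" and t: "t <= T"
 shows "conv k f t = conv k g t"
 unfolding conv_def set_int
proof (rule integral_cong_AE)
 show "AE s in lborel. indicator {0<..<t} s *R k (t - s) *R f s = indicator {0<..<t} s *R k (t - s) *R g s"
  using ae[unfolded AE_interval] by eventually_elim (use t in "auto simp: indicator_def")
qed measurable

lemma nn_fatou:
 assumes m: "!!n. f n \<in> bm N" and g: "AE x in N. g x <= liminf (%n. f n x)"
  and K: "!!n. (PI x|N. f n x) <= K"
 shows "(PI x|N. g x) <= (K :: ennreal)"
proof -
 have "(PI x|N. g x) <= (PI x|N. liminf (%n. f n x))" by (rule nn_integral_mono_AE[OF g])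
 also have "... <= liminf (%n. PI x|N. f n x)" by (rule nn_integral_liminf) (rule m)
 also have "... <= K"
 proof -
  have "liminf (%n. PI x|N. f n x) <= liminf (%n. K)"
   by (rule Liminf_mono) (simp add: K)
  thus ?thesis by (simp add: Liminf_const)
 qed
 finally show ?thesis .
qed

section \<open>Weak solutions, their mollification and uniform bounds\<close>

locale weak_flow = quad_flow i A b C1 C2 al T
 for i :: "'x::{banach, second_countable_topology} => 'h::{real_inner, banach, second_countable_topology}"
  and A b C1 C2 al T +
 fixes U :: "real => 'x"
 assumes dense: "closure (range i) = UNIV"
  and U_meas [measurable]: "U \<in> bm borel" and U2: "iint T (%t. nsq (U t))"
  and weak_eq: "AE t in ivl T. \<forall>v. inner (i (conv (gker (1 - al)) U t)) (i v) = - prim (%s. A (U s) v + b v) t"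
begin

abbreviation "M \<equiv> Mw al"
definition F where "F = conv (gker (1 - al)) U"
definition M0 where "M0 = ki\<^sup>2 * (LI t<T. nsq (U t))"
text \<open>Formally \<open>pk th\<close> convolved with the time derivative of \<open>F\<close>.
  That derivative is not known to have values in \<open>X\<close>, but \<open>F\<close> is; the form
  given by \<open>conv_pk_ode\<close> avoids it, so \<open>us\<close> has values in
  \<open>X\<close>.\<close>

definition us where "us th t = c0 th *R F t - c1 th *R conv (pk th) F t"
definition w where "w t v = - (A (U t) v + b v)"

lemma F_measurable [measurable]: "F \<in> bm borel"
 unfolding F_def by measurable

lemma U_iint: "t <= T ==> iint t U"
 by (rule iint_mono[OF iint_of_square[OF U_meas U2]])

lemma F_iint: "t <= T ==> iint t F"
 unfolding F_def by (rule iint_mono[of T]) (use U_iint iint_gker al in "auto intro!: conv_integrable(1)")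

lemma A_measurable: "(%s. A (U s) v) \<in> bm borel"
proof -
 show ?thesis by (rule bilinear_measurable[OF A]) measurable
qed

lemma w_measurable [measurable]: "(%t. w t v) \<in> bm borel"
 unfolding w_def using A_measurable by measurable

lemma AU_iint: assumes "t <= T" shows "iint t (%s. A (U s) v)"
proof -
 interpret A: bounded_bilinear A by (rule A)
 have "bounded_linear (%u. A u v)" by (rule A.bounded_linear_left)
 hence "integrable lborel (%s. A (cut t U s) v)"
  by (rule integrable_bounded_linear) (use U_iint[OF assms] in "simp add: set_integrable_def")
 thus ?thesis by (simp add: set_integrable_def A.scaleR_left)
qed

lemma w_iint: assumes "t <= T" shows "iint t (%s. A (U s) v + b v)" "iint t (%s. w s v)"
proof -
 show 1: "iint t (%s. A (U s) v + b v)"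
  by (rule set_integral_add(1)[OF AU_iint[OF assms] iint_bounded[where C="\<bar>b v\<bar>"]]) auto
 hence "iint t (%s. - (A (U s) v + b v))" using set_integrable_mult_right[OF 1, of "-1"] by simp
 thus "iint t (%s. w s v)" by (simp add: w_def)
qed

text \<open>All derivatives fall on the mollifier, so the mollified quantities stay in
  \<open>X\<close>. The pointwise equation comes from convolving the integrated weak equation with
  \<open>rho1 m\<close>; the relations between solution and Caputo derivative come from
  \<open>conv_gker_kernel\<close>.\<close>

lemma smooth: assumes m: "m > 0"
 shows "smooth_flow i A b C1 C2 al T (conv (rho1 m) F) (conv (rho2 m) F) (conv (rho m) U) (conv (rho1 m) U) (chi m) (rho m) M0"
proof (intro smooth_flow.intro smooth_flow_axioms.intro)
 interpret A: bounded_bilinear A by (rule A)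
 show "quad_flow i A b C1 C2 al T" by unfold_locales
 show "conv (rho1 m) F \<in> bm borel" "conv (rho2 m) F \<in> bm borel"
  "conv (rho m) U \<in> bm borel" "conv (rho1 m) U \<in> bm borel" by measurable
 show "\<exists>C. \<forall>s. 0 < s \<longrightarrow> s < T \<longrightarrow> norm (conv (rho2 m) F s) <= C"
 proof -
  obtain C where C: "!!s. [|0 < s; s < T|] ==> \<bar>rho2 m s\<bar> <= C" "C \<ge> 0" using continuous_bounded_on[OF rho_continuous(3)] by metis
  have "norm (conv (rho2 m) F s) <= C * (LI r<T. norm (F r))" if s: "0 < s" "s < T" for s
  proof -
   have "norm (conv (rho2 m) F s) <= C * (LI r<s. norm (F r))"
    by (rule conv_bounded) (use C s F_iint in auto)
   also have "(LI r<s. norm (F r)) <= (LI r<T. norm (F r))"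
    unfolding set_int
    by (rule integral_mono) (use set_integrable_norm[OF F_iint[of s]] set_integrable_norm[OF F_iint[of T]] s in "auto simp: set_integrable_def indicator_def")
   finally show ?thesis using C by (simp add: mult_left_mono)
  qed
  thus ?thesis by blast
 qed
 show "((chi m) has_real_derivative rho m t) (at t)" for t by (rule DERIV_chi)
 show "continuous_on UNIV (rho m)" by (rule rho_continuous)
 show "chi m 0 = 0" by (simp add: chi_def ebump_def)
 fix t assume t: "t \<in> {0..T}"
 show "0 <= chi m t" "chi m t <= 1" "0 <= rho m t" using chi_bounds rho_nonneg[OF m] t by auto
 show "conv (rho1 m) F t = prim (conv (rho2 m) F) t"
  using conv_one_kernel(1)[OF F_iint rho_continuous(3), of t m] t conv_cong[of t "prim (rho2 m)" "rho1 m" F F]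
  by (simp add: conv_one_rho2)
 show "conv (rho m) U t = prim (conv (rho1 m) U) t"
  using conv_one_kernel(1)[OF U_iint rho_continuous(2), of t m] t conv_cong[of t "prim (rho1 m)" "rho m" U U]
  by (simp add: conv_one_rho1)
 show "conv (rho m) U t = conv (gker al) (conv (rho1 m) F) t"
  using conv_gker_kernel[OF al U_iint rho_continuous(2), of t m] t conv_cong[of t "prim (rho1 m)" "rho m" U U]
  by (simp add: conv_one_rho1 F_def)
 show "conv (rho1 m) U t = conv (gker al) (conv (rho2 m) F) t"
  using conv_gker_kernel[OF al U_iint rho_continuous(3), of t m] t conv_cong[of t "prim (rho2 m)" "rho1 m" U U]
  by (simp add: conv_one_rho2 F_def)
 fix v
 let ?g = "%s. A (U s) v + b v"
 have tT: "t <= T" using t by simp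
 have g: "iint t ?g" by (rule w_iint(1)[OF tT])
 have [measurable]: "?g \<in> bm borel" using A_measurable by measurable
 have "inner (i (conv (rho1 m) F t)) (i v) = conv (rho1 m) (%s. inner (i (F s)) (i v)) t"
  by (rule conv_linear[symmetric, OF bounded_linear_compose[OF bounded_linear_inner_left i]])
   (rule iint_conv_continuous[OF rho_continuous(2) F_iint[OF tT]])
 also have "... = conv (rho1 m) (%s. - prim ?g s) t"
  by (rule conv_cong_AE[where T=T]) (use weak_eq tT in "auto simp: F_def elim!: eventually_mono")
 also have "... = - conv (rho1 m) (prim ?g) t"
  by (simp add: conv_def set_int)
 \<comment> \<open>The time integral moves from the gradient to the kernel and turns
   \<open>rho1 m\<close> into \<open>rho m\<close>.\<close>
 also have "conv (rho1 m) (prim ?g) t = conv (prim (rho1 m)) ?g t"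
  by (rule conv_one_kernel(2)[OF g rho_continuous(2)])
 also have "... = conv (rho m) ?g t" by (rule conv_cong) (auto simp: conv_one_rho1)
 also have "... = conv (rho m) (%s. A (U s) v) t + conv (rho m) (%s. b v) t"
 proof (rule conv_add_right)
  show "iint t (%s. rho m (t - s) *R A (U s) v)" by (rule iint_conv_continuous[OF rho_continuous(1) AU_iint[OF tT]])
  have "iint t (%s. b v)" by (rule iint_bounded[where C="\<bar>b v\<bar>"]) auto
  thus "iint t (%s. rho m (t - s) *R b v)" by (rule iint_conv_continuous[OF rho_continuous(1)])
 qed
 also have "conv (rho m) (%s. A (U s) v) t = A (conv (rho m) U t) v"
  by (rule conv_linear[OF A.bounded_linear_left]) (rule iint_conv_continuous[OF rho_continuous(1) U_iint[OF tT]])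
 \<comment> \<open>Constants are not preserved, because \<open>rho m\<close> has only the mass
   \<open>chi m t\<close> on \<open>(0, t)\<close>.\<close>
 also have "conv (rho m) (%s. b v) t = chi m t * b v"
 proof -
  have "conv (rho m) (%s. b v) t = conv (%s. b v) (rho m) t" by (rule conv_commute)
  also have "... = b v * prim (rho m) t" by (simp add: conv_def)
  finally show ?thesis using t by (simp add: conv_one_rho)
 qed
 finally show "inner (i (conv (rho1 m) F t)) (i v) = - (A (conv (rho m) U t) v + chi m t * b v)" .
next
 show "continuous_on {0..T} (conv (rho1 m) U)"
 proof (rule iffD2[OF continuous_on_cong[OF refl] conv_one_continuous])
  show "iint T (conv (rho2 m) U)" by (rule conv_integrable(1)[OF rho_iint(3) U_iint]) simp
  show "conv (rho1 m) U t = prim (conv (rho2 m) U) t" if "t \<in> {0..T}" for t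
   using conv_one_kernel(1)[OF U_iint rho_continuous(3), of t m] that conv_cong[of t "prim (rho2 m)" "rho1 m" U U]
   by (simp add: conv_one_rho2)
 qed
 show "(LI s<T. nsq (i (conv (rho m) U s))) <= M0"
 proof -
  obtain C where C: "!!s. [|0 < s; s < T|] ==> \<bar>rho m s\<bar> <= C" using continuous_bounded_on[OF rho_continuous(1)] by metis
  have "(LI s<T. \<bar>rho m s\<bar>) = prim (rho m) T"
   unfolding conv_one using rho_nonneg[OF m] by simp
  also have "... <= 1" using chi_bounds[of m T] T by (simp add: conv_one_rho)
  finally have K: "(LI s<T. \<bar>rho m s\<bar>) <= 1" .
  note L2 = conv_L2[OF rho_measurable(1) rho_nonneg[OF m] C K U_meas U2]
  have I: "iint T (%s. ki\<^sup>2 * nsq (conv (rho m) U s))" using L2(1) by simp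
  have le: "nsq (i v) <= ki\<^sup>2 * nsq v" for v
   unfolding power_mult_distrib[symmetric] by (intro power_mono ki) simp
  have "(LI s<T. nsq (i (conv (rho m) U s))) <= (LI s<T. ki\<^sup>2 * nsq (conv (rho m) U s))"
  proof (rule set_integral_mono[OF set_integrable_bound[OF I] I le])
   show "set_borel_measurable lborel {0<..<T} (%s. nsq (i (conv (rho m) U s)))" unfolding set_borel_measurable_def by measurable
   show "AE s\<in>{0<..<T} in lborel. norm (nsq (i (conv (rho m) U s))) <= norm (ki\<^sup>2 * nsq (conv (rho m) U s))"
    using le by simp
  qed
  also have "... <= M0"
   unfolding M0_def using L2(2) by (simp add: mult_left_mono)
  finally show ?thesis .
 qed
qed

definition yn where "yn m th t = conv (pk th) (conv (rho1 m) F) t"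
definition yn' where "yn' m th t = conv (pk th) (conv (rho2 m) F) t"

lemma uniform_estimates:
 obtains K where "K \<ge> 0"
  "!!m. m > 0 ==> (PI t|ivl T. (NI th|M. nsq (yn m th t))) <= ennreal K"
  "!!m. m > 0 ==> (NI t|ivl T. nsq (i (conv (rho1 m) F t))) <= ennreal K"
  "!!m t. [|m > 0; t \<in> {0..T}|] ==> (NI th|M. th * nsq (i (yn m th t))) <= ennreal K"
  "!!m. m > 0 ==> (PI t|ivl T. (NI th|M. (1 - th) * nsq (i (yn' m th t)))) <= ennreal K"
  "!!m t. [|m > 0; t \<in> {0..T}|] ==> nsq (conv (rho m) U t) <= K"
proof -
 have "\<exists>K\<ge>0. \<forall>m>0. (PI t|ivl T. (NI th|M. nsq (yn m th t))) <= ennreal K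
  \<and> (NI t|ivl T. nsq (i (conv (rho1 m) F t))) <= ennreal K
  \<and> (\<forall>t\<in>{0..T}. (NI th|M. th * nsq (i (yn m th t))) <= ennreal K)
  \<and> (PI t|ivl T. (NI th|M. (1 - th) * nsq (i (yn' m th t)))) <= ennreal K
  \<and> (\<forall>t\<in>{0..T}. nsq (conv (rho m) U t) <= K)"
 proof -
  \<comment> \<open>\<open>KK\<close> and \<open>R\<close> mention neither the kernel nor the
    mollified functions, so the values taken from the instance \<open>m = 1\<close> are valid for
    every \<open>m\<close>.\<close>
  interpret S: smooth_flow i A b C1 C2 al T "conv (rho1 1) F" "conv (rho2 1) F" "conv (rho 1) U" "conv (rho1 1) U" "chi 1" "rho 1" M0
   by (rule smooth) simp
  define K where "K = max 0 (max ((8 * S.KK * T + 4 * S.KK) / C1) (max (4 * S.KK) (max (8 * S.R) (max (2 * S.R) (4 * S.R / C1)))))"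
  have K: "0 <= K" "(8 * S.KK * T + 4 * S.KK) / C1 <= K" "4 * S.KK <= K" "8 * S.R <= K" "2 * S.R <= K" "4 * S.R / C1 <= K"
   by (auto simp: K_def)
  show ?thesis
  proof (intro exI[of _ K] conjI allI impI ballI K(1))
   fix m :: real assume "m > 0"
   then interpret m: smooth_flow i A b C1 C2 al T "conv (rho1 m) F" "conv (rho2 m) F" "conv (rho m) U" "conv (rho1 m) U" "chi m" "rho m" M0
    by (rule smooth)
   note e = m.nn_estimates[unfolded m.y_def m.y'_def, folded yn_def yn'_def] m.second_estimate(2)
   show "(PI t|ivl T. (NI th|M. nsq (yn m th t))) <= ennreal K"
    by (rule order_trans[OF e(1) ennreal_leI]) (use K in simp)
   show "(NI t|ivl T. nsq (i (conv (rho1 m) F t))) <= ennreal K"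
    by (rule order_trans[OF e(2) ennreal_leI]) (use K in simp)
   show "(NI th|M. th * nsq (i (yn m th t))) <= ennreal K" if "t \<in> {0..T}" for t
    by (rule order_trans[OF e(3)[OF that] ennreal_leI]) (use K in simp)
   show "(PI t|ivl T. (NI th|M. (1 - th) * nsq (i (yn' m th t)))) <= ennreal K"
    by (rule order_trans[OF e(4) ennreal_leI]) (use K in simp)
   show "nsq (conv (rho m) U t) <= K" if "t \<in> {0..T}" for t
    using e(5)[OF that] K by simp
  qed
 qed
 then obtain K where "K \<ge> 0 \<and> (\<forall>m>0. (PI t|ivl T. (NI th|M. nsq (yn m th t))) <= ennreal K
  \<and> (NI t|ivl T. nsq (i (conv (rho1 m) F t))) <= ennreal K
  \<and> (\<forall>t\<in>{0..T}. (NI th|M. th * nsq (i (yn m th t))) <= ennreal K)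
  \<and> (PI t|ivl T. (NI th|M. (1 - th) * nsq (i (yn' m th t)))) <= ennreal K
  \<and> (\<forall>t\<in>{0..T}. nsq (conv (rho m) U t) <= K))" by blast
 thus ?thesis by (intro that[of K]) auto
qed

end

text \<open>A bound on the liminf bounds the norms only infinitely often; that is enough to
  contradict an inequality that holds eventually. The sequence need not be bounded.\<close>

lemma weak_limit_bound:
 fixes a :: "nat => 'h::real_inner"
 assumes lim: "(%n. inner (a n) v) ----> l" and C: "liminf (%n. ennreal (nsq (a n))) < ennreal (C\<^sup>2)" "C \<ge> 0"
 shows "l <= C * norm v"
proof (rule ccontr)
 assume "\<not> ?thesis"
 hence ev: "\<forall>\<^sub>F n in sequentially. C * norm v < inner (a n) v" using order_tendstoD(1)[OF lim] by simp
 have "\<exists>\<^sub>F n in sequentially. norm (a n) <= C"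
 proof (rule ccontr)
  assume "\<not> ?thesis"
  hence "\<forall>\<^sub>F n in sequentially. C < norm (a n)" by (simp add: not_frequently not_le)
  hence "\<forall>\<^sub>F n in sequentially. ennreal (C\<^sup>2) <= ennreal (nsq (a n))"
   by eventually_elim (use C in "auto intro!: ennreal_leI power_mono")
  hence "ennreal (C\<^sup>2) <= liminf (%n. ennreal (nsq (a n)))" by (rule Liminf_bounded)
  with C(1) show False by simp
 qed
 from frequently_eventually_frequently[OF this ev]
 obtain n where n: "norm (a n) <= C" "C * norm v < inner (a n) v" using frequently_ex by blast
 have "inner (a n) v <= norm (a n) * norm v" by (rule norm_cauchy_schwarz)
 also have "... <= C * norm v" using n(1) by (intro mult_right_mono) auto
 finally show False using n(2) by simp
qed

text \<open>Weak lower semicontinuity of the norm. Convergence is tested on a dense set only, and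
  the liminf may be infinite, so no bound on the sequence has to be known beforehand.\<close>

lemma weak_liminf_le:
 fixes h :: "'h::real_inner"
 assumes dense: "closure D = UNIV" and lim: "!!v. v \<in> D ==> (%n. inner (a n) v) ----> inner h v"
 shows "ennreal (nsq h) <= liminf (%n. ennreal (nsq (a n)))"
proof (rule ccontr)
 assume "\<not> ?thesis"
 hence "liminf (%n. ennreal (nsq (a n))) < ennreal (nsq h)" by (simp add: not_le)
 from dense_order_class.dense[OF this]
 obtain c where c: "liminf (%n. ennreal (nsq (a n))) < c" "c < ennreal (nsq h)" by blast
 obtain c' where c': "c = ennreal c'" "c' \<ge> 0" using c(2) by (cases c) auto
 define C where "C = sqrt c'"
 have C: "C \<ge> 0" "c = ennreal (C\<^sup>2)" using c' by (auto simp: C_def)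
 have "norm h <= C"
  by (rule dense_norm_le[OF dense _ C(1)]) (rule weak_limit_bound[OF lim], use c(1) C in auto)
 hence "ennreal (nsq h) <= c" unfolding C(2) by (intro ennreal_leI power_mono) auto
 with c(2) show False by simp
qed

lemma nn_integral_Mw_measurable:
 fixes f :: "real \<times> real => ennreal"
 assumes a: "0 < a" "a < 1" and f: "f \<in> bm (borel *M borel)"
 shows "(%t. PI th|Mw a. f (th, t)) \<in> bm borel"
proof -
 interpret finite_measure "Mw a" by (rule prob_space_Mw(2)[OF a])
 have "f \<in> bm (Mw a *M borel)" by (rule measurable_pair_Mw[OF f])
 hence "(%(t, th). f (th, t)) \<in> bm (borel *M Mw a)"
  by (rule measurable_pair_swap)
 thus ?thesis by (rule borel_measurable_nn_integral)
qed

context weak_flow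
begin

lemma us_measurable [measurable]: "(%x. us (fst x) (snd x)) \<in> bm (borel *M borel)"
proof -
 have [measurable]: "(%x. conv (pk (fst x)) F (snd x)) \<in> bm (borel *M borel)"
  using conv_measurable_param[OF pk_measurable F_measurable] by (simp add: split_beta')
 show ?thesis unfolding us_def by measurable
qed

lemma yn_measurable [measurable]: "(%x. yn m (fst x) (snd x)) \<in> bm (borel *M borel)"
  "(%x. yn' m (fst x) (snd x)) \<in> bm (borel *M borel)"
 using conv_measurable_param[OF pk_measurable, of "conv (rho1 m) F"] conv_measurable_param[OF pk_measurable, of "conv (rho2 m) F"]
 by (simp_all add: split_beta' yn_def yn'_def)

text \<open>Removes the derivatives of the kernel from \<open>yn\<close>: in this form only
  \<open>rho m\<close> acts on \<open>F\<close>, and the limit in \<open>m\<close> can be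
  taken.\<close>

lemma yn_eq:
 assumes th: "0 < th" "th < 1" and t: "t \<in> {0..T}"
 shows "yn m th t = c0 th *R conv (rho m) F t - c1 th *R conv (pk th) (conv (rho m) F) t"
  and "yn' m th t = c0 th *R conv (rho1 m) F t - c1 th *R yn m th t"
proof -
 have e1: "prim (conv (rho1 m) F) s = conv (rho m) F s" if "s \<in> {0..T}" for s
  using conv_one_kernel(1)[OF F_iint rho_continuous(2), of s m] that conv_cong[of s "prim (rho1 m)" "rho m" F F]
  by (simp add: conv_one_rho1)
 have e2: "prim (conv (rho2 m) F) s = conv (rho1 m) F s" if "s \<in> {0..T}" for s
  using conv_one_kernel(1)[OF F_iint rho_continuous(3), of s m] that conv_cong[of s "prim (rho2 m)" "rho1 m" F F]
  by (simp add: conv_one_rho2)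
 have i1: "iint t (conv (rho1 m) F)" and i2: "iint t (conv (rho2 m) F)"
  by (rule conv_integrable(1)[OF rho_iint(2) F_iint], use t in simp) (rule conv_integrable(1)[OF rho_iint(3) F_iint], use t in simp)
 have "yn m th t = c0 th *R prim (conv (rho1 m) F) t - c1 th *R conv (pk th) (prim (conv (rho1 m) F)) t"
  unfolding yn_def by (rule conv_pk_ode(2)[OF th _ i1]) (use t in simp)
 also have "conv (pk th) (prim (conv (rho1 m) F)) t = conv (pk th) (conv (rho m) F) t"
  by (rule conv_cong) (use t e1 in auto)
 finally show "yn m th t = c0 th *R conv (rho m) F t - c1 th *R conv (pk th) (conv (rho m) F) t"
  by (simp only: e1[OF t])
 have "yn' m th t = c0 th *R prim (conv (rho2 m) F) t - c1 th *R conv (pk th) (prim (conv (rho2 m) F)) t"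
  unfolding yn'_def by (rule conv_pk_ode(2)[OF th _ i2]) (use t in simp)
 also have "conv (pk th) (prim (conv (rho2 m) F)) t = yn m th t"
  unfolding yn_def by (rule conv_cong) (use t e2 in auto)
 finally show "yn' m th t = c0 th *R conv (rho1 m) F t - c1 th *R yn m th t"
  by (simp only: e2[OF t])
qed

text \<open>For fixed \<open>th\<close> the kernel is bounded by \<open>c0 th\<close>, so
  convergence of the mollified \<open>F\<close> in the mean gives convergence at every
  \<open>t\<close>.\<close>

lemma conv_pk_rho_tendsto:
 assumes th: "0 < th" "th < 1" and t: "t \<in> {0..T}"
 shows "(%n. conv (pk th) (conv (rho (real (Suc n))) F) t) ----> conv (pk th) F t"
proof (rule metric_tendsto_imp_tendsto)
 show "(%n. c0 th * moll_err T n F) ----> 0"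
  using tendsto_mult_left[OF moll_err_tendsto[OF _ F_iint[OF order_refl]], of "c0 th"] T by simp
 have tT: "t <= T" using t by simp
 show "\<forall>\<^sub>F n in sequentially. dist (conv (pk th) (conv (rho (real (Suc n))) F) t) (conv (pk th) F t) <= dist (c0 th * moll_err T n F) 0"
 proof (rule always_eventually, rule allI)
  fix n
  note I = conv_integrable(1)[OF rho_iint(1) F_iint[OF tT], of "real (Suc n)"]
  note D = set_integral_diff(1)[OF I F_iint[OF tT]]
  note D' = moll_integrable(2)[OF F_iint[OF order_refl], of "real (Suc n)"]
  have c0: "c0 th \<ge> 0" using th by (simp add: c0_def)
  have "conv (pk th) (conv (rho (real (Suc n))) F) t - conv (pk th) F t = conv (pk th) (%s. conv (rho (real (Suc n))) F s - F s) t"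
   by (rule conv_diff_right[OF iint_conv_continuous[OF pk_continuous I] iint_conv_continuous[OF pk_continuous F_iint[OF tT]], symmetric])
  also have "norm ... <= c0 th * (LI s<t. norm (conv (rho (real (Suc n))) F s - F s))"
   by (rule conv_bounded[OF pk_measurable1 _ D c0]) (use pk_le[OF th] in simp)
  also have "... <= c0 th * moll_err T n F"
   unfolding moll_err_def set_int
   by (rule mult_left_mono[OF integral_mono c0]) (use set_integrable_norm[OF D] D' tT in "auto simp: set_integrable_def indicator_def")
  finally show "dist (conv (pk th) (conv (rho (real (Suc n))) F) t) (conv (pk th) F t) <= dist (c0 th * moll_err T n F) 0"
   using moll_err_nonneg[of T n F] c0 by (simp add: dist_norm)
 qed
qed

text \<open>The times at which the Caputo derivative, a priori a functional on \<open>X\<close>, is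
  bounded in the norm of \<open>H\<close>. Almost every time is of this kind, as
  \<open>limit_estimates\<close> shows; elsewhere \<open>h\<close> gets the value 0, which keeps it
  Borel measurable.\<close>

definition GS where "GS = {t. \<exists>C. \<forall>v. \<bar>w t v\<bar> <= C * norm (i v)}"
definition h where "h t = (if t \<in> GS then SOME h. \<forall>v. w t v = inner h (i v) else 0)"

lemma w_linear: "bounded_linear (w t)"
proof -
 interpret A: bounded_bilinear A by (rule A)
 show ?thesis unfolding w_def by (intro bounded_linear_minus bounded_linear_add A.bounded_linear_right b)
qed

text \<open>The constant may be taken to be a natural number, and by continuity the bound need only
  be checked on a countable dense set.\<close>

lemma GS_measurable [measurable]: "GS \<in> sets borel"
proof -
 obtain D :: "'x set" where D: "countable D" "closure D = UNIV" by (rule countable_dense_closure)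
 have "GS = (\<Union>n::nat. {t. \<forall>v\<in>D. \<bar>w t v\<bar> <= real n * norm (i v)})"
 proof (intro set_eqI iffI)
  fix t assume "t \<in> GS"
  then obtain C where C: "!!v. \<bar>w t v\<bar> <= C * norm (i v)" by (auto simp: GS_def)
  obtain n where n: "C <= real n" using real_arch_simple by blast
  have "\<bar>w t v\<bar> <= real n * norm (i v)" for v
   using C[of v] mult_right_mono[OF n, of "norm (i v)"] by simp
  thus "t \<in> (\<Union>n::nat. {t. \<forall>v\<in>D. \<bar>w t v\<bar> <= real n * norm (i v)})" by blast
 next
  fix t assume "t \<in> (\<Union>n::nat. {t. \<forall>v\<in>D. \<bar>w t v\<bar> <= real n * norm (i v)})"
  then obtain n :: nat where n: "!!v. v \<in> D ==> \<bar>w t v\<bar> <= real n * norm (i v)" by blast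
  have "\<bar>w t v\<bar> <= real n * norm (i v)" for v
  proof -
   have "v \<in> closure D" using D by simp
   then obtain x where x: "!!k. x k \<in> D" "x ----> v" unfolding closure_sequential by blast
   have "(%k. \<bar>w t (x k)\<bar>) ----> \<bar>w t v\<bar>" by (intro tendsto_rabs bounded_linear.tendsto[OF w_linear] x)
   moreover have "(%k. real n * norm (i (x k))) ----> real n * norm (i v)"
    by (intro tendsto_mult tendsto_const tendsto_norm bounded_linear.tendsto[OF i] x)
   ultimately show ?thesis by (rule LIMSEQ_le) (use n x in auto)
  qed
  thus "t \<in> GS" by (auto simp: GS_def)
 qed
 moreover have "{t. \<forall>v\<in>D. \<bar>w t v\<bar> <= real n * norm (i v)} \<in> sets borel" for n :: nat
 proof -
  have "{t \<in> space borel. \<forall>v\<in>D. \<bar>w t v\<bar> <= real n * norm (i v)} \<in> sets borel"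
  proof (rule sets.sets_Collect_countable_All')
   show "{t \<in> space borel. \<bar>w t v\<bar> <= real n * norm (i v)} \<in> sets borel" for v by measurable
  qed (rule D(1))
  thus ?thesis by simp
 qed
 ultimately show ?thesis by auto
qed

lemma h_eq: assumes "t \<in> GS" shows "inner (h t) (i v) = w t v"
proof -
 obtain C where C: "!!v. \<bar>w t v\<bar> <= C * norm (i v)" using assms by (auto simp: GS_def)
 obtain h' where "!!v. w t v = inner h' (i v)"
  by (rule riesz_through_embedding[OF bounded_linear.linear[OF i] bounded_linear.linear[OF w_linear] C]) (rule that)
 hence ex: "\<exists>h. \<forall>v. w t v = inner h (i v)" by blast
 have e: "h t = (SOME h. \<forall>v. w t v = inner h (i v))" using assms by (simp only: h_def if_True)
 have "\<forall>v. w t v = inner (h t) (i v)" unfolding e by (rule someI_ex[OF ex])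
 thus ?thesis by (rule allE) (erule sym)
qed

lemma h_measurable [measurable]: "h \<in> bm borel"
proof (rule weakly_measurable)
 fix a
 have "a \<in> closure (range i)" using dense by simp
 then obtain x where x: "!!k. x k \<in> range i" "x ----> a" unfolding closure_sequential by blast
 hence "\<forall>k. \<exists>v. x k = i v" by auto
 then obtain v where v: "!!k. x k = i (v k)" by metis
 show "(%t. inner (h t) a) \<in> bm borel"
 proof (rule borel_measurable_LIMSEQ_real)
  show "(%k. inner (h t) (x k)) ----> inner (h t) a" for t by (intro tendsto_inner tendsto_const x)
  have "(%t. inner (h t) (x k)) = (%t. if t \<in> GS then w t (v k) else 0)" for k
   by (auto simp: fun_eq_iff v h_eq) (simp add: h_def)
  thus "(%t. inner (h t) (x k)) \<in> bm borel" for k by simp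
 qed
qed

text \<open>Two modes of convergence are combined. For almost every \<open>t\<close> and all
  \<open>th\<close> the functions \<open>yn\<close> converge strongly in \<open>X\<close>, and
  Fatou's lemma applies to them directly. The mollified Caputo derivative converges only when paired
  with elements of \<open>range i\<close>, and is treated through
  \<open>weak_liminf_le\<close>.\<close>

lemma limit_estimates:
 obtains K where "K \<ge> 0"
  "(NI t|ivl T. nsq (h t)) <= ennreal K"
  "AE t in ivl T. \<forall>v. inner (h t) (i v) = w t v"
  "(PI t|ivl T. (NI th|M. nsq (us th t))) <= ennreal K"
  "AE t in ivl T. (NI th|M. th * nsq (i (us th t))) <= ennreal K"
  "(PI t|ivl T. (NI th|M. (1 - th) * nsq (c0 th *R h t - c1 th *R i (us th t)))) <= ennreal K"
  "AE t in ivl T. nsq (U t) <= K"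
proof -
 interpret A: bounded_bilinear A by (rule A)
 note il = linear_simps[OF i]
 obtain K where K: "K \<ge> 0"
  "!!m. m > 0 ==> (PI t|ivl T. (NI th|M. nsq (yn m th t))) <= ennreal K"
  "!!m. m > 0 ==> (NI t|ivl T. nsq (i (conv (rho1 m) F t))) <= ennreal K"
  "!!m t. [|m > 0; t \<in> {0..T}|] ==> (NI th|M. th * nsq (i (yn m th t))) <= ennreal K"
  "!!m. m > 0 ==> (PI t|ivl T. (NI th|M. (1 - th) * nsq (i (yn' m th t)))) <= ennreal K"
  "!!m t. [|m > 0; t \<in> {0..T}|] ==> nsq (conv (rho m) U t) <= K"
  by (rule uniform_estimates) (rule that)
 obtain r where r: "strict_mono r"
  "AE t in ivl T. (%n. conv (rho (real (Suc (r n)))) F t) ----> F t"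
  "AE t in ivl T. (%n. conv (rho (real (Suc (r n)))) U t) ----> U t"
  by (rule moll_AE_subseq[OF less_imp_le[OF T] F_iint[OF order_refl] U_iint[OF order_refl]]) (rule that)
 define m where "m n = real (Suc (r n))" for n
 have m0: "m n > 0" for n by (simp add: m_def)
 let ?I = "ivl T"
 have sp: "t \<in> {0..T}" "0 < t" "t < T" if "t \<in> space ?I" for t using that by (auto simp: space_restrict_space)
 define good where "good t \<longleftrightarrow> t \<in> space ?I \<and> (%n. conv (rho (m n)) F t) ----> F t \<and> (%n. conv (rho (m n)) U t) ----> U t" for t
 have good: "AE t in ?I. good t"
  using r(2) r(3) AE_space[of ?I] unfolding good_def m_def by eventually_elim blast
 have y_lim: "(%n. yn (m n) th t) ----> us th t" if g: "good t" and th: "0 < th" "th < 1" for th t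
 proof -
  have t: "t \<in> {0..T}" using g sp(1) unfolding good_def by blast
  have "(%n. conv (pk th) (conv (rho (m n)) F) t) ----> conv (pk th) F t"
   using LIMSEQ_subseq_LIMSEQ[OF conv_pk_rho_tendsto[OF th t] r(1)] by (simp add: m_def o_def)
  thus ?thesis
   unfolding yn_eq(1)[OF th t] us_def using g by (intro tendsto_intros) (auto simp: good_def)
 qed
 have G_lim: "(%n. inner (i (conv (rho1 (m n)) F t)) (i v)) ----> w t v" if g: "good t" for t v
 proof -
  have t: "t \<in> {0..T}" and t0: "t > 0" using g sp(1,2) unfolding good_def by blast+
  have e: "inner (i (conv (rho1 (m n)) F t)) (i v) = - (A (conv (rho (m n)) U t) v + chi (m n) t * b v)" for n
   by (rule smooth_flow.eq[OF smooth[OF m0] t])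
  have "(%n. chi (m n) t) ----> 1"
   using LIMSEQ_subseq_LIMSEQ[OF chi_tendsto[OF t0] r(1)] by (simp add: m_def o_def)
  hence "(%n. - (A (conv (rho (m n)) U t) v + chi (m n) t * b v)) ----> - (A (U t) v + 1 * b v)"
   using g by (intro tendsto_intros A.tendsto) (auto simp: good_def)
  thus ?thesis unfolding e w_def by simp
 qed
 \<comment> \<open>Finite almost everywhere by Fatou's lemma; where it is finite, the functional
   \<open>w t\<close> is bounded in the norm of \<open>H\<close>.\<close>
 define L where "L t = liminf (%n. ennreal (nsq (i (conv (rho1 (m n)) F t))))" for t
 have Gm: "(%t. ennreal (nsq (i (conv (rho1 (m n)) F t)))) \<in> bm ?I" for n
  by (rule interval_measurable) measurable
 have Lm: "L \<in> bm ?I" unfolding L_def[abs_def] using Gm by measurable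
 have "(PI t|?I. L t) <= ennreal K"
  by (rule nn_fatou[OF Gm]) (use K(3)[OF m0] in "auto simp: L_def")
 hence "(PI t|?I. L t) \<noteq> \<infinity>" by (auto simp: top_unique)
 hence L_fin: "AE t in ?I. L t \<noteq> \<infinity>" by (rule nn_integral_PInf_AE[OF Lm])
 have GS: "AE t in ?I. good t \<and> t \<in> GS"
  using good L_fin
 proof eventually_elim
  case (elim t)
  obtain c where c: "L t = ennreal c" "c \<ge> 0" using elim(2) by (cases "L t") auto
  \<comment> \<open>The summand 1 makes the square of \<open>C\<close> strictly larger than the
    liminf, as \<open>weak_limit_bound\<close> requires.\<close>
  define C where "C = sqrt (c + 1)"
  have C: "L t < ennreal (C\<^sup>2)" "C \<ge> 0" using c by (auto simp: C_def ennreal_lessI)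
  have bd: "w t v <= C * norm (i v)" for v
   by (rule weak_limit_bound[OF G_lim[OF elim(1)] C[unfolded L_def]])
  have "\<bar>w t v\<bar> <= C * norm (i v)" for v
   using bd[of v] bd[of "- v"] linear_simps(4)[OF w_linear, of t v] il(4)[of v] by (simp add: abs_le_iff)
  with elim(1) show ?case by (auto simp: GS_def)
 qed
 show ?thesis
 proof (rule that[OF K(1)])
  show AEh: "AE t in ?I. \<forall>v. inner (h t) (i v) = w t v" using GS by eventually_elim (simp add: h_eq)
  have h_le: "AE t in ?I. ennreal (nsq (h t)) <= L t"
   using GS
  proof eventually_elim
   case (elim t)
   show ?case unfolding L_def
    by (rule weak_liminf_le[OF dense]) (use G_lim elim h_eq in auto)
  qed
  show "(NI t|?I. nsq (h t)) <= ennreal K"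
   by (rule nn_fatou[OF Gm h_le[unfolded L_def]]) (rule K(3)[OF m0])
  have ym: "(%th. yn k th t) \<in> bm borel" "(%th. yn' k th t) \<in> bm borel" for k t
  proof -
   have 1: "(%th. (th, t)) \<in> borel \<rightarrow>\<^sub>M borel *M borel" by measurable
   show "(%th. yn k th t) \<in> bm borel" "(%th. yn' k th t) \<in> bm borel"
    using measurable_compose[OF 1 yn_measurable(1)] measurable_compose[OF 1 yn_measurable(2)] by simp_all
  qed
  show "(PI t|?I. (NI th|M. nsq (us th t))) <= ennreal K"
  proof (rule nn_fatou)
   show "(%t. NI th|M. nsq (yn (m n) th t)) \<in> bm ?I" for n
    by (rule interval_measurable)
     (use nn_integral_Mw_measurable[OF al, of "%x. ennreal (nsq (yn (m n) (fst x) (snd x)))"] in simp)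
   show "AE t in ?I. (NI th|M. nsq (us th t)) <= liminf (%n. NI th|M. nsq (yn (m n) th t))"
    using good
   proof eventually_elim
    case (elim t)
    have "(NI th|M. nsq (us th t)) <= (PI th|M. liminf (%n. ennreal (nsq (yn (m n) th t))))"
    proof (rule nn_integral_mono)
     fix th assume "th \<in> space M"
     hence "(%n. ennreal (nsq (yn (m n) th t))) ----> ennreal (nsq (us th t))"
      by (intro tendsto_intros y_lim[OF elim]) auto
     thus "ennreal (nsq (us th t)) <= liminf (%n. ennreal (nsq (yn (m n) th t)))"
      by (rule eq_refl[OF lim_imp_Liminf[symmetric], rotated]) simp
    qed
    also have "... <= liminf (%n. NI th|M. nsq (yn (m n) th t))"
     by (rule nn_integral_liminf) (rule bm_weighted, use ym in measurable)
    finally show ?case .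
   qed
  qed (rule K(2)[OF m0])
  show "AE t in ?I. (NI th|M. th * nsq (i (us th t))) <= ennreal K"
   using good
  proof eventually_elim
   case (elim t)
   have t: "t \<in> {0..T}" using elim sp(1) unfolding good_def by blast
   show ?case
   proof (rule nn_fatou)
    show "(%th. ennreal (th * nsq (i (yn (m n) th t)))) \<in> bm M" for n
     by (rule bm_weighted) (use ym in measurable)
    show "AE th in M. ennreal (th * nsq (i (us th t))) <= liminf (%n. ennreal (th * nsq (i (yn (m n) th t))))"
    proof (rule AE_I2)
     fix th assume "th \<in> space M"
     hence "(%n. ennreal (th * nsq (i (yn (m n) th t)))) ----> ennreal (th * nsq (i (us th t)))"
      by (intro tendsto_intros bounded_linear.tendsto[OF i] y_lim[OF elim]) auto
     thus "ennreal (th * nsq (i (us th t))) <= liminf (%n. ennreal (th * nsq (i (yn (m n) th t))))"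
      by (rule eq_refl[OF lim_imp_Liminf[symmetric], rotated]) simp
    qed
   qed (rule K(4)[OF m0 t])
  qed
  show "(PI t|?I. (NI th|M. (1 - th) * nsq (c0 th *R h t - c1 th *R i (us th t)))) <= ennreal K"
  proof (rule nn_fatou)
   show "(%t. NI th|M. (1 - th) * nsq (i (yn' (m n) th t))) \<in> bm ?I" for n
    by (rule interval_measurable)
     (use nn_integral_Mw_measurable[OF al, of "%x. ennreal ((1 - fst x) * nsq (i (yn' (m n) (fst x) (snd x))))"] in simp)
   show "AE t in ?I. (NI th|M. (1 - th) * nsq (c0 th *R h t - c1 th *R i (us th t)))
    <= liminf (%n. NI th|M. (1 - th) * nsq (i (yn' (m n) th t)))"
    using GS
   proof eventually_elim
    case (elim t)
    hence g: "good t" and gs: "t \<in> GS" by auto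
    have t: "t \<in> {0..T}" using g sp(1) unfolding good_def by blast
    have "(NI th|M. (1 - th) * nsq (c0 th *R h t - c1 th *R i (us th t)))
      <= (PI th|M. liminf (%n. ennreal ((1 - th) * nsq (i (yn' (m n) th t)))))"
    proof (rule nn_integral_mono)
     fix th assume "th \<in> space M"
     hence th: "0 < th" "th < 1" by auto
     \<comment> \<open>The weight is moved into the norm, so that weak lower semicontinuity applies
       to the weighted vectors.\<close>
     have s: "(1 - th) * nsq z = nsq (sqrt (1 - th) *R z)" for z :: 'h
      using th by (simp add: power_mult_distrib)
     show "ennreal ((1 - th) * nsq (c0 th *R h t - c1 th *R i (us th t))) <= liminf (%n. ennreal ((1 - th) * nsq (i (yn' (m n) th t))))"
      unfolding s
     proof (rule weak_liminf_le[OF dense])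
      fix z assume "z \<in> range i"
      then obtain v where v: "z = i v" by auto
      have e: "inner (i (yn' (m n) th t)) z = c0 th * inner (i (conv (rho1 (m n)) F t)) (i v) - c1 th * inner (i (yn (m n) th t)) (i v)" for n
       unfolding yn_eq(2)[OF th t] v by (simp add: il inner_diff_left)
      have "(%n. c0 th * inner (i (conv (rho1 (m n)) F t)) (i v) - c1 th * inner (i (yn (m n) th t)) (i v)) ----> c0 th * w t v - c1 th * inner (i (us th t)) (i v)"
       by (intro tendsto_intros G_lim[OF g] bounded_linear.tendsto[OF i] y_lim[OF g th])
      moreover have "c0 th * w t v - c1 th * inner (i (us th t)) (i v) = inner (c0 th *R h t - c1 th *R i (us th t)) z"
       by (simp add: v inner_diff_left h_eq[OF gs])
      ultimately have "(%n. inner (i (yn' (m n) th t)) z) ----> inner (c0 th *R h t - c1 th *R i (us th t)) z"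
       unfolding e by simp
      thus "(%n. inner (sqrt (1 - th) *R i (yn' (m n) th t)) z) ----> inner (sqrt (1 - th) *R (c0 th *R h t - c1 th *R i (us th t))) z"
       unfolding inner_scaleR_left by (rule tendsto_mult_left)
     qed
    qed
    also have "... <= liminf (%n. NI th|M. (1 - th) * nsq (i (yn' (m n) th t)))"
     by (rule nn_integral_liminf) (rule bm_weighted, use ym in measurable)
    finally show "(NI th|M. (1 - th) * nsq (c0 th *R h t - c1 th *R i (us th t)))
    <= liminf (%n. NI th|M. (1 - th) * nsq (i (yn' (m n) th t)))" .
   qed
  qed (rule K(5)[OF m0])
  show "AE t in ?I. nsq (U t) <= K"
   using good
  proof eventually_elim
   case (elim t)
   have t: "t \<in> {0..T}" using elim sp(1) unfolding good_def by blast
   have "(%n. nsq (conv (rho (m n)) U t)) ----> nsq (U t)"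
    using elim by (intro tendsto_intros) (simp add: good_def)
   thus ?case by (rule LIMSEQ_le_const2) (use K(6)[OF m0 t] in auto)
  qed
 qed
qed

end

section \<open>Distributional derivatives\<close>

text \<open>Because \<open>rho m\<close> is the integral of \<open>rho1 m\<close>, every
  mollification of \<open>f\<close> factors through \<open>prim f\<close> and vanishes. The
  mollification error is then the integral of the norm of \<open>f\<close>, and it tends to
  0.\<close>

lemma AE_zero_of_conv_one:
 assumes T: "T \<ge> 0" and f: "iint T f" and z: "!!t. [|0 < t; t < T|] ==> prim f t = 0"
 shows "AE t in ivl T. f t = 0"
proof -
 have c0: "conv (rho m) f t = 0" if "0 < t" "t < T" for m t
 proof -
  have "conv (rho m) f t = conv (prim (rho1 m)) f t"
   by (rule conv_cong) (auto simp: conv_one_rho1)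
  also have "... = conv (rho1 m) (prim f) t"
   by (rule conv_one_kernel(2)[symmetric, OF iint_mono[OF f] rho_continuous(2)]) (use that in simp)
  also have "... = conv (rho1 m) (%_. 0) t"
   by (rule conv_cong) (use z that in auto)
  also have "... = 0" by (simp add: conv_def set_int)
  finally show ?thesis .
 qed
 have "moll_err T n f = (LI t<T. norm (f t))" for n
  unfolding moll_err_def by (rule set_lebesgue_integral_cong) (use c0 in auto)
 hence "(LI t<T. norm (f t)) = 0"
  using moll_err_tendsto[OF T f] by (simp add: LIMSEQ_const_iff)
 hence "(LI t|ivl T. norm (f t)) = 0" by (simp add: integral_interval)
 thus ?thesis
  using integral_nonneg_eq_0_iff_AE[of "ivl T" "%t. norm (f t)"] f by (simp add: iint_iff[symmetric])
qed

lemma AE_eq_of_conv_one: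
 assumes T: "T \<ge> 0" and f: "iint T f" and g: "iint T g"
  and e: "!!t. [|0 < t; t < T|] ==> prim f t = prim g t"
 shows "AE t in ivl T. f t = g t"
proof -
 have "AE t in ivl T. f t - g t = 0"
 proof (rule AE_zero_of_conv_one[OF T set_integral_diff(1)[OF f g]])
  fix t assume t: "0 < t" "t < T"
  have "prim (%s. f s - g s) t = prim f t - prim g t"
   by (rule conv_diff_right) (use iint_mono[OF f] iint_mono[OF g] t in auto)
  thus "prim (%s. f s - g s) t = 0" using e[OF t] by simp
 qed
 thus ?thesis by simp
qed

text \<open>Products of a factor that vanishes before \<open>a\<close> and one that vanishes after
  \<open>b\<close>. Differentiation raises the indices and produces linear combinations, so closing
  the family under both makes infinite differentiability an induction.\<close>

inductive_set bumps :: "real => (real => real) set" for T :: real where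
 base: "[|0 < a; a < b; b < T; n > 0|] ==> (%t. ebump k (n * (t - a)) * ebump l (n * (b - t))) \<in> bumps T"
| add: "[|f \<in> bumps T; g \<in> bumps T|] ==> (%t. f t + g t) \<in> bumps T"
| scale: "f \<in> bumps T ==> (%t. c * f t) \<in> bumps T"

lemma bumps_deriv: "f \<in> bumps T ==> \<exists>f'\<in>bumps T. \<forall>t. (f has_real_derivative f' t) (at t)"
proof (induction rule: bumps.induct)
 case (base a b n k l)
 let ?e = "%k l t. ebump k (n * (t - a)) * ebump l (n * (b - t))"
 have mem: "?e k l \<in> bumps T" for k l by (rule bumps.base) fact+
 let ?f' = "%t. (n * ?e (k + 2) l t + (- n * real k) * ?e (k + 1) l t) + ((- n) * ?e k (l + 2) t + (n * real l) * ?e k (l + 1) t)"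
 have "?f' \<in> bumps T" by (intro bumps.add bumps.scale mem)
 moreover have "(?e k l has_real_derivative ?f' t) (at t)" for t
 proof -
  have 1: "((%t. ebump k (n * (t - a))) has_real_derivative (ebump (k + 2) (n * (t - a)) - real k * ebump (k + 1) (n * (t - a))) * n) (at t)"
   by (rule DERIV_chain2[OF DERIV_ebump]) (auto intro!: derivative_eq_intros)
  have 2: "((%t. ebump l (n * (b - t))) has_real_derivative (ebump (l + 2) (n * (b - t)) - real l * ebump (l + 1) (n * (b - t))) * (- n)) (at t)"
   by (rule DERIV_chain2[OF DERIV_ebump]) (auto intro!: derivative_eq_intros)
  show ?thesis
   by (rule DERIV_cong[OF DERIV_mult[OF 1 2]]) (simp add: algebra_simps)
 qed
 ultimately show ?case by (intro bexI[of _ ?f'] allI)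
next
 case (add f g)
 then obtain f' g' where "f' \<in> bumps T" "g' \<in> bumps T" "!!t. (f has_real_derivative f' t) (at t)" "!!t. (g has_real_derivative g' t) (at t)" by auto
 thus ?case by (intro bexI[of _ "%t. f' t + g' t"] allI DERIV_add bumps.add)
next
 case (scale f c)
 then obtain f' where "f' \<in> bumps T" "!!t. (f has_real_derivative f' t) (at t)" by auto
 thus ?case by (intro bexI[of _ "%t. c * f' t"] allI DERIV_cmult bumps.scale)
qed

lemma bumps_support: "f \<in> bumps T ==> \<exists>a b. 0 < a \<and> a < b \<and> b < T \<and> (\<forall>x. x \<notin> {a..b} \<longrightarrow> f x = 0)"
proof (induction rule: bumps.induct)
 case (base a b n k l)
 thus ?case by (intro exI[of _ a] exI[of _ b]) (auto simp: ebump_def zero_less_mult_iff)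
next
 case (add f g)
 then obtain a b a' b' where *: "0 < a" "a < b" "b < T" "\<forall>x. x \<notin> {a..b} \<longrightarrow> f x = 0" "0 < a'" "a' < b'" "b' < T" "\<forall>x. x \<notin> {a'..b'} \<longrightarrow> g x = 0" by blast
 have "f x + g x = 0" if "x \<notin> {min a a'..max b b'}" for x
 proof -
  have "x \<notin> {a..b}" "x \<notin> {a'..b'}" using that by auto
  thus ?thesis using * by simp
 qed
 thus ?case using * by (intro exI[of _ "min a a'"] exI[of _ "max b b'"] conjI allI impI) auto
qed auto

lemma bumps_smooth:
 assumes "\<exists>f'\<in>bumps T. \<forall>t. (f has_real_derivative f' t) (at t)"
 shows "((deriv ^^ n) f) differentiable (at x)" "deriv f \<in> bumps T"
proof -
 have d: "deriv g \<in> bumps T" if g: "\<exists>f'\<in>bumps T. \<forall>t. (g has_real_derivative f' t) (at t)" for g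
 proof -
  obtain f' where f': "f' \<in> bumps T" "\<forall>t. (g has_real_derivative f' t) (at t)" using g by blast
  hence "deriv g = f'" by (auto simp: fun_eq_iff intro: DERIV_imp_deriv)
  thus ?thesis using f' by simp
 qed
 show "deriv f \<in> bumps T" by (rule d[OF assms])
 have "\<exists>f'\<in>bumps T. \<forall>t. (((deriv ^^ n) f) has_real_derivative f' t) (at t)"
  by (induction n) (use assms bumps_deriv[OF d] in auto)
 thus "((deriv ^^ n) f) differentiable (at x)" using real_differentiable_def by blast
qed

lemma bumps_test: "f \<in> bumps T ==> f \<in> test_functions T"
 using bumps_smooth(1)[OF bumps_deriv] bumps_support[of f T] unfolding test_functions_def by blast

lemma test_function_facts:
 assumes "\<phi> \<in> test_functions T"
 shows "(\<phi> has_real_derivative deriv \<phi> t) (at t)" "continuous_on UNIV (deriv \<phi>)" "continuous_on UNIV \<phi>"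
  "t <= 0 ==> \<phi> t = 0" "t \<ge> T ==> \<phi> t = 0"
proof -
 have d: "((deriv ^^ n) \<phi>) differentiable (at x)" for n x using assms by (auto simp: test_functions_def)
 show "(\<phi> has_real_derivative deriv \<phi> t) (at t)" using d[of 0 t] by (auto simp: DERIV_deriv_iff_real_differentiable)
 have "continuous (at x) (deriv \<phi>)" for x using d[of 1 x] by (auto intro: differentiable_imp_continuous_within)
 thus "continuous_on UNIV (deriv \<phi>)" by (simp add: continuous_on_eq_continuous_within)
 have "continuous (at x) \<phi>" for x using d[of 0 x] by (auto intro: differentiable_imp_continuous_within)
 thus "continuous_on UNIV \<phi>" by (simp add: continuous_on_eq_continuous_within)
 show "t <= 0 ==> \<phi> t = 0" "t \<ge> T ==> \<phi> t = 0" using assms by (auto simp: test_functions_def)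
qed

text \<open>Integration by parts read as associativity of convolution, evaluated at \<open>T\<close>
  with the time-reversed kernel.\<close>

lemma integral_by_parts_conv:
 assumes g: "iint T g" and d: "!!t. (\<phi> has_real_derivative \<phi>' t) (at t)" and c: "continuous_on UNIV \<phi>'" and z: "\<phi> T = 0"
 shows "(LI t<T. \<phi>' t *R prim g t) = - (LI t<T. \<phi> t *R g t)"
proof -
 let ?k = "%s. \<phi>' (T - s)"
 have k: "continuous_on UNIV ?k" by (intro continuous_on_compose2[OF c] continuous_intros) auto
 have "(LI t<T. \<phi>' t *R prim g t) = conv ?k (prim g) T"
  by (simp add: conv_def[of ?k])
 also have "... = conv (prim ?k) g T" by (rule conv_one_kernel(2)[OF g k])
 also have "... = conv (%s. - \<phi> (T - s)) g T"
 proof (rule conv_cong[OF _ refl])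
  fix s assume s: "0 < s" "s < T"
  have "prim ?k s = - \<phi> (T - s) - (- \<phi> (T - 0))"
  proof (rule conv_one_FTC[OF _ _ k])
   fix x
   have "((%x. \<phi> (T - x)) has_real_derivative \<phi>' (T - x) * (- 1)) (at x)"
    by (rule DERIV_chain2[OF d]) (auto intro!: derivative_eq_intros)
   from DERIV_minus[OF this] show "((%x. - \<phi> (T - x)) has_real_derivative \<phi>' (T - x)) (at x)" by simp
  qed (use s in simp)
  thus "prim ?k s = - \<phi> (T - s)" using z by simp
 qed
 also have "... = - (LI t<T. \<phi> t *R g t)" by (simp add: conv_def set_int)
 finally show ?thesis .
qed

lemma has_distr_deriv_conv_one:
 assumes f: "iint T f" and g: "iint T g" and e: "AE t in ivl T. f t = prim g t"
 shows "has_distr_deriv T f g"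
 unfolding has_distr_deriv_def iint_iff integral_interval[symmetric]
proof (intro conjI ballI f g)
 fix \<phi> assume phi: "\<phi> \<in> test_functions T"
 note tf = test_function_facts[OF phi]
 have "(LI t|ivl T. deriv \<phi> t *R f t) = (LI t|ivl T. deriv \<phi> t *R prim g t)"
 proof (rule integral_cong_AE)
  have m: "deriv \<phi> \<in> bm (ivl T)"
   by (rule interval_measurable[OF borel_measurable_continuous_onI[OF tf(2)]])
  show "(%t. deriv \<phi> t *R f t) \<in> bm (ivl T)"
   using m f[folded iint_iff] by (intro borel_measurable_scaleR) auto
  have "iint T (prim g)" by (rule conv_integrable(1)[OF iint_bounded[where C=1] g]) auto
  thus "(%t. deriv \<phi> t *R prim g t) \<in> bm (ivl T)"
   using m by (intro borel_measurable_scaleR) (auto simp: iint_iff[symmetric])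
 qed (use e in "auto elim!: eventually_mono")
 also have "... = - (LI t|ivl T. \<phi> t *R g t)"
  unfolding integral_interval by (rule integral_by_parts_conv[OF g tf(1) tf(2) tf(5)]) simp
 finally show "(LI t|ivl T. deriv \<phi> t *R f t) = - (LI t|ivl T. \<phi> t *R g t)" .
qed

text \<open>The difference \<open>H\<close> annihilates all derivatives of test functions. Products
  of a rising and a falling \<open>chi\<close> give the identity \<open>key\<close>: its left side
  approximates \<open>H\<close>, while its right side is bounded by the integral of
  \<open>rho m * \<bar>H\<bar>\<close>, which concentrates at 0. There \<open>H\<close> is small by
  the initial limit, so \<open>H\<close> is zero and not merely constant.\<close>

lemma du_bois_reymond_zero:
 fixes f g z :: "real => real"
 assumes T: "T > 0" and d: "has_distr_deriv T f g"
  and z: "AE t in ivl T. f t = z t" "(z \<longlongrightarrow> 0) (at_right 0)"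
 shows "AE t in ivl T. f t = prim g t"
proof -
 have f: "iint T f" and g: "iint T g" using d by (auto simp: has_distr_deriv_def iint_iff)
 have i1: "iint T (prim g)" by (rule conv_integrable(1)[OF iint_bounded[where C=1] g]) auto
 define H where "H t = f t - prim g t" for t
 have H: "iint T H" unfolding H_def by (rule set_integral_diff(1)[OF f i1])
 have [measurable]: "cut T H \<in> bm borel" using H by (auto simp: set_integrable_def)
 note [measurable] = rho_measurable borel_measurable_continuous_onI[OF rho_continuous(4)]
 have mult: "iint T (%t. k t * F t)" if k: "continuous_on UNIV k" and F: "iint T F" for k F :: "real => real"
 proof -
  obtain C where "!!s. [|0 < s; s < T|] ==> \<bar>k s\<bar> <= C" using continuous_bounded_on[OF k] by metis
  from iint_mult_bounded[OF borel_measurable_continuous_onI[OF k] this F] show ?thesis by simp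
 qed
 have test: "(LI t<T. deriv \<phi> t * H t) = 0" if phi: "\<phi> \<in> test_functions T" for \<phi>
 proof -
  note tf = test_function_facts[OF phi]
  have "(LI t<T. deriv \<phi> t * f t) = (LI t<T. deriv \<phi> t * prim g t)"
   using d phi integral_by_parts_conv[OF g tf(1) tf(2) tf(5)] by (auto simp: has_distr_deriv_def integral_interval)
  thus ?thesis
   unfolding H_def right_diff_distrib by (simp add: set_integral_diff(2)[OF mult[OF tf(2) f] mult[OF tf(2) i1]])
 qed
 \<comment> \<open>Obtained from the test function \<open>chi m (t - a) * chi m (\<tau> - t)\<close>
   by letting \<open>a\<close> tend to 0; its derivative is the difference of the two
   integrands.\<close>
 have key: "conv (rho m) (%t. chi m t * H t) \<tau> = conv (chi m) (%t. rho m t * H t) \<tau>" if m: "m > 0" and \<tau>: "0 < \<tau>" "\<tau> < T" for m \<tau>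
 proof -
  let ?D = "%a t. rho m (t - a) * chi m (\<tau> - t) - chi m (t - a) * rho m (\<tau> - t)"
  have zero: "(LI t<T. ?D a t * H t) = 0" if a: "0 < a" "a < \<tau>" for a
  proof -
   let ?p = "%t. chi m (t - a) * chi m (\<tau> - t)"
   have "((%t. chi m (t - a)) has_real_derivative rho m (t - a) * 1) (at t)"
    "((%t. chi m (\<tau> - t)) has_real_derivative rho m (\<tau> - t) * (- 1)) (at t)" for t
    by (rule DERIV_chain2[OF DERIV_chi]; auto intro!: derivative_eq_intros)+
   from DERIV_mult[OF this] have d: "deriv ?p = ?D a" by (intro ext DERIV_imp_deriv) (simp add: algebra_simps)
   have "?p \<in> test_functions T"
    using bumps_test[OF bumps.base[of a \<tau> T m 0 0]] a \<tau> m by (simp add: chi_def)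
   from test[OF this] show ?thesis unfolding d .
  qed
  \<comment> \<open>Two successors, since \<open>a\<close> must stay strictly below
    \<open>\<tau>\<close>.\<close>
  have "(%n. LI t<T. ?D (\<tau> * (1 / real (Suc (Suc n)))) t * H t) ----> (LI t<T. ?D (\<tau> * 0) t * H t)"
   unfolding set_int
  proof (rule integral_dominated_convergence)
   have e: "indicator {0<..<T} t *R (?D a t * H t) = ?D a t * cut T H t" for a t by simp
   show "integrable lborel (%t. 4 * m * \<bar>cut T H t\<bar>)"
    using H unfolding set_integrable_def by (intro integrable_mult_right integrable_abs)
   have bm: "(%t. indicator {0<..<T} t *R (?D a t * H t)) \<in> bm lborel" for a unfolding e by measurable
   show "(%t. indicator {0<..<T} t *R (?D (\<tau> * (1 / real (Suc (Suc n)))) t * H t)) \<in> bm lborel"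
    "(%t. indicator {0<..<T} t *R (?D (\<tau> * 0) t * H t)) \<in> bm lborel" for n by (rule bm)+
   have b: "\<bar>rho m x * chi m y\<bar> <= 2 * m * 1" for x y
    unfolding abs_mult by (rule mult_mono) (use chi_bounds rho_nonneg[OF m] rho_le[OF m] m in auto)
   have "\<bar>?D a t\<bar> <= 4 * m" for a t
    using abs_triangle_ineq4[of "rho m (t - a) * chi m (\<tau> - t)" "rho m (\<tau> - t) * chi m (t - a)"] b[of "t - a" "\<tau> - t"] b[of "\<tau> - t" "t - a"]
    by (simp only: mult.commute[of "chi m (t - a)"])
   thus "AE t in lborel. norm (indicator {0<..<T} t *R (?D (\<tau> * (1 / real (Suc (Suc n)))) t * H t)) <= 4 * m * \<bar>cut T H t\<bar>" for n
    unfolding e by (intro AE_I2) (simp add: abs_mult mult_right_mono del: indicator_simps)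
   have c: "isCont (rho m) x" "isCont (chi m) x" for x
    using rho_continuous by (auto simp: continuous_on_eq_continuous_at)
   show "AE t in lborel. (%n. indicator {0<..<T} t *R (?D (\<tau> * (1 / real (Suc (Suc n)))) t * H t)) ----> indicator {0<..<T} t *R (?D (\<tau> * 0) t * H t)"
    by (intro AE_I2 tendsto_intros isCont_tendsto_compose[OF c(1)] isCont_tendsto_compose[OF c(2)] LIMSEQ_Suc[OF LIMSEQ_Suc[OF lim_1_over_n]])
  qed
  moreover have "(LI t<T. ?D (\<tau> * (1 / real (Suc (Suc n)))) t * H t) = 0" for n
   by (rule zero) (use \<tau> in "auto simp: field_simps add_pos_nonneg")
  ultimately have "(LI t<T. ?D 0 t * H t) = 0" by (simp add: LIMSEQ_const_iff)
  also have "(LI t<T. ?D 0 t * H t) = (LI t<\<tau>. chi m (\<tau> - t) * (rho m t * H t) - rho m (\<tau> - t) * (chi m t * H t))"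
   unfolding set_int
   by (rule LI_cong[OF refl])
    (use \<tau> m in "auto simp: indicator_def chi_def rho_def ebump_def zero_less_mult_iff algebra_simps")
  also have "... = conv (chi m) (%t. rho m t * H t) \<tau> - conv (rho m) (%t. chi m t * H t) \<tau>"
   unfolding conv_def real_scaleR_def
   by (rule set_integral_diff(2))
    (use iint_conv_continuous[OF _ iint_mono[OF mult[OF _ H]]] rho_continuous \<tau> in auto)
  finally show ?thesis by simp
 qed
 define I where "I = (LI t<T. \<bar>H t\<bar>)"
 have Hn: "iint T (%t. \<bar>H t\<bar>)" using set_integrable_norm[OF H] by simp
 have "I <= 0 + e" if e: "e > 0" for e
 proof -
  have "(prim g \<longlongrightarrow> prim g 0) (at 0 within {0..T})"
   by (rule bspec[OF conv_one_continuous[OF g, unfolded continuous_on_def]]) (use T in simp)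
  hence "((%t. z t - prim g t) \<longlongrightarrow> 0 - 0) (at_right 0)"
   using z(2) by (intro tendsto_diff) (simp_all add: at_within_Icc_at_right[OF T])
  from tendstoD[OF this, of "e / T"] e T obtain \<delta> where \<delta>: "\<delta> > 0" "!!t. [|0 < t; t < \<delta>|] ==> \<bar>z t - prim g t\<bar> < e / T"
   unfolding eventually_at_right_field by auto
  \<comment> \<open>Before \<open>\<delta>\<close> the function \<open>H\<close> is below
    \<open>e / T\<close> and the mass of the kernel is at most 1; after \<open>\<delta>\<close> the
    kernel is below its decay bound.\<close>
  have bound: "(LI t<T. norm (rho m t * H t)) <= e / T + 1 / (m * \<delta>\<^sup>2) * I" if m: "m > 0" for m
  proof -
   have i: "iint T (%t. e / T * rho m t)" "iint T (%t. 1 / (m * \<delta>\<^sup>2) * \<bar>H t\<bar>)"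
    by (intro set_integrable_mult_right rho_iint Hn)+
   have "(LI t<T. norm (rho m t * H t)) <= (LI t<T. e / T * rho m t + 1 / (m * \<delta>\<^sup>2) * \<bar>H t\<bar>)"
   proof (rule set_integral_mono_AE[OF set_integrable_norm[OF mult[OF rho_continuous(1) H]] set_integral_add(1)[OF i]])
    show "AE t\<in>{0<..<T} in lborel. norm (rho m t * H t) <= e / T * rho m t + 1 / (m * \<delta>\<^sup>2) * \<bar>H t\<bar>"
     using z(1) unfolding AE_interval
    proof eventually_elim
     fix t assume H: "t \<in> {0<..<T} \<longrightarrow> f t = z t"
     show "t \<in> {0<..<T} \<longrightarrow> norm (rho m t * H t) <= e / T * rho m t + 1 / (m * \<delta>\<^sup>2) * \<bar>H t\<bar>"
     proof
      assume t: "t \<in> {0<..<T}"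
      show "norm (rho m t * H t) <= e / T * rho m t + 1 / (m * \<delta>\<^sup>2) * \<bar>H t\<bar>"
      proof (cases "t < \<delta>")
       case True
       hence "rho m t * \<bar>H t\<bar> <= rho m t * (e / T)"
        using \<delta>(2)[of t] t H by (intro mult_left_mono rho_nonneg m) (auto simp: H_def)
       moreover have "0 <= 1 / (m * \<delta>\<^sup>2) * \<bar>H t\<bar>" using m by simp
       ultimately show ?thesis using rho_nonneg[OF m, of t] by (simp add: abs_mult mult.commute)
      next
       case False
       hence le: "m * \<delta>\<^sup>2 <= m * t\<^sup>2" using m \<delta>(1) by (intro mult_left_mono power_mono) auto
       have "rho m t <= 1 / (m * \<delta>\<^sup>2)"
        using rho_le(2)[OF m, of t] m \<delta>(1) t divide_left_mono[OF le, of 1] by simp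
       hence "rho m t * \<bar>H t\<bar> <= 1 / (m * \<delta>\<^sup>2) * \<bar>H t\<bar>" by (rule mult_right_mono) simp
       moreover have "0 <= e / T * rho m t" using e T rho_nonneg[OF m, of t] by simp
       ultimately show ?thesis using rho_nonneg[OF m, of t] by (simp add: abs_mult)
      qed
     qed
    qed
   qed
   also have "... = e / T * chi m T + 1 / (m * \<delta>\<^sup>2) * I"
    unfolding set_integral_add(2)[OF i] set_integral_mult_right I_def using conv_one_rho[of T m] T by (simp add: conv_one)
   finally show ?thesis using mult_left_le[OF chi_bounds(2), of "e / T" m T] e T by simp
  qed
  \<comment> \<open>The factor \<open>T\<close> comes from integrating a bound that does not depend
    on time; it cancels the denominator of \<open>e / T\<close>, so the limit is
    \<open>e\<close>.\<close>
  define R where "R n = moll_err T n H + (LI t<T. \<bar>H t - chi (real (Suc n)) t * H t\<bar>) + T * (e / T + 1 / \<delta>\<^sup>2 * I * (1 / real (Suc n)))" for n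
  have "I <= R n" for n
  proof -
   let ?m = "real (Suc n)" let ?K = "e / T + 1 / \<delta>\<^sup>2 * I * (1 / ?m)"
   let ?G = "%t. H t - chi ?m t * H t"
   have G: "iint T ?G" by (rule set_integral_diff(1)[OF H mult[OF rho_continuous(4) H]])
   have iK: "iint T (%_. ?K)" by (rule iint_bounded[where C="\<bar>?K\<bar>"]) auto
   note i = moll_integrable(2)[OF H, of ?m] set_integrable_norm[OF moll_integrable(1)[OF G, of ?m]] iK
   have "I = (LI t<T. \<bar>H t\<bar>)" by (rule I_def)
   also have "... <= (LI t<T. (norm (conv (rho ?m) H t - H t) + norm (conv (rho ?m) ?G t)) + ?K)"
   proof (rule set_integral_mono[OF Hn set_integral_add(1)[OF set_integral_add(1)[OF i(1,2)] i(3)]])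
    fix t assume "t \<in> {0<..<T}"
    hence t: "0 < t" "t < T" by auto
    have it: "iint t H" by (rule iint_mono[OF H]) (use t in simp)
    have "norm (conv (chi ?m) (%t. rho ?m t * H t) t) <= 1 * (LI s<t. norm (rho ?m s * H s))"
     by (rule conv_bounded) (use chi_bounds iint_mono[OF mult[OF rho_continuous(1) H]] t in auto)
    also have "... <= (LI s<T. norm (rho ?m s * H s))"
     unfolding mult_1 set_int
     by (rule integral_mono) (use set_integrable_norm[OF mult[OF rho_continuous(1) H]] iint_mono[OF set_integrable_norm[OF mult[OF rho_continuous(1) H]]] t in "auto simp: set_integrable_def indicator_def")
    also have "... <= ?K" using bound[of ?m] by (simp add: ac_simps)
    finally have "\<bar>conv (rho ?m) (%t. chi ?m t * H t) t\<bar> <= ?K" using key[of ?m t] t by simp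
    moreover have "conv (rho ?m) ?G t = conv (rho ?m) H t - conv (rho ?m) (%t. chi ?m t * H t) t"
     by (rule conv_diff_right) (use t iint_conv_continuous[OF rho_continuous(1) it] iint_conv_continuous[OF rho_continuous(1) iint_mono[OF mult[OF rho_continuous(4) H]]] in simp_all)
    ultimately show "\<bar>H t\<bar> <= (norm (conv (rho ?m) H t - H t) + norm (conv (rho ?m) ?G t)) + ?K" by simp
   qed
   also have "... = moll_err T n H + (LI t<T. norm (conv (rho ?m) ?G t)) + T * ?K"
    unfolding set_integral_add(2)[OF set_integral_add(1)[OF i(1,2)] i(3)] set_integral_add(2)[OF i(1,2)] moll_err_def
    using T by (simp add: set_int)
   also have "... <= R n" unfolding R_def using moll_integrable(3)[OF G, of ?m] T by simp
   finally show ?thesis .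
  qed
  moreover have "R ----> 0 + 0 + T * (e / T + 1 / \<delta>\<^sup>2 * I * 0)"
  proof -
   have "(%n. LI t<T. \<bar>H t - chi (real (Suc n)) t * H t\<bar>) ----> (LI t<T. 0)"
    unfolding set_int
   proof (rule integral_dominated_convergence)
    have e: "indicator {0<..<T} t *R \<bar>H t - chi m t * H t\<bar> = (1 - chi m t) * \<bar>cut T H t\<bar>" for m t
     using chi_bounds[of m t] abs_mult[of "1 - chi m t" "H t"] by (simp add: left_diff_distrib indicator_def)
    show "integrable lborel (%t. \<bar>cut T H t\<bar>)" using H unfolding set_integrable_def by (rule integrable_abs)
    show "(%t. indicator {0<..<T} t *R \<bar>H t - chi (real (Suc n)) t * H t\<bar>) \<in> bm lborel" for n
     unfolding e by measurable
    show "AE t in lborel. norm (indicator {0<..<T} t *R \<bar>H t - chi (real (Suc n)) t * H t\<bar>) <= \<bar>cut T H t\<bar>" for n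
     unfolding e using chi_bounds[of "real (Suc n)"] by (intro AE_I2) (simp add: abs_mult mult_left_le_one_le)
    show "AE t in lborel. (%n. indicator {0<..<T} t *R \<bar>H t - chi (real (Suc n)) t * H t\<bar>) ----> indicator {0<..<T} t *R 0"
    proof (rule AE_I2)
     fix t
     have "(%n. \<bar>H t - chi (real (Suc n)) t * H t\<bar>) ----> \<bar>H t - 1 * H t\<bar>" if "t > 0"
      by (intro tendsto_intros chi_tendsto that)
     thus "(%n. indicator {0<..<T} t *R \<bar>H t - chi (real (Suc n)) t * H t\<bar>) ----> indicator {0<..<T} t *R 0"
      by (auto simp: indicator_def)
    qed
   qed simp
   thus ?thesis unfolding R_def[abs_def]
    by (intro tendsto_add moll_err_tendsto[OF less_imp_le[OF T] H] tendsto_mult tendsto_const LIMSEQ_Suc[OF lim_1_over_n]) simp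
  qed
  ultimately have "I <= 0 + 0 + T * (e / T + 1 / \<delta>\<^sup>2 * I * 0)" by (intro LIMSEQ_le_const) auto
  thus ?thesis using T by simp
 qed
 hence "I <= 0" by (rule field_le_epsilon)
 hence "(LI t|ivl T. \<bar>H t\<bar>) = 0"
  unfolding integral_interval I_def[symmetric] by (intro antisym) (simp_all add: I_def set_int)
 hence "AE t in ivl T. \<bar>H t\<bar> = 0"
  using integral_nonneg_eq_0_iff_AE[of "ivl T" "%t. \<bar>H t\<bar>"] Hn by (simp add: iint_iff[symmetric])
 thus ?thesis by eventually_elim (simp add: H_def)
qed

section \<open>Affine gradients\<close>

text \<open>The Rademacher functions, extended periodically to the line so that doubling the
  argument raises the index by one.\<close>

definition rad :: "nat => real => real" where
 "rad n x = (if frac (2 ^ n * x) < 1/2 then 1 else -1)"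

lemma rad_measurable [measurable]: "rad n \<in> bm borel"
 unfolding rad_def[abs_def] frac_def by measurable

lemma rad_abs: "\<bar>rad n x\<bar> = 1" "rad n x = 1 \<or> rad n x = -1"
 by (auto simp: rad_def)

lemma rad_periodic: "rad n (x + 1) = rad n x"
proof -
 have "frac (2 ^ n * x + of_int (2 ^ n)) = frac (2 ^ n * x)"
  unfolding frac_def floor_add_int[symmetric] by simp
 thus ?thesis by (simp add: rad_def distrib_left)
qed

lemma rad_double: "rad n (2 * x) = rad (Suc n) x"
 by (simp add: rad_def ac_simps)

text \<open>While \<open>x\<close> runs through either half of the interval,
  \<open>g (2 * x)\<close> runs through a full period and \<open>rad 0\<close> is constant with
  opposite signs, so the contributions of \<open>q\<close> cancel. Means and orthogonality follow by
  induction.\<close>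

lemma integral_periodic_double:
 fixes g h :: "real => real"
 assumes [measurable]: "g \<in> bm borel" and b: "!!x. \<bar>g x\<bar> <= C" and per: "!!x. g (x + 1) = g x"
 shows "(LI x<1. (p + q * rad 0 x) * g (2 * x)) = p * (LI x<1. g x)"
proof -
 have ig: "set_integrable lborel {a<..<c} (%x. f x * g x)" if [measurable]: "f \<in> bm borel" and f: "!!x. \<bar>f x\<bar> <= D" for a c f D
  unfolding set_integrable_def
 proof (rule integrableI_bounded_set_indicator[where B="D * C"])
  show "AE x\<in>{a<..<c} in lborel. norm (f x * g x) <= D * C"
  proof (intro AE_I2 impI)
   fix x
   have "0 <= D" using f[of x] by linarith
   thus "norm (f x * g x) <= D * C" using f[of x] b[of x] by (simp add: abs_mult mult_mono)
  qed
 qed (cases "a <= c"; simp)+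
 let ?f = "%y. p + q * rad 0 (y / 2)"
 have fb: "\<bar>?f y\<bar> <= \<bar>p\<bar> + \<bar>q\<bar>" for y
  using abs_triangle_ineq[of p "q * rad 0 (y / 2)"] rad_abs(1)[of 0 "y / 2"] by (simp add: abs_mult)
 have fm [measurable]: "?f \<in> bm borel" by measurable
 have i2: "iint 2 (%y. ?f y * g y)" by (rule ig[OF fm fb])
 have "(LI x<1. (p + q * rad 0 x) * g (2 * x)) = 1/2 * (LI y<2. ?f y * g y)"
  unfolding set_int
  by (subst lborel_integral_real_affine[of "1/2" _ 0]) (auto intro!: LI_cong simp: indicator_def)
 also have "(LI y<2. ?f y * g y) = (LI y<1. ?f y * g y) + (LINT y:{1<..<2}|lborel. ?f y * g y)"
  using conv_one_diff[OF i2, of 1 2] by (simp add: conv_one)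
 also have "(LI y<1. ?f y * g y) = (LI y<1. (p + q) * g y)"
  by (rule set_lebesgue_integral_cong) (auto simp: rad_def frac_eq[THEN iffD2])
 also have "(LINT y:{1<..<2}|lborel. ?f y * g y) = (LINT y:{1<..<2}|lborel. (p - q) * g y)"
  by (rule set_lebesgue_integral_cong) (auto simp: rad_def frac_eq[THEN iffD2])
 also have "... = (LI y<1. (p - q) * g y)"
  unfolding set_int
  by (subst lborel_integral_real_affine[of 1 _ 1]) (auto intro!: LI_cong simp: indicator_def per add.commute)
 finally show ?thesis unfolding set_integral_mult_right by (simp add: algebra_simps)
qed

lemma rad_orthogonal:
 assumes "m < n" shows "(LI x<1. rad m x * rad n x) = 0"
 using assms
proof (induction m arbitrary: n)
 case 0
 then obtain k where n: "n = Suc k" by (cases n) auto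
 show ?case
  using integral_periodic_double[of "rad k" 1 0 1] rad_abs(1)[of k] rad_periodic[of k] by (simp add: n rad_double)
next
 case (Suc m)
 then obtain k where n: "n = Suc k" "m < k" by (cases n) auto
 have "(LI x<1. (1 + 0 * rad 0 x) * (%x. rad m x * rad k x) (2 * x)) = 1 * (LI x<1. rad m x * rad k x)"
  by (rule integral_periodic_double[where C=1]) (auto simp: abs_mult rad_abs rad_periodic)
 thus ?case using Suc.IH[OF n(2)] by (simp add: n rad_double)
qed

lemma rad_mean: "(LI x<1. rad n x) = 0"
proof (induction n)
 case 0
 show ?case using integral_periodic_double[of "%_. 1" 1 0 1] by simp
next
 case (Suc n)
 thus ?case using integral_periodic_double[of "rad n" 1 1 0] rad_abs(1)[of n] rad_periodic[of n] by (simp add: rad_double)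
qed

definition radT :: "real => nat => real => real" where "radT T n t = rad n (t / T)"

lemma radT_measurable [measurable]: "radT T n \<in> bm borel"
 unfolding radT_def[abs_def] by measurable

lemma integral_scale_T:
 fixes f :: "real => real"
 assumes "T > 0" shows "(LI t<T. f (t / T)) = T * (LI x<1. f x)"
 unfolding set_int using assms
 by (subst lborel_integral_real_affine[of T _ 0])
  (auto intro!: arg_cong[where f="%x. T * x"] LI_cong simp: indicator_def zero_less_mult_iff)

lemma radT_integrals:
 assumes "T > 0"
 shows "(LI t<T. radT T n t) = 0"
  and "m \<noteq> n ==> (LI t<T. radT T m t * radT T n t) = 0"
 using integral_scale_T[OF assms, of "rad n"] rad_mean[of n]
  integral_scale_T[OF assms, of "%x. rad m x * rad n x"] rad_orthogonal[of m n] rad_orthogonal[of n m]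
 by (auto simp: radT_def mult.commute neq_iff)

text \<open>Orthogonality makes the integral of the square at most \<open>T / N\<close>. Since the
  average is also bounded by 1, splitting at the level \<open>\<delta>\<close> turns this into an
  estimate for any positive power \<open>p\<close>.\<close>

lemma rad_average_Lp:
 assumes T: "T > 0" and p: "p > 0" and inj: "inj \<sigma>" and s: "!!n. \<bar>s n\<bar> <= (1 :: real)" and N: "N > 0" and d: "\<delta> > 0"
 shows "(LI t<T. \<bar>1 / real N * (\<Sum>n<N. s n * radT T (\<sigma> n) t)\<bar> powr p) <= \<delta> powr p * T + T / (\<delta>\<^sup>2 * real N)"
proof -
 let ?a = "%t. 1 / real N * (\<Sum>n<N. s n * radT T (\<sigma> n) t)"
 have r1: "\<bar>radT T n t\<bar> = 1" for n t by (simp add: radT_def rad_abs)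
 have a1: "\<bar>?a t\<bar> <= 1" for t
 proof -
  have "\<bar>\<Sum>n<N. s n * radT T (\<sigma> n) t\<bar> <= (\<Sum>n<N. 1)"
   by (rule order_trans[OF sum_abs]) (rule sum_mono, simp add: abs_mult r1 s)
  thus ?thesis using N by (simp add: abs_mult)
 qed
 have bi: "iint T f" if "f \<in> bm borel" "!!t. \<bar>f t\<bar> <= C" for f :: "real => real" and C
  by (rule iint_bounded[where C=C]) (use that in auto)
 have sq: "(LI t<T. (?a t)\<^sup>2) <= T / real N"
 proof -
  have e: "(?a t)\<^sup>2 = (\<Sum>m<N. \<Sum>n<N. (1 / (real N)\<^sup>2 * s m * s n) * (radT T (\<sigma> m) t * radT T (\<sigma> n) t))" for t
   by (simp add: power2_eq_square sum_product sum_distrib_left ac_simps)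
  have I: "iint T (%t. (1 / (real N)\<^sup>2 * s m * s n) * (radT T (\<sigma> m) t * radT T (\<sigma> n) t))" for m n
   by (rule set_integrable_mult_right, rule bi[of _ 1]) (auto simp: abs_mult r1)
  have "(LI t<T. (?a t)\<^sup>2) = (\<Sum>m<N. \<Sum>n<N. (LI t<T. (1 / (real N)\<^sup>2 * s m * s n) * (radT T (\<sigma> m) t * radT T (\<sigma> n) t)))"
   unfolding e set_int scaleR_sum_right
   using I by (subst Bochner_Integration.integral_sum; (subst Bochner_Integration.integral_sum)?)
    (auto simp: set_integrable_def intro!: Bochner_Integration.integrable_sum)
  also have "... = (\<Sum>m<N. \<Sum>n<N. if n = m then 1 / (real N)\<^sup>2 * s m * s n * T else 0)"
  proof (intro sum.cong refl)
   fix m n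
   have "(LI t<T. (1 / (real N)\<^sup>2 * s m * s n) * (radT T (\<sigma> m) t * radT T (\<sigma> n) t)) = (1 / (real N)\<^sup>2 * s m * s n) * (LI t<T. radT T (\<sigma> m) t * radT T (\<sigma> n) t)"
    by (rule set_integral_mult_right)
   moreover have "(LI t<T. radT T (\<sigma> m) t * radT T (\<sigma> n) t) = (if n = m then T else 0)"
   proof (cases "n = m")
    case True
    have "radT T (\<sigma> m) t * radT T (\<sigma> m) t = 1" for t using r1[of "\<sigma> m" t] by (auto simp: abs_if split: if_splits)
    thus ?thesis using True T by (simp add: set_int)
   next
    case False
    hence "\<sigma> m \<noteq> \<sigma> n" using inj by (auto dest: injD)
    thus ?thesis using False radT_integrals(2)[OF T] by simp
   qed
   ultimately show "(LI t<T. (1 / (real N)\<^sup>2 * s m * s n) * (radT T (\<sigma> m) t * radT T (\<sigma> n) t)) = (if n = m then 1 / (real N)\<^sup>2 * s m * s n * T else 0)"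
    by simp
  qed
  also have "... = (\<Sum>m<N. 1 / (real N)\<^sup>2 * (s m)\<^sup>2 * T)"
   by (rule sum.cong[OF refl]) (simp add: sum.delta' power2_eq_square)
  also have "... <= (\<Sum>m<N. 1 / (real N)\<^sup>2 * T)"
  proof (rule sum_mono)
   fix m
   have "(s m)\<^sup>2 <= 1" using s[of m] by (simp add: abs_square_le_1)
   thus "1 / (real N)\<^sup>2 * (s m)\<^sup>2 * T <= 1 / (real N)\<^sup>2 * T" using T by (simp add: divide_right_mono)
  qed
  also have "... = T / real N" using N by (simp add: power2_eq_square)
  finally show ?thesis .
 qed
 have am [measurable]: "?a \<in> bm borel" by measurable
 have pw: "\<bar>?a t\<bar> powr p <= \<delta> powr p + 1 / \<delta>\<^sup>2 * (?a t)\<^sup>2" for t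
 proof (cases "\<bar>?a t\<bar> <= \<delta>")
  case True
  hence "\<bar>?a t\<bar> powr p <= \<delta> powr p" using p by (intro powr_mono2) auto
  thus ?thesis using d by (simp add: add_increasing2)
 next
  case False
  have "\<bar>?a t\<bar> powr p <= 1" using a1[of t] p powr_mono2[of p "\<bar>?a t\<bar>" 1] by simp
  also have "1 <= 1 / \<delta>\<^sup>2 * (?a t)\<^sup>2"
  proof -
   have "\<delta>\<^sup>2 <= \<bar>?a t\<bar>\<^sup>2" using False d by (intro power_mono) auto
   hence "\<delta>\<^sup>2 <= (?a t)\<^sup>2" by (simp only: power2_abs)
   hence "1 <= (?a t)\<^sup>2 / \<delta>\<^sup>2" using d by (simp only: pos_le_divide_eq zero_less_power mult_1)
   thus ?thesis by simp
  qed
  finally show ?thesis by (simp add: add_increasing)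
 qed
 have i2: "iint T (%t. 1 / \<delta>\<^sup>2 * (?a t)\<^sup>2)"
  by (rule set_integrable_mult_right, rule bi[of _ 1]) (use am a1 in "auto simp: abs_square_le_1")
 have i1: "iint T (%t. \<delta> powr p)" by (rule bi[of _ "\<delta> powr p"]) auto
 have "(LI t<T. \<bar>?a t\<bar> powr p) <= (LI t<T. \<delta> powr p + 1 / \<delta>\<^sup>2 * (?a t)\<^sup>2)"
 proof (rule set_integral_mono[OF _ set_integral_add(1)[OF i1 i2]])
  have "\<bar>\<bar>?a t\<bar> powr p\<bar> <= 1" for t using a1[of t] p powr_mono2[of p "\<bar>?a t\<bar>" 1] by simp
  thus "iint T (%t. \<bar>?a t\<bar> powr p)" by (intro bi[of _ 1]) (use am in auto)
 qed (rule pw)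
 also have "... = \<delta> powr p * T + 1 / \<delta>\<^sup>2 * (LI t<T. (?a t)\<^sup>2)"
  unfolding set_integral_add(2)[OF i1 i2] using T by (simp add: set_int)
 also have "... <= \<delta> powr p * T + 1 / \<delta>\<^sup>2 * (T / real N)"
  using sq by (intro add_left_mono mult_left_mono) auto
 finally show ?thesis by simp
qed

lemma bounded_in_Lq:
 fixes f :: "real => 'b::real_normed_vector"
 assumes f: "f \<in> bm (ivl T)" and C: "!!t. norm (f t) <= C" and q: "q > 0"
 shows "f \<in> Lq q (ivl T)"
proof -
 have "finite_measure (ivl T)"
  by (rule finite_measureI) (cases "T > 0", auto simp: emeasure_restrict_space)
 hence "integrable (ivl T) (%x. norm (f x) powr q)"
  by (rule finite_measure.integrable_const_bound[where B="C powr q"])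
   (use f C q in "auto intro!: powr_mono2 AE_I2")
 thus ?thesis using f by (simp add: Lq_def)
qed

lemma fun_dualD:
 assumes "l \<in> fun_dual V N"
 shows "[|f \<in> V; g \<in> V|] ==> l (%x. f x + g x) = l f + l g"
  and "f \<in> V ==> l (%x. c *R f x) = c * l f"
 using assms by (simp_all add: fun_dual_def)

lemma fun_dual_sum:
 assumes l: "l \<in> fun_dual V N" and f: "!!n. f n \<in> V" and z: "(%_. 0) \<in> V"
  and add: "!!f g. f \<in> V ==> g \<in> V ==> (%x. f x + g x) \<in> V" and sc: "!!c f. f \<in> V ==> (%x. c *R f x) \<in> V"
 shows "(%x. \<Sum>n<(k::nat). c n *R f n x) \<in> V \<and> l (%x. \<Sum>n<k. c n *R f n x) = (\<Sum>n<k. c n * l (f n))"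
proof (induction k)
 case 0
 have "l (%x. 0 *R (0 :: 'b)) = 0 * l (%_. 0 :: 'b)" by (rule fun_dualD(2)[OF l z])
 thus ?case using z by simp
next
 case (Suc k)
 have fk: "(%x. c k *R f k x) \<in> V" by (rule sc[OF f])
 have "l (%x. (\<Sum>n<k. c n *R f n x) + c k *R f k x) = l (%x. \<Sum>n<k. c n *R f n x) + l (%x. c k *R f k x)"
  by (rule fun_dualD(1)[OF l _ fk]) (use Suc in simp)
 moreover have "l (%x. c k *R f k x) = c k * l (f k)" by (rule fun_dualD(2)[OF l f])
 ultimately show ?case using Suc add[OF _ fk] by simp
qed

lemma Lq_add_scale:
 fixes f g :: "'a => 'b::{real_normed_vector, second_countable_topology}"
 assumes q: "q > 0"
 shows "[|f \<in> Lq q M; g \<in> Lq q M|] ==> (%x. f x + g x) \<in> Lq q M"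
  and "f \<in> Lq q M ==> (%x. c *R f x) \<in> Lq q M" and "(%_. 0 :: 'b) \<in> Lq q M"
proof -
 assume f: "f \<in> Lq q M" and g: "g \<in> Lq q M"
 hence [measurable]: "f \<in> bm M" "g \<in> bm M" by (auto simp: Lq_def)
 have le: "norm (f x + g x) powr q <= 2 powr q * (norm (f x) powr q + norm (g x) powr q)" for x
 proof -
  let ?m = "max (norm (f x)) (norm (g x))"
  have "norm (f x + g x) <= 2 * ?m" using norm_triangle_ineq[of "f x" "g x"] by linarith
  hence "norm (f x + g x) powr q <= (2 * ?m) powr q" using q by (intro powr_mono2) auto
  also have "... = 2 powr q * ?m powr q" by (simp add: powr_mult)
  also have "?m powr q <= norm (f x) powr q + norm (g x) powr q" by (simp add: max_def)
  finally show ?thesis by simp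
 qed
 have I: "integrable M (%x. 2 powr q * (norm (f x) powr q + norm (g x) powr q))" using f g by (simp add: Lq_def)
 have "integrable M (%x. norm (f x + g x) powr q)"
  by (rule LI_bound[OF I]) (use le in "auto intro!: AE_I2")
 thus "(%x. f x + g x) \<in> Lq q M" by (simp add: Lq_def)
next
 show "f \<in> Lq q M ==> (%x. c *R f x) \<in> Lq q M" by (auto simp: Lq_def powr_mult)
 show "(%_. 0 :: 'b) \<in> Lq q M" using q by (simp add: Lq_def)
qed

text \<open>No representation of the dual space enters. If a functional stayed away from 0 along
  infinitely many of these functions, its value on their averages with suitable signs would stay
  away from 0 as well, while the norms of these averages tend to 0.\<close>

lemma rad_weakly_null:
 fixes d :: "'x::{real_normed_vector, second_countable_topology}"
 assumes T: "T > 0" and p: "p > 1" and l: "l \<in> fun_dual (Lq p (ivl T)) (Lnorm p (ivl T))"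
 shows "(%n. l (%t. radT T n t *R d)) ----> 0"
proof (rule ccontr)
 let ?V = "Lq p (ivl T) :: (real => 'x) set"
 define \<Lambda> where "\<Lambda> n = l (%t. radT T n t *R d)" for n
 assume "\<not> ?thesis"
 then obtain e where e: "e > 0" "!!n0. \<exists>n\<ge>n0. \<bar>\<Lambda> n\<bar> \<ge> e"
  unfolding LIMSEQ_iff \<Lambda>_def by (auto simp: not_less)
 define S where "S = {n. \<bar>\<Lambda> n\<bar> \<ge> e}"
 have inf: "infinite S" unfolding S_def infinite_nat_iff_unbounded_le using e(2) by auto
 define \<sigma> where "\<sigma> = enumerate S"
 have inj: "inj \<sigma>" unfolding \<sigma>_def using strict_mono_enumerate[OF inf] strict_mono_imp_inj_on by blast
 have sig: "\<bar>\<Lambda> (\<sigma> n)\<bar> \<ge> e" for n using enumerate_in_set[OF inf, of n] by (simp add: S_def \<sigma>_def)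
 obtain C0 where C0: "!!f. f \<in> ?V ==> \<bar>l f\<bar> <= C0 * Lnorm p (ivl T) f"
  using l unfolding fun_dual_def by blast
 \<comment> \<open>The summand 1 keeps \<open>C\<close> positive. The choice of
   \<open>\<eta>\<close> makes \<open>\<eta> powr (1 / p)\<close> equal to
   \<open>e / (2 * C)\<close>, so that the final estimate reads \<open>e <= e / 2\<close>.\<close>
 define C where "C = \<bar>C0\<bar> * norm d + 1"
 have C: "C > 0" by (simp add: C_def add_nonneg_pos)
 define \<eta> where "\<eta> = (e / (2 * C)) powr p"
 have eta: "\<eta> > 0" using e C by (simp add: \<eta>_def)
 define \<delta> where "\<delta> = (\<eta> / (2 * T)) powr (1 / p)"
 have delta: "\<delta> > 0" "\<delta> powr p * T = \<eta> / 2" using eta T p by (auto simp: \<delta>_def powr_powr)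
 obtain N where N: "real N > 2 * T / (\<delta>\<^sup>2 * \<eta>)" "N > 0"
 proof -
  obtain N0 where "real N0 > 2 * T / (\<delta>\<^sup>2 * \<eta>)" using reals_Archimedean2 by blast
  thus ?thesis by (intro that[of "Suc N0"]) auto
 qed
 have "T / (\<delta>\<^sup>2 * real N) <= \<eta> / 2" using N delta eta T by (simp add: field_simps)
 \<comment> \<open>These signs make all the terms of the average contribute positively.\<close>
 define s where "s n = (sgn (\<Lambda> (\<sigma> n)) :: real)" for n
 have s: "\<bar>s n\<bar> <= 1" for n by (simp add: s_def sgn_if)
 let ?a = "%t. 1 / real N * (\<Sum>n<N. s n * radT T (\<sigma> n) t)"
 have aLp: "(LI t<T. \<bar>?a t\<bar> powr p) <= \<eta>"
 proof -
  have "(LI t<T. \<bar>?a t\<bar> powr p) <= \<delta> powr p * T + T / (\<delta>\<^sup>2 * real N)"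
   using p by (intro rad_average_Lp[OF T _ inj s N(2) delta(1)]) simp
  thus ?thesis using delta(2) \<open>T / (\<delta>\<^sup>2 * real N) <= \<eta> / 2\<close> by linarith
 qed
 let ?f = "%t. \<Sum>n<N. (s n / real N) *R (radT T (\<sigma> n) t *R d)"
 have mem: "(%t. radT T n t *R d) \<in> ?V" for n
  by (rule bounded_in_Lq[where C="norm d"]) (use p in "auto intro!: interval_measurable simp: radT_def rad_abs")
 have fl: "?f \<in> ?V \<and> l ?f = (\<Sum>n<N. (s n / real N) * l (%t. radT T (\<sigma> n) t *R d))"
  by (rule fun_dual_sum[OF l mem]) (use p in "auto intro: Lq_add_scale")
 have "l ?f = (\<Sum>n<N. \<bar>\<Lambda> (\<sigma> n)\<bar> / real N)"
  using fl by (auto simp: \<Lambda>_def[symmetric] s_def intro!: sum.cong) (metis abs_sgn mult.commute)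
 also have "... \<ge> (\<Sum>n<N. e / real N)" using sig by (intro sum_mono divide_right_mono) auto
 finally have "e <= l ?f" using N(2) by simp
 also have "... <= C0 * Lnorm p (ivl T) ?f" using C0[of ?f] fl by auto
 also have "Lnorm p (ivl T) ?f <= \<eta> powr (1 / p) * norm d"
 proof -
  have fa: "?f t = ?a t *R d" for t by (simp add: scaleR_sum_left sum_distrib_left)
  have "Lnorm p (ivl T) ?f = ((LI t<T. \<bar>?a t\<bar> powr p) * norm d powr p) powr (1 / p)"
   unfolding Lnorm_def fa integral_interval norm_scaleR powr_mult set_integral_mult_left ..
  also have "... <= (\<eta> * norm d powr p) powr (1 / p)"
   using p aLp by (intro powr_mono2 mult_right_mono mult_nonneg_nonneg) (auto simp: set_int)
  also have "... = \<eta> powr (1 / p) * norm d" using p eta by (simp add: powr_mult powr_powr)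
  finally show ?thesis .
 qed
 hence "C0 * Lnorm p (ivl T) ?f <= \<bar>C0\<bar> * (\<eta> powr (1 / p) * norm d)"
 proof -
  have "0 <= Lnorm p (ivl T) ?f" by (simp add: Lnorm_def)
  hence "C0 * Lnorm p (ivl T) ?f <= \<bar>C0\<bar> * Lnorm p (ivl T) ?f" by (intro mult_right_mono) auto
  also have "... <= \<bar>C0\<bar> * (\<eta> powr (1 / p) * norm d)"
   using \<open>Lnorm p (ivl T) ?f <= \<eta> powr (1 / p) * norm d\<close> by (intro mult_left_mono) auto
  finally show ?thesis .
 qed
 moreover have "\<eta> powr (1 / p) = e / (2 * C)" using p e C by (simp add: \<eta>_def powr_powr)
 moreover have "\<bar>C0\<bar> * norm d * (e / (2 * C)) <= C * (e / (2 * C))" using e C by (intro mult_right_mono) (auto simp: C_def)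
 moreover have "C * (e / (2 * C)) = e / 2" using C by simp
 ultimately show False using e(1) by (simp add: ac_simps)
qed

text \<open>The elementary bound \<open>x <= 1 + x powr q\<close>, applied to \<open>f\<close>
  divided by its norm, takes the place of Hoelder's inequality; hence the constant
  \<open>T + 1\<close>.\<close>

lemma Lq_interval_bound:
 assumes T: "T > 0" and q: "q \<ge> 1" and f: "f \<in> Lq q (ivl T)"
 shows "integrable (ivl T) (%t. norm (f t))"
  and "(LI t|ivl T. norm (f t)) <= (T + 1) * Lnorm q (ivl T) f"
proof -
 let ?I = "ivl T" and ?N = "Lnorm q (ivl T) f"
 have [measurable]: "f \<in> bm ?I" and fi: "integrable ?I (%t. norm (f t) powr q)" using f by (auto simp: Lq_def)
 interpret finite_measure ?I by (rule finite_measureI) (use T in "auto simp: emeasure_restrict_space")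
 have m: "measure ?I (space ?I) = T" using T by (simp add: measure_restrict_space)
 have le1: "x <= 1 + x powr q" if "x \<ge> 0" for x :: real
  using that q powr_mono[of 1 q x] powr_ge_zero[of x q] by (cases "x <= 1") (simp_all del: powr_ge_zero)
 show int: "integrable ?I (%t. norm (f t))"
  by (rule LI_bound[of _ "%t. 1 + norm (f t) powr q"])
   (use fi le1 in "auto intro!: AE_I2")
 have "?N \<ge> 0" by (simp add: Lnorm_def)
 show "(LI t|?I. norm (f t)) <= (T + 1) * ?N"
 proof (cases "?N = 0")
  case True
  hence "(LI t|?I. norm (f t) powr q) = 0" using q by (simp add: Lnorm_def)
  hence "AE t in ?I. norm (f t) = 0" using integral_nonneg_eq_0_iff_AE[OF fi] by auto
  hence "(LI t|?I. norm (f t)) = (LI t|?I. 0)" by (intro integral_cong_AE) auto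
  thus ?thesis using True by simp
 next
  case False
  hence N: "?N > 0" using \<open>?N \<ge> 0\<close> by simp
  have Nq: "?N powr q = (LI t|?I. norm (f t) powr q)" using q by (simp add: Lnorm_def powr_powr)
  have "(LI t|?I. norm (f t)) <= (LI t|?I. ?N * (1 + norm (f t) powr q / ?N powr q))"
  proof (rule integral_mono[OF int])
   show "integrable ?I (%t. ?N * (1 + norm (f t) powr q / ?N powr q))" using fi by auto
   show "norm (f t) <= ?N * (1 + norm (f t) powr q / ?N powr q)" for t
    using le1[of "norm (f t) / ?N"] N by (simp add: powr_divide field_simps)
  qed
  also have "... = ?N * (T + (LI t|?I. norm (f t) powr q) / ?N powr q)" using fi m by simp
  also have "... = (T + 1) * ?N" using N unfolding Nq[symmetric] by simp
  finally show ?thesis .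
 qed
qed

lemma evaluation_fun_dual:
 fixes v :: "'x::real_normed_vector"
 assumes T: "T > 0" and q: "q \<ge> 1"
 shows "(%f. LI t|ivl T. blinfun_apply (f t) v)
  \<in> fun_dual (Lq q (ivl T)) (Lnorm q (ivl T) :: (real => 'x \<Rightarrow>\<^sub>L real) => real)"
proof -
 let ?I = "ivl T"
 have I: "integrable ?I (%t. blinfun_apply (f t) v)" and B: "\<bar>(LI t|?I. blinfun_apply (f t) v)\<bar> <= ((T + 1) * norm v) * Lnorm q ?I f"
  if f: "f \<in> Lq q ?I" for f :: "real => 'x \<Rightarrow>\<^sub>L real"
 proof -
  have fm: "f \<in> bm ?I" using f by (simp add: Lq_def)
  have m: "(%t. blinfun_apply (f t) v) \<in> bm ?I"
   by (rule measurable_compose[OF fm borel_measurable_continuous_onI]) (intro continuous_intros)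
  note b = Lq_interval_bound[OF T q f]
  have b1: "integrable ?I (%t. norm (f t) * norm v)" using b(1) by simp
  show i: "integrable ?I (%t. blinfun_apply (f t) v)"
   by (rule LI_bound[OF b1 m]) (use norm_blinfun[of "f _" v] in "auto intro!: AE_I2")
  have "\<bar>(LI t|?I. blinfun_apply (f t) v)\<bar> <= (LI t|?I. norm (f t) * norm v)"
   by (rule order_trans[OF integral_abs_bound integral_mono[OF integrable_abs[OF i] b1]])
    (use norm_blinfun[of "f _" v] in simp)
  also have "... = (LI t|?I. norm (f t)) * norm v" using b(1) by simp
  also have "... <= ((T + 1) * Lnorm q ?I f) * norm v" using b(2) by (rule mult_right_mono) simp
  finally show "\<bar>(LI t|?I. blinfun_apply (f t) v)\<bar> <= ((T + 1) * norm v) * Lnorm q ?I f" by (simp add: ac_simps)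
 qed
 show ?thesis unfolding fun_dual_def using I B by (auto simp: blinfun.add_left blinfun.scaleR_left)
qed

lemma weak_weak_continuous_midpoint:
 fixes F :: "'x::{real_normed_vector, second_countable_topology} => 'y::real_normed_vector \<Rightarrow>\<^sub>L real"
 assumes T: "T > 0" and p: "p > 1" and q: "q > 1" and F: "weak_weak_continuous T p q F"
 shows "F m = (1/2) *R (F (m + d) + F (m - d))"
proof (rule blinfun_eqI)
 fix v
 let ?I = "ivl T"
 let ?f = "%n t. m + radT T n t *R d"
 have r: "radT T n t = 1 \<or> radT T n t = -1" for n t by (simp add: radT_def rad_abs)
 have rm: "(%t. radT T n t *R d) \<in> Lq p ?I" for n
  by (rule bounded_in_Lq[where C="norm d"]) (use p in "auto intro!: interval_measurable simp: radT_def rad_abs")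
 have cm: "(%t. m) \<in> Lq p ?I" by (rule bounded_in_Lq[where C="norm m"]) (use p in auto)
 have fm: "?f n \<in> Lq p ?I" for n by (rule Lq_add_scale(1)[OF _ cm rm]) (use p in simp)
 have "weakly_converges (Lq p ?I) (Lnorm p ?I) ?f (%_. m)"
  unfolding weakly_converges_def
 proof
  fix l assume l: "l \<in> fun_dual (Lq p ?I) (Lnorm p ?I :: (real => 'x) => real)"
  have "(%n. l (%_. m) + l (%t. radT T n t *R d)) ----> l (%_. m) + 0"
   by (intro tendsto_add tendsto_const rad_weakly_null[OF T p l])
  thus "(%n. l (?f n)) ----> l (%_. m)" using fun_dualD(1)[OF l cm rm] by simp
 qed
 hence "weakly_converges (Lq q ?I) (Lnorm q ?I) (%n t. F (?f n t)) (%_. F m)"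
  using F fm cm unfolding weak_weak_continuous_def by (auto dest!: spec[of _ ?f] spec[of _ "%_. m"])
 hence lim: "(%n. LI t|?I. blinfun_apply (F (?f n t)) v) ----> (LI t|?I. blinfun_apply (F m) v)"
  using evaluation_fun_dual[OF T less_imp_le[OF q], of v] unfolding weakly_converges_def by (rule bspec)
 let ?a = "(blinfun_apply (F (m + d)) v + blinfun_apply (F (m - d)) v) / 2"
 let ?b = "(blinfun_apply (F (m + d)) v - blinfun_apply (F (m - d)) v) / 2"
 have "(LI t|?I. blinfun_apply (F (?f n t)) v) = T * ?a" for n
 proof -
  \<comment> \<open>\<open>F\<close> sees only two arguments, so its values are affine in the sign,
    and the oscillating part has mean 0.\<close>
  have e: "blinfun_apply (F (?f n t)) v = ?a + ?b * radT T n t" for t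
   using r[of n t] by (auto simp: field_simps)
  have i: "iint T (%t. ?b * radT T n t)"
   by (rule set_integrable_mult_right, rule iint_bounded[where C=1]) (auto simp: radT_def rad_abs)
  have j: "iint T (%t. ?a)" by (rule iint_bounded[where C="\<bar>?a\<bar>"]) auto
  show ?thesis unfolding e integral_interval set_integral_add(2)[OF j i] set_integral_mult_right radT_integrals(1)[OF T]
   using T by (simp add: set_int)
 qed
 moreover have "(LI t|?I. blinfun_apply (F m) v) = T * blinfun_apply (F m) v"
  unfolding integral_interval using T by (simp add: set_int)
 ultimately have "(%n::nat. T * ?a) ----> T * blinfun_apply (F m) v" using lim by (simp only:)
 hence "T * ?a = T * blinfun_apply (F m) v" by (simp only: LIMSEQ_const_iff)
 thus "blinfun_apply (F m) v = blinfun_apply ((1/2) *R (F (m + d) + F (m - d))) v"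
  using T by (simp add: blinfun.add_left blinfun.scaleR_left)
qed

lemma additive_bounded_imp_bounded_linear:
 fixes G :: "'x::real_normed_vector => 'y::real_normed_vector"
 assumes add: "!!u v. G (u + v) = G u + G v" and b: "!!u. norm u <= 1 ==> norm (G u) <= B"
 shows "bounded_linear G"
proof -
 have z: "G 0 = 0" using add[of 0 0] by simp
 have neg: "G (- u) = - G u" for u using add[of u "- u"] z by (simp add: eq_neg_iff_add_eq_0 add.commute)
 have nat: "G (real n *R u) = real n *R G u" for n u
  by (induction n) (simp_all add: z add scaleR_add_left)
 have int: "G (of_int k *R u) = of_int k *R G u" for k u
  by (cases k) (use nat neg in "auto simp del: of_nat_Suc")
 have sc1: "G (c *R u) = c *R G u" if u: "norm u <= 1" for c u
 proof -
  \<comment> \<open>The defect is additive in \<open>c\<close> and vanishes on integers, so it is bounded on all of \<open>\<real>\<close>.\<close>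
  define D where "D c = G (c *R u) - c *R G u" for c
  have "norm (D c) <= 2 * B" for c
  proof -
   have sp: "c *R x = of_int \<lfloor>c\<rfloor> *R x + frac c *R x" for x :: "'z::real_vector"
    by (simp add: frac_def flip: scaleR_add_left)
   have "D c = G (frac c *R u) - frac c *R G u" unfolding D_def sp[of u] sp[of "G u"] add int by simp
   moreover have "norm (frac c *R u) <= 1"
    using u frac_lt_1[of c] by (simp add: mult_le_one less_imp_le)
   moreover have "norm (frac c *R G u) <= B"
    using mult_left_le_one_le[of "norm (G u)" "frac c"] b[OF u] frac_lt_1[of c] by (simp add: less_imp_le)
   ultimately show ?thesis using b[of "frac c *R u"] norm_triangle_ineq4[of "G (frac c *R u)" "frac c *R G u"] by simp
  qed
  moreover have "real n *R D c = D (real n * c)" for n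
   using nat[of n "c *R u"] by (simp add: D_def scaleR_diff_right)
  ultimately have "real n * norm (D c) <= 2 * B" for n by (metis norm_scaleR abs_of_nat)
  hence "norm (D c) = 0" using b[OF u] order_trans[OF norm_ge_zero] by (intro real_archimedian_rdiv_eq_0[of _ "2 * B"]) auto
  thus ?thesis by (simp add: D_def)
 qed
 have sc: "G (c *R u) = c *R G u" for c u
 proof -
  obtain n where n: "norm u < real n" using reals_Archimedean2 by blast
  hence n0: "real n > 0" by (rule order_le_less_trans[OF norm_ge_zero])
  hence "norm ((1 / real n) *R u) <= 1" using n by simp
  from arg_cong[OF sc1[OF this, of c], of "%x. real n *R x"] show ?thesis
   using n0 nat[of n "c *R (1 / real n) *R u"] nat[of n "(1 / real n) *R u"] by simp
 qed
 show ?thesis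
 proof (rule bounded_linear_intro[where K=B])
  fix u show "norm (G u) <= norm u * B"
  proof (cases "u = 0")
   case False
   have "norm (G ((1 / norm u) *R u)) <= B" by (rule b) (use False in simp)
   thus ?thesis using False unfolding sc by (simp add: field_simps)
  qed (simp add: z)
 qed (use add sc in auto)
qed

lemma C1_functional_grad:
 assumes "C1_functional E"
 shows "(E has_derivative blinfun_apply (grad E u)) (at u)" and "gateaux E u v = blinfun_apply (grad E u) v"
  and "((%h. (E (u + h *R v) - E u) / h) \<longlongrightarrow> blinfun_apply (grad E u) v) (at 0)"
  and "continuous_on UNIV (grad E)"
proof -
 obtain E' where d: "!!u. (E has_derivative blinfun_apply (E' u)) (at u)" and c: "continuous_on UNIV E'"
  using assms unfolding C1_functional_def by blast
 have q: "((%h. (E (u + h *R v) - E u) / h) \<longlongrightarrow> blinfun_apply (E' u) v) (at 0)" for u v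
 proof -
  have "((%h. E (u + h *R v)) has_derivative (%h. blinfun_apply (E' u) (h *R v))) (at 0)"
   by (rule has_derivative_compose[of "%h. u + h *R v" "%h. h *R v" 0 UNIV E])
    (use d[of u] in "auto intro!: derivative_eq_intros")
  hence "((%h. E (u + h *R v)) has_real_derivative blinfun_apply (E' u) v) (at 0)"
   by (simp add: has_field_derivative_def blinfun.scaleR_right mult_commute_abs)
  thus ?thesis by (simp add: DERIV_def)
 qed
 have g: "gateaux E u v = blinfun_apply (E' u) v" for u v
  unfolding gateaux_def by (rule tendsto_Lim[OF _ q]) simp
 have gr: "grad E = E'" by (rule ext) (simp add: grad_def g[abs_def] blinfun_apply_inverse)
 show "(E has_derivative blinfun_apply (grad E u)) (at u)" "gateaux E u v = blinfun_apply (grad E u) v"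
  "((%h. (E (u + h *R v) - E u) / h) \<longlongrightarrow> blinfun_apply (grad E u) v) (at 0)"
  "continuous_on UNIV (grad E)"
  using d g c q by (auto simp: gr)
qed

text \<open>Preserving midpoints makes \<open>G\<close> additive, and the growth bound on the unit
  ball makes it bounded, hence linear. Integrating the gradient along rays gives the quadratic
  energy. On each ray coercivity then compares a square with the power \<open>p\<close>, for all
  scales at once.\<close>

lemma affine_gradient:
 fixes E :: "'x::{real_normed_vector, second_countable_topology} => real" and i :: "'x => 'h::real_inner"
 assumes T: "T > 0" and E: "C1_functional E" and p: "p > 1" "1 / p + 1 / p' = 1" and C1: "C1 > 0"
  and i: "bounded_linear i"
  and growth: "!!u. norm (grad E u) <= C0 * norm u powr (p - 1) + C0" and C0: "C0 > 0"
  and coercive: "!!u. gateaux E u u \<ge> C1 * norm u powr p - C2 * nsq (i u)"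
  and weak: "weak_weak_continuous T p p' (grad E)"
  and nontrivial: "\<exists>u::'x. u \<noteq> 0"
 obtains A where "bounded_bilinear A" "!!u v. A u v = A v u" "!!u. blinfun_apply (grad E u) = (%v. A u v + blinfun_apply (grad E 0) v)"
  "!!u. E u = E 0 + blinfun_apply (grad E 0) u + A u u / 2"
  "!!u. A u u \<ge> C1 * nsq u - C2 * nsq (i u)" "p = 2"
proof -
 interpret i: bounded_linear i by fact
 have q: "p' > 1"
 proof -
  have "1 / p' = 1 - 1 / p" using p by simp
  moreover have "1 - 1 / p > 0" "1 - 1 / p < 1" using p by auto
  ultimately have "1 / p' > 0" "1 / p' < 1" by simp_all
  thus ?thesis by (simp add: divide_less_eq)
 qed
 define G where "G u = grad E u - grad E 0" for u
 note mid = weak_weak_continuous_midpoint[OF T p(1) q weak]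
 have half: "G ((1/2) *R (u + v)) = (1/2) *R (G u + G v)" for u v
  using mid[of "(1/2) *R (u + v)" "(1/2) *R (u - v)"]
  by (simp add: G_def scaleR_add_right[symmetric] scaleR_diff_right[symmetric] scaleR_2[symmetric] del: scaleR_add_right scaleR_diff_right)
   (simp add: algebra_simps scaleR_2[symmetric])
 have hz: "G ((1/2) *R u) = (1/2) *R G u" for u using half[of u 0] by (simp add: G_def)
 have add: "G (u + v) = G u + G v" for u v using half[of u v] unfolding hz by simp
 have "norm (G u) <= 2 * C0 + norm (grad E 0)" if "norm u <= 1" for u
 proof -
  have "norm u powr (p - 1) <= 1" using that p powr_mono2[of "p - 1" "norm u" 1] by simp
  hence "C0 * norm u powr (p - 1) <= C0 * 1" using C0 by (intro mult_left_mono) auto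
  thus ?thesis using growth[of u] norm_triangle_ineq4[of "grad E u" "grad E 0"] by (simp add: G_def)
 qed
 hence G: "bounded_linear G" by (rule additive_bounded_imp_bounded_linear[OF add])
 interpret G: bounded_linear G by fact
 define A where "A u v = blinfun_apply (G u) v" for u v
 have A: "bounded_bilinear A"
  unfolding A_def[abs_def] by (rule bounded_bilinear.comp1[OF bounded_bilinear_blinfun_apply G])
 interpret A: bounded_bilinear A by fact
 let ?b = "blinfun_apply (grad E 0)"
 have gA: "blinfun_apply (grad E u) v = A u v + ?b v" for u v by (simp add: A_def G_def blinfun.diff_left)
 note D = C1_functional_grad[OF E]
 have Ef: "E u = E 0 + ?b u + A u u / 2" for u
 proof -
  let ?\<phi> = "%s. E (s *R u) - s * ?b u - s\<^sup>2 / 2 * A u u"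
  have "(?\<phi> has_real_derivative 0) (at s)" for s
  proof -
   have "((%h. E (h *R u)) has_derivative (%h. blinfun_apply (grad E (s *R u)) (h *R u))) (at s)"
    by (rule has_derivative_compose[OF _ D(1)]) (auto intro!: derivative_eq_intros)
   hence "((%h. E (h *R u)) has_real_derivative (s * A u u + ?b u)) (at s)"
    unfolding has_field_derivative_def blinfun.scaleR_right gA[of "s *R u"] A.scaleR_left by (simp add: mult_commute_abs)
   thus ?thesis by (auto intro!: derivative_eq_intros)
  qed
  from DERIV_isconst_all[of ?\<phi>, OF allI[OF this], of 1 0] show ?thesis by simp
 qed
 \<comment> \<open>The energy sees only the symmetric part of \<open>A\<close>: its difference
   quotient tends to the symmetrized form, which must therefore be the gradient.\<close>
 have sym: "A u v = A v u" for u v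
 proof -
  have "(%h. (E (u + h *R v) - E u) / h) = (%h. if h = 0 then 0 else ?b v + (A u v + A v u) / 2 + h * A v v / 2)"
  proof
   fix h
   have e: "E (u + h *R v) = E 0 + (?b u + h * ?b v) + (A u u + h * A u v + h * A v u + h * h * A v v) / 2"
    unfolding Ef[of "u + h *R v"] by (simp add: blinfun.add_right blinfun.scaleR_right A.add_left A.add_right A.scaleR_left A.scaleR_right algebra_simps)
   show "(E (u + h *R v) - E u) / h = (if h = 0 then 0 else ?b v + (A u v + A v u) / 2 + h * A v v / 2)"
    unfolding e unfolding Ef[of u] by (simp add: field_simps)
  qed
  moreover have "((%h. if h = 0 then 0 else ?b v + (A u v + A v u) / 2 + h * A v v / 2) \<longlongrightarrow> ?b v + (A u v + A v u) / 2) (at 0)"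
   by (rule tendsto_cong[THEN iffD2, of _ "%h. ?b v + (A u v + A v u) / 2 + h * A v v / 2"])
    (auto simp: eventually_at_filter intro!: tendsto_eq_intros)
  ultimately have "blinfun_apply (grad E u) v = ?b v + (A u v + A v u) / 2"
   using D(3)[of u v] by (intro tendsto_unique[of "at (0::real)"]) auto
  thus ?thesis unfolding gA[of u] by simp
 qed
 \<comment> \<open>Coercivity at \<open>s *R u\<close> and at \<open>- s *R u\<close>, added up,
   cancels the linear part.\<close>
 have co: "s\<^sup>2 * (A u u + C2 * nsq (i u)) \<ge> C1 * (s powr p * norm u powr p)" if s: "s > 0" for s u
  using coercive[of "s *R u"] coercive[of "- s *R u"] s
  unfolding D(2) gA[of "s *R u"] gA[of "- s *R u"]
  by (simp add: A.scaleR_left A.scaleR_right A.minus_left A.minus_right i.scaleR i.neg blinfun.scaleR_right blinfun.minus_right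
   power_mult_distrib powr_mult power2_eq_square algebra_simps)
 have p2: "p = 2"
 proof (rule ccontr)
  assume p2: "p \<noteq> 2"
  obtain u :: 'x where u: "u \<noteq> 0" using nontrivial by blast
  define a where "a = (A u u + C2 * nsq (i u)) / (C1 * norm u powr p)"
  have c: "C1 * norm u powr p > 0" using u C1 by simp
  have ap: "s powr (p - 2) <= a" if "s > 0" for s
  proof -
   have "s powr p = s\<^sup>2 * s powr (p - 2)" using that by (simp add: powr_diff)
   hence "s\<^sup>2 * (C1 * norm u powr p * s powr (p - 2)) <= s\<^sup>2 * (A u u + C2 * nsq (i u))"
    using co[OF that, of u] by (simp add: ac_simps)
   hence "C1 * norm u powr p * s powr (p - 2) <= A u u + C2 * nsq (i u)" using that by simp
   thus ?thesis using c by (simp add: a_def pos_le_divide_eq ac_simps)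
  qed
  have "a \<ge> 1" using ap[of 1] by simp
  \<comment> \<open>This scale lies above 1 if \<open>p > 2\<close> and below 1 if
    \<open>p < 2\<close>; either way its power exceeds the bound \<open>a\<close>.\<close>
  hence "((a + 1) powr (1 / (p - 2))) powr (p - 2) = a + 1" using p2 by (simp add: powr_powr)
  moreover have "(a + 1) powr (1 / (p - 2)) > 0" using \<open>a \<ge> 1\<close> by simp
  ultimately show False using ap[of "(a + 1) powr (1 / (p - 2))"] by simp
 qed
 have "A u u \<ge> C1 * nsq u - C2 * nsq (i u)" for u
  using co[of 1 u] p2 by (simp add: powr_numeral)
 thus thesis by (rule that[OF A sym ext[OF gA] Ef _ p2])
qed

section \<open>The extended energy\<close>

lemma Lq2_iff: "f \<in> Lq 2 M \<longleftrightarrow> f \<in> bm M \<and> integrable M (%x. nsq (f x))"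
 by (simp add: Lq_def powr_numeral)

lemma Lnorm2: "Lnorm 2 M f = sqrt (LI x|M. nsq (f x))"
 by (simp add: Lnorm_def powr_numeral powr_half_sqrt)

text \<open>A measurable substitute for a unit vector at which \<open>l\<close> attains its norm.\<close>

primrec maximizer :: "(nat => 'x::real_vector) => ('x => real) => nat => 'x" where
 "maximizer e l 0 = 0"
| "maximizer e l (Suc n) = (if l (e n) > l (maximizer e l n) then e n else maximizer e l n)"

lemma maximizer_measurable:
 fixes l :: "'a => 'x::{real_normed_vector, second_countable_topology} => real"
 assumes m: "!!v. v \<in> bm N ==> (%x. l x (v x)) \<in> bm N"
 shows "(%x. maximizer e (l x) n) \<in> bm N"
proof (induction n)
 case (Suc n)
 note [measurable] = Suc m[OF Suc] m[of "%_. e n", OF borel_measurable_const]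
 show ?case unfolding maximizer.simps by measurable
qed simp

text \<open>The dual norm equals the square norm of the pointwise dual norm \<open>g x\<close> of
  \<open>l x\<close>, which is the increasing limit of the values at the maximizers. The second
  claim presents the dual norm as a limit of plain integrals, and this is what makes it measurable
  when \<open>l\<close> also depends on time.\<close>

lemma fun_dual_norm_L2:
 fixes l :: "'a => 'x::{real_normed_vector, second_countable_topology} => real" and M :: "'a measure"
 assumes l: "!!x. x \<in> space M ==> bounded_linear (l x)"
  and G: "!!x v. x \<in> space M ==> \<bar>l x v\<bar> <= G x * norm v" "!!x. x \<in> space M ==> G x \<ge> 0"
  and G2: "G \<in> bm M" "integrable M (%x. (G x)\<^sup>2)"
  and m: "!!v. v \<in> bm M ==> (%x. l x (v x)) \<in> bm M"
  and e: "closure (range e) = sphere 0 1"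
 shows "(%v. LI x|M. l x (v x)) \<in> fun_dual (Lq 2 M) (Lnorm 2 M)"
  and "(%n. sqrt (LI x|M. (l x (maximizer e (l x) n))\<^sup>2)) ----> fun_dual_norm (Lq 2 M) (Lnorm 2 M) (%v. LI x|M. l x (v x))"
  and "(fun_dual_norm (Lq 2 M) (Lnorm 2 M) (%v. LI x|M. l x (v x)))\<^sup>2 <= (LI x|M. (G x)\<^sup>2)"
proof -
 let ?W = "%v. LI x|M. l x (v x)"
 let ?N = "fun_dual_norm (Lq 2 M) (Lnorm 2 M) ?W"
 define s where "s n x = maximizer e (l x) n" for n x
 have e1: "norm (e n) = 1" for n
 proof -
  have "e n \<in> sphere 0 1" using closure_subset[of "range e"] unfolding e by blast
  thus ?thesis by simp
 qed
 have s1: "norm (s n x) <= 1" for n x unfolding s_def by (induction n) (auto simp: e1)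
 have sm [measurable]: "s n \<in> bm M" for n unfolding s_def[abs_def] by (rule maximizer_measurable[OF m])
 define q where "q n x = l x (s n x)" for n x
 have qm [measurable]: "q n \<in> bm M" for n unfolding q_def[abs_def] by (rule m[OF sm])
 have q_inc: "q n x <= q (Suc n) x" for n x by (simp add: q_def s_def)
 have q_e: "l x (e n) <= q (Suc n) x" for n x by (simp add: q_def s_def)
 have q_mono: "mono (%n. q n x)" for x by (rule incseq_SucI) (rule q_inc)
 have q0: "0 <= q n x" if "x \<in> space M" for n x
 proof -
  have "q 0 x = 0" using linear_simps(3)[OF l[OF that]] by (simp add: q_def s_def)
  thus ?thesis using monoD[OF q_mono, of 0 n x] by simp
 qed
 have qG: "q n x <= G x" if "x \<in> space M" for n x
 proof -
  have "q n x <= G x * norm (s n x)" using G(1)[OF that, of "s n x"] by (simp add: q_def)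
  also have "... <= G x * 1" by (rule mult_left_mono[OF s1 G(2)[OF that]])
  finally show ?thesis by simp
 qed
 define g where "g x = (SUP n. q n x)" for x
 have lim: "(%n. q n x) ----> g x" if "x \<in> space M" for x
  unfolding g_def by (rule LIMSEQ_incseq_SUP[OF _ q_mono]) (use qG[OF that] in \<open>auto intro!: bdd_aboveI2[where M="G x"]\<close>)
 have qg: "q n x <= g x" if "x \<in> space M" for n x by (rule incseq_le[OF q_mono lim[OF that]])
 have g0: "0 <= g x" "g x <= G x" if "x \<in> space M" for x
  using order_trans[OF q0 qg] LIMSEQ_le_const2[OF lim] qG that by blast+
 have gm [measurable]: "g \<in> bm M"
  by (rule borel_measurable_LIMSEQ_metric[OF _ lim]) auto
 have sph: "l x v <= g x" if x: "x \<in> space M" and "norm v = 1" for x v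
 proof -
  have "v \<in> closure (range e)" using that e by simp
  then obtain r where r: "!!n. r n \<in> range e" "r ----> v" unfolding closure_sequential by blast
  have "(%n. l x (r n)) ----> l x v" by (rule bounded_linear.tendsto[OF l[OF x] r(2)])
  moreover have "l x (r n) <= g x" for n
  proof -
   obtain k where "r n = e k" using r(1)[of n] by blast
   thus ?thesis using q_e[of x k] qg[OF x, of "Suc k"] by simp
  qed
  ultimately show ?thesis by (intro LIMSEQ_le_const2) auto
 qed
 have lg: "\<bar>l x v\<bar> <= g x * norm v" if x: "x \<in> space M" for x v
 proof (cases "v = 0")
  case False
  have "l x (c *R v) = c * l x v" for c using linear_simps(5)[OF l[OF x], of c v] by simp
  hence "1 / norm v * l x v <= g x" "(- 1 / norm v) * l x v <= g x"
   using sph[OF x, of "(1 / norm v) *R v"] sph[OF x, of "(- 1 / norm v) *R v"] False by (simp_all only: norm_scaleR) simp_all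
  thus ?thesis using False by (simp add: abs_le_iff field_simps)
 qed (use linear_simps(3)[OF l[OF x]] in simp)
 have g2: "integrable M (%x. (g x)\<^sup>2)"
  by (rule LI_bound[OF G2(2)]) (use g0 in "auto intro!: AE_I2 power_mono")
 have q2: "integrable M (%x. (q n x)\<^sup>2)" for n
  by (rule LI_bound[OF g2]) (use q0 qg in "auto intro!: AE_I2 power_mono")
 have WB: "integrable M (%x. l x (v x)) \<and> \<bar>?W v\<bar> <= sqrt (LI x|M. (g x)\<^sup>2) * Lnorm 2 M v" if v: "v \<in> Lq 2 M" for v
 proof -
  have [measurable]: "v \<in> bm M" and v2: "integrable M (%x. nsq (v x))" using v by (auto simp: Lq2_iff)
  have "(%x. norm (v x)) \<in> bm M" by measurable
  note cs = Cauchy_Schwarz_integral[OF gm this g2 v2]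
  have i: "integrable M (%x. l x (v x))"
   by (rule LI_bound[OF cs(1) m]) (use lg g0 in "auto intro!: AE_I2")
  have "\<bar>?W v\<bar> <= (LI x|M. g x * norm (v x))"
   by (rule order_trans[OF integral_abs_bound integral_mono[OF integrable_abs[OF i] cs(1)]]) (rule lg)
  also have "... <= sqrt ((LI x|M. (g x)\<^sup>2) * (LI x|M. nsq (v x)))" using cs(2) by (rule real_le_rsqrt)
  finally show ?thesis using i by (simp add: Lnorm2 real_sqrt_mult)
 qed
 have add: "?W (%x. f x + h x) = ?W f + ?W h" if "f \<in> Lq 2 M" "h \<in> Lq 2 M" for f h
 proof -
  have "?W (%x. f x + h x) = (LI x|M. l x (f x) + l x (h x))"
   by (intro LI_cong refl) (use linear_simps(1)[OF l] in simp)
  thus ?thesis using WB that by simp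
 qed
 have sc: "?W (%x. c *R f x) = c * ?W f" for c f
 proof -
  have "?W (%x. c *R f x) = (LI x|M. c * l x (f x))"
   by (intro LI_cong refl) (use linear_simps(5)[OF l] in simp)
  thus ?thesis by simp
 qed
 show "?W \<in> fun_dual (Lq 2 M) (Lnorm 2 M)"
  unfolding fun_dual_def using add sc WB by blast
 let ?S = "{f \<in> Lq 2 M. Lnorm 2 M f <= 1}"
 have B: "\<bar>?W v\<bar> <= sqrt (LI x|M. (g x)\<^sup>2)" if "v \<in> ?S" for v
 proof -
  have "\<bar>?W v\<bar> <= sqrt (LI x|M. (g x)\<^sup>2) * Lnorm 2 M v" using WB that by blast
  also have "... <= sqrt (LI x|M. (g x)\<^sup>2) * 1" using that by (intro mult_left_mono) auto
  finally show ?thesis by simp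
 qed
 have z: "(%_. 0) \<in> ?S" by (simp add: Lq2_iff Lnorm2)
 have Nle: "?N <= sqrt (LI x|M. (g x)\<^sup>2)"
  unfolding fun_dual_norm_def by (rule cSUP_least) (use z B in blast)+
 have bdd: "bdd_above ((%f. \<bar>?W f\<bar>) ` ?S)" using B by (intro bdd_aboveI2[where M="sqrt (LI x|M. (g x)\<^sup>2)"]) auto
 have N0: "0 <= ?N" unfolding fun_dual_norm_def by (rule cSUP_upper2[OF bdd z]) simp
 have Nge: "sqrt (LI x|M. (q n x)\<^sup>2) <= ?N" for n
 proof (cases "(LI x|M. (q n x)\<^sup>2) = 0")
  case False
  define J where "J = (LI x|M. (q n x)\<^sup>2)"
  have J: "J > 0" using False by (simp add: J_def order_less_le)
  \<comment> \<open>The maximizing directions, weighted by the values reached and normalized, attain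
    \<open>sqrt J\<close> exactly.\<close>
  let ?v = "%x. (q n x / sqrt J) *R s n x"
  have v2: "nsq (?v x) <= (q n x)\<^sup>2 / J" for x
  proof -
   have "nsq (?v x) = (q n x)\<^sup>2 / J * nsq (s n x)"
    using J by (simp add: power_mult_distrib power_divide)
   also have "... <= (q n x)\<^sup>2 / J * 1" using J s1[of n x] by (intro mult_left_mono) (auto simp: power_le_one)
   finally show ?thesis by simp
  qed
  have vi: "integrable M (%x. nsq (?v x))"
   by (rule LI_bound[of _ "%x. (q n x)\<^sup>2 / J"]) (use q2 v2 J in "auto intro!: AE_I2 simp del: norm_scaleR")
  have "(LI x|M. nsq (?v x)) <= (LI x|M. (q n x)\<^sup>2 / J)" by (rule integral_mono[OF vi _ v2]) (use q2 in simp)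
  also have "... = 1" using J by (simp add: J_def)
  finally have vS: "?v \<in> ?S" using vi by (simp add: Lq2_iff Lnorm2)
  have "?W ?v = (LI x|M. (q n x)\<^sup>2 / sqrt J)"
   by (intro LI_cong refl)
    (use linear_simps(5)[OF l] in "simp add: q_def power2_eq_square")
  also have "... = J / sqrt J" by (simp add: J_def)
  also have "... = sqrt J" using J by (simp add: real_div_sqrt)
  finally have "sqrt J <= \<bar>?W ?v\<bar>" by simp
  thus ?thesis unfolding fun_dual_norm_def J_def[symmetric] by (rule cSUP_upper2[OF bdd vS])
 qed (use N0 in simp)
 have "(%n. LI x|M. (q n x)\<^sup>2) ----> (LI x|M. (g x)\<^sup>2)"
  by (rule integral_dominated_convergence[OF _ _ g2]) (use lim q0 qg in "auto intro!: AE_I2 tendsto_intros power_mono")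
 hence lq: "(%n. sqrt (LI x|M. (q n x)\<^sup>2)) ----> sqrt (LI x|M. (g x)\<^sup>2)" by (rule tendsto_real_sqrt)
 have "sqrt (LI x|M. (g x)\<^sup>2) <= ?N" by (rule LIMSEQ_le_const2[OF lq]) (use Nge in blast)
 hence N: "?N = sqrt (LI x|M. (g x)\<^sup>2)" using Nle by simp
 show "(%n. sqrt (LI x|M. (l x (maximizer e (l x) n))\<^sup>2)) ----> ?N"
  unfolding N using lq by (simp add: q_def[abs_def] s_def)
 show "?N\<^sup>2 <= (LI x|M. (G x)\<^sup>2)"
  unfolding N by (simp, rule integral_mono[OF g2 G2(2)]) (use g0 in "auto intro: power_mono")
qed

lemma dense_unit_sequence:
 assumes "\<exists>x::'x::{real_normed_vector, second_countable_topology}. x \<noteq> 0"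
 obtains e :: "nat => 'x::{real_normed_vector, second_countable_topology}" where "closure (range e) = sphere 0 1"
proof -
 obtain x :: 'x where "x \<noteq> 0" using assms by blast
 hence "(1 / norm x) *R x \<in> sphere 0 1" by simp
 hence ne: "sphere (0::'x) 1 \<noteq> {}" by blast
 obtain D where D: "countable D" "D \<subseteq> sphere (0::'x) 1" "sphere 0 1 \<subseteq> closure D"
  by (rule separable)
 have "D \<noteq> {}" using ne D(3) by auto
 have "closure D = sphere 0 1" proof -
  have "closed (sphere (0::'x) 1)" by (simp add: sphere_def dist_norm closed_Collect_eq continuous_intros)
  thus ?thesis using D(3) closure_minimal[OF D(2)] by blast
 qed
 thus thesis using that[of "from_nat_into D"] range_from_nat_into[OF \<open>D \<noteq> {}\<close> D(1)] by simp
qed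

text \<open>The energy is expanded about \<open>x0\<close>, the element of \<open>X\<close> that
  represents the initial datum. Then \<open>Cop\<close> is \<open>x0\<close> plus an average, and
  \<open>U = u - x0\<close> satisfies an equation whose constant part \<open>b\<close> is the
  gradient at the initial state.\<close>

locale affine_flow = quad_flow i A b C1 C2 al T
 for i :: "'x::{banach, second_countable_topology} => 'h::{real_inner, banach, second_countable_topology}"
  and A b C1 C2 al T +
 fixes E :: "'x => real" and x0 :: 'x
 assumes inj_i: "inj i" and dense_i: "closure (range i) = UNIV" and nontrivial: "\<exists>x::'x. x \<noteq> 0"
  and grad_E: "blinfun_apply (grad E u) v = A (u - x0) v + b v"
  and E_eq: "E (x0 + y) = E x0 + b y + A y y / 2"
begin

lemma Xt_facts:
 assumes f: "f \<in> Xt al"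
 shows "f \<in> bm (Mw al)" "integrable (Mw al) (%th. nsq (f th))" "integrable (Mw al) f"
  "integrable (Mw al) (%th. i (f th))" "(LI th|Mw al. i (f th)) = i (LI th|Mw al. f th)"
  "(%th. i (f th)) \<in> bm (Mw al)" "integrable (Mw al) (%th. nsq (i (f th)))"
proof -
 show 1: "f \<in> bm (Mw al)" "integrable (Mw al) (%th. nsq (f th))"
  using f by (auto simp: Xt_def Lq2_iff)
 show 2: "integrable (Mw al) f" by (rule norm_integral_square_le(1)[OF prob_space_Mw(2)[OF al] 1 sets.top])
 show "integrable (Mw al) (%th. i (f th))" by (rule integrable_bounded_linear[OF i 2])
 show "(LI th|Mw al. i (f th)) = i (LI th|Mw al. f th)" by (rule integral_bounded_linear[OF i 2])
 show 3: "(%th. i (f th)) \<in> bm (Mw al)" by (rule measurable_compose[OF 1(1) i_measurable])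
 have "nsq (i (f th)) <= ki\<^sup>2 * nsq (f th)" for th
  using power_mono[OF onorm[OF i, of "f th"], of 2] by (simp add: ki_def power_mult_distrib)
 thus "integrable (Mw al) (%th. nsq (i (f th)))"
  by (intro LI_bound[OF integrable_mult_right[OF 1(2), of "ki\<^sup>2"]]) (use 3 in "auto intro!: AE_I2")
qed

lemma weighted_inner_integrable:
 assumes f: "f \<in> Xt al" and v: "v \<in> Xt al"
 shows "integrable (Mw al) (%th. th * inner (i (f th)) (i (v th)))" "integrable (Mw al) (%th. th * nsq (i (f th)))"
proof -
 note F = Xt_facts[OF f] and V = Xt_facts[OF v]
 note [measurable] = F(6) V(6)
 have id: "(%th. th) \<in> bm (Mw al)" by (rule bm_weighted) simp
 have I: "integrable (Mw al) (%th. norm (i (f th)) * norm (i (v th)))"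
  by (rule Cauchy_Schwarz_integral(1)) (use F V in auto)
 have B: "norm (th * inner (i (f th)) (i (v th))) <= norm (norm (i (f th)) * norm (i (v th)))" if "th \<in> space (Mw al)" for th
 proof -
  have "\<bar>th\<bar> * \<bar>inner (i (f th)) (i (v th))\<bar> <= 1 * (norm (i (f th)) * norm (i (v th)))"
   using that Cauchy_Schwarz_ineq2[of "i (f th)" "i (v th)"] by (intro mult_mono) auto
  thus ?thesis by (simp add: abs_mult)
 qed
 show "integrable (Mw al) (%th. th * inner (i (f th)) (i (v th)))"
  by (rule LI_bound[OF I]) (intro borel_measurable_times id borel_measurable_inner F(6) V(6), rule AE_I2, rule B)
 have C: "norm (th * nsq (i (f th))) <= norm (nsq (i (f th)))" if "th \<in> space (Mw al)" for th
  using that by (simp add: abs_mult mult_left_le_one_le)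
 show "integrable (Mw al) (%th. th * nsq (i (f th)))"
  by (rule LI_bound[OF F(7)])
   (intro borel_measurable_times id borel_measurable_power measurable_compose[OF F(6) borel_measurable_norm], rule AE_I2, rule C)
qed

lemma Et_eq:
 assumes f: "f \<in> Xt al"
 shows "Cop al (i x0) (%th. i (f th)) = i (x0 + (LI th|Mw al. f th))"
  "Et al i (i x0) E f = E x0 + b (LI th|Mw al. f th) + A (LI th|Mw al. f th) (LI th|Mw al. f th) / 2
   + 1 / 2 * (LI th|Mw al. th * nsq (i (f th)))"
proof -
 note F = Xt_facts[OF f]
 have m: "(%th. i (f th)) \<in> bm (ivl 1)"
  using F(6) by (simp add: measurable_cong_sets[OF sets_weighted refl])
 show c: "Cop al (i x0) (%th. i (f th)) = i (x0 + (LI th|Mw al. f th))"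
  unfolding Cop_def integral_weighted[OF wt_measurable m wt_nonneg[OF al], symmetric] F(5)
  by (simp add: linear_simps(1)[OF i])
 have id: "(%th. th) \<in> bm (ivl 1)" by (rule interval_measurable) simp
 have "(LI th<1. th * wt al th * nsq (i (f th))) = (LI th|Mw al. th * nsq (i (f th)))"
  by (subst integral_weighted[OF wt_measurable _ wt_nonneg[OF al]])
   (auto intro!: id borel_measurable_times borel_measurable_power measurable_compose[OF m borel_measurable_norm] simp: ac_simps)
 thus "Et al i (i x0) E f = E x0 + b (LI th|Mw al. f th) + A (LI th|Mw al. f th) (LI th|Mw al. f th) / 2
   + 1 / 2 * (LI th|Mw al. th * nsq (i (f th)))"
  unfolding Et_def c inv_f_f[OF inj_i] E_eq Hop_def by simp
qed

lemma fun_grad_Et: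
 assumes f: "f \<in> Xt al" and v: "v \<in> Xt al"
 shows "fun_grad (Et al i (i x0) E) f v = A (LI th|Mw al. f th) (LI th|Mw al. v th) + b (LI th|Mw al. v th)
  + (LI th|Mw al. th * inner (i (f th)) (i (v th)))"
proof -
 interpret A: bounded_bilinear A by (rule A)
 note F = Xt_facts[OF f] and V = Xt_facts[OF v]
 let ?F = "LI th|Mw al. f th" and ?V = "LI th|Mw al. v th" and ?I = "LI th|Mw al. th * inner (i (f th)) (i (v th))"
 let ?J = "LI th|Mw al. th * nsq (i (v th))"
 let ?r = "A ?F ?V + b ?V + ?I"
 have "Et al i (i x0) E (%th. f th + h *R v th) = Et al i (i x0) E f + h * ?r + h\<^sup>2 * (A ?V ?V / 2 + ?J / 2)" for h
 proof -
  have fv: "(%th. f th + h *R v th) \<in> Xt al" using f v unfolding Xt_def by (intro Lq_add_scale) auto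
  have I: "(LI th|Mw al. f th + h *R v th) = ?F + h *R ?V" using F V by simp
  have sq: "nsq (x + h *R y) = nsq x + 2 * h * inner x y + h\<^sup>2 * nsq y" for x y :: 'h
   unfolding power2_norm_eq_inner by (simp add: inner_add_left inner_add_right inner_commute power2_eq_square algebra_simps)
  have "(LI th|Mw al. th * nsq (i (f th + h *R v th))) =
   (LI th|Mw al. th * nsq (i (f th)) + 2 * h * (th * inner (i (f th)) (i (v th))) + h\<^sup>2 * (th * nsq (i (v th))))"
   by (intro LI_cong refl)
    (simp add: linear_simps[OF i] sq algebra_simps)
  also have "... = (LI th|Mw al. th * nsq (i (f th))) + 2 * h * ?I + h\<^sup>2 * ?J"
   using weighted_inner_integrable[OF f v] weighted_inner_integrable(2)[OF v f] by simp
  finally have "(LI th|Mw al. th * nsq (i (f th + h *R v th))) = (LI th|Mw al. th * nsq (i (f th))) + 2 * h * ?I + h\<^sup>2 * ?J" .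
  thus ?thesis unfolding Et_eq(2)[OF fv] I Et_eq(2)[OF f]
   by (simp add: linear_simps[OF b] A.add_left A.add_right A.scaleR_left A.scaleR_right A_sym[of ?V ?F] power2_eq_square field_simps)
 qed
 \<comment> \<open>The energy is exactly quadratic in \<open>h\<close>. At \<open>h = 0\<close> the
   quotient has the default value 0 of division, which the limit ignores.\<close>
 hence "(%h. (Et al i (i x0) E (%th. f th + h *R v th) - Et al i (i x0) E f) / h) =
  (%h. if h = 0 then 0 else ?r + h * (A ?V ?V / 2 + ?J / 2))"
  by (auto simp: fun_eq_iff power2_eq_square field_simps)
 moreover have "((%h. if h = 0 then 0 else ?r + h * (A ?V ?V / 2 + ?J / 2)) \<longlongrightarrow> ?r) (at 0)"
  by (rule tendsto_cong[THEN iffD2, of _ "%h. ?r + h * (A ?V ?V / 2 + ?J / 2)"])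
   (auto simp: eventually_at_filter intro!: tendsto_eq_intros)
 ultimately show ?thesis unfolding fun_grad_def by (intro tendsto_Lim) auto
qed

end

section \<open>From the fractional to the integer-order flow\<close>

lemma conv_inner:
 fixes f :: "real => 'h::{real_inner, banach, second_countable_topology}"
 assumes "iint t (%s. k (t - s) *R f s)"
 shows "conv k (%s. inner (f s) v) t = inner (conv k f t) v"
 by (rule conv_linear[OF bounded_linear_inner_left assms])

lemma conv_one_conv_gker:
 assumes a: "0 < a" and f: "iint t f"
 shows "prim (conv (gker a) f) t = conv (gker a) (prim f) t"
proof -
 have "prim (conv (gker a) f) t = conv (prim (gker a)) f t"
  by (rule conv_assoc_bounded[where C=1]) (use iint_gker[OF a] f in auto)
 moreover have "conv (gker a) (prim f) t = conv (conv (gker a) (%_. 1)) f t"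
  by (rule conv_assoc_bounded2[where C=1]) (use iint_gker[OF a] f in auto)
 moreover have "prim (gker a) = conv (gker a) (%_. 1)" by (rule ext) (rule conv_commute)
 ultimately show ?thesis by simp
qed

text \<open>By Cauchy-Schwarz only the integral of the squared kernel is needed, and this is at most
  its height times its mass. The height is \<open>c0 th\<close>, which the weight
  \<open>1 - th\<close> cancels exactly.\<close>

lemma norm_conv_pk_square:
 assumes th: "0 < th" "th < 1" and t: "0 <= t" "t <= T"
  and f [measurable]: "f \<in> bm borel" and f2: "iint T (%s. nsq (f s))"
 shows "nsq (conv (pk th) f t) <= c0 th * (2 * (1 + T)) * (LI s<T. nsq (f s))"
proof -
 let ?I = "ivl t"
 have c0: "c0 th \<ge> 0" using th by (simp add: c0_def)
 have pb: "\<bar>pk th (t - s)\<bar> <= c0 th" if "0 < s" "s < t" for s using pk_le[OF th, of "t - s"] that by simp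
 have pn: "pk th s \<ge> 0" for s by (rule pk_nonneg[OF th(2)])
 have p2: "iint t (%s. (pk th (t - s))\<^sup>2)" and p1: "iint t (%s. c0 th * pk th (t - s))"
  by (rule iint_bounded[where C="(c0 th)\<^sup>2"]; use pb power_mono[OF pb, of _ 2] in "simp add: power2_eq_square abs_mult mult_mono c0")+
 have f2t: "iint t (%s. nsq (f s))" by (rule iint_mono[OF f2 t(2)])
 have ft: "iint t f" by (rule iint_of_square[OF f f2t])
 note cs = Cauchy_Schwarz_integral[of "%s. pk th (t - s)" ?I "%s. norm (f s)", unfolded iint_iff integral_interval]
 have "norm (conv (pk th) f t) <= (LI s<t. pk th (t - s) * norm (f s))"
  using set_integral_norm_bound[OF iint_conv_bounded[OF pk_measurable1 _ ft, of th "c0 th"]] pk_le[OF th] pn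
  by (simp add: conv_def)
 hence "nsq (conv (pk th) f t) <= (LI s<t. pk th (t - s) * norm (f s))\<^sup>2" by (rule power_mono) simp
 also have "... <= (LI s<t. (pk th (t - s))\<^sup>2) * (LI s<t. nsq (f s))"
  by (rule cs(2)) (auto intro!: interval_measurable p2 f2t)
 also have "... <= (c0 th * (2 * (1 + T))) * (LI s<T. nsq (f s))"
 proof (rule mult_mono)
  have "(LI s<t. (pk th (t - s))\<^sup>2) <= (LI s<t. c0 th * pk th (t - s))"
  proof (rule set_integral_mono[OF p2 p1])
   fix s assume "s \<in> {0<..<t}"
   hence "pk th (t - s) <= c0 th" using pb[of s] by simp
   thus "(pk th (t - s))\<^sup>2 <= c0 th * pk th (t - s)" unfolding power2_eq_square by (rule mult_right_mono[OF _ pn])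
  qed
  also have "... = c0 th * prim (pk th) t"
   unfolding set_integral_mult_right conv_commute[of "%_. 1"] by (simp add: conv_def)
  also have "... <= c0 th * (2 * (1 + T))"
   using conv_one_pk_bounds(2)[OF th t(1)] t by (intro mult_left_mono[OF _ c0]) auto
  finally show "(LI s<t. (pk th (t - s))\<^sup>2) <= c0 th * (2 * (1 + T))" .
  show "(LI s<t. nsq (f s)) <= (LI s<T. nsq (f s))"
   unfolding set_int
   by (rule integral_mono) (use f2 f2t t in "auto simp: set_integrable_def indicator_def")
  show "0 <= c0 th * (2 * (1 + T))" using c0 t by simp
  show "0 <= (LI s<t. nsq (f s))" by (simp add: set_int)
 qed
 finally show ?thesis .
qed

context weak_flow
begin

definition h2 where "h2 = (LI s<T. nsq (h s))"
text \<open>The version of the extended solution with values in \<open>H\<close>. It is defined at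
  all times and, for \<open>th\<close> in \<open>(0, 1)\<close>, continuous on
  \<open>[0, T]\<close>, which \<open>us\<close> need not be.\<close>

definition z where "z th t = conv (pk th) h t"

lemma h_square: "iint T (%s. nsq (h s))"
 and h_weak: "AE t in ivl T. \<forall>v. inner (h t) (i v) = w t v"
proof -
 obtain K where K: "(NI t|ivl T. nsq (h t)) <= ennreal K"
  "AE t in ivl T. \<forall>v. inner (h t) (i v) = w t v"
  by (rule limit_estimates)
 have "integrable (ivl T) (%t. nsq (h t))"
  unfolding integrable_iff_bounded using le_less_trans[OF K(1) ennreal_less_top] by (auto intro!: interval_measurable)
 thus "iint T (%s. nsq (h s))" by (simp add: iint_iff)
 show "AE t in ivl T. \<forall>v. inner (h t) (i v) = w t v" by (rule K(2))
qed

lemma h_iint: "t <= T ==> iint t h"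
 by (rule iint_mono[OF iint_of_square[OF h_measurable h_square]])

lemma z_measurable [measurable]: "(%x. z (fst x) (snd x)) \<in> bm (borel *M borel)"
 using conv_measurable_param[OF pk_measurable h_measurable] by (simp add: split_beta' z_def)

lemma iF_eq: "AE t in ivl T. i (F t) = prim h t"
proof -
 have "AE t in ivl T. t \<in> {0<..<T}" unfolding AE_interval by simp
 with weak_eq show ?thesis
 proof eventually_elim
  case (elim t)
  have "inner (i (F t) - prim h t) (i v) = 0" for v
  proof -
   have "inner (prim h t) (i v) = prim (%s. inner (h s) (i v)) t"
    by (rule conv_inner[symmetric]) (use h_iint[of t] elim in simp)
   also have "... = prim (%s. w s v) t"
    by (rule conv_cong_AE[where T=T]) (use h_weak elim in "auto elim: eventually_mono")
   also have "... = - prim (%s. A (U s) v + b v) t"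
    unfolding conv_one w_def set_int scaleR_minus_right Bochner_Integration.integral_minus ..
   finally show ?thesis using elim(1) by (simp add: F_def inner_diff_left)
  qed
  hence "norm (i (F t) - prim h t) <= 0" by (intro dense_norm_le[OF dense]) auto
  thus ?case by simp
 qed
qed

lemma iu_meas [measurable]: "(%s. i (U s)) \<in> bm borel"
 by measurable

text \<open>One null set of times serves all \<open>th\<close>: it is the one from
  \<open>iF_eq\<close>, and the convolution with \<open>pk th\<close> ignores null sets. This
  permits integration over \<open>th\<close> at a fixed time.\<close>

lemma i_us_eq: "AE t in ivl T. \<forall>th. 0 < th \<longrightarrow> th < 1 \<longrightarrow> i (us th t) = z th t"
proof -
 have "AE t in ivl T. t \<in> {0<..<T}" unfolding AE_interval by simp
 with iF_eq show ?thesis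
 proof eventually_elim
  case (elim t)
  show ?case
  proof (intro allI impI)
   fix th :: real assume th: "0 < th" "th < 1"
   have "conv (pk th) (prim h) t = conv (pk th) (%s. i (F s)) t"
    by (rule conv_cong_AE[where T=T]) (use iF_eq elim in "auto elim: eventually_mono")
   also have "... = i (conv (pk th) F t)"
    by (rule conv_linear[OF i iint_conv_continuous[OF pk_continuous F_iint]]) (use elim in simp)
   finally show "i (us th t) = z th t"
    unfolding z_def using conv_pk_ode(2)[OF th, of t h] h_iint[of t] elim by (simp add: us_def linear_simps[OF i])
  qed
 qed
qed

lemma conv_iU: "AE t in ivl T. conv (gker (1 - al)) (%s. i (U s)) t = i (F t)"
proof -
 have "AE t in ivl T. iint t (%s. gker (1 - al) (t - s) *R U s)"
  unfolding AE_interval by (rule conv_integrable(2)) (use U_iint iint_gker al in auto)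
 thus ?thesis by eventually_elim (simp add: F_def conv_linear[OF i])
qed

lemma iU_iint: "t <= T ==> iint t (%s. i (U s))"
proof -
 assume "t <= T"
 hence "integrable lborel (%s. i (cut t U s))"
  by (intro integrable_bounded_linear[OF i]) (use U_iint in "simp add: set_integrable_def")
 thus ?thesis by (simp add: set_integrable_def linear_simps[OF i])
qed

text \<open>Abel inversion. The integrals of both sides agree, because \<open>gker al\<close> and
  \<open>gker (1 - al)\<close> convolve to the constant 1.\<close>

lemma iU_eq: "AE t in ivl T. i (U t) = conv (gker al) h t"
proof (rule AE_eq_of_conv_one)
 show "iint T (conv (gker al) h)" by (rule conv_integrable(1)) (use iint_gker al h_iint in auto)
 fix t assume t: "0 < t" "t < T"
 have "prim (conv (gker al) h) t = conv (gker al) (prim h) t"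
  by (rule conv_one_conv_gker) (use al h_iint t in auto)
 also have "... = conv (gker al) (conv (gker (1 - al)) (%s. i (U s))) t"
 proof (rule conv_cong_AE[where T=T])
  show "AE s in ivl T. prim h s = conv (gker (1 - al)) (%s. i (U s)) s"
   using iF_eq conv_iU by eventually_elim simp
 qed (use t in auto)
 also have "... = prim (%s. i (U s)) t"
  by (rule conv_gker_inverse) (use al iU_iint t in auto)
 finally show "prim (%s. i (U s)) t = prim (conv (gker al) h) t" by simp
qed (use T iU_iint in auto)

text \<open>Holds at every \<open>t\<close>, not only almost everywhere, since the outer convolution
  ignores the null set of \<open>iU_eq\<close>. So the fractional integral is continuous and
  vanishes at time 0.\<close>

lemma conv_gker_iU:
 assumes "t <= T" shows "conv (gker (1 - al)) (%s. i (U s)) t = prim h t"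
proof -
 have "conv (gker (1 - al)) (%s. i (U s)) t = conv (gker (1 - al)) (conv (gker al) h) t"
  by (rule conv_cong_AE[where T=T]) (use iU_eq assms in auto)
 also have "... = prim h t" using conv_gker_inverse[of "1 - al" t h] al h_iint[OF assms] by simp
 finally show ?thesis .
qed

lemma z_integral: "AE t in ivl T. (LI th|M. z th t) = i (U t)"
proof -
 have "AE t in ivl T. iint t (%s. gker al (t - s) *R h s)"
  unfolding AE_interval by (rule conv_integrable(2)) (use h_iint iint_gker al in auto)
 with iU_eq show ?thesis
  by eventually_elim (simp add: z_def integral_conv_pk(2)[OF al h_measurable])
qed

lemma z_bound:
 assumes th: "0 < th" "th < 1" and t: "0 <= t" "t <= T"
 shows "nsq (z th t) <= c0 th * (2 * (1 + T)) * h2"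
 unfolding z_def h2_def by (rule norm_conv_pk_square[OF th t h_measurable h_square])

lemma h2_nonneg: "h2 \<ge> 0" by (simp add: h2_def set_int)

lemma z_continuous: assumes th: "0 < th" "th < 1" shows "continuous_on {0..T} (z th)"
proof -
 have zi: "iint T (z th)"
  unfolding z_def[abs_def] by (rule conv_integrable(1)[OF iint_continuous[OF continuous_on_subset[OF pk_continuous subset_UNIV]] h_iint]) auto
 have "continuous_on {0..T} (%t. c0 th *R prim h t - c1 th *R prim (z th) t)"
  by (intro continuous_intros conv_one_continuous zi h_iint) simp
 thus ?thesis
  by (rule continuous_on_cong[THEN iffD1, rotated -1])
   (auto simp: z_def[abs_def] conv_pk_ode(1)[OF th _ h_iint, symmetric])
qed

text \<open>Removes the weight \<open>th\<close> from the second energy estimate. For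
  \<open>th >= 1/2\<close> it costs a factor 2; for smaller \<open>th\<close> the bound of
  \<open>z_bound\<close> applies with \<open>c0 th <= 2\<close>, which explains the constant
  \<open>?C\<close>.\<close>

lemma z_square_bound:
 obtains K where "K \<ge> 0" "AE t in ivl T. (NI th|M. nsq (z th t)) <= ennreal K"
proof -
 obtain K where K: "K \<ge> 0" "AE t in ivl T. (NI th|M. th * nsq (i (us th t))) <= ennreal K"
  by (rule limit_estimates)
 let ?C = "4 * (1 + T) * h2"
 have C: "?C \<ge> 0" using T h2_nonneg by simp
 have "AE t in ivl T. t \<in> {0<..<T}" unfolding AE_interval by simp
 with K(2) i_us_eq have "AE t in ivl T. (NI th|M. nsq (z th t)) <= ennreal (?C + 2 * K)"
 proof eventually_elim
  case (elim t)
  have b: "nsq (z th t) <= ?C + 2 * (th * nsq (i (us th t)))" if th: "th \<in> {0<..<1}" for th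
  proof (cases "th < 1 / 2")
   case True
   have "c0 th <= 2" using th True by (simp add: c0_def field_simps)
   hence "c0 th * (2 * (1 + T)) * h2 <= 2 * (2 * (1 + T)) * h2"
    using T h2_nonneg by (intro mult_right_mono) auto
   thus ?thesis using z_bound[of th t] th elim(3) by (simp add: add_increasing2)
  next
   case False
   hence "1 * nsq (z th t) <= (2 * th) * nsq (z th t)" by (intro mult_right_mono) auto
   thus ?thesis using elim(2) th C by simp
  qed
  have "(NI th|M. nsq (z th t)) <= (PI th|M. ennreal ?C + 2 * ennreal (th * nsq (i (us th t))))"
   using b C by (intro nn_integral_mono) (simp add: ennreal_plus[symmetric] ennreal_mult[symmetric] ennreal_numeral[symmetric] del: ennreal_plus ennreal_numeral)
  also have "... = ennreal ?C + 2 * (NI th|M. th * nsq (i (us th t)))"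
  proof -
   have m: "(%th. ennreal (th * nsq (i (us th t)))) \<in> bm M"
    by (rule bm_weighted, measurable, rule measurable_compose[OF _ us_measurable, of "%th. (th, t)", simplified]) simp
   show ?thesis by (subst nn_integral_add) (use m prob_space_Mw(1)[OF al] in "auto simp: nn_integral_cmult")
  qed
  also have "... <= ennreal ?C + 2 * ennreal K" by (intro add_left_mono mult_left_mono elim(1)) simp
  also have "... = ennreal (?C + 2 * K)"
   using C K(1) by (simp add: ennreal_plus ennreal_mult)
  finally show ?case .
 qed
 thus thesis by (rule that[rotated]) (use C K(1) in simp)
qed

lemma z_L2_time:
 assumes th: "0 < th" "th < 1"
 shows "iint T (%t. nsq (z th t))" "(LI t<T. nsq (z th t)) <= (2 * (1 + T))\<^sup>2 * h2"
proof -
 have p: "(LI s<T. \<bar>pk th s\<bar>) <= 2 * (1 + T)"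
  using conv_one_pk_bounds(2)[OF th, of T] T pk_nonneg[OF th(2)] by (simp add: conv_one)
 note c = conv_L2[OF pk_measurable1 pk_nonneg[OF th(2)] _ p h_measurable h_square, of "c0 th"]
 show "iint T (%t. nsq (z th t))" "(LI t<T. nsq (z th t)) <= (2 * (1 + T))\<^sup>2 * h2"
  using c pk_le[OF th] by (simp_all add: z_def[abs_def] h2_def)
qed

end

lemma Lq2_nn:
 fixes f :: "'a => 'b::{banach, second_countable_topology}"
 assumes f: "f \<in> bm M" and K: "(NI x|M. nsq (f x)) <= ennreal K" and K0: "K \<ge> 0"
 shows "f \<in> Lq 2 M" "(Lnorm 2 M f)\<^sup>2 <= K" "ennreal ((Lnorm 2 M f)\<^sup>2) = (NI x|M. nsq (f x))"
proof -
 note [measurable] = f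
 have i: "integrable M (%x. nsq (f x))"
  unfolding integrable_iff_bounded using le_less_trans[OF K ennreal_less_top] by auto
 thus "f \<in> Lq 2 M" by (simp add: Lq2_iff)
 show e: "ennreal ((Lnorm 2 M f)\<^sup>2) = (NI x|M. nsq (f x))"
  using nn_integral_eq_integral[OF i] by (simp add: Lnorm2)
 show "(Lnorm 2 M f)\<^sup>2 <= K" using K K0 unfolding e[symmetric] by simp
qed

lemma slice_measurable:
 assumes "case_prod u \<in> bm (M *M N)" "x \<in> space M"
 shows "u x \<in> bm N"
 using measurable_Pair_compose_split[OF assms(1) measurable_const[OF assms(2)] measurable_id[of N]] by (simp add: id_def)

lemma LqLr2_intro:
 fixes u :: "'a => 'c => 'b::{banach, second_countable_topology}"
 assumes N: "sigma_finite_measure N" and u: "case_prod u \<in> bm (M *M N)"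
  and fin: "(PI x|M. (NI y|N. nsq (u x y))) < \<infinity>"
 shows "u \<in> LqLr 2 M 2 N"
proof -
 interpret N: sigma_finite_measure N by (rule N)
 let ?n = "%x. NI y|N. nsq (u x y)"
 have [measurable]: "(%p. u (fst p) (snd p)) \<in> bm (M *M N)" using u by (simp add: split_beta')
 have nm [measurable]: "?n \<in> bm M"
  by (rule N.borel_measurable_nn_integral) (simp add: split_beta')
 have ae: "AE x in M. ?n x \<noteq> \<infinity>" by (rule nn_integral_PInf_AE[OF nm]) (use fin in simp)
 have L: "Lnorm 2 N (u x) powr 2 = enn2real (?n x)" if x: "x \<in> space M" for x
 proof -
  have [measurable]: "u x \<in> bm N" by (rule slice_measurable[OF u x])
  show ?thesis by (simp add: Lnorm2 integral_eq_nn_integral powr_numeral)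
 qed
 have e: "AE x in M. ennreal (enn2real (?n x)) = ?n x" using ae by eventually_elim (simp add: top.not_eq_extremum)
 have "(NI x|M. enn2real (?n x)) = (PI x|M. ?n x)" by (rule nn_integral_cong_AE[OF e])
 hence "integrable M (%x. enn2real (?n x))" unfolding integrable_iff_bounded using fin by simp
 hence 1: "integrable M (%x. Lnorm 2 N (u x) powr 2)"
  by (rule LI_icong[THEN iffD1, rotated -1]) (simp_all add: L)
 have "AE x in M. u x \<in> Lq 2 N" using ae AE_space
 proof eventually_elim
  case (elim x)
  note [measurable] = slice_measurable[OF u elim(2)]
  show ?case using elim(1) by (simp add: Lq2_iff integrable_iff_bounded top.not_eq_extremum)
 qed
 thus ?thesis using u 1 by (simp add: LqLr_def)
qed

lemma LinfLr2_intro: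
 fixes u :: "'a => 'c => 'b::{banach, second_countable_topology}"
 assumes u: "case_prod u \<in> bm (M *M N)" and K: "K \<ge> 0"
  and b: "AE x in M. (NI y|N. nsq (u x y)) <= ennreal K"
 shows "u \<in> LinfLr M 2 N"
proof -
 have "AE x in M. u x \<in> Lq 2 N \<and> Lnorm 2 N (u x) <= sqrt K" using b AE_space
 proof eventually_elim
  case (elim x)
  note L = Lq2_nn[OF slice_measurable[OF u elim(2)] elim(1) K]
  show ?case using L(1) real_le_rsqrt[OF L(2)] by simp
 qed
 thus ?thesis using u unfolding LinfLr_def by blast
qed

lemma wt0_measurable [measurable]: "wt0 a \<in> bm borel"
 unfolding wt0_def[abs_def] by measurable

lemma nn_integral_wt0:
 assumes a: "0 < a" "a < 1" and f: "f \<in> bm (ivl 1)"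
 shows "(PI th|wm (wt0 a). f th) = (PI th|Mw a. ennreal (1 - th) * f th)"
proof -
 have id: "(%th::real. ennreal (1 - th)) \<in> bm (ivl 1)" by (rule interval_measurable) measurable
 show ?thesis
  unfolding nn_integral_weighted[OF wt0_measurable f] nn_integral_weighted[OF wt_measurable borel_measurable_times_ennreal[OF id f]]
  by (rule nn_integral_cong) (use wt_nonneg[OF a] in "auto simp: wt0_def ennreal_mult indicator_def ac_simps")
qed

lemma sets_wt0: "sets (wm (wt0 a)) = sets (Mw a)" by simp

lemma measurable_wt0: "f \<in> bm (wm (wt0 a)) \<longleftrightarrow> f \<in> bm (Mw a)"
 by (simp cong: measurable_cong_sets[OF sets_wt0 refl])

lemma integral_wt0:
 fixes f :: "real => 'b::{banach, second_countable_topology}"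
 assumes a: "0 < a" "a < 1" and f: "f \<in> bm (Mw a)"
 shows "(LI th|wm (wt0 a). f th) = (LI th|Mw a. (1 - th) *R f th)"
  and "integrable (wm (wt0 a)) f \<longleftrightarrow> integrable (Mw a) (%th. (1 - th) *R f th)"
proof -
 have m: "f \<in> bm (ivl 1)" using f by (simp add: measurable_cong_sets[OF sets_weighted refl])
 have id: "(%th::real. 1 - th) \<in> bm (Mw a)" by (rule bm_weighted) measurable
 have w0: "wt0 a = (%th. wt0 a th)" by simp
 have e: "wm (wt0 a) = density (Mw a) (%th. ennreal (1 - th))"
  unfolding weighted_measure_def
  by (subst density_density_eq)
   (auto intro!: interval_measurable density_cong simp: wt0_def ennreal_mult' wt_nonneg[OF a] AE_interval)
 have nn: "AE th in Mw a. 0 <= 1 - th" by (rule AE_I2) simp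
 show "(LI th|wm (wt0 a). f th) = (LI th|Mw a. (1 - th) *R f th)"
  "integrable (wm (wt0 a)) f \<longleftrightarrow> integrable (Mw a) (%th. (1 - th) *R f th)"
  unfolding e by (rule integral_density[OF f id nn], rule integrable_density[OF f id nn])
qed

lemma AE_wt0: assumes "0 < a" "a < 1"
 shows "(AE th in wm (wt0 a). P th) \<longleftrightarrow> (AE th in ivl 1. P th)"
  and "(AE th in Mw a. P th) \<longleftrightarrow> (AE th in ivl 1. P th)"
 by (rule AE_weighted; simp add: wt0_def wt_pos[OF assms])+

lemma finite_wt0: assumes "0 < a" "a < 1" shows "finite_measure (wm (wt0 a))"
proof (rule finite_measureI)
 have "(PI th|wm (wt0 a). 1) = (PI th|Mw a. ennreal (1 - th) * 1)"
  by (rule nn_integral_wt0[OF assms]) simp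
 also have "... <= (PI th|Mw a. 1)" by (rule nn_integral_mono) (simp add: ennreal_le_1)
 also have "... = 1" using prob_space_Mw(1)[OF assms] by simp
 finally show "emeasure (wm (wt0 a)) (space (wm (wt0 a))) \<noteq> \<infinity>" by (auto simp: top_unique)
qed

lemma sigma_finite_interval: "sigma_finite_measure (ivl T)"
 by (rule finite_measure.axioms(1), rule finite_measureI) (cases "T \<ge> 0"; simp add: emeasure_restrict_space)

lemma weighted_pair_measurable:
 "f \<in> bm (N *M wm w) \<longleftrightarrow> f \<in> bm (N *M ivl 1)"
 by (simp cong: measurable_cong_sets[OF sets_pair_measure_cong[OF refl sets_weighted] refl])

lemma borel_pair_interval:
 assumes "f \<in> bm (borel *M borel)" shows "f \<in> bm (ivl S *M ivl T)"
proof -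
 have "(%x::real. x) \<in> measurable (ivl S) borel" for S by (rule interval_measurable) simp
 hence "(%x. (fst x, snd x)) \<in> measurable (ivl S *M ivl T) (borel *M borel)"
  by (intro measurable_Pair measurable_compose[OF measurable_fst] measurable_compose[OF measurable_snd]) auto
 from measurable_compose[OF this assms] show ?thesis by simp
qed

lemma Lq_cong_AE:
 assumes f: "f \<in> bm M" and ae: "AE x in M. f x = g x" and g: "g \<in> Lq q M"
 shows "f \<in> Lq q M"
proof -
 have m: "(%x. norm (f x) powr q) \<in> bm M" "(%x. norm (g x) powr q) \<in> bm M"
  using f g by (auto simp: Lq_def)
 have "integrable M (%x. norm (f x) powr q) = integrable M (%x. norm (g x) powr q)"
  by (rule integrable_cong_AE[OF m]) (use ae in "auto elim: eventually_mono")
 thus ?thesis using f g by (simp add: Lq_def)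
qed

lemma conv_cong_AE_interval:
 assumes k: "k \<in> bm borel" and f: "f \<in> bm (ivl T)" and g: "g \<in> bm borel"
  and ae: "AE s in ivl T. f s = g s" and t: "t <= T"
 shows "conv k f t = conv k g t"
proof -
 have fm: "cut T f \<in> bm borel"
  using f by (simp add: borel_measurable_restrict_space_iff)
 have "conv k f t = conv k (cut T f) t" using t by (intro conv_cong) auto
 also have "... = conv k g t"
  by (rule conv_cong_AE[OF k fm g _ t]) (use ae in "simp add: AE_interval")
 finally show ?thesis .
qed

context affine_flow
begin

lemma dual_embedding_apply: "blinfun_apply (dual_embedding i h) v = inner h (i v)"
 unfolding dual_embedding_def
 by (subst bounded_linear_Blinfun_apply) (auto intro: bounded_linear_inner_right_comp i)

lemma dual_embedding_bounded_linear: "bounded_linear (dual_embedding i)"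
proof (rule bounded_linear_intro[where K=ki])
 fix h show "norm (dual_embedding i h) <= norm h * ki"
 proof (rule norm_blinfun_bound)
  show "0 <= norm h * ki" by (simp add: ki_def onorm_pos_le[OF i])
  show "norm (blinfun_apply (dual_embedding i h) v) <= norm h * ki * norm v" for v
   unfolding dual_embedding_apply ki_def
   using order_trans[OF Cauchy_Schwarz_ineq2[of h "i v"] mult_left_mono[OF onorm[OF i, of v], of "norm h"]] by (simp add: ac_simps)
 qed
qed (auto intro!: blinfun_eqI simp: dual_embedding_apply blinfun.add_left blinfun.scaleR_left inner_add_left)

lemma dual_embedding_Lq2:
 assumes "f \<in> Lq 2 (ivl T)"
 shows "(%t. dual_embedding i (f t)) \<in> Lq 2 (ivl T)"
proof -
 have f: "f \<in> bm (ivl T)" "integrable (ivl T) (%t. nsq (f t))"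
  using assms by (auto simp: Lq2_iff)
 have m: "(%t. dual_embedding i (f t)) \<in> bm (ivl T)"
  by (rule measurable_compose[OF f(1) borel_measurable_continuous_onI])
   (rule linear_continuous_on[OF dual_embedding_bounded_linear])
 have "nsq (dual_embedding i (f t)) <= (onorm (dual_embedding i))\<^sup>2 * nsq (f t)" for t
  using power_mono[OF onorm[OF dual_embedding_bounded_linear, of "f t"], of 2] by (simp add: power_mult_distrib)
 hence "integrable (ivl T) (%t. nsq (dual_embedding i (f t)))"
  by (intro LI_bound[OF integrable_mult_right[OF f(2), of "(onorm (dual_embedding i))\<^sup>2"]])
   (use m in "auto intro!: AE_I2 borel_measurable_power measurable_compose[OF m borel_measurable_norm]")
 thus ?thesis using m by (simp add: Lq2_iff)
qed

end

locale flow_pair = weak_flow i A b C1 C2 al T U + affine_flow i A b C1 C2 al T E x0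
 for i :: "'x::{banach, second_countable_topology} => 'h::{real_inner, banach, second_countable_topology}"
  and A b C1 C2 al T U E x0
begin

lemma grad_w: "blinfun_apply (grad E (x0 + U t)) v = - w t v"
 by (simp add: grad_E w_def)

lemma U_us: "AE t in ivl T. (LI th|M. i (us th t)) = i (U t)"
 using z_integral i_us_eq
proof eventually_elim
 case (elim t)
 thus ?case by (auto intro!: LI_cong simp flip: elim(1))
qed

lemma fractional_part:
 assumes um: "u \<in> bm (ivl T)" and ue: "AE t in ivl T. u t = x0 + U t"
 shows "fractional_solution T al 2 2 i (i x0) E u" "regular_fractional T al 2 i (i x0) u"
proof -
 let ?I = "ivl T"
 have c: "(%t. x0) \<in> Lq 2 ?I" by (rule bounded_in_Lq[where C="norm x0"]) auto
 have "U \<in> Lq 2 ?I" using U2 by (auto simp: Lq2_iff iint_iff intro: interval_measurable)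
 hence u2: "u \<in> Lq 2 ?I" by (intro Lq_cong_AE[OF um ue] Lq_add_scale(1) c) auto
 have im: "(%t. i (u t)) \<in> bm ?I" by (rule measurable_compose[OF um i_measurable])
 obtain K where K: "AE t in ?I. nsq (U t) <= K" by (rule limit_estimates)
 have Li: "(%t. i (u t)) \<in> Linf ?I"
 proof -
  have "AE t in ?I. norm (i (u t)) <= ki * (norm x0 + sqrt K)" using K ue
  proof eventually_elim
   case (elim t)
   have "norm (u t) <= norm x0 + norm (U t)" unfolding elim(2) by (rule norm_triangle_ineq)
   also have "norm (U t) <= sqrt K" using elim(1) by (rule real_le_rsqrt)
   finally have "ki * norm (u t) <= ki * (norm x0 + sqrt K)"
    by (intro mult_left_mono) (auto simp: ki_def onorm_pos_le[OF i])
   thus ?case using onorm[OF i, of "u t"] by (simp add: ki_def)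
  qed
  thus ?thesis using im by (auto simp: Linf_def)
 qed
 have i2: "(%t. i (u t)) \<in> Lq 2 ?I"
 proof -
  have "nsq (i (u t)) <= ki\<^sup>2 * nsq (u t)" for t
   using power_mono[OF onorm[OF i, of "u t"], of 2] by (simp add: ki_def power_mult_distrib)
  moreover have I: "integrable ?I (%t. ki\<^sup>2 * nsq (u t))" using u2 by (simp add: Lq2_iff)
  ultimately have "integrable ?I (%t. nsq (i (u t)))"
   by (intro LI_bound[OF I])
    (auto intro!: AE_I2 borel_measurable_power measurable_compose[OF im borel_measurable_norm])
  thus ?thesis using im by (simp add: Lq2_iff)
 qed
 have h: "h \<in> Lq 2 ?I" using h_square by (auto simp: Lq2_iff iint_iff intro: interval_measurable)
 define G where "G = conv (gker (1 - al)) (%s. i (u s) - i x0)"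
 have G: "G t = prim h t" if "t <= T" for t
 proof -
  have "(%s. i (u s) - i x0) \<in> bm ?I" using im by (intro borel_measurable_diff) auto
  hence "G t = conv (gker (1 - al)) (%s. i (U s)) t" unfolding G_def
   by (rule conv_cong_AE_interval[OF gker_measurable _ _ _ that]) (use ue in "auto elim!: eventually_mono simp: linear_simps[OF i]")
  thus ?thesis using conv_gker_iU[OF that] by simp
 qed
 have Gc: "continuous_on {0..T} G"
  using conv_one_continuous[OF h_iint[OF order_refl]] by (rule continuous_on_cong[THEN iffD1, rotated -1]) (auto simp: G)
 have "(G \<longlongrightarrow> G 0) (at 0 within {0..T})" using Gc T by (auto simp: continuous_on_def)
 hence G0: "(G \<longlongrightarrow> 0) (at_right 0)" using G[of 0] T by (simp add: at_within_Icc_at_right)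
 have GAE: "AE t in ?I. G t = prim h t" unfolding AE_interval using G by auto
 have Gi: "iint T G" by (rule iint_continuous[OF Gc]) simp
 have W: "has_caputo T al (i x0) (%t. i (u t)) h"
  unfolding has_caputo_def G_def[symmetric] by (rule has_distr_deriv_conv_one[OF Gi h_iint[OF order_refl] GAE])
 thus "regular_fractional T al 2 i (i x0) u"
  unfolding regular_fractional_def W_frac_def using u2 Li i2 h by blast
 have "has_caputo_dual T al i (i x0) (%t. i (u t)) (%t. dual_embedding i (h t))"
  unfolding has_caputo_dual_def G_def[symmetric] dual_embedding_apply
 proof
  fix v
  show "has_distr_deriv T (%t. inner (G t) (i v)) (%t. inner (h t) (i v))"
  proof (rule has_distr_deriv_conv_one)
   show "iint T (%t. inner (G t) (i v))" "iint T (%t. inner (h t) (i v))"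
    using Gi h_iint[OF order_refl] unfolding iint_iff[symmetric] by auto
   show "AE t in ?I. inner (G t) (i v) = prim (%t. inner (h t) (i v)) t"
    unfolding AE_interval using G by (auto simp: conv_inner h_iint)
  qed
 qed
 moreover have "AE t in ?I. \<forall>v. blinfun_apply (dual_embedding i (h t) + grad E (u t)) v = 0"
  using h_weak ue by eventually_elim (simp add: blinfun.add_left dual_embedding_apply grad_w)
 ultimately show "fractional_solution T al 2 2 i (i x0) E u"
  unfolding fractional_solution_def G_def[symmetric]
  using u2 Li dual_embedding_Lq2[OF i2] dual_embedding_Lq2[OF h] Gc G0 by blast
qed

section \<open>Representatives of the extended solution: equivalence and regularity\<close>

context
 fixes ut
 assumes utm: "case_prod ut \<in> bm (ivl T *M ivl 1)"
  and ute: "AE t in ivl T. AE th in ivl 1. ut t th = us th t"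
begin

lemma iut_measurable: "(%x. i (ut (fst x) (snd x))) \<in> bm (ivl T *M ivl 1)"
 using measurable_compose[OF utm i_measurable] by (simp add: split_beta')

lemma z_pair: "(%x. z (snd x) (fst x)) \<in> bm (ivl T *M ivl 1)"
 by (rule borel_pair_interval) (rule measurable_compose[OF _ z_measurable, of "%x. (snd x, fst x)", simplified], simp)

lemma iut_z: "AE t in ivl T. AE th in ivl 1. i (ut t th) = z th t"
 using ute i_us_eq
proof eventually_elim
 case (elim t)
 have "AE th in ivl 1. th \<in> {0<..<1}" unfolding AE_interval by simp
 with elim(1) show ?case by eventually_elim (use elim(2) in auto)
qed

text \<open>The same null set in the product and seen from the other factor; regularity in time at
  fixed \<open>th\<close> needs the exchanged order of quantifiers.\<close>

lemma iut_z_pair: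
 "AE x in ivl T *M ivl 1. i (ut (fst x) (snd x)) = z (snd x) (fst x)"
 "AE th in ivl 1. AE t in ivl T. i (ut t th) = z th t"
proof -
 interpret pair_sigma_finite "ivl T" "ivl 1"
  using sigma_finite_interval by (simp add: pair_sigma_finite_def)
 note [measurable] = iut_measurable z_pair
 have "Measurable.pred (ivl T *M ivl 1) (%x. i (ut (fst x) (snd x)) = z (snd x) (fst x))"
  by measurable
 hence S: "{x \<in> space (ivl T *M ivl 1). i (ut (fst x) (snd x)) = z (snd x) (fst x)}
  \<in> sets (ivl T *M ivl 1)" by (simp add: pred_def)
 show "AE x in ivl T *M ivl 1. i (ut (fst x) (snd x)) = z (snd x) (fst x)"
  by (rule AE_pair_measure[OF S]) (use iut_z in simp)
 show "AE th in ivl 1. AE t in ivl T. i (ut t th) = z th t"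
  using AE_commute[OF S] iut_z by simp
qed

text \<open>At almost every time the gradient is represented by \<open>- h\<close>, so the integral
  in the dual of \<open>X\<close> is the image of a convolution in \<open>H\<close>. Integration
  ignores the exceptional times, hence the identity at every \<open>t\<close> and
  \<open>th\<close>.\<close>

lemma Gop_z:
 assumes um: "u \<in> bm (ivl T)" and ue: "AE t in ivl T. u t = x0 + U t"
  and t: "0 < t" "t < T" and th: "0 < th" "th < 1"
 shows "Gop E u t th = dual_embedding i (z th t)"
proof -
 have gm: "(%s. blinfun_apply (grad E (u s)) v) \<in> bm (ivl T)" for v
  unfolding grad_E using um by (intro borel_measurable_add bilinear_measurable[OF A]) auto
 have "(LI s|ivl t. blinfun_apply (exp (- c1 th * (t - s)) *R grad E (u s)) v) =
  inner (- conv (%s. exp (- c1 th * s)) h t) (i v)" for v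
 proof -
  have ki: "iint t (%s. exp (- c1 th * (t - s)) *R h s)"
   by (rule iint_conv_continuous[of "%s. exp (- c1 th * s)"]) (use h_iint t in "auto intro!: continuous_intros")
  have "(LI s|ivl t. blinfun_apply (exp (- c1 th * (t - s)) *R grad E (u s)) v) =
   conv (%s. exp (- c1 th * s)) (%s. blinfun_apply (grad E (u s)) v) t"
   unfolding integral_interval conv_def by (simp add: blinfun.scaleR_left)
  also have "... = conv (%s. exp (- c1 th * s)) (%s. inner (- h s) (i v)) t"
  proof (rule conv_cong_AE_interval[OF _ gm])
   show "AE s in ivl T. blinfun_apply (grad E (u s)) v = inner (- h s) (i v)"
    using h_weak ue by eventually_elim (simp add: grad_w)
  qed (use t in auto)
  also have "... = inner (conv (%s. exp (- c1 th * s)) (%s. - h s) t) (i v)"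
   by (rule conv_inner) (use ki in "simp add: set_integrable_def")
  also have "conv (%s. exp (- c1 th * s)) (%s. - h s) t = - conv (%s. exp (- c1 th * s)) h t"
   by (simp add: conv_def set_int)
  finally show ?thesis .
 qed
 hence "dual_integral (ivl t) (%s. exp (- c1 th * (t - s)) *R grad E (u s)) =
  dual_embedding i (- conv (%s. exp (- c1 th * s)) h t)"
  unfolding dual_integral_def dual_embedding_def by simp
 thus ?thesis
  unfolding Gop_def z_def pk_def[abs_def] conv_scale by (simp add: linear_simps[OF dual_embedding_bounded_linear])
qed

lemma equivalent_part:
 assumes um: "u \<in> bm (ivl T)" and ue: "AE t in ivl T. u t = x0 + U t"
 shows "equivalent_solutions T al i (i x0) E u ut"
 unfolding equivalent_solutions_def
proof
 show "AE t in ivl T. i (u t) = Cop al (i x0) (%th. i (ut t th))"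
  using ue iut_z z_integral AE_space
 proof eventually_elim
  case (elim t)
  have m: "(%th. i (ut t th)) \<in> bm (ivl 1)"
   by (rule slice_measurable[OF _ elim(4)]) (use iut_measurable in "simp add: split_beta'")
  have zm: "(%th. z th t) \<in> bm M"
   by (rule bm_weighted, rule measurable_compose[OF _ z_measurable, of "%th. (th, t)", simplified]) simp
  have "(LI th|M. i (ut t th)) = (LI th|M. z th t)"
   by (rule integral_cong_AE) (use m zm elim(2) in "simp_all add: AE_wt0(2)[OF al] measurable_cong_sets[OF sets_weighted refl]")
  thus ?case
   unfolding Cop_def integral_weighted[OF wt_measurable m wt_nonneg[OF al], symmetric]
   using elim(1,3) by (simp add: linear_simps[OF i])
 qed
 have "AE x in ivl T *M ivl 1. dual_embedding i (i (ut (fst x) (snd x))) = Gop E u (fst x) (snd x)"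
  using iut_z_pair(1) AE_space
 proof eventually_elim
  case (elim x)
  hence "0 < fst x" "fst x < T" "0 < snd x" "snd x < 1" by (auto simp: space_pair_measure)
  thus ?case using elim(1) Gop_z[OF um ue] by simp
 qed
 thus "AE (t, th) in ivl T *M ivl 1. dual_embedding i (i (ut t th)) = Gop E u t th"
  by (simp add: split_beta')
qed

lemma regular_integer_part: "regular_integer T al 2 (%t th. i (ut t th))"
proof -
 let ?I = "ivl T" and ?J = "ivl 1"
 have jm: "case_prod (%t th. i (ut t th)) \<in> bm (?I *M wm w)" for w
  using iut_measurable by (simp add: split_beta' weighted_pair_measurable)
 obtain K where K: "K \<ge> 0" "AE t in ?I. (NI th|M. nsq (z th t)) <= ennreal K" by (rule z_square_bound)
 have B: "AE t in ?I. (NI th|M. nsq (i (ut t th))) <= ennreal K" using K(2) iut_z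
 proof eventually_elim
  case (elim t)
  have "(NI th|M. nsq (i (ut t th))) = (NI th|M. nsq (z th t))"
   by (rule nn_integral_cong_AE) (use elim(2) in "auto simp: AE_wt0(2)[OF al] elim: eventually_mono")
  thus ?case using elim(1) by simp
 qed
 have 1: "(%t th. i (ut t th)) \<in> LinfLr ?I 2 M" by (rule LinfLr2_intro[OF jm K(1) B])
 have le: "(PI th|wm (wt0 al). f th) <= (PI th|M. f th)" if "f \<in> bm ?J" for f
  unfolding nn_integral_wt0[OF al that]
 proof (rule nn_integral_mono)
  fix th :: real assume "th \<in> space M"
  hence "ennreal (1 - th) * f th <= 1 * f th" by (intro mult_right_mono) (auto simp: ennreal_le_1)
  thus "ennreal (1 - th) * f th <= f th" by simp
 qed
 have sf: "sigma_finite_measure (wm (wt0 al))" by (rule finite_measure.axioms(1)[OF finite_wt0[OF al]])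
 have 2: "(%t th. i (ut t th)) \<in> LqLr 2 ?I 2 (wm (wt0 al))"
 proof (rule LqLr2_intro[OF sf jm])
  have "(PI t|?I. (NI th|wm (wt0 al). nsq (i (ut t th)))) <= (PI t|?I. ennreal K)"
  proof (rule nn_integral_mono_AE)
   show "AE t in ?I. (NI th|wm (wt0 al). nsq (i (ut t th))) <= ennreal K"
    using B AE_space
   proof eventually_elim
    case (elim t)
    have m: "(%th. i (ut t th)) \<in> bm ?J"
     by (rule slice_measurable[OF _ elim(2)]) (use iut_measurable in "simp add: split_beta'")
    show ?case
     by (rule order_trans[OF le elim(1)], rule measurable_compose[OF m, of "%x. ennreal (nsq x)"]) measurable
   qed
  qed
  also have "... < \<infinity>" using T by (simp add: emeasure_restrict_space ennreal_mult_less_top)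
  finally show "(PI t|?I. (NI th|wm (wt0 al). nsq (i (ut t th)))) < \<infinity>" .
 qed
 \<comment> \<open>The time derivative as read off from the extended equation.\<close>
 define D where "D t th = c0 th *R h t - c1 th *R z th t" for t th
 have Db: "(%x. D (fst x) (snd x)) \<in> bm (borel *M borel)"
 proof -
  have [measurable]: "(%x. z (snd x) (fst x)) \<in> bm (borel *M borel)"
   by (rule measurable_compose[OF _ z_measurable, of "%x. (snd x, fst x)", simplified]) simp
  show ?thesis unfolding D_def by measurable
 qed
 have Dm: "case_prod D \<in> bm (?I *M wm w)" for w
  using borel_pair_interval[OF Db] by (simp add: split_beta' weighted_pair_measurable)
 \<comment> \<open>The difference has to be estimated as a whole: the square of \<open>c0 th\<close>
   is not integrable in the weight \<open>wt0\<close>. The bound is the dissipation of the second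
   energy estimate.\<close>
 have 3: "D \<in> LqLr 2 ?I 2 (wm (wt0 al))"
 proof (rule LqLr2_intro[OF sf Dm])
  obtain K where K: "(PI t|?I. (NI th|M. (1 - th) * nsq (c0 th *R h t - c1 th *R i (us th t)))) <= ennreal K"
   by (rule limit_estimates)
  have "(PI t|?I. (NI th|wm (wt0 al). nsq (D t th))) =
   (PI t|?I. (NI th|M. (1 - th) * nsq (c0 th *R h t - c1 th *R i (us th t))))"
  proof (rule nn_integral_cong_AE)
   show "AE t in ?I. (NI th|wm (wt0 al). nsq (D t th)) =
    (NI th|M. (1 - th) * nsq (c0 th *R h t - c1 th *R i (us th t)))"
    using i_us_eq
   proof eventually_elim
    case (elim t)
    have [measurable]: "(%th. D t th) \<in> bm borel"
     by (rule measurable_compose[OF _ Db, of "%th. (t, th)", simplified]) simp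
    have "(NI th|wm (wt0 al). nsq (D t th)) = (PI th|M. ennreal (1 - th) * ennreal (nsq (D t th)))"
     by (rule nn_integral_wt0[OF al]) (rule interval_measurable, measurable)
    also have "... = (NI th|M. (1 - th) * nsq (c0 th *R h t - c1 th *R i (us th t)))"
     by (rule nn_integral_cong) (use elim in "auto simp: ennreal_mult D_def")
    finally show ?case .
   qed
  qed
  thus "(PI t|?I. (NI th|wm (wt0 al). nsq (D t th))) < \<infinity>"
   using le_less_trans[OF K ennreal_less_top] by simp
 qed
 have sw: "case_prod (%th t. i (ut t th)) \<in> bm (?J *M ?I)"
  using measurable_pair_swap[OF iut_measurable] by (simp add: split_beta')
 have zi: "iint T (z th)" if "0 < th" "th < 1" for th by (rule iint_continuous[OF z_continuous[OF that]]) simp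
 have "AE th in ?J. has_distr_deriv T (%t. i (ut t th)) (%t. D t th)" using iut_z_pair(2) AE_space
 proof eventually_elim
  case (elim th)
  hence th: "0 < th" "th < 1" by auto
  have m: "(%t. i (ut t th)) \<in> bm ?I" by (rule slice_measurable[OF sw elim(2)])
  have iz: "integrable ?I (z th)" using zi[OF th] by (simp add: iint_iff)
  have "integrable ?I (%t. i (ut t th))"
   by (rule integrable_cong_AE_imp[OF iz m]) (use elim(1) in "auto elim: eventually_mono")
  hence 1: "iint T (%t. i (ut t th))" by (simp add: iint_iff)
  have ih: "iint T (%t. c0 th *R h t)" "iint T (%t. c1 th *R z th t)"
   using h_iint[OF order_refl] zi[OF th] by (simp_all add: iint_iff[symmetric])
  have 2: "iint T (%t. D t th)" unfolding D_def by (rule set_integral_diff(1)[OF ih])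
  have "prim (%t. D t th) t = z th t" if t: "0 < t" "t < T" for t
  proof -
   have "prim (%t. D t th) t = prim (%t. c0 th *R h t) t - prim (%t. c1 th *R z th t) t"
    unfolding D_def by (rule conv_diff_right) (use iint_mono[OF ih(1)] iint_mono[OF ih(2)] t in auto)
   also have "... = c0 th *R prim h t - c1 th *R prim (z th) t"
    by (simp add: conv_one)
   finally show ?thesis using conv_pk_ode(1)[OF th, of t h] h_iint[of t] t by (simp add: z_def[abs_def])
  qed
  hence "AE t in ?I. i (ut t th) = prim (%t. D t th) t"
   using elim(1) unfolding AE_interval by (auto elim: eventually_mono)
  thus ?case by (rule has_distr_deriv_conv_one[OF 1 2])
 qed
 hence 4: "(%t th. i (ut t th)) \<in> H1_Ht T al" unfolding H1_Ht_def using 2 3 by blast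
 have 5: "(%th t. i (ut t th)) \<in> LinfLr ?J 2 ?I"
 proof (rule LinfLr2_intro[OF sw])
  show "0 <= (2 * (1 + T))\<^sup>2 * h2" using h2_nonneg by simp
  show "AE th in ?J. (NI t|?I. nsq (i (ut t th))) <= ennreal ((2 * (1 + T))\<^sup>2 * h2)"
   using iut_z_pair(2) AE_space
  proof eventually_elim
   case (elim th)
   hence th: "0 < th" "th < 1" by auto
   have "(NI t|?I. nsq (i (ut t th))) = (NI t|?I. nsq (z th t))"
    by (rule nn_integral_cong_AE) (use elim(1) in "auto elim: eventually_mono")
   also have "... = ennreal (LI t<T. nsq (z th t))"
    by (rule nn_iint[OF z_L2_time(1)[OF th]]) simp
   finally show ?case using z_L2_time(2)[OF th] by (simp add: ennreal_leI)
  qed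
 qed
 show ?thesis unfolding regular_integer_def using 1 4 5 by blast
qed

end

end

context flow_pair
begin

text \<open>The cut-off puts every time slice, not only almost every one, into \<open>Xt\<close>.\<close>

definition ut where "ut t th = (if (NI th|M. nsq (us th t)) < \<infinity> then us th t else 0)"

lemma ut_borel [measurable]: "(%x. ut (fst x) (snd x)) \<in> bm (borel *M borel)"
proof -
 have [measurable]: "(%t. NI th|M. nsq (us th t)) \<in> bm borel"
  using nn_integral_Mw_measurable[OF al, of "%x. ennreal (nsq (us (fst x) (snd x)))"] by simp
 have [measurable]: "(%x. us (snd x) (fst x)) \<in> bm (borel *M borel)"
  by (rule measurable_compose[OF _ us_measurable, of "%x. (snd x, fst x)", simplified]) simp
 show ?thesis unfolding ut_def by measurable
qed

lemma ut_slice: "ut t \<in> bm M"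
 by (rule bm_weighted, rule measurable_compose[OF _ ut_borel, of "%th. (t, th)", simplified]) simp

lemma ut_joint: "case_prod ut \<in> bm (ivl T *M ivl 1)"
 using borel_pair_interval[OF ut_borel] by (simp add: split_beta')

lemma ut_us: "AE t in ivl T. AE th in ivl 1. ut t th = us th t"
 and ut_LqLr: "ut \<in> LqLr 2 (ivl T) 2 M"
proof -
 obtain K where K: "(PI t|ivl T. (NI th|M. nsq (us th t))) <= ennreal K"
  by (rule limit_estimates)
 hence fin: "(PI t|ivl T. (NI th|M. nsq (us th t))) < \<infinity>"
  using le_less_trans[OF K ennreal_less_top] by simp
 have m: "(%t. NI th|M. nsq (us th t)) \<in> bm (ivl T)"
  using nn_integral_Mw_measurable[OF al, of "%x. ennreal (nsq (us (fst x) (snd x)))"] by (intro interval_measurable) simp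
 have "AE t in ivl T. (NI th|M. nsq (us th t)) \<noteq> \<infinity>"
  by (rule nn_integral_PInf_AE[OF m]) (use fin in simp)
 thus "AE t in ivl T. AE th in ivl 1. ut t th = us th t"
  by eventually_elim (simp add: ut_def top.not_eq_extremum)
 show "ut \<in> LqLr 2 (ivl T) 2 M"
 proof (rule LqLr2_intro)
  show "sigma_finite_measure M" by (rule finite_measure.axioms(1)[OF prob_space_Mw(2)[OF al]])
  show "case_prod ut \<in> bm (ivl T *M M)" using ut_joint by (simp add: weighted_pair_measurable)
  show "(PI t|ivl T. (NI th|M. nsq (ut t th))) < \<infinity>"
   by (rule le_less_trans[OF nn_integral_mono[OF nn_integral_mono] fin]) (simp add: ut_def)
 qed
qed

lemma ut_Xt: "ut t \<in> Xt al"
proof (cases "(NI th|M. nsq (us th t)) < \<infinity>")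
 case True
 hence "ut t = (%th. us th t)" by (auto simp: ut_def)
 thus ?thesis using ut_slice[of t] True by (simp add: Xt_def Lq2_iff integrable_iff_bounded)
next
 case False
 hence "ut t = (%th. 0)" by (auto simp: ut_def)
 thus ?thesis by (simp add: Xt_def Lq2_iff)
qed

definition Ut where "Ut t = (LI th|M. ut t th)"
text \<open>The density in \<open>th\<close> of minus the gradient of the extended energy at
  \<open>ut t\<close>. In this form its dual norm falls under
  \<open>fun_dual_norm_L2\<close>.\<close>

definition dl where "dl t th x = - (A (Ut t) x + b x + th * inner (i (ut t th)) (i x))"
definition W where "W t v = (LI th|M. dl t th (v th))"

lemma Ut_measurable: "Ut \<in> bm (ivl T)"
proof -
 interpret M: sigma_finite_measure M by (rule finite_measure.axioms(1)[OF prob_space_Mw(2)[OF al]])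
 show ?thesis unfolding Ut_def[abs_def]
  by (rule M.borel_measurable_lebesgue_integral) (use ut_joint in "simp add: weighted_pair_measurable")
qed

lemma Ut_eq: "AE t in ivl T. Ut t = U t"
 using ut_us U_us
proof eventually_elim
 case (elim t)
 have m: "(%th. us th t) \<in> bm M"
  by (rule bm_weighted, rule measurable_compose[OF _ us_measurable, of "%th. (th, t)", simplified]) simp
 have "(LI th|M. i (ut t th)) = (LI th|M. i (us th t))"
  by (rule integral_cong_AE) (use elim(1) measurable_compose[OF ut_slice i_measurable] measurable_compose[OF m i_measurable]
   in "auto simp: AE_wt0(2)[OF al] elim: eventually_mono")
 hence "i (Ut t) = i (U t)" using elim(2) Xt_facts(5)[OF ut_Xt] by (simp add: Ut_def)
 thus ?case using inj_i by (simp add: inj_eq)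
qed

lemma W_eq:
 assumes v: "v \<in> Xt al"
 shows "W t v = - (A (Ut t) (LI th|M. v th) + b (LI th|M. v th) + (LI th|M. th * inner (i (ut t th)) (i (v th))))"
proof -
 have Ab: "bounded_linear (A (Ut t))" by (rule bounded_bilinear.bounded_linear_right[OF A])
 note V = Xt_facts[OF v]
 show ?thesis unfolding W_def dl_def
  using integrable_bounded_linear[OF Ab V(3)] integrable_bounded_linear[OF b V(3)] weighted_inner_integrable(1)[OF ut_Xt v, of t]
  by (simp add: integral_bounded_linear[OF Ab V(3)] integral_bounded_linear[OF b V(3)])
qed

lemma W_fun_grad: "v \<in> Xt al ==> W t v + fun_grad (Et al i (i x0) E) (ut t) v = 0"
 by (simp add: W_eq fun_grad_Et[OF ut_Xt] Ut_def)

lemma dl_joint: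
 assumes v: "v \<in> bm (ivl T *M M)"
 shows "(%x. dl (fst x) (snd x) (v x)) \<in> bm (ivl T *M M)"
proof -
 have [measurable]: "(%x. Ut (fst x)) \<in> bm (ivl T *M M)"
  by (rule measurable_compose[OF measurable_fst Ut_measurable])
 have [measurable]: "(%x. i (ut (fst x) (snd x))) \<in> bm (ivl T *M M)"
  using measurable_compose[OF ut_joint i_measurable] by (simp add: weighted_pair_measurable split_beta')
 have [measurable]: "(%x. snd x) \<in> bm (ivl T *M M)"
  by (rule measurable_compose[OF measurable_snd, of "%x. x"], rule bm_weighted) simp
 note [measurable] = v measurable_compose[OF v i_measurable]
  measurable_compose[OF v borel_measurable_continuous_onI[OF bounded_linear.continuous_on[OF b continuous_on_id]]]
 have [measurable]: "(%x. A (Ut (fst x)) (v x)) \<in> bm (ivl T *M M)"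
  by (rule bilinear_measurable[OF A]) measurable
 show ?thesis unfolding dl_def by measurable
qed

text \<open>Bounds the norm of the functional \<open>dl t th\<close>. The gradient part does not
  depend on \<open>th\<close>; the other part comes from \<open>Hop\<close>, with its factor
  \<open>th\<close> bounded by 1.\<close>

definition GB where "GB t th = (onorm (A (Ut t)) + kb) + ki\<^sup>2 * norm (ut t th)"

lemma GB_facts:
 obtains C where "C \<ge> 0" "!!t. integrable M (%th. (GB t th)\<^sup>2)" "!!t. (LI th|M. (GB t th)\<^sup>2) <= C * (1 + (LI th|M. nsq (ut t th)))"
proof -
 interpret A: bounded_bilinear A by (rule A)
 obtain K where K: "K > 0" "!!u v. norm (A u v) <= norm u * norm v * K" using A.pos_bounded by blast
 have on: "0 <= onorm (A u)" for u by (rule onorm_pos_le[OF A.bounded_linear_right])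
 have on': "onorm (A u) <= K * norm u" for u by (rule onorm_bound) (use K(1) K(2)[of u] in "simp_all add: ac_simps")
 let ?C = "3 * (K\<^sup>2 + kb\<^sup>2 + ki^4)"
 have sq: "(x + y + z)\<^sup>2 <= 3 * (x\<^sup>2 + y\<^sup>2 + z\<^sup>2)" for x y z :: real
  using sum_squares_ge_zero[of "x - y" "y - z"] zero_le_power2[of "x - z"] zero_le_power2[of "x - y"] zero_le_power2[of "y - z"]
  by (simp add: power2_eq_square algebra_simps)
 note X = Xt_facts[OF ut_Xt]
 have ptw: "(GB t th)\<^sup>2 <= 3 * ((K * norm (Ut t))\<^sup>2 + kb\<^sup>2) + 3 * ki^4 * nsq (ut t th)" for t th
 proof -
  have "(onorm (A (Ut t)))\<^sup>2 <= (K * norm (Ut t))\<^sup>2" using on on' by (intro power_mono)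
  thus ?thesis using sq[of "onorm (A (Ut t))" kb "ki\<^sup>2 * norm (ut t th)"]
   by (simp add: GB_def power_mult_distrib algebra_simps)
 qed
 have I: "integrable M (%th. 3 * ((K * norm (Ut t))\<^sup>2 + kb\<^sup>2) + 3 * ki^4 * nsq (ut t th))" for t
  by (intro Bochner_Integration.integrable_add integrable_mult_right X(2) finite_measure.integrable_const[OF prob_space_Mw(2)[OF al]])
 have Gi: "integrable M (%th. (GB t th)\<^sup>2)" for t
 proof (rule LI_bound[OF I[of t]])
  note [measurable] = ut_slice
  show "(%th. (GB t th)\<^sup>2) \<in> bm M" unfolding GB_def by measurable
  show "AE th in M. norm ((GB t th)\<^sup>2) <= norm (3 * ((K * norm (Ut t))\<^sup>2 + kb\<^sup>2) + 3 * ki^4 * nsq (ut t th))"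
   using ptw[of t] by (intro AE_I2) (simp add: order_trans[OF _ abs_ge_self])
 qed
 show thesis
 proof (rule that[of ?C, OF _ Gi])
  show "?C \<ge> 0" by simp
  fix t
  have m1: "measure M {0<..<1} = 1" using prob_space_Mw(1)[OF al] by (simp add: measure_def)
  let ?J = "LI th|M. nsq (ut t th)"
  have "nsq (Ut t) <= ?J" unfolding Ut_def by (rule norm_integral_Mw_square_le[OF al X(1,2)])
  hence U: "K\<^sup>2 * nsq (Ut t) <= K\<^sup>2 * ?J" by (rule mult_left_mono) simp
  have J: "0 <= ?J" by simp
  have "(LI th|M. (GB t th)\<^sup>2) <= (LI th|M. 3 * ((K * norm (Ut t))\<^sup>2 + kb\<^sup>2) + 3 * ki^4 * nsq (ut t th))"
   by (rule integral_mono[OF Gi I ptw])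
  also have "... = 3 * ((K * norm (Ut t))\<^sup>2 + kb\<^sup>2) + 3 * ki^4 * ?J"
   by (subst Bochner_Integration.integral_add)
    (use m1 in "simp_all add: X(2) finite_measure.integrable_const[OF prob_space_Mw(2)[OF al]]")
  also have "... <= 3 * (K\<^sup>2 * ?J + kb\<^sup>2) + 3 * ki^4 * ?J" using U by (simp add: power_mult_distrib)
  also have "... <= ?C * (1 + ?J)" using J by (simp add: algebra_simps)
  finally show "(LI th|M. (GB t th)\<^sup>2) <= ?C * (1 + ?J)" .
 qed
qed

text \<open>The difficulty is measurability in time of the dual norm, a supremum over uncountably
  many test functions. It is the limit of integrals over \<open>th\<close> of jointly measurable
  functions, because the maximizers depend measurably on time and \<open>th\<close>.\<close>

lemma W_dual: "W \<in> Lq_dual 2 (ivl T) (Xt al) (Xt_norm al)"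
proof -
 interpret A: bounded_bilinear A by (rule A)
 interpret M: sigma_finite_measure M by (rule finite_measure.axioms(1)[OF prob_space_Mw(2)[OF al]])
 obtain e :: "nat => 'x" where e: "closure (range e) = sphere 0 1" by (rule dense_unit_sequence[OF nontrivial])
 obtain C where C: "C \<ge> 0" "!!t. integrable M (%th. (GB t th)\<^sup>2)" "!!t. (LI th|M. (GB t th)\<^sup>2) <= C * (1 + (LI th|M. nsq (ut t th)))"
  by (rule GB_facts) (rule that)
 have bl: "bounded_linear (dl t th)" for t th
  unfolding dl_def[abs_def]
  by (intro bounded_linear_minus bounded_linear_add A.bounded_linear_right b bounded_linear_const_mult bounded_linear_inner_right_comp i)
 have Gb: "\<bar>dl t th x\<bar> <= GB t th * norm x" if "th \<in> space M" for t th x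
 proof -
  have a: "\<bar>A (Ut t) x\<bar> <= onorm (A (Ut t)) * norm x" using onorm[OF A.bounded_linear_right] by simp
  have bb: "\<bar>b x\<bar> <= kb * norm x" using onorm[OF b, of x] by (simp add: kb_def)
  have "\<bar>th * inner (i (ut t th)) (i x)\<bar> <= 1 * (norm (i (ut t th)) * norm (i x))"
   unfolding abs_mult using that Cauchy_Schwarz_ineq2 by (intro mult_mono) auto
  also have "... <= (ki * norm (ut t th)) * (ki * norm x)"
   unfolding mult_1 ki_def using onorm[OF i] onorm_pos_le[OF i] by (intro mult_mono) auto
  finally show ?thesis using a bb abs_triangle_ineq[of "A (Ut t) x + b x"] abs_triangle_ineq[of "A (Ut t) x" "b x"]
   unfolding dl_def GB_def by (simp add: power2_eq_square algebra_simps)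
 qed
 have G0: "0 <= GB t th" for t th
  unfolding GB_def using onorm_pos_le[OF A.bounded_linear_right] onorm_pos_le[OF b] by (simp add: kb_def)
 have Gm: "GB t \<in> bm M" for t unfolding GB_def[abs_def] using ut_slice[of t] by measurable
 have slice: "(%th. dl t th (v th)) \<in> bm M" if v: "v \<in> bm M" for t v
 proof -
  note [measurable] = measurable_compose[OF v i_measurable] measurable_compose[OF ut_slice i_measurable, of t]
   measurable_compose[OF v borel_measurable_continuous_onI[OF bounded_linear.continuous_on[OF b continuous_on_id]]]
   measurable_compose[OF v borel_measurable_continuous_onI[OF bounded_linear.continuous_on[OF A.bounded_linear_right[of "Ut t"] continuous_on_id]]]
  have [measurable]: "(%th. th) \<in> bm M" by (rule bm_weighted) simp
  show ?thesis unfolding dl_def by measurable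
 qed
 note F = fun_dual_norm_L2[OF bl Gb G0 Gm C(2) slice e, folded W_def[abs_def] Xt_def Xt_norm_def]
 have F1: "W t \<in> fun_dual (Xt al) (Xt_norm al)" for t
  using F(1)[of t] by (simp add: W_def[abs_def] Xt_def Xt_norm_def)
 define N where "N t = fun_dual_norm (Xt al) (Xt_norm al) (W t)" for t
 have N: "(%n. sqrt (LI th|M. (dl t th (maximizer e (dl t th) n))\<^sup>2)) ----> N t" "(N t)\<^sup>2 <= (LI th|M. (GB t th)\<^sup>2)" for t
  using F(2,3)[of t] by (simp_all add: N_def W_def[abs_def] Xt_def Xt_norm_def)
 have Nm: "N \<in> bm (ivl T)"
 proof (rule borel_measurable_LIMSEQ_real[OF N(1)])
  fix n
  have "(%x. dl (fst x) (snd x) (maximizer e (dl (fst x) (snd x)) n)) \<in> bm (ivl T *M M)"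
   by (rule dl_joint[OF maximizer_measurable[where l="%x. dl (fst x) (snd x)", OF dl_joint]])
  hence "(%x. (dl (fst x) (snd x) (maximizer e (dl (fst x) (snd x)) n))\<^sup>2) \<in> bm (ivl T *M M)" by simp
  hence "(%t. LI th|M. (dl t th (maximizer e (dl t th) n))\<^sup>2) \<in> bm (ivl T)"
   by (intro M.borel_measurable_lebesgue_integral) (simp add: split_beta')
  thus "(%t. sqrt (LI th|M. (dl t th (maximizer e (dl t th) n))\<^sup>2)) \<in> bm (ivl T)" by simp
 qed
 have "integrable (ivl T) (%t. Lnorm 2 M (ut t) powr 2)" using ut_LqLr by (simp add: LqLr_def)
 hence "integrable (ivl T) (%t. LI th|M. nsq (ut t th))" by (simp add: Lnorm2 powr_numeral)
 moreover have "integrable (ivl T) (%t. 1 :: real)"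
  unfolding iint_iff by (rule iint_bounded[where C=1]) auto
 ultimately have CI: "integrable (ivl T) (%t. C * (1 + (LI th|M. nsq (ut t th))))" by simp
 have "integrable (ivl T) (%t. (N t)\<^sup>2)"
  by (rule LI_bound[OF CI])
   (use Nm in simp, rule AE_I2, use order_trans[OF N(2) C(3)] C(1) in simp)
 moreover have "N t powr 2 = (N t)\<^sup>2" for t
 proof -
  have "0 <= N t" by (rule LIMSEQ_le_const[OF N(1)]) simp
  thus ?thesis by (simp add: powr_numeral)
 qed
 moreover have "(%t. W t v) \<in> bm (ivl T)" if v: "v \<in> Xt al" for v
 proof -
  have "(%x. v (snd x)) \<in> bm (ivl T *M M)"
   by (rule measurable_compose[OF measurable_snd Xt_facts(1)[OF v]])
  from dl_joint[OF this] show ?thesis unfolding W_def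
   by (intro M.borel_measurable_lebesgue_integral) (simp add: split_beta')
 qed
 ultimately show ?thesis unfolding Lq_dual_def using F1 by (simp add: N_def)
qed

end

section \<open>Continuity in the extended Hilbert space and the weak extended equation\<close>

context flow_pair
begin

lemma z_slice: "(%th. z th t) \<in> bm M"
 by (rule bm_weighted, rule measurable_compose[OF _ z_measurable, of "%th. (th, t)", simplified]) simp

lemma weighted_z_bound:
 assumes "0 < th" "th < 1" "0 <= t" "t <= T"
 shows "(1 - th) * nsq (z th t) <= 2 * (1 + T) * h2"
 using mult_left_mono[OF z_bound[OF assms], of "1 - th"] assms by (simp add: c0_def)

lemma one_minus_measurable: "(%th::real. 1 - th) \<in> bm M"
 by (rule bm_weighted) measurable

lemma z_Ht: assumes t: "t \<in> {0..T}" shows "(%th. z th t) \<in> Ht al"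
proof -
 have "integrable M (%th. (1 - th) *R (nsq (z th t)))"
  by (rule Mw_bounded_integrable[OF al])
   (use weighted_z_bound t z_slice[of t] one_minus_measurable in "auto simp: abs_mult")
 thus ?thesis
  using z_slice[of t] by (simp add: Ht_def Lq2_iff measurable_wt0 integral_wt0(2)[OF al])
qed

text \<open>Dominated convergence in \<open>th\<close>: each \<open>z th\<close> is continuous in
  time, and the weight \<open>1 - th\<close> compensates the growth of \<open>c0 th\<close> in
  \<open>z_bound\<close>, so a constant dominates.\<close>

lemma z_Ht_continuous:
 assumes t: "t \<in> {0..T}"
 shows "((%s. Ht_norm al (%th. z th s - z th t)) \<longlongrightarrow> 0) (at t within {0..T})"
 unfolding tendsto_at_iff_sequentially
proof (intro allI impI)
 fix X assume X: "\<forall>n. X n \<in> {0..T} - {t}" "X ----> t"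
 let ?g = "%n th. (1 - th) *R (nsq (z th (X n) - z th t))"
 have dm: "(%th. z th (X n) - z th t) \<in> bm M" for n
  by (intro borel_measurable_diff z_slice)
 have gm: "?g n \<in> bm M" for n
  by (intro borel_measurable_scaleR one_minus_measurable borel_measurable_power measurable_compose[OF dm borel_measurable_norm])
 have gb: "norm (?g n th) <= 8 * (1 + T) * h2" if th: "0 < th" "th < 1" for n th
 proof -
  have "nsq (z th (X n) - z th t) <= 2 * nsq (z th (X n)) + 2 * nsq (z th t)"
  proof -
   have "nsq (z th (X n) - z th t) <= (norm (z th (X n)) + norm (z th t))\<^sup>2"
    by (intro power_mono norm_triangle_ineq4) simp
   thus ?thesis using sum_squares_bound[of "norm (z th (X n))" "norm (z th t)"] by (simp add: power2_sum)
  qed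
  hence "(1 - th) * nsq (z th (X n) - z th t) <= 2 * ((1 - th) * nsq (z th (X n))) + 2 * ((1 - th) * nsq (z th t))"
   using th mult_left_mono[of _ _ "1 - th"] by (fastforce simp: algebra_simps)
  also have "... <= 2 * (2 * (1 + T) * h2) + 2 * (2 * (1 + T) * h2)"
   by (intro add_mono mult_left_mono weighted_z_bound[OF th]) (use X(1) t in auto)
  also have "... = 8 * (1 + T) * h2" by simp
  finally show ?thesis using th by (simp add: abs_mult)
 qed
 have "(%n. LI th|M. ?g n th) ----> (LI th|M. 0)"
 proof (rule integral_dominated_convergence[where w="%_. 8 * (1 + T) * h2"])
  show "integrable M (%_. 8 * (1 + T) * h2)" by (rule finite_measure.integrable_const[OF prob_space_Mw(2)[OF al]])
  show "AE th in M. (%n. ?g n th) ----> 0"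
  proof (rule AE_I2)
   fix th assume "th \<in> space M"
   hence th: "0 < th" "th < 1" by auto
   have "(%n. z th (X n)) ----> z th t"
    using z_continuous[OF th] X t unfolding continuous_on_sequentially by (auto simp: o_def)
   hence "(%n. ?g n th) ----> (1 - th) *R (nsq (z th t - z th t))" by (intro tendsto_intros)
   thus "(%n. ?g n th) ----> 0" by simp
  qed
  show "AE th in M. norm (?g n th) <= 8 * (1 + T) * h2" for n by (rule AE_I2) (use gb in simp)
 qed (use gm in auto)
 moreover have "Ht_norm al (%th. z th (X n) - z th t) = sqrt (LI th|M. ?g n th)" for n
  unfolding Ht_norm_def Lnorm2
  by (subst integral_wt0(1)[OF al]) (auto intro!: borel_measurable_power measurable_compose[OF dm borel_measurable_norm])
 ultimately show "((%s. Ht_norm al (%th. z th s - z th t)) \<circ> X) ----> 0"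
  using tendsto_real_sqrt[of _ 0 sequentially] by (simp add: o_def)
qed

lemma q_integrable:
 assumes v: "v \<in> Xt al" and t: "0 <= t" "t <= T"
 shows "integrable (M *M ivl t) (%(th, s). inner (h s - th *R z th s) (i (v th)))"
proof -
 interpret I: sigma_finite_measure "ivl t" by (rule sigma_finite_interval)
 interpret M: sigma_finite_measure M by (rule finite_measure.axioms(1)[OF prob_space_Mw(2)[OF al]])
 interpret pair_sigma_finite M "ivl t" ..
 note V = Xt_facts[OF v]
 let ?q = "%x. inner (h (snd x) - fst x *R z (fst x) (snd x)) (i (v (fst x)))"
 let ?H = "LI s<t. norm (h s)"
 have iN: "integrable (ivl t) h" using h_iint[OF t(2)] by (simp add: iint_iff)
 have qb: "(%x. h (snd x) - fst x *R z (fst x) (snd x)) \<in> bm (M *M ivl t)"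
 proof -
  have "(%x. h (snd x) - fst x *R z (fst x) (snd x)) \<in> bm (borel *M borel)" by measurable
  thus ?thesis by (subst measurable_cong_sets[OF sets_pair_Mw refl]) (rule borel_pair_interval)
 qed
 have vm: "(%x. i (v (fst x))) \<in> bm (M *M ivl t)"
  by (rule measurable_compose[OF measurable_fst V(6)])
 have qm: "?q \<in> bm (M *M ivl t)" by (intro borel_measurable_inner qb vm)
 have zi: "iint t (z th)" "(LI s<t. norm (z th s)) <= 2 * (1 + T) * ?H" if th: "0 < th" "th < 1" for th
 proof -
  show "iint t (z th)" by (rule iint_continuous[OF z_continuous[OF th] t(2)])
  have "(LI s<t. \<bar>pk th s\<bar>) <= 2 * (1 + T)"
   using conv_one_pk_bounds(2)[OF th, of t] t pk_nonneg[OF th(2)] by (simp add: conv_one)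
  hence "(LI s<t. \<bar>pk th s\<bar>) * ?H <= 2 * (1 + T) * ?H"
   by (rule mult_right_mono) (simp add: set_int)
  moreover have "iint t (pk th)"
   by (rule iint_continuous[OF continuous_on_subset[OF pk_continuous subset_UNIV] order_refl])
  ultimately show "(LI s<t. norm (z th s)) <= 2 * (1 + T) * ?H"
   unfolding z_def using conv_integrable(3)[OF _ h_iint[OF t(2)], of "pk th"] by linarith
 qed
 have qi: "integrable (ivl t) (%s. inner (h s - th *R z th s) (i (v th)))" if "0 < th" "th < 1" for th
  using iN zi(1)[OF that] by (auto simp: iint_iff[symmetric])
 have qe: "(LI s|ivl t. norm (inner (h s - th *R z th s) (i (v th)))) <= ((1 + 2 * (1 + T)) * ?H) * norm (i (v th))" if th: "0 < th" "th < 1" for th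
 proof -
  have nz: "integrable (ivl t) (%s. norm (z th s))" using zi(1)[OF th] by (simp add: iint_iff[symmetric])
  have nh: "integrable (ivl t) (%s. norm (h s))" using iN by simp
  have "(LI s|ivl t. norm (inner (h s - th *R z th s) (i (v th)))) <= (LI s|ivl t. (norm (h s) + norm (z th s)) * norm (i (v th)))"
  proof (rule integral_mono)
   show "norm (inner (h s - th *R z th s) (i (v th))) <= (norm (h s) + norm (z th s)) * norm (i (v th))" for s
   proof -
    have "norm (h s - th *R z th s) <= norm (h s) + norm (th *R z th s)" by (rule norm_triangle_ineq4)
    also have "norm (th *R z th s) <= norm (z th s)" using th by (simp add: mult_left_le_one_le)
    finally have "norm (h s - th *R z th s) * norm (i (v th)) <= (norm (h s) + norm (z th s)) * norm (i (v th))"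
     by (intro mult_right_mono) auto
    thus ?thesis using Cauchy_Schwarz_ineq2[of "h s - th *R z th s" "i (v th)"] by simp
   qed
  qed (use qi[OF th] nh nz in auto)
  also have "... = (?H + (LI s<t. norm (z th s))) * norm (i (v th))"
   unfolding integral_interval[symmetric] using nh nz by simp
  also have "... <= ((1 + 2 * (1 + T)) * ?H) * norm (i (v th))"
   using zi(2)[OF th] by (intro mult_right_mono) (auto simp: algebra_simps)
  finally show ?thesis .
 qed
 have "integrable (M *M ivl t) ?q"
 proof (rule Fubini_integrable[OF qm])
  show "AE th in M. integrable (ivl t) (%s. ?q (th, s))" by (rule AE_I2) (use qi in simp)
  show "integrable M (%th. LI s|ivl t. norm (?q (th, s)))"
  proof (rule LI_bound)
   show "integrable M (%th. ((1 + 2 * (1 + T)) * ?H) * norm (i (v th)))" using V(4) by simp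
   show "(%th. LI s|ivl t. norm (?q (th, s))) \<in> bm M"
    by (rule I.borel_measurable_lebesgue_integral) (use qm in "simp add: split_beta'")
   show "AE th in M. norm (LI s|ivl t. norm (?q (th, s))) <= norm (((1 + 2 * (1 + T)) * ?H) * norm (i (v th)))"
   proof (rule AE_I2)
    fix th assume "th \<in> space M"
    hence th: "0 < th" "th < 1" by auto
    have "0 <= (LI s|ivl t. norm (?q (th, s)))" by simp
    thus "norm (LI s|ivl t. norm (?q (th, s))) <= norm (((1 + 2 * (1 + T)) * ?H) * norm (i (v th)))"
     using qe[OF th] unfolding real_norm_def by (simp only: abs_of_nonneg fst_conv snd_conv)
   qed
  qed
 qed
 thus ?thesis by (simp add: split_beta')
qed

lemma z_weighted_eq:
 assumes th: "0 < th" "th < 1" and t: "0 <= t" "t <= T"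
 shows "(1 - th) *R z th t = prim (%s. h s - th *R z th s) t"
proof -
 have zi: "iint t (%s. th *R z th s)"
  using iint_continuous[OF z_continuous[OF th] t(2)] by (simp add: iint_iff[symmetric])
 have "prim (%s. h s - th *R z th s) t = prim h t - th *R prim (z th) t"
  using conv_diff_right[of t "%_. 1" h "%s. th *R z th s"] zi h_iint[OF t(2)] by (simp add: conv_one)
 moreover have "z th t = c0 th *R prim h t - c1 th *R prim (z th) t"
  using conv_pk_ode(1)[OF th t(1) h_iint[OF t(2)]] by (simp add: z_def[abs_def])
 ultimately show ?thesis using th by (simp add: c0_def c1_def scaleR_diff_right)
qed

text \<open>By \<open>z_weighted_eq\<close>, \<open>(1 - th) z\<close> is the time integral of
  \<open>h - th z\<close>. After pairing with \<open>i (v th)\<close> and averaging, Fubini's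
  theorem makes the pairing in \<open>Ht\<close> the time integral of \<open>g\<close>, and
  \<open>g\<close> agrees with \<open>W t v\<close> at almost every time.\<close>

lemma W_distr_deriv:
 assumes v: "v \<in> Xt al"
 shows "has_distr_deriv T (%t. Ht_inner al (%th. i (ut t th)) (%th. i (v th))) (%t. W t v)"
proof -
 interpret M: sigma_finite_measure M by (rule finite_measure.axioms(1)[OF prob_space_Mw(2)[OF al]])
 note V = Xt_facts[OF v]
 let ?I = "ivl T"
 define g where "g s = (LI th|M. inner (h s - th *R z th s) (i (v th)))" for s
 have pq: "pair_sigma_finite M (ivl t)" for t
  using sigma_finite_interval M.sigma_finite_measure_axioms by (simp add: pair_sigma_finite_def)
 have gi: "iint T g" unfolding iint_iff[symmetric] g_def
  by (rule pair_sigma_finite.integrable_snd[OF pq q_integrable[OF v]]) (use T in auto)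
 have gt: "prim g t = (LI th|M. (1 - th) * inner (z th t) (i (v th)))" if t: "0 <= t" "t <= T" for t
 proof -
  have "prim g t = (LI s|ivl t. g s)" by (simp add: conv_one integral_interval)
  also have "... = (LI th|M. (LI s|ivl t. inner (h s - th *R z th s) (i (v th))))"
   unfolding g_def by (rule pair_sigma_finite.Fubini_integral[OF pq q_integrable[OF v t]])
  also have "... = (LI th|M. (1 - th) * inner (z th t) (i (v th)))"
  proof (rule LI_cong[OF refl])
   fix th assume "th \<in> space M"
   hence th: "0 < th" "th < 1" by auto
   have zi: "iint t (%s. h s - th *R z th s)"
    using iint_continuous[OF z_continuous[OF th] t(2)] h_iint[OF t(2)] by (auto simp: iint_iff[symmetric])
   have "(LI s|ivl t. inner (h s - th *R z th s) (i (v th))) = prim (%s. inner (h s - th *R z th s) (i (v th))) t"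
    by (simp add: conv_one integral_interval)
   also have "... = inner (prim (%s. h s - th *R z th s) t) (i (v th))" by (rule conv_inner) (use zi in simp)
   finally show "(LI s|ivl t. inner (h s - th *R z th s) (i (v th))) = (1 - th) * inner (z th t) (i (v th))"
    unfolding z_weighted_eq[OF th t, symmetric] by simp
  qed
  finally show ?thesis .
 qed
 have Wg: "AE t in ?I. W t v = g t"
  using Ut_eq h_weak iut_z[OF ut_joint ut_us]
 proof eventually_elim
  case (elim t)
  have zX: "AE th in M. i (ut t th) = z th t" using elim(3) by (simp add: AE_wt0(2)[OF al])
  have m: "(%th. th * inner (z th t) (i (v th))) \<in> bm M"
   by (intro borel_measurable_times borel_measurable_inner z_slice V(6) bm_weighted) simp
  have ae: "AE th in M. th * inner (i (ut t th)) (i (v th)) = th * inner (z th t) (i (v th))" using zX by eventually_elim simp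
  note wi = weighted_inner_integrable(1)[OF ut_Xt v, of t]
  have zi: "integrable M (%th. th * inner (z th t) (i (v th)))" by (rule integrable_cong_AE_imp[OF wi m]) (use ae in "auto elim: eventually_mono")
  have "(LI th|M. th * inner (i (ut t th)) (i (v th))) = (LI th|M. th * inner (z th t) (i (v th)))"
   by (rule integral_cong_AE[OF borel_measurable_integrable[OF wi] m ae])
  moreover have "g t = inner (h t) (LI th|M. i (v th)) - (LI th|M. th * inner (z th t) (i (v th)))"
   unfolding g_def inner_diff_left using V(4) zi by simp
  ultimately show ?case using elim(1,2) unfolding W_eq[OF v] V(5) by (simp add: w_def)
 qed
 have Wi: "iint T (%t. W t v)"
 proof -
  have "(%t. W t v) \<in> bm ?I" using W_dual v by (simp add: Lq_dual_def)
  thus ?thesis unfolding iint_iff[symmetric]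
   by (rule integrable_cong_AE_imp[OF gi[folded iint_iff] _ AE_symmetric[OF Wg]])
 qed
 let ?f = "%t. Ht_inner al (%th. i (ut t th)) (%th. i (v th))"
 have fg: "AE t in ?I. ?f t = prim g t"
  using iut_z[OF ut_joint ut_us] AE_space
 proof eventually_elim
  case (elim t)
  have m1: "(%th. inner (i (ut t th)) (i (v th))) \<in> bm M"
   by (intro borel_measurable_inner Xt_facts(6)[OF ut_Xt] V(6))
  have m2: "(%th. (1 - th) * inner (z th t) (i (v th))) \<in> bm M"
   by (intro borel_measurable_times borel_measurable_inner z_slice V(6) one_minus_measurable)
  have "?f t = (LI th|M. (1 - th) * inner (i (ut t th)) (i (v th)))"
   unfolding Ht_inner_def integral_wt0(1)[OF al m1] by simp
  also have "... = (LI th|M. (1 - th) * inner (z th t) (i (v th)))"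
   by (rule integral_cong_AE[OF _ m2])
    (use elim(1) m1 one_minus_measurable in "auto simp: AE_wt0(2)[OF al] elim: eventually_mono")
  finally show ?case using gt[of t] elim(2) by simp
 qed
 have fi: "iint T ?f"
 proof -
  interpret M0: sigma_finite_measure "wm (wt0 al)" by (rule finite_measure.axioms(1)[OF finite_wt0[OF al]])
  have "(%x. i (v (snd x))) \<in> bm (?I *M wm (wt0 al))"
   by (rule measurable_compose[OF measurable_snd]) (use V(6) in "simp add: measurable_wt0")
  moreover have "(%x. i (ut (fst x) (snd x))) \<in> bm (?I *M wm (wt0 al))"
   using iut_measurable[OF ut_joint ut_us] by (simp add: weighted_pair_measurable)
  ultimately have fm: "?f \<in> bm ?I" unfolding Ht_inner_def
   by (intro M0.borel_measurable_lebesgue_integral) (simp add: split_beta')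
  have ci: "integrable ?I (prim g)"
   unfolding iint_iff by (rule iint_continuous[OF conv_one_continuous[OF gi]]) simp
  show ?thesis unfolding iint_iff[symmetric] by (rule integrable_cong_AE_imp[OF ci fm AE_symmetric[OF fg]])
 qed
 show ?thesis
 proof (rule has_distr_deriv_conv_one[OF fi Wi])
  show "AE t in ?I. ?f t = prim (%t. W t v) t"
   using fg AE_space
  proof eventually_elim
   case (elim t)
   have Wm: "(%t. W t v) \<in> bm ?I" using W_dual v by (simp add: Lq_dual_def)
   have "prim (%t. W t v) t = (LI s|ivl t. W s v)" "prim g t = (LI s|ivl t. g s)"
    by (simp_all add: conv_one integral_interval)
   moreover have "(LI s|ivl t. W s v) = (LI s|ivl t. g s)"
   proof (rule integral_cong_AE)
    have t: "t <= T" using elim(2) by simp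
    show "AE s in ivl t. W s v = g s" using Wg t unfolding AE_interval by (auto elim: eventually_mono)
    show "(%s. W s v) \<in> bm (ivl t)" "g \<in> bm (ivl t)"
     using iint_mono[OF Wi t] iint_mono[OF gi t] by (auto simp: iint_iff[symmetric])
   qed
   ultimately show ?case using elim(1) by simp
  qed
 qed
qed

lemma integer_part: "integer_solution T al 2 2 i (i x0) E ut"
 unfolding integer_solution_def
proof (intro conjI bexI[OF _ W_dual] ballI exI[of _ "%t th. z th t"])
 show "ut \<in> LqLr 2 (ivl T) 2 M" by (rule ut_LqLr)
 show "AE t in ivl T. \<forall>v\<in>Xt al. W t v + fun_grad (Et al i (i x0) E) (ut t) v = 0"
  by (rule AE_I2) (use W_fun_grad in blast)
 show "AE t in ivl T. AE th in ivl 1. z th t = i (ut t th)"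
  using iut_z[OF ut_joint ut_us] by eventually_elim (auto elim: eventually_mono)
 show "AE th in ivl 1. z th 0 = 0" by (simp add: z_def)
qed (use W_distr_deriv z_Ht z_Ht_continuous in auto)

end

section \<open>From the integer-order to the fractional flow\<close>

lemma AE_all_of_dense:
 fixes f g :: "'t => 'x::topological_space => real"
 assumes D: "countable D" "closure D = UNIV" and eq: "!!v. v \<in> D ==> AE t in N. f t v = g t v"
  and c: "AE t in N. continuous_on UNIV (f t) \<and> continuous_on UNIV (g t)"
 shows "AE t in N. \<forall>v. f t v = g t v"
proof -
 have "AE t in N. \<forall>v\<in>D. f t v = g t v" unfolding AE_ball_countable[OF D(1)] using eq by blast
 with c show ?thesis
 proof eventually_elim
  case (elim t)
  have "closed {v. f t v = g t v}" using elim(1) by (intro closed_Collect_eq) auto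
  hence "closure D \<subseteq> {v. f t v = g t v}" by (rule closure_minimal[rotated]) (use elim(2) in auto)
  thus ?case using D(2) by auto
 qed
qed

context affine_flow
begin

lemma conv_one_affine:
 assumes U: "iint t U"
 shows "iint t (%s. A (U s) v + b v)" "0 < t ==> prim (%s. A (U s) v + b v) t = A (prim U t) v + t * b v"
proof -
 interpret A: bounded_bilinear A by (rule A)
 have 1: "iint t (%s. A (U s) v)"
  using integrable_bounded_linear[OF A.bounded_linear_left[of v], of "ivl t" U] U by (simp add: iint_iff)
 have 2: "iint t (%s. b v)" by (rule iint_bounded[where C="\<bar>b v\<bar>"]) auto
 show "iint t (%s. A (U s) v + b v)" by (rule set_integral_add(1)[OF 1 2])
 assume "0 < t"
 have "prim (%s. A (U s) v + b v) t = prim (%s. A (U s) v) t + prim (%s. b v) t"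
  by (rule conv_add_right) (use 1 2 in auto)
 also have "prim (%s. A (U s) v) t = A (prim U t) v"
  by (rule conv_linear[OF A.bounded_linear_left]) (use U in simp)
 finally show "prim (%s. A (U s) v + b v) t = A (prim U t) v + t * b v"
  using \<open>0 < t\<close> by (simp add: conv_one set_int)
qed

text \<open>The exceptional null set may depend on \<open>v\<close>. Both sides are continuous in
  \<open>v\<close>, the right one because the integral of \<open>U\<close> can be taken inside
  \<open>A\<close>, so countably many \<open>v\<close> suffice.\<close>

lemma weak_flow_intro:
 assumes D: "countable D" "closure D = UNIV" and U [measurable]: "U \<in> bm borel" and U2: "iint T (%t. nsq (U t))"
  and eq: "!!v. v \<in> D ==> AE t in ivl T. inner (i (conv (gker (1 - al)) U t)) (i v) = - prim (%s. A (U s) v + b v) t"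
 shows "weak_flow i A b C1 C2 al T U"
proof unfold_locales
 interpret A: bounded_bilinear A by (rule A)
 show "AE t in ivl T. \<forall>v. inner (i (conv (gker (1 - al)) U t)) (i v) = - prim (%s. A (U s) v + b v) t"
 proof (rule AE_all_of_dense[OF D eq])
  show "AE t in ivl T. continuous_on UNIV (%v. inner (i (conv (gker (1 - al)) U t)) (i v)) \<and>
   continuous_on UNIV (%v. - prim (%s. A (U s) v + b v) t)"
  proof (rule AE_I2)
   fix t assume t: "t \<in> space (ivl T)"
   have "iint t U" by (rule iint_mono[OF iint_of_square[OF U U2]]) (use t in simp)
   hence e: "(%v. - prim (%s. A (U s) v + b v) t) = (%v. - (A (prim U t) v + t * b v))"
    using t conv_one_affine(2) by auto
   show "continuous_on UNIV (%v. inner (i (conv (gker (1 - al)) U t)) (i v)) \<and>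
    continuous_on UNIV (%v. - prim (%s. A (U s) v + b v) t)"
    unfolding e by (auto intro!: continuous_intros bounded_linear.continuous_on[OF i] bounded_linear.continuous_on[OF b] bounded_linear.continuous_on[OF A.bounded_linear_right])
  qed
 qed
qed (use dense_i U U2 in auto)

lemma cut_borel: "f \<in> bm (ivl T) ==> cut T f \<in> bm borel" for f :: "real => 'b::{banach, second_countable_topology}"
 by (simp add: borel_measurable_restrict_space_iff)

text \<open>Cut off by 0 outside \<open>(0, T)\<close>, the shifted solution is Borel on the line.
  For each \<open>v\<close> the distributional equation is integrated once, and the vanishing
  initial limit removes the constant of integration.\<close>

lemma weak_flow_of_fractional:
 assumes u: "fractional_solution T al 2 2 i (i x0) E u"
 obtains U where "weak_flow i A b C1 C2 al T U" "u \<in> bm (ivl T)" "AE t in ivl T. u t = x0 + U t"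
proof -
 let ?I = "ivl T"
 obtain w where u2: "u \<in> Lq 2 ?I" and lim: "(conv (gker (1 - al)) (%s. i (u s) - i x0) \<longlongrightarrow> 0) (at_right 0)"
  and w: "has_caputo_dual T al i (i x0) (%t. i (u t)) w" "AE t in ?I. \<forall>v. blinfun_apply (w t + grad E (u t)) v = 0"
  using u unfolding fractional_solution_def by blast
 have um: "u \<in> bm ?I" using u2 by (simp add: Lq2_iff)
 have vm: "(%t. u t - x0) \<in> bm ?I" using um by simp
 define U where "U = cut T (%t. u t - x0)"
 have Um [measurable]: "U \<in> bm borel" unfolding U_def by (rule cut_borel[OF vm])
 have uU: "u t = x0 + U t" if "0 < t" "t < T" for t using that by (simp add: U_def)
 have ae: "AE t in ?I. u t = x0 + U t" unfolding AE_interval using uU by auto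
 have "(%t. x0) \<in> Lq 2 ?I" by (rule bounded_in_Lq[where C="norm x0"]) auto
 hence "(%t. (-1) *R x0) \<in> Lq 2 ?I" by (intro Lq_add_scale(2)) auto
 hence "(%t. u t + (-1) *R x0) \<in> Lq 2 ?I" by (intro Lq_add_scale(1) u2) auto
 hence "U \<in> Lq 2 ?I" by (rule Lq_cong_AE[rotated 2]) (use Um in "auto intro: interval_measurable simp: AE_interval U_def")
 hence U2: "iint T (%t. nsq (U t))" by (simp add: Lq2_iff iint_iff)
 have Ui: "iint T U" by (rule iint_of_square[OF Um U2])
 obtain D :: "'x set" where D: "countable D" "closure D = UNIV" by (rule countable_dense_closure)
 let ?G = "conv (gker (1 - al)) (%s. i (u s) - i x0)"
 have G: "AE t in ?I. ?G t = i (conv (gker (1 - al)) U t)"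
 proof -
  have "AE t in ?I. iint t (%s. gker (1 - al) (t - s) *R U s)"
   unfolding AE_interval by (rule conv_integrable(2)) (use Ui iint_gker al in auto)
  thus ?thesis using AE_space
  proof eventually_elim
   case (elim t)
   have "?G t = conv (gker (1 - al)) (%s. i (U s)) t"
    by (rule conv_cong) (use elim(2) uU in "auto simp: linear_simps[OF i]")
   thus ?case using conv_linear[OF i elim(1)] by simp
  qed
 qed
 have "weak_flow i A b C1 C2 al T U"
 proof (rule weak_flow_intro[OF D Um U2])
  fix v
  have d: "has_distr_deriv T (%t. inner (?G t) (i v)) (%t. blinfun_apply (w t) v)"
   using w(1) by (simp add: has_caputo_dual_def dual_embedding_apply)
  hence wm: "(%t. blinfun_apply (w t) v) \<in> bm ?I" by (auto simp: has_distr_deriv_def)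
  have "((%t. inner (?G t) (i v)) \<longlongrightarrow> inner 0 (i v)) (at_right 0)" by (intro tendsto_inner lim tendsto_const)
  hence "AE t in ?I. inner (?G t) (i v) = prim (%t. blinfun_apply (w t) v) t"
   by (intro du_bois_reymond_zero[OF T d]) auto
  with G AE_space show "AE t in ?I. inner (i (conv (gker (1 - al)) U t)) (i v) = - prim (%s. A (U s) v + b v) t"
  proof eventually_elim
   case (elim t)
   have Am: "(%s. - (A (U s) v + b v)) \<in> bm borel"
    by (intro borel_measurable_uminus borel_measurable_add bilinear_measurable[OF A] Um) auto
   have "prim (%t. blinfun_apply (w t) v) t = prim (%s. - (A (U s) v + b v)) t"
   proof (rule conv_cong_AE_interval[OF _ wm Am])
    show "AE s in ?I. blinfun_apply (w s) v = - (A (U s) v + b v)"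
     using w(2) ae
    proof eventually_elim
     case (elim s)
     hence "blinfun_apply (w s) v + (A (U s) v + b v) = 0" by (simp add: blinfun.add_left grad_E)
     thus ?case by linarith
    qed
   qed (use elim(2) in auto)
   also have "... = - prim (%s. A (U s) v + b v) t"
    unfolding conv_one set_int scaleR_minus_right Bochner_Integration.integral_minus ..
   finally show ?case using elim(1,3) by simp
  qed
 qed
 thus thesis by (rule that[OF _ um ae])
qed

end

text \<open>Convolving the equation with \<open>pk th\<close> and comparing with
  \<open>conv_pk_ode\<close> for \<open>f\<close> itself cancels all terms except the integral of
  \<open>f\<close> and that of \<open>pk th\<close> convolved with \<open>g\<close>. No Gronwall
  argument is involved.\<close>

lemma pk_equation_unique:
 fixes f g :: "real => real"
 assumes th: "0 < th" "th < 1" and T: "T \<ge> 0" and f: "iint T f" "f \<in> bm (ivl T)" and g: "iint T g"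
  and eq: "AE t in ivl T. f t = c0 th * prim g t - c1 th * prim f t"
 shows "AE t in ivl T. f t = conv (pk th) g t"
proof (rule AE_eq_of_conv_one[OF T f(1)])
 show "iint T (conv (pk th) g)"
  by (rule conv_integrable(1)[OF iint_continuous[OF continuous_on_subset[OF pk_continuous subset_UNIV] order_refl] g])
 fix t assume t: "0 < t" "t < T"
 hence ft: "iint t f" and gt: "iint t g" using iint_mono[OF f(1)] iint_mono[OF g] by auto
 have b: "iint t (%s. pk th (t - s) *R (c0 th * prim g s))" "iint t (%s. pk th (t - s) *R (c1 th * prim f s))"
  by (rule iint_conv_continuous[OF pk_continuous set_integrable_mult_right[OF iint_continuous[OF conv_one_continuous[OF gt] order_refl]]],
    rule iint_conv_continuous[OF pk_continuous set_integrable_mult_right[OF iint_continuous[OF conv_one_continuous[OF ft] order_refl]]])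
 have c0: "c0 th \<noteq> 0" using th by (simp add: c0_def)
 have cc: "continuous_on {0..T} (%t. c0 th * prim g t - c1 th * prim f t)"
  by (intro continuous_intros conv_one_continuous f(1) g)
 have "conv (pk th) f t = conv (pk th) (cut T (%t. c0 th * prim g t - c1 th * prim f t)) t"
 proof (rule conv_cong_AE_interval[OF pk_measurable1 f(2)])
  show "cut T (%t. c0 th * prim g t - c1 th * prim f t) \<in> bm borel"
   using iint_continuous[OF cc order_refl] unfolding iint_cut by simp
  show "AE s in ivl T. f s = cut T (%t. c0 th * prim g t - c1 th * prim f t) s"
   using eq by (simp add: AE_interval)
 qed (use t in simp)
 also have "... = conv (pk th) (%t. c0 th * prim g t - c1 th * prim f t) t"
  by (rule conv_cong) (use t in auto)
 also have "... = c0 th * conv (pk th) (prim g) t - c1 th * conv (pk th) (prim f) t"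
  unfolding conv_diff_right[OF b]
   conv_linear[OF bounded_linear_mult_right iint_conv_continuous[OF pk_continuous iint_continuous[OF conv_one_continuous[OF gt] order_refl]]]
   conv_linear[OF bounded_linear_mult_right iint_conv_continuous[OF pk_continuous iint_continuous[OF conv_one_continuous[OF ft] order_refl]]] ..
 finally have "c0 th * conv (pk th) (prim g) t = c0 th * prim f t"
  using conv_pk_ode(2)[OF th _ ft] t by auto
 thus "prim f t = prim (conv (pk th) g) t"
  using c0 conv_one_kernel[OF gt pk_continuous, of th] by simp
qed

text \<open>Rational endpoints suffice by continuity of the integral in its endpoint. Their
  countability is what allows a common null set of times when this is applied at almost every
  time.\<close>

lemma AE_zero_of_initial_integrals:
 fixes f :: "real => real"
 assumes a: "0 < a" "a < 1" and f: "integrable (Mw a) f"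
  and z: "!!c. [|c \<in> \<rat>; 0 < c; c < 1|] ==> (LI th|Mw a. indicator {0<..<c} th * f th) = 0"
 shows "AE th in ivl 1. f th = 0"
proof -
 have fm: "f \<in> bm (ivl 1)"
  using borel_measurable_integrable[OF f] by (simp add: measurable_cong_sets[OF sets_weighted refl])
 let ?g = "%th. wt a th *R f th"
 have g: "iint 1 ?g" using f unfolding integrable_weighted[OF wt_measurable fm wt_nonneg[OF a]] .
 have r: "prim ?g c = 0" if c: "c \<in> \<rat>" "0 < c" "c < 1" for c
 proof -
  have im: "(%th::real. indicator {0<..<c} th :: real) \<in> bm (ivl 1)" by (rule interval_measurable) simp
  have "(LI th|Mw a. indicator {0<..<c} th * f th) = (LI th<1. wt a th *R (indicator {0<..<c} th * f th))"
   by (rule integral_weighted[OF wt_measurable borel_measurable_times[OF im fm] wt_nonneg[OF a]])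
  also have "... = prim ?g c"
   unfolding conv_one set_int
   by (rule LI_cong) (use c in "auto simp: indicator_def")
  finally show ?thesis using z[OF c] by simp
 qed
 have "prim ?g c = 0" if c: "0 < c" "c < 1" for c
 proof (rule ccontr)
  let ?K = "%c. prim ?g c"
  assume ne: "?K c \<noteq> 0"
  have "continuous_on {0<..<1} ?K" by (rule continuous_on_subset[OF conv_one_continuous[OF g]]) auto
  hence "open ({0<..<1} \<inter> ?K -` (- {0}))" by (intro continuous_open_preimage) auto
  moreover have "c \<in> {0<..<1} \<inter> ?K -` (- {0})" using c ne by simp
  ultimately obtain e where e: "e > 0" "!!y. dist y c < e ==> y \<in> {0<..<1} \<inter> ?K -` (- {0})"
   unfolding open_dist by blast
  obtain q where "q \<in> \<rat>" "c < q" "q < c + e" using Rats_dense_in_real[of c "c + e"] e by auto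
  moreover from this have "q \<in> {0<..<1} \<inter> ?K -` (- {0})" by (intro e(2)) (simp add: dist_real_def)
  ultimately show False using r[of q] by auto
 qed
 hence "AE th in ivl 1. ?g th = 0" by (intro AE_zero_of_conv_one g) auto
 thus ?thesis using AE_space by eventually_elim (use wt_pos[OF a] in force)
qed

context affine_flow
begin

lemma Ht_inner_bound:
 fixes f g :: "real => 'h"
 assumes "f \<in> Ht al" "g \<in> Ht al"
 shows "\<bar>Ht_inner al f g\<bar> <= Ht_norm al f * Ht_norm al g"
proof -
 let ?N = "wm (wt0 al)"
 have m: "f \<in> bm ?N" "g \<in> bm ?N" and i: "integrable ?N (%x. nsq (f x))" "integrable ?N (%x. nsq (g x))"
  using assms by (auto simp: Ht_def Lq2_iff)
 note cs = Cauchy_Schwarz_integral[OF measurable_compose[OF m(1) borel_measurable_norm] measurable_compose[OF m(2) borel_measurable_norm] i]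
 have fg: "integrable ?N (%x. inner (f x) (g x))"
  by (rule LI_bound[OF cs(1)]) (use m in "auto intro!: AE_I2 borel_measurable_inner Cauchy_Schwarz_ineq2")
 have "\<bar>Ht_inner al f g\<bar> <= (LI x|?N. norm (f x) * norm (g x))" unfolding Ht_inner_def
  by (rule order_trans[OF integral_abs_bound integral_mono[OF integrable_abs[OF fg] cs(1)]]) (rule Cauchy_Schwarz_ineq2)
 also have "... <= sqrt ((LI x|?N. nsq (f x)) * (LI x|?N. nsq (g x)))" using cs(2) by (rule real_le_rsqrt)
 finally show ?thesis by (simp add: Ht_norm_def Lnorm2 real_sqrt_mult)
qed

lemma Xt_Ht: assumes v: "v \<in> Xt al" shows "(%th. i (v th)) \<in> Ht al"
proof -
 have "integrable (Mw al) (%th. nsq (i (v th)) - th * nsq (i (v th)))"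
  using Xt_facts(7)[OF v] weighted_inner_integrable(2)[OF v v] by simp
 hence "integrable (Mw al) (%th. (1 - th) *R (nsq (i (v th))))" by (simp add: algebra_simps)
 thus ?thesis using Xt_facts(6)[OF v]
  by (simp add: Ht_def Lq2_iff measurable_wt0 integral_wt0(2)[OF al borel_measurable_power[OF measurable_compose[OF Xt_facts(6)[OF v] borel_measurable_norm]]])
qed

text \<open>The continuous representative supplies the initial limit 0 that
  \<open>du_bois_reymond_zero\<close> asks for, by Cauchy-Schwarz in \<open>Ht\<close>.\<close>

lemma integer_equation:
 assumes sol: "integer_solution T al 2 2 i (i x0) E ut"
 obtains W where "!!v. v \<in> Xt al ==> iint T (%t. W t v)"
  "!!v. v \<in> Xt al ==> AE t in ivl T. Ht_inner al (%th. i (ut t th)) (%th. i (v th)) = prim (%t. W t v) t"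
  "AE t in ivl T. \<forall>v\<in>Xt al. W t v + fun_grad (Et al i (i x0) E) (ut t) v = 0"
proof -
 let ?I = "ivl T"
 obtain W zz where ul: "ut \<in> LqLr 2 ?I 2 (Mw al)"
  and W: "!!v. v \<in> Xt al ==> has_distr_deriv T (%t. Ht_inner al (%th. i (ut t th)) (%th. i (v th))) (%t. W t v)"
   "AE t in ?I. \<forall>v\<in>Xt al. W t v + fun_grad (Et al i (i x0) E) (ut t) v = 0"
  and zz: "!!t. t \<in> {0..T} ==> zz t \<in> Ht al"
   "!!t. t \<in> {0..T} ==> ((%s. Ht_norm al (%th. zz s th - zz t th)) \<longlongrightarrow> 0) (at t within {0..T})"
   "AE t in ?I. AE th in ivl 1. zz t th = i (ut t th)" "AE th in ivl 1. zz 0 th = 0"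
  using sol unfolding integer_solution_def by blast
 have zm: "zz t \<in> bm (wm (wt0 al))" if "t \<in> {0..T}" for t
  using zz(1)[OF that] by (simp add: Ht_def Lq2_iff)
 have gd: "AE t in ?I. ut t \<in> Xt al" using ul by (simp add: LqLr_def Xt_def)
 show thesis
 proof (rule that[OF _ _ W(2)])
  fix v :: "real => 'x" assume v: "v \<in> Xt al"
  have vH: "(%th. i (v th)) \<in> Ht al" by (rule Xt_Ht[OF v])
  hence vm: "(%th. i (v th)) \<in> bm (wm (wt0 al))" by (simp add: Ht_def Lq2_iff)
  let ?z = "%t. Ht_inner al (zz t) (%th. i (v th))"
  show "iint T (%t. W t v)" using W(1)[OF v] by (simp add: has_distr_deriv_def iint_iff)
  show "AE t in ?I. Ht_inner al (%th. i (ut t th)) (%th. i (v th)) = prim (%t. W t v) t"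
  proof (rule du_bois_reymond_zero[OF T W(1)[OF v]])
   show "AE t in ?I. Ht_inner al (%th. i (ut t th)) (%th. i (v th)) = ?z t"
    using zz(3) gd AE_space
   proof eventually_elim
    case (elim t)
    have um: "(%th. i (ut t th)) \<in> bm (wm (wt0 al))"
     using Xt_facts(6)[OF elim(2)] by (simp add: measurable_wt0)
    have "AE th in wm (wt0 al). zz t th = i (ut t th)" using elim(1) by (simp add: AE_wt0[OF al])
    thus ?case unfolding Ht_inner_def
     by (intro integral_cong_AE borel_measurable_inner um vm zm) (use elim(3) in "auto elim: eventually_mono")
   qed
   have "\<bar>?z s\<bar> <= Ht_norm al (%th. zz s th - zz 0 th) * Ht_norm al (%th. i (v th))" if s: "s \<in> {0..T}" for s
   proof -
    have zs: "zz s \<in> Lq 2 (wm (wt0 al))" "zz 0 \<in> Lq 2 (wm (wt0 al))"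
     using zz(1)[OF s] zz(1)[of 0] T by (auto simp: Ht_def)
    have "(%th. zz s th + (-1) *R zz 0 th) \<in> Lq 2 (wm (wt0 al))"
     by (intro Lq_add_scale zs) auto
    hence "(%th. zz s th - zz 0 th) \<in> Ht al" by (simp add: Ht_def)
    from Ht_inner_bound[OF this vH]
    have "\<bar>Ht_inner al (%th. zz s th - zz 0 th) (%th. i (v th))\<bar> <= Ht_norm al (%th. zz s th - zz 0 th) * Ht_norm al (%th. i (v th))" .
    moreover have "AE th in wm (wt0 al). inner (zz s th - zz 0 th) (i (v th)) = inner (zz s th) (i (v th))"
     using zz(4) unfolding AE_wt0[OF al, symmetric] by eventually_elim simp
    hence "Ht_inner al (%th. zz s th - zz 0 th) (%th. i (v th)) = ?z s" unfolding Ht_inner_def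
     by (intro integral_cong_AE borel_measurable_inner borel_measurable_diff vm zm) (use s T in auto)
    ultimately show ?thesis by simp
   qed
   hence ev: "\<forall>\<^sub>F s in at 0 within {0..T}. \<bar>?z s\<bar> <= Ht_norm al (%th. zz s th - zz 0 th) * Ht_norm al (%th. i (v th))"
    by (auto simp: eventually_at_filter)
   have "((%s. Ht_norm al (%th. zz s th - zz 0 th) * Ht_norm al (%th. i (v th))) \<longlongrightarrow> 0 * Ht_norm al (%th. i (v th))) (at 0 within {0..T})"
    by (intro tendsto_mult tendsto_const zz(2)) (use T in simp)
   hence "(?z \<longlongrightarrow> 0) (at 0 within {0..T})"
    by (intro Lim_null_comparison[of ?z]) (use ev in auto)
   thus "(?z \<longlongrightarrow> 0) (at_right 0)" using T by (simp add: at_within_Icc_at_right)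
  qed
 qed
qed

text \<open>Test functions that equal \<open>x\<close> on an initial segment of
  \<open>(0, 1)\<close> and vanish elsewhere localize the equation in \<open>th\<close>. They force
  the residual to vanish for almost every \<open>th\<close>, and what remains is a scalar Volterra
  equation in time with a unique solution.\<close>

lemma integer_pointwise:
 assumes sol: "integer_solution T al 2 2 i (i x0) E ut" and U: "U = cut T (%t. LI th|Mw al. ut t th)"
 shows "U \<in> bm borel" "iint T (%t. nsq (U t))"
  and "AE t in ivl T. AE th in ivl 1.
   inner (i (ut t th)) (i x) = conv (pk th) (%s. - (A (U s) x + b x)) t"
proof -
 interpret A: bounded_bilinear A by (rule A)
 let ?I = "ivl T" and ?J = "ivl 1"
 interpret M: sigma_finite_measure "Mw al" by (rule finite_measure.axioms(1)[OF prob_space_Mw(2)[OF al]])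
 interpret I: sigma_finite_measure ?I by (rule sigma_finite_interval)
 interpret P: pair_sigma_finite ?I "Mw al" ..
 have ul: "ut \<in> LqLr 2 ?I 2 (Mw al)" using sol by (simp add: integer_solution_def)
 hence utm: "case_prod ut \<in> bm (?I *M Mw al)" and gd: "AE t in ?I. ut t \<in> Xt al"
  and n2: "integrable ?I (%t. LI th|Mw al. nsq (ut t th))"
  by (auto simp: LqLr_def Xt_def Lnorm2 powr_numeral)
 have Um0: "(%t. LI th|Mw al. ut t th) \<in> bm ?I" by (rule M.borel_measurable_lebesgue_integral[OF utm])
 show Um [measurable]: "U \<in> bm borel" unfolding U by (rule cut_borel[OF Um0])
 have UI: "U \<in> bm ?I" by (rule interval_measurable[OF Um])
 have Ueq: "U t = (LI th|Mw al. ut t th)" if "t \<in> space ?I" for t using that by (simp add: U)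
 have "AE t in ?I. nsq (U t) <= (LI th|Mw al. nsq (ut t th))" using gd AE_space
  by eventually_elim (simp add: Ueq norm_integral_Mw_square_le[OF al] Xt_facts(1,2))
 hence U2: "integrable ?I (%t. nsq (U t))"
  by (intro LI_bound[OF n2]) (use UI in "auto elim!: eventually_mono")
 thus U2': "iint T (%t. nsq (U t))" by (simp add: iint_iff)
 have Ui: "iint t U" if "t <= T" for t by (rule iint_mono[OF iint_of_square[OF Um U2'] that])
 define r where "r s = A (U s) x + b x" for s
 define p where "p t th = inner (i (ut t th)) (i x)" for t th
 have rm [measurable]: "r \<in> bm borel" unfolding r_def[abs_def]
  by (intro borel_measurable_add bilinear_measurable[OF A]) auto
 have ri: "iint t r" if "t <= T" for t unfolding r_def[abs_def] by (rule conv_one_affine(1)[OF Ui[OF that]])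
 have pm: "(%y. p (fst y) (snd y)) \<in> bm (?I *M Mw al)" unfolding p_def
  using measurable_compose[OF utm i_measurable] by (intro borel_measurable_inner) (auto simp: split_beta')
 have idm: "(%y. snd y) \<in> bm (?I *M Mw al)"
  by (rule measurable_compose[OF measurable_snd, of "%x. x"], rule bm_weighted) simp
 have rpm: "(%y. r (fst y)) \<in> bm (?I *M Mw al)"
  by (rule measurable_compose[OF measurable_fst interval_measurable[OF rm]])
 have pslice: "integrable (Mw al) (p t)" "(LI th|Mw al. p t th) = inner (i (LI th|Mw al. ut t th)) (i x)"
  "(LI th|Mw al. norm (p t th)) <= norm (i x) * ki * (1 + (LI th|Mw al. nsq (ut t th)))"
  if t: "ut t \<in> Xt al" for t
 proof -
  note X = Xt_facts[OF t]
  show pi: "integrable (Mw al) (p t)" unfolding p_def[abs_def] using X(4) by simp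
  show "(LI th|Mw al. p t th) = inner (i (LI th|Mw al. ut t th)) (i x)" unfolding p_def using X(4,5) by simp
  have k0: "0 <= norm (i x) * ki" by (simp add: ki_def onorm_pos_le[OF i])
  have pb: "norm (p t th) <= norm (i x) * ki * (1 + nsq (ut t th))" for th
  proof -
   have "norm (p t th) <= norm (i (ut t th)) * norm (i x)" unfolding p_def real_norm_def by (rule Cauchy_Schwarz_ineq2)
   also have "... <= (ki * norm (ut t th)) * norm (i x)" unfolding ki_def by (intro mult_right_mono onorm[OF i]) simp
   also have "... <= norm (i x) * ki * (1 + nsq (ut t th))"
   proof -
    have "norm (ut t th) <= 1 + nsq (ut t th)"
     using sum_squares_bound[of "norm (ut t th)" 1] norm_ge_zero[of "ut t th"] unfolding power_one mult_1_right by linarith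
    from mult_left_mono[OF this k0] show ?thesis by (simp add: ac_simps)
   qed
   finally show ?thesis .
  qed
  have c1: "integrable (Mw al) (%th. 1 :: real)" by (rule finite_measure.integrable_const[OF prob_space_Mw(2)[OF al]])
  have "(LI th|Mw al. norm (p t th)) <= (LI th|Mw al. norm (i x) * ki * (1 + nsq (ut t th)))"
   by (rule integral_mono[OF _ _ pb]) (use pi c1 X(2) in auto)
  also have "... = norm (i x) * ki * (1 + (LI th|Mw al. nsq (ut t th)))"
   using c1 X(2) prob_space_Mw(1)[OF al] by (simp add: measure_def)
  finally show "(LI th|Mw al. norm (p t th)) <= norm (i x) * ki * (1 + (LI th|Mw al. nsq (ut t th)))" .
 qed
 have pint: "integrable (?I *M Mw al) (%y. p (fst y) (snd y))"
 proof (rule P.Fubini_integrable[OF pm])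
  show "AE t in ?I. integrable (Mw al) (%th. p (fst (t, th)) (snd (t, th)))" using gd by eventually_elim (simp add: pslice(1))
  have "integrable ?I (%t. 1 :: real)" unfolding iint_iff by (rule iint_bounded[where C=1]) auto
  hence "integrable ?I (%t. norm (i x) * ki * (1 + (LI th|Mw al. nsq (ut t th))))" using n2 by simp
  thus "integrable ?I (%t. LI th|Mw al. norm (p (fst (t, th)) (snd (t, th))))"
  proof (rule LI_bound)
   show "(%t. LI th|Mw al. norm (p (fst (t, th)) (snd (t, th)))) \<in> bm ?I"
    by (rule M.borel_measurable_lebesgue_integral) (use pm in "simp add: split_beta'")
   show "AE t in ?I. norm (LI th|Mw al. norm (p (fst (t, th)) (snd (t, th)))) <= norm (norm (i x) * ki * (1 + (LI th|Mw al. nsq (ut t th))))"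
    using gd
   proof eventually_elim
    case (elim t)
    have "0 <= (LI th|Mw al. norm (p t th))" by simp
    thus ?case using pslice(3)[OF elim] unfolding fst_conv snd_conv real_norm_def by linarith
   qed
  qed
 qed
 \<comment> \<open>\<open>r\<close> comes from the energy and is shared by all \<open>th\<close>;
   the other summand comes from \<open>Hop\<close>.\<close>
 define k where "k s th = r s + th * p s th" for s th
 have km: "(%y. k (fst y) (snd y)) \<in> bm (?I *M Mw al)" unfolding k_def
  by (intro borel_measurable_add borel_measurable_times rpm idm pm)
 have kint: "integrable (?I *M Mw al) (%y. k (fst y) (snd y))"
 proof -
  have "integrable (?I *M Mw al) (%y. r (fst y))"
  proof (rule P.Fubini_integrable[OF rpm])
   have c: "integrable (Mw al) (%th. c :: real)" for c by (rule finite_measure.integrable_const[OF prob_space_Mw(2)[OF al]])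
   thus "AE t in ?I. integrable (Mw al) (%th. r (fst (t, th)))" by simp
   show "integrable ?I (%t. LI th|Mw al. norm (r (fst (t, th))))"
    using ri[OF order_refl] by (simp add: iint_iff[symmetric])
  qed
  moreover have "integrable (?I *M Mw al) (%y. snd y * p (fst y) (snd y))"
   by (rule LI_bound[OF pint borel_measurable_times[OF idm pm]])
    (auto intro!: AE_I2 mult_left_le_one_le simp: space_pair_measure abs_mult)
  ultimately show ?thesis unfolding k_def by simp
 qed
 \<comment> \<open>The residual of the extended equation, integrated in time and paired with
   \<open>x\<close>.\<close>
 define R where "R t th = (1 - th) * p t th + prim (%s. k s th) t" for t th
 have Rm: "(%y. R (fst y) (snd y)) \<in> bm (?I *M Mw al)"
 proof -
  have 1: "(%y. (snd y, snd (fst y))) \<in> measurable ((?I *M Mw al) *M ?I) (?I *M Mw al)" by measurable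
  have bm: "(%x::real. x) \<in> measurable ?I borel" by (rule interval_measurable) simp
  have fs: "(%y. snd y) \<in> bm ((?I *M Mw al) *M ?I)" "(%y. fst (fst y)) \<in> bm ((?I *M Mw al) *M ?I)"
   by (rule measurable_compose[OF measurable_snd bm], rule measurable_compose[OF measurable_fst measurable_compose[OF measurable_fst bm]])
  have "(%y. if snd y < fst (fst y) then k (snd y) (snd (fst y)) else 0) \<in> bm ((?I *M Mw al) *M ?I)"
   using measurable_compose[OF 1 km] borel_measurable_less[OF fs] by (intro measurable_If) simp_all
  hence "(%y. LI s|?I. (if s < fst y then k s (snd y) else 0)) \<in> bm (?I *M Mw al)"
   by (intro I.borel_measurable_lebesgue_integral) (simp add: split_beta')
  moreover have "(LI s|?I. (if s < fst y then k s (snd y) else 0)) = prim (%s. k s (snd y)) (fst y)" if "y \<in> space (?I *M Mw al)" for y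
   unfolding integral_interval conv_one set_int
   by (rule LI_cong) (use that in "auto simp: space_pair_measure indicator_def")
  ultimately have "(%y. prim (%s. k s (snd y)) (fst y)) \<in> bm (?I *M Mw al)"
   by (simp cong: measurable_cong)
  thus ?thesis unfolding R_def by (intro borel_measurable_add borel_measurable_times borel_measurable_diff borel_measurable_const idm pm)
 qed
 obtain W where W: "!!v. v \<in> Xt al ==> iint T (%t. W t v)"
  "!!v. v \<in> Xt al ==> AE t in ?I. Ht_inner al (%th. i (ut t th)) (%th. i (v th)) = prim (%t. W t v) t"
  "AE t in ?I. \<forall>v\<in>Xt al. W t v + fun_grad (Et al i (i x0) E) (ut t) v = 0"
  using integer_equation[OF sol] by blast
 have kt: "integrable (?I *M Mw al) (%(s, th). if s < t then k s th else 0)" for t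
 proof -
  have bm: "(%y. fst y) \<in> bm (?I *M Mw al)"
   by (rule measurable_compose[OF measurable_fst, of "%x. x"], rule interval_measurable) simp
  have "(%y. if fst y < t then k (fst y) (snd y) else 0) \<in> bm (?I *M Mw al)"
   using bm km by measurable
  hence "integrable (?I *M Mw al) (%y. if fst y < t then k (fst y) (snd y) else 0)"
   by (rule LI_bound[OF kint]) (auto intro!: AE_I2)
  thus ?thesis by (simp add: split_beta')
 qed
 have convk: "(LI s|?I. (if s < t then f s else 0)) = prim f t" if "0 < t" "t < T" for t and f :: "real => real"
  unfolding integral_interval conv_one set_int
  by (rule LI_cong) (use that in "auto simp: indicator_def")
 have tI: "0 < t" "t < T" if "t \<in> space ?I" for t using that by auto
 have Ri: "integrable (Mw al) (%th. prim (%s. k s th) t)" if "t \<in> space ?I" for t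
  using P.integrable_snd[OF kt[of t]] convk[OF tI[OF that]] by simp
 have idM: "(%th::real. th) \<in> bm (Mw al)" by (rule bm_weighted) simp
 have mono1: "integrable (Mw al) (%th. m th * f th)" if "integrable (Mw al) f" "m \<in> bm borel" "!!th. [|0 < th; th < 1|] ==> \<bar>m th\<bar> <= 1"
  for m f :: "real => real"
  by (rule LI_bound[OF that(1) borel_measurable_times[OF bm_weighted[OF that(2)] borel_measurable_integrable[OF that(1)]]])
   (use that(3) in "auto intro!: AE_I2 mult_left_le_one_le simp: abs_mult")
 \<comment> \<open>Fubini's theorem exchanges time and \<open>th\<close>, so the integrated equation
   for this test function is an integral of the residual over an initial segment.\<close>
 have zero: "AE t in ?I. (LI th|Mw al. indicator {0<..<c} th * R t th) = 0" for c
 proof -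
  let ?v = "%th. indicator {0<..<c} th *R x" and ?c = "%th. indicator {0<..<c} th :: real"
  have cm: "?c \<in> bm (Mw al)" by (rule bm_weighted) simp
  have vX: "?v \<in> Xt al" unfolding Xt_def Lq2_iff
   by (intro conjI Mw_bounded_integrable[OF al, where C="nsq x"])
    (use cm in "auto intro!: borel_measurable_scaleR simp: indicator_def power_mult_distrib")
  have Wv: "W s ?v = - (LI th|Mw al. ?c th * k s th)" if s: "s \<in> space ?I" "ut s \<in> Xt al" "W s ?v + fun_grad (Et al i (i x0) E) (ut s) ?v = 0" for s
  proof -
   have ci: "integrable (Mw al) ?c" by (rule Mw_bounded_integrable[OF al cm, of 1]) (simp add: indicator_def)
   have pc: "integrable (Mw al) (%th. ?c th * (th * p s th))"
    by (intro mono1 pslice(1)[OF s(2)]) (auto simp: indicator_def)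
   have V: "(LI th|Mw al. ?v th) = (LI th|Mw al. ?c th) *R x" using ci by simp
   have "(LI th|Mw al. ?c th * k s th) = (LI th|Mw al. ?c th * r s + ?c th * (th * p s th))"
    unfolding k_def by (simp add: distrib_left)
   also have "... = (LI th|Mw al. ?c th) * r s + (LI th|Mw al. ?c th * (th * p s th))" using ci pc by simp
   also have "(%th. ?c th * (th * p s th)) = (%th. th * inner (i (ut s th)) (i (?v th)))"
    by (simp add: p_def linear_simps[OF i] ac_simps)
   finally show ?thesis
    using s(3) unfolding fun_grad_Et[OF s(2) vX] V Ueq[OF s(1), symmetric] r_def
    by (simp add: A.scaleR_right linear_simps[OF b] algebra_simps)
  qed
  have Wae: "AE s in ?I. W s ?v = - (LI th|Mw al. ?c th * k s th)"
   using W(3) gd AE_space by eventually_elim (use Wv vX in blast)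
  have Wm: "(%s. W s ?v) \<in> bm ?I"
   using W(1)[OF vX] unfolding iint_iff[symmetric] by (rule borel_measurable_integrable)
  have gm: "(%s. LI th|Mw al. ?c th * k s th) \<in> bm ?I"
   by (rule M.borel_measurable_lebesgue_integral)
    (use km measurable_compose[OF measurable_snd cm] in "auto simp: split_beta' intro!: borel_measurable_times")
  show ?thesis using W(2)[OF vX] gd AE_space
  proof eventually_elim
   case (elim t)
   note t = tI[OF elim(3)]
   let ?k = "%s th. if s < t then k s th else 0"
   have ck: "integrable (?I *M Mw al) (%(s, th). ?c th * ?k s th)"
    by (rule LI_bound[OF kt[of t]])
     (use measurable_compose[OF measurable_snd cm] borel_measurable_integrable[OF kt[of t]] in
      \<open>auto simp: split_beta' indicator_def intro!: AE_I2 borel_measurable_times\<close>)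
   have "prim (%s. W s ?v) t = prim (cut T (%s. - (LI th|Mw al. ?c th * k s th))) t"
    by (rule conv_cong_AE_interval[OF _ Wm cut_borel]) (use gm Wae t in "auto simp: AE_interval")
   also have "... = prim (%s. - (LI th|Mw al. ?c th * k s th)) t" by (rule conv_cong) (use t in auto)
   also have "... = (LI s|?I. (if s < t then - (LI th|Mw al. ?c th * k s th) else 0))" by (rule convk[OF t, symmetric])
   also have "... = - (LI s|?I. (LI th|Mw al. ?c th * ?k s th))"
    unfolding Bochner_Integration.integral_minus[symmetric] by (rule LI_cong) auto
   also have "(LI s|?I. (LI th|Mw al. ?c th * ?k s th)) = (LI th|Mw al. (LI s|?I. ?c th * ?k s th))"
    by (rule P.Fubini_integral[OF ck, symmetric])
   also have "... = (LI th|Mw al. ?c th * prim (%s. k s th) t)" by (simp add: convk[OF t])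
   finally have e1: "prim (%s. W s ?v) t = - (LI th|Mw al. ?c th * prim (%s. k s th) t)" .
   have e2: "Ht_inner al (%th. i (ut t th)) (%th. i (?v th)) = (LI th|Mw al. ?c th * ((1 - th) * p t th))"
    unfolding Ht_inner_def
    by (subst integral_wt0(1)[OF al borel_measurable_inner[OF Xt_facts(6)[OF elim(2)] Xt_facts(6)[OF vX]]])
     (simp add: p_def linear_simps[OF i] ac_simps)
   have i1: "integrable (Mw al) (%th. ?c th * ((1 - th) * p t th))"
    by (intro mono1 pslice(1)[OF elim(2)]) (auto simp: indicator_def)
   have i2: "integrable (Mw al) (%th. ?c th * prim (%s. k s th) t)"
    by (intro mono1 Ri elim(3)) (auto simp: indicator_def)
   have "(LI th|Mw al. ?c th * R t th) = (LI th|Mw al. ?c th * ((1 - th) * p t th) + ?c th * prim (%s. k s th) t)"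
    unfolding R_def by (simp add: distrib_left)
   also have "... = 0" using elim(1) e1 e2 i1 i2 by simp
   finally show ?case .
  qed
 qed
 have Rz: "AE t in ?I. AE th in Mw al. R t th = 0"
 proof -
  have "AE t in ?I. \<forall>c\<in>\<rat>. (LI th|Mw al. indicator {0<..<c} th * R t th) = 0"
   unfolding AE_ball_countable[OF countable_rat] using zero by blast
  thus ?thesis using gd AE_space
  proof eventually_elim
   case (elim t)
   have "integrable (Mw al) (R t)" unfolding R_def[abs_def]
    by (intro Bochner_Integration.integrable_add Ri elim(3) mono1 pslice(1)[OF elim(2)]) auto
   thus ?case unfolding AE_wt0(2)[OF al]
    by (rule AE_zero_of_initial_integrals[OF al]) (use elim(1) in auto)
  qed
 qed
 have sR: "{y \<in> space (?I *M Mw al). R (fst y) (snd y) = 0} \<in> sets (?I *M Mw al)"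
  using Rm by measurable
 hence Rz': "AE th in Mw al. AE t in ?I. R t th = 0" using P.AE_commute[OF sR] Rz by simp
 have pth: "AE th in Mw al. integrable ?I (%t. p t th)"
  using P.AE_integrable_snd[of "%t th. p t th"] pint by (simp add: split_beta')
 have q: "AE th in Mw al. AE t in ?I. p t th = conv (pk th) (%s. - r s) t"
  using Rz' pth AE_space
 proof eventually_elim
  case (elim th)
  hence th: "0 < th" "th < 1" by auto
  have pi: "iint T (%t. p t th)" using elim(2) by (simp add: iint_iff)
  have mr: "iint t (%s. - r s)" if "t <= T" for t using set_integrable_mult_right[OF ri[OF that], of "-1"] by simp
  show ?case
  proof (rule pk_equation_unique[OF th less_imp_le[OF T] pi borel_measurable_integrable[OF elim(2)] mr[OF order_refl]])
   show "AE t in ?I. p t th = c0 th * prim (%s. - r s) t - c1 th * prim (%t. p t th) t"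
    using elim(1) AE_space
   proof eventually_elim
    case (elim t)
    note t = tI[OF elim(2)]
    have pt: "iint t (%s. th * p s th)" by (rule set_integrable_mult_right[OF iint_mono[OF pi]]) (use t in simp)
    have "prim (%s. k s th) t = prim r t + th * prim (%s. p s th) t"
     unfolding k_def using conv_add_right[of t "%_. 1" r "%s. th * p s th"] ri[of t] pt t by (simp add: conv_one)
    moreover have "prim (%s. - r s) t = - prim r t"
     unfolding conv_one set_int scaleR_minus_right Bochner_Integration.integral_minus ..
    ultimately have "p t th * (1 - th) = prim (%s. - r s) t - th * prim (%s. p s th) t"
     using elim(1) unfolding R_def by (simp add: mult.commute)
    hence "p t th = (prim (%s. - r s) t - th * prim (%s. p s th) t) / (1 - th)"
     using th by (intro eq_divide_imp) auto
    thus ?case by (simp add: c0_def c1_def diff_divide_distrib)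
   qed
  qed
 qed
 have sq: "{y \<in> space (?I *M Mw al). p (fst y) (snd y) = conv (pk (snd y)) (%s. - r s) (fst y)} \<in> sets (?I *M Mw al)"
 proof -
  have "(%(th, t). conv (pk th) (%s. - r s) t) \<in> bm (borel *M borel)"
   by (rule conv_measurable_param[OF pk_measurable]) measurable
  from measurable_compose[OF _ this, of "%y. (snd y, fst y)" "borel *M borel"]
  have "(%y. conv (pk (snd y)) (%s. - r s) (fst y)) \<in> bm (borel *M borel)" by simp
  hence [measurable]: "(%y. conv (pk (snd y)) (%s. - r s) (fst y)) \<in> bm (?I *M Mw al)"
   unfolding weighted_pair_measurable by (rule borel_pair_interval)
  show ?thesis using pm by measurable
 qed
 show "AE t in ?I. AE th in ?J. inner (i (ut t th)) (i x) = conv (pk th) (%s. - (A (U s) x + b x)) t"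
  using P.AE_commute[OF sq] q unfolding AE_wt0(2)[OF al] by (simp add: p_def r_def)
qed

end

text \<open>Pairings with \<open>i x\<close> for countably many \<open>x\<close> determine
  \<open>i (vt t th)\<close>, and \<open>i\<close> is injective. So a given solution of the extended
  flow is the one built from its own average.\<close>

lemma (in flow_pair) eq_us_of_equation:
 assumes D: "countable D" "closure D = UNIV"
  and eq: "!!x. x \<in> D ==> AE t in ivl T. AE th in ivl 1.
   inner (i (vt t th)) (i x) = conv (pk th) (%s. - (A (U s) x + b x)) t"
 shows "AE t in ivl T. AE th in ivl 1. vt t th = us th t"
proof -
 have "AE t in ivl T. \<forall>x\<in>D. AE th in ivl 1.
   inner (i (vt t th)) (i x) = conv (pk th) (%s. - (A (U s) x + b x)) t"
  unfolding AE_ball_countable[OF D(1)] using eq by blast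
 thus ?thesis using i_us_eq AE_space
 proof eventually_elim
  case (elim t)
  hence t: "0 < t" "t < T" by auto
  have "AE th in ivl 1. \<forall>x\<in>D. inner (i (vt t th)) (i x) = conv (pk th) (%s. - (A (U s) x + b x)) t"
   unfolding AE_ball_countable[OF D(1)] using elim(1) .
  thus ?case using AE_space
  proof eventually_elim
   case (elim th)
   hence th: "0 < th" "th < 1" by auto
   have "inner (i (us th t)) (i x) = conv (pk th) (%s. - (A (U s) x + b x)) t" for x
   proof -
    have "inner (z th t) (i x) = conv (pk th) (%s. inner (h s) (i x)) t" unfolding z_def
     by (rule conv_inner[symmetric]) (rule iint_conv_continuous[OF pk_continuous h_iint[OF less_imp_le[OF t(2)]]])
    also have "... = conv (pk th) (%s. - (A (U s) x + b x)) t"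
    proof (rule conv_cong_AE[where T=T])
     show "(%s. - (A (U s) x + b x)) \<in> bm borel" using w_measurable[of x] by (simp add: w_def)
     show "AE s in ivl T. inner (h s) (i x) = - (A (U s) x + b x)"
      using h_weak by eventually_elim (simp add: w_def)
    qed (use t in auto)
    finally show ?thesis using \<open>\<forall>th. 0 < th \<longrightarrow> th < 1 \<longrightarrow> i (us th t) = z th t\<close> th by simp
   qed
   hence eq: "inner (i (vt t th) - i (us th t)) (i x) = 0" if "x \<in> D" for x
    using elim(1) that by (simp add: inner_diff_left)
   have "closed {x. inner (i (vt t th) - i (us th t)) (i x) = 0}"
    by (intro closed_Collect_eq continuous_intros bounded_linear.continuous_on[OF i])
   hence "closure D \<subseteq> {x. inner (i (vt t th) - i (us th t)) (i x) = 0}"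
    by (rule closure_minimal[rotated]) (use eq in auto)
   hence "inner (i (vt t th) - i (us th t)) (i x) = 0" for x using D(2) by auto
   hence "norm (i (vt t th) - i (us th t)) <= 0" by (intro dense_norm_le[OF dense_i]) auto
   thus ?case using inj_i by (simp add: inj_eq)
  qed
 qed
qed

context affine_flow
begin

text \<open>Averaging the pointwise equation over \<open>th\<close> turns \<open>pk\<close> into
  \<open>gker al\<close>; convolution with the complementary kernel then produces the integrated
  fractional equation.\<close>

lemma weak_flow_of_integer:
 assumes sol: "integer_solution T al 2 2 i (i x0) E ut" and U: "U = cut T (%t. LI th|Mw al. ut t th)"
 shows "weak_flow i A b C1 C2 al T U"
proof -
 note P = integer_pointwise[OF sol U]
 note [measurable] = P(1)
 obtain D :: "'x set" where D: "countable D" "closure D = UNIV" by (rule countable_dense_closure)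
 have Ui: "iint t U" if "t <= T" for t by (rule iint_mono[OF iint_of_square[OF P(1,2)] that])
 have ul: "ut \<in> LqLr 2 (ivl T) 2 (Mw al)" using sol by (simp add: integer_solution_def)
 hence gd: "AE t in ivl T. ut t \<in> Xt al" by (simp add: LqLr_def Xt_def)
 show ?thesis
 proof (rule weak_flow_intro[OF D P(1,2)])
  fix x
  define r where "r s = - (A (U s) x + b x)" for s
  have rm: "r \<in> bm borel" unfolding r_def[abs_def]
   by (intro borel_measurable_uminus borel_measurable_add bilinear_measurable[OF A]) auto
  have ri: "iint t r" if "t <= T" for t
   using set_integrable_mult_right[OF conv_one_affine(1)[OF Ui[OF that]], of "-1"] by (simp add: r_def[abs_def])
  have "AE t in ivl T. iint t (%s. gker al (t - s) *R r s)"
   unfolding AE_interval by (rule conv_integrable(2)) (use ri iint_gker al in auto)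
  with P(3)[of x] gd AE_space have Ur: "AE t in ivl T. inner (i (U t)) (i x) = conv (gker al) r t"
  proof eventually_elim
   case (elim t)
   note X = Xt_facts[OF elim(2)]
   have "inner (i (U t)) (i x) = (LI th|Mw al. inner (i (ut t th)) (i x))"
    using X(4,5) elim(3) by (simp add: U)
   also have "... = (LI th|Mw al. conv (pk th) r t)"
   proof (rule integral_cong_AE)
    show "(%th. inner (i (ut t th)) (i x)) \<in> bm (Mw al)" using X(6) by (intro borel_measurable_inner) auto
    show "(%th. conv (pk th) r t) \<in> bm (Mw al)"
     by (rule borel_measurable_integrable[OF integral_conv_pk(1)[OF al rm elim(4)]])
    show "AE th in Mw al. inner (i (ut t th)) (i x) = conv (pk th) r t"
     using elim(1) unfolding AE_wt0(2)[OF al] by (simp add: r_def[abs_def])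
   qed
   also have "... = conv (gker al) r t" by (rule integral_conv_pk(2)[OF al rm elim(4)])
   finally show ?case .
  qed
  have "AE t in ivl T. iint t (%s. gker (1 - al) (t - s) *R U s)"
   unfolding AE_interval by (rule conv_integrable(2)) (use Ui iint_gker al in auto)
  thus "AE t in ivl T. inner (i (conv (gker (1 - al)) U t)) (i x) = - prim (%s. A (U s) x + b x) t"
   using AE_space
  proof eventually_elim
   case (elim t)
   hence t: "t <= T" by auto
   have "inner (i (conv (gker (1 - al)) U t)) (i x) = conv (gker (1 - al)) (%s. inner (i (U s)) (i x)) t"
    by (rule conv_linear[symmetric, OF bounded_linear_compose[OF bounded_linear_inner_left i] elim(1)])
   also have "... = conv (gker (1 - al)) (conv (gker al) r) t"
   proof (rule conv_cong_AE[OF _ _ _ Ur t])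
    show "(%s. inner (i (U s)) (i x)) \<in> bm borel"
     using measurable_compose[OF P(1) i_measurable] by (intro borel_measurable_inner) auto
    show "conv (gker al) r \<in> bm borel" by (rule conv_measurable[OF gker_measurable rm])
   qed simp
   also have "... = prim r t" using conv_gker_inverse[of "1 - al" t r] al ri[OF t] by simp
   also have "... = - prim (%s. A (U s) x + b x) t"
    unfolding r_def[abs_def] conv_one set_int scaleR_minus_right Bochner_Integration.integral_minus ..
   finally show ?case .
  qed
 qed
qed

lemma flow_pair_intro: "weak_flow i A b C1 C2 al T U ==> flow_pair i A b C1 C2 al T U E x0"
 unfolding flow_pair_def using affine_flow_axioms by simp

lemma flow_equivalence:
 shows "fractional_solution T al 2 2 i (i x0) E u ==>
   \<exists>ut. integer_solution T al 2 2 i (i x0) E ut \<and> equivalent_solutions T al i (i x0) E u ut \<and>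
    regular_fractional T al 2 i (i x0) u \<and> regular_integer T al 2 (%t th. i (ut t th))"
  and "integer_solution T al 2 2 i (i x0) E vt ==>
   \<exists>u. fractional_solution T al 2 2 i (i x0) E u \<and> equivalent_solutions T al i (i x0) E u vt \<and>
    regular_fractional T al 2 i (i x0) u \<and> regular_integer T al 2 (%t th. i (vt t th))"
proof -
 assume "fractional_solution T al 2 2 i (i x0) E u"
 then obtain U where U: "weak_flow i A b C1 C2 al T U" and um: "u \<in> bm (ivl T)"
  and ue: "AE t in ivl T. u t = x0 + U t" by (rule weak_flow_of_fractional)
 interpret flow_pair i A b C1 C2 al T U E x0 by (rule flow_pair_intro[OF U])
 show "\<exists>ut. integer_solution T al 2 2 i (i x0) E ut \<and> equivalent_solutions T al i (i x0) E u ut \<and>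
    regular_fractional T al 2 i (i x0) u \<and> regular_integer T al 2 (%t th. i (ut t th))"
  using integer_part equivalent_part[OF ut_joint ut_us um ue] fractional_part(2)[OF um ue] regular_integer_part[OF ut_joint ut_us] by blast
next
 assume sol: "integer_solution T al 2 2 i (i x0) E vt"
 define U where "U = cut T (%t. LI th|Mw al. vt t th)"
 interpret flow_pair i A b C1 C2 al T U E x0 by (rule flow_pair_intro[OF weak_flow_of_integer[OF sol U_def]])
 have utm: "case_prod vt \<in> bm (ivl T *M ivl 1)"
  using sol by (simp add: integer_solution_def LqLr_def weighted_pair_measurable)
 obtain D :: "'x set" where D: "countable D" "closure D = UNIV" by (rule countable_dense_closure)
 have ute: "AE t in ivl T. AE th in ivl 1. vt t th = us th t"
  by (rule eq_us_of_equation[OF D]) (rule integer_pointwise(3)[OF sol U_def])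
 have um: "(%t. x0 + U t) \<in> bm (ivl T)" by (rule interval_measurable) measurable
 have ue: "AE t in ivl T. x0 + U t = x0 + U t" by simp
 show "\<exists>u. fractional_solution T al 2 2 i (i x0) E u \<and> equivalent_solutions T al i (i x0) E u vt \<and>
    regular_fractional T al 2 i (i x0) u \<and> regular_integer T al 2 (%t th. i (vt t th))"
  using fractional_part[OF um ue] equivalent_part[OF utm ute um ue] regular_integer_part[OF utm ute] by blast
qed

end

lemma trivial_space:
 fixes i :: "'x::{banach, second_countable_topology} => 'h::{real_inner, banach, second_countable_topology}"
 assumes x: "!!x::'x. x = 0" and dense: "closure (range i) = UNIV" and p: "p > 0" "p' > 0" and T: "T > 0"
 shows "fractional_solution T al p p' i u0 E u" "integer_solution T al p p' i u0 E ut" "equivalent_solutions T al i u0 E u ut"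
  "regular_fractional T al p i u0 u" "regular_integer T al p' (%t th. i (ut t th))"
proof -
 have "i x = i 0" for x using x[of x] by simp
 hence "range i = {i 0}" by auto
 hence "(UNIV :: 'h set) = {i 0}" using dense by simp
 hence h: "y = (0::'h)" for y by (metis UNIV_I singletonD)
 have L: "F = (0 :: 'x \<Rightarrow>\<^sub>L real)" for F by (rule blinfun_eqI) (use x in "metis blinfun.zero_left blinfun.zero_right")
 have F: "f = (%_. 0)" for f :: "real => 'x" using x by auto
 have F2: "f = (%_ _. 0)" for f :: "real => real => 'x" using x by auto
 have H: "f = (%_. 0)" for f :: "real => 'h" using h by auto
 have H2: "f = (%_ _. 0)" for f :: "real => real => 'h" by (rule ext)+ (rule h)
 have LF: "f = (%_. 0)" for f :: "real => 'x \<Rightarrow>\<^sub>L real" using L by auto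
 have Lqx: "f \<in> Lq q M" if "q > 0" for f :: "real => 'x" and q M using that by (subst F[of f]) (simp add: Lq_def)
 have Lqh: "f \<in> Lq q M" if "q > 0" for f :: "real => 'h" and q M using that by (subst H[of f]) (simp add: Lq_def)
 have LqL: "f \<in> Lq q M" if "q > 0" for f :: "real => 'x \<Rightarrow>\<^sub>L real" and q M using that by (subst LF[of f]) (simp add: Lq_def)
 have dd: "has_distr_deriv T f g" if "f = (%_. 0)" "g = (%_. 0)" for f g :: "real => 'z::{banach, second_countable_topology}"
  unfolding that by (simp add: has_distr_deriv_def)
 have Linfh: "f \<in> Linf M" for f :: "real => 'h" and M by (subst H[of f]) (auto simp: Linf_def)
 have blz: "blinfun_apply F v = 0" for F :: "'x \<Rightarrow>\<^sub>L real" and v using L[of F] by simp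
 show fr: "fractional_solution T al p p' i u0 E u"
  unfolding fractional_solution_def has_caputo_dual_def
  using Lqx[OF p(1)] Linfh LqL[OF p(2)]
  by (auto simp: H[of "conv _ _"] blz intro!: dd exI[of _ "%_. 0"])
 show "regular_fractional T al p i u0 u"
  unfolding regular_fractional_def W_frac_def has_caputo_def
  using Lqx[OF p(1)] Linfh Lqh[of 2] by (auto intro!: bexI[of _ "%_. 0"] dd H)
 have mh: "case_prod f \<in> bm N" for f :: "real => real => 'h" and N :: "(real \<times> real) measure" by (subst H2[of f]) simp
 have mx: "case_prod f \<in> bm N" for f :: "real => real => 'x" and N :: "(real \<times> real) measure" by (subst F2[of f]) simp
 have Lnx: "Lnorm q M f = 0" if "q > 0" for f :: "real => 'x" and q M using that by (subst F[of f]) (simp add: Lnorm_def)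
 have Lnh: "Lnorm q M f = 0" if "q > 0" for f :: "real => 'h" and q M using that by (subst H[of f]) (simp add: Lnorm_def)
 have LLh: "f \<in> LqLr 2 M 2 N" for f :: "real => real => 'h" and M N using mh Lqh[of 2] Lnh[of 2] by (simp add: LqLr_def)
 have LIh: "f \<in> LinfLr M q N" if "q > 0" for f :: "real => real => 'h" and M N q
  using mh Lqh[OF that] Lnh[OF that] by (auto simp: LinfLr_def)
 show "regular_integer T al p' (%t th. i (ut t th))"
  unfolding regular_integer_def H1_Ht_def using LLh LIh[of 2] LIh[OF p(2)] by (auto intro!: bexI[of _ "%_ _. 0"] dd H)
 show "equivalent_solutions T al i u0 E u ut"
 proof -
  have "a = b" for a b :: 'h using h[of a] h[of b] by simp
  moreover have "F = G" for F G :: "'x \<Rightarrow>\<^sub>L real" using L[of F] L[of G] by simp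
  ultimately show ?thesis unfolding equivalent_solutions_def by (simp add: split_beta')
 qed
 have W: "(%_ _. 0) \<in> Lq_dual p' (ivl T) (Xt al) (Xt_norm al :: (real => 'x) => real)"
 proof -
  have "(%_. 0 :: 'x) \<in> {f \<in> Xt al. Xt_norm al f <= (1::real)}" for al using Lqx[of 2] Lnx[of 2] by (simp add: Xt_def Xt_norm_def)
  hence "fun_dual_norm (Xt al) (Xt_norm al :: (real => 'x) => real) (%_. 0) = 0"
   unfolding fun_dual_norm_def by (subst cSUP_const) auto
  moreover have "(%_. 0) \<in> fun_dual (Xt al) (Xt_norm al :: (real => 'x) => real)"
   unfolding fun_dual_def by (auto intro!: exI[of _ 0])
  ultimately show ?thesis using p(2) by (simp add: Lq_dual_def)
 qed
 have fg: "fun_grad G f v = 0" for G and f v :: "real => 'x"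
 proof -
  have "(%x. f x + c *R v x) = f" for c using F[of f] F[of "%x. f x + c *R v x"] by metis
  thus ?thesis unfolding fun_grad_def by (intro tendsto_Lim) auto
 qed
 show "integer_solution T al p p' i u0 E ut"
  unfolding integer_solution_def
 proof (intro conjI bexI[OF _ W] ballI exI[of _ "%_ _. 0"])
  show "ut \<in> LqLr p (ivl T) 2 (Mw al)" using mx Lqx[of 2] Lnx[of 2] p by (simp add: LqLr_def)
  show "has_distr_deriv T (%t. Ht_inner al (%th. i (ut t th)) (%th. i (v th))) (%t. 0)" for v
  proof (rule dd)
   have "inner (a::'h) b = 0" for a b using h[of a] by simp
   thus "(%t. Ht_inner al (%th. i (ut t th)) (%th. i (v th))) = (%_. 0)" by (simp add: Ht_inner_def)
  qed simp
  show "((%s. Ht_norm al (%th. 0 - (0::'h))) \<longlongrightarrow> 0) (at t within {0..T})" for t using Lnh[of 2] by (simp add: Ht_norm_def)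
  show "(%_. 0 :: 'h) \<in> Ht al" using Lqh[of 2] by (simp add: Ht_def)
  show "AE t in ivl T. AE th in ivl 1. 0 = i (ut t th)" using h by simp
 qed (use fg in auto)
qed

theorem theorem2:
  fixes i :: "'x::{banach, second_countable_topology} \<Rightarrow>
              'h::{real_inner, banach, second_countable_topology}"
    and E :: "'x \<Rightarrow> real"
    and u0 :: 'h
    and T \<alpha> p p' C0 C1 C2 :: real
  assumes T: "T > 0"
    and alpha: "0 < \<alpha>" "\<alpha> < 1"
    and X_reflexive: "reflexive TYPE('x)"
    and embedding: "compact_dense_embedding i"
    and E_C1: "C1_functional E"
    and p: "p > 1" "1 / p + 1 / p' = 1"
    and constants: "C0 > 0" "C1 > 0" "C2 > 0"
    and growth: "\<And>u. norm (grad E u) \<le> C0 * norm u powr (p - 1) + C0"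
    and coercive: "\<And>u. gateaux E u u \<ge> C1 * norm u powr p - C2 * (norm (i u))\<^sup>2"
    and weak_continuity: "weak_weak_continuous T p p' (grad E)"
    and Et_defined: "\<And>v. v \<in> Xt \<alpha> \<Longrightarrow> Cop \<alpha> u0 (\<lambda>\<theta>. i (v \<theta>)) \<in> range i"
  shows "(\<forall>u. fractional_solution T \<alpha> p p' i u0 E u \<longrightarrow>
            (\<exists>ut. integer_solution T \<alpha> p p' i u0 E ut \<and>
                  equivalent_solutions T \<alpha> i u0 E u ut \<and>
                  regular_fractional T \<alpha> p i u0 u \<and>
                  regular_integer T \<alpha> p' (\<lambda>t \<theta>. i (ut t \<theta>)))) \<and>
         (\<forall>ut. integer_solution T \<alpha> p p' i u0 E ut \<longrightarrow>
            (\<exists>u. fractional_solution T \<alpha> p p' i u0 E u \<and>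
                 equivalent_solutions T \<alpha> i u0 E u ut \<and>
                 regular_fractional T \<alpha> p i u0 u \<and>
                 regular_integer T \<alpha> p' (\<lambda>t \<theta>. i (ut t \<theta>))))"
proof -
 have i: "bounded_linear i" "inj i" "closure (range i) = UNIV"
  using embedding by (auto simp: compact_dense_embedding_def)
 have "1 / p' = 1 - 1 / p" using p(2) by simp
 hence "1 / p' > 0" using p(1) by simp
 hence p': "p' > 0" by simp
 show ?thesis
 proof (cases "\<exists>x::'x. x \<noteq> 0")
  case False
  note tr = trivial_space[where i=i and p=p and p'=p' and T=T, OF _ i(3) _ p' T]
  show ?thesis using tr False p by auto
 next
  case True
  obtain A where A: "bounded_bilinear A" "!!u v. A u v = A v u"
   and g: "!!u. blinfun_apply (grad E u) = (%v. A u v + blinfun_apply (grad E 0) v)"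
   and e: "!!u. E u = E 0 + blinfun_apply (grad E 0) u + A u u / 2"
   and co: "!!u. A u u \<ge> C1 * nsq u - C2 * nsq (i u)" and p2: "p = 2"
   by (rule affine_gradient[OF T E_C1 p constants(2) i(1) growth constants(1) coercive weak_continuity True]) (rule that)
  have p'2: "p' = 2" using p p2 by (simp add: field_simps)
  interpret A: bounded_bilinear A by (rule A(1))
  \<comment> \<open>The zero function is an admissible argument of the extended energy and
    \<open>Cop\<close> sends it to the initial datum, which therefore lies in
    \<open>X\<close>.\<close>
  have "Cop \<alpha> u0 (%th. i 0) \<in> range i" by (rule Et_defined) (simp add: Xt_def Lq2_iff)
  then obtain x0 where x0: "u0 = i x0" by (auto simp: Cop_def linear_simps[OF i(1)])
  interpret affine_flow i A "blinfun_apply (grad E x0)" C1 C2 \<alpha> T E x0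
  proof (intro affine_flow.intro affine_flow_axioms.intro quad_flow.intro)
   show "bounded_linear (blinfun_apply (grad E x0))" by (rule blinfun.bounded_linear_right)
   show "blinfun_apply (grad E u) v = A (u - x0) v + blinfun_apply (grad E x0) v" for u v
    using fun_cong[OF g[of u], of v] fun_cong[OF g[of x0], of v] by (simp add: A.diff_left)
   show "E (x0 + y) = E x0 + blinfun_apply (grad E x0) y + A y y / 2" for y
    using e[of "x0 + y"] e[of x0] fun_cong[OF g[of x0], of y] A(2)[of y x0]
    by (simp add: A.add_left A.add_right blinfun.add_right)
  qed (use i A co constants alpha T True in auto)
  show ?thesis unfolding x0 p2 p'2 using flow_equivalence by blast
 qed
qed

end
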